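(* Let $A$ be a Dirac--Jacobi structure in a Courant--Jacobi algebroid $(E;L)$, let $B\subset E$ be an almost Dirac--Jacobi structure complementary to $A$, and let $(\Omega^\bullet(A;L)[2],\{\mathfrak m_k\})$ be the associated $L_\infty[1]$-algebra. Consider the Kuranishi map $$\mathrm{Kur}:H^2(\Omega^\bullet(A;L),\mathrm d_{A,L})\to H^3(\Omega^\bullet(A;L),\mathrm d_{A,L}),\qquad[w]\mapsto[\mathfrak m_2(w,w)].$$ Let $\eta$ be an infinitesimal deformation of $A$. If $\mathrm{Kur}[\eta]\neq0$, then $\eta$ is obstructed.
   Context: **Courant--Jacobi algebroids.** For a line bundle $L\to M$, $DL\to M$ is the gauge (Atiyah) algebroid: its sections are the derivations of $L$, i.e. $\mathbb R$-linear maps $\Delta:\Gamma(L)\to\Gamma(L)$ with $\Delta(f\lambda)=\sigma(\Delta)(f)\lambda+f\Delta\lambda$ for a (unique) vector field $\sigma(\Delta)$. A *Courant--Jacobi algebroid* $(E;L)$ over $M$ is a vector bundle $E\to M$ and a line bundle $L\to M$ with: a non-degenerate symmetric $C^\infty(M)$-bilinear product $\langle\!\langle-,-\rangle\!\rangle:E\otimes E\to L$; an $\mathbb R$-bilinear bracket $[\![-,-]\!]$ on $\Gamma(E)$ with $[\![e_1,[\![e_2,e_3]\!]]\!]=[\![[\![e_1,e_2]\!],e_3]\!]+[\![e_2,[\![e_1,e_3]\!]]\!]$; a vector bundle morphism $\nabla:E\to DL$ over $\mathrm{id}_M$; such that $\langle\!\langle[\![e_1,e_2]\!],e_2\rangle\!\rangle=\langle\!\langle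 e_1,[\![e_2,e_2]\!]\rangle\!\rangle$ and $\nabla_{e_1}\langle\!\langle e_2,e_2\rangle\!\rangle=2\langle\!\langle[\![e_1,e_2]\!],e_2\rangle\!\rangle$. A subbundle $A\subset E$ is an *almost Dirac--Jacobi structure* if it is Lagrangian ($A=A^\perp$), and a *Dirac--Jacobi structure* if moreover $[\![\Gamma(A),\Gamma(A)]\!]\subset\Gamma(A)$. **Identification.** Put $A^\dagger:=A^\ast\otimes L$. With $E=A\oplus B$, both Lagrangian, $B\to A^\dagger$, $v\mapsto\langle\!\langle v,-\rangle\!\rangle|_A$, is an isomorphism; the induced isomorphism $E=A\oplus B\to A\oplus A^\dagger$ transfers the Courant--Jacobi structure to $(A\oplus A^\dagger;L)$, with product $\langle\!\langle\xi+\alpha,\zeta+\beta\rangle\!\rangle=\alpha(\zeta)+\beta(\xi)$. **Forms and brackets.** $\Omega^\bullet(A)=\Gamma(\wedge^\bullet A^\ast)$, $\Omega^\bullet(A;L)=\Gamma(\wedge^\bullet A^\ast\otimes L)$. With $[\xi,\zeta]_A=[\![\xi,\zeta]\!]$, $$(\mathrm d_{A,L}\alpha)(X_0,\dots,X_k)=\sum_i(-1)^i\nabla_{X_i}(\alpha(\dots,\widehat{X_i},\dots))+\sum_{i<j}(-1)^{i+j}\alpha([X_i,X_j]_A,\dots,\widehat{X_i},\dots,\widehat{X_j},\dots);$$ since $A$ is Dirac--Jacobi, $\mathrm d_{A,L}^2=0$. On $A^\dagger$ put $[\alpha,\beta]_{A^\dagger}=\mathrm{pr}_{A^\dagger}[\![\alpha,\beta]\!]$,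 $\nabla^{A^\dagger}=\nabla|_{A^\dagger}$ (transferred structure). $[-,-]_{A^\dagger,L}$ is the unique degree $0$ graded skew-symmetric bracket on $\Omega^\bullet(A;L)[1]$ that is a graded derivation of the $\Omega^\bullet(A)$-module $\Omega^\bullet(A;L)[1]$ in each entry, with $[\alpha,\beta]_{A^\dagger,L}=[\alpha,\beta]_{A^\dagger}$, $[\alpha,\lambda]_{A^\dagger,L}=\nabla^{A^\dagger}_\alpha\lambda$ for $\alpha,\beta\in\Gamma(A^\dagger)=\Omega^1(A;L)$, $\lambda\in\Gamma(L)$. (A graded derivation $X$ of a graded module satisfies $X(\omega\alpha)=\underline X(\omega)\alpha+(-1)^{|X||\omega|}\omega X(\alpha)$ for a graded derivation $\underline X$ of the algebra.) $\Upsilon_{A^\dagger}\in\Gamma(\wedge^3(A\otimes L^\ast)\otimes L)$ is $\Upsilon_{A^\dagger}(\alpha_1,\alpha_2,\alpha_3)=\langle\!\langle[\![\alpha_1,\alpha_2]\!],\alpha_3\rangle\!\rangle$ (determinant convention for wedges). **The $L_\infty[1]$-algebra.** For $\alpha\in\Omega^{k+1}(A;L)$, $\alpha^\sharp:A\otimes L^\ast\to\wedge^kA^\ast$ is $\alpha^\sharp(u_0\otimes\nu)(u_1,\dots,u_k)=\nu(\alpha(u_0,\dots,u_k))$ ($0$ if $k=-1$), and $(\alpha_1^\sharp\wedge\alpha_2^\sharp\wedge\alpha_3^\sharp)(\tilde u_1\wedge\tilde u_2\wedge\tilde u_3)=\sum_{\sigma\in S_3}(-1)^\sigma\alpha_1^\sharp(\tilde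 u_{\sigma(1)})\wedge\alpha_2^\sharp(\tilde u_{\sigma(2)})\wedge\alpha_3^\sharp(\tilde u_{\sigma(3)})$. The $L_\infty[1]$-structure on $\Omega^\bullet(A;L)[2]$ has only non-trivial brackets $\mathfrak m_1=\mathrm d_{A,L}$, $\mathfrak m_2(\alpha,\beta)=(-1)^{|\alpha|}[\alpha,\beta]_{A^\dagger,L}$, $\mathfrak m_3(\alpha,\beta,\gamma)=-(-1)^{|\beta|}(\alpha^\sharp\wedge\beta^\sharp\wedge\gamma^\sharp\otimes\mathrm{id}_L)\Upsilon_{A^\dagger}$, with $|\cdot|$ the form degree. **Deformations.** A *smooth deformation* of $A$ is a smooth one-parameter family $A_t$ of Dirac--Jacobi structures in $(E;L)$ with $A_0=A$; being interested in small deformations, one assumes all $A_t$ transverse to $B$. Then $A_t=\mathrm{Gr}(\eta_t)=\{\xi+\eta_t(\xi,-)\mid\xi\in A\}\subset A\oplus A^\dagger\simeq E$ for a unique smooth family $\eta_t\in\Omega^2(A;L)$ with $\eta_0=0$. An *infinitesimal deformation* of $A$ is a $2$-cocycle $\eta$ of $(\Omega^\bullet(A;L),\mathrm d_{A,L})$. It *arises from* the smooth deformation $A_t$ if $\eta=\frac{\mathrm d}{\mathrm dt}|_{t=0}\eta_t$. It is *obstructed* if it does not arise from any smooth deformation of $A$. *)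

theory Defs
  imports "HOL-Analysis.Analysis" "HOL-Combinatorics.Permutations"
begin

section \<open>Smooth manifolds and vector bundles\<close>

primrec Ck_on :: "nat \<Rightarrow> 'a::real_normed_vector set \<Rightarrow> ('a \<Rightarrow> 'b::real_normed_vector) \<Rightarrow> bool" where
  "Ck_on 0 S f \<longleftrightarrow> continuous_on S f"
| "Ck_on (Suc n) S f \<longleftrightarrow> (\<forall>x\<in>S. f differentiable (at x)) \<and>
     (\<forall>v. Ck_on n S (\<lambda>x. frechet_derivative f (at x) v))"

definition smooth_on :: "'a::real_normed_vector set \<Rightarrow> ('a \<Rightarrow> 'b::real_normed_vector) \<Rightarrow> bool" where
  "smooth_on S f \<longleftrightarrow> (\<forall>n. Ck_on n S f)"

type_synonym ('m, 'e) atlas = "('m set \<times> ('m \<Rightarrow> 'e)) set"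

text \<open>
  The manifold is the whole type \<open>'m\<close>, assumed Hausdorff and second countable. The model space is a
  finite-dimensional normed space rather than a type of class \<^class>\<open>euclidean_space\<close>, because the
  latter has positive dimension and would exclude \<open>0\<close>-dimensional manifolds.
\<close>
definition smooth_atlas ::
  "('m::{t2_space, second_countable_topology}, 'e::real_normed_vector) atlas \<Rightarrow> bool" where
  "smooth_atlas M \<longleftrightarrow>
     (\<exists>S::'e set. finite S \<and> span S = UNIV) \<and>
     (\<Union>(U, \<phi>)\<in>M. U) = UNIV \<and>
     (\<forall>(U, \<phi>)\<in>M. open U \<and> open (\<phi> ` U) \<and> homeomorphism U (\<phi> ` U) \<phi> (inv_into U \<phi>)) \<and>
     (\<forall>(U, \<phi>)\<in>M. \<forall>(V, \<psi>)\<in>M. smooth_on (\<phi> ` (U \<inter> V)) (\<lambda>y. \<psi> (inv_into U \<phi> y)))"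

definition smooth_fun_on ::
  "('m, 'e::real_normed_vector) atlas \<Rightarrow> 'm set \<Rightarrow> ('m \<Rightarrow> real) \<Rightarrow> bool" where
  "smooth_fun_on M U f \<longleftrightarrow>
     (\<forall>(V, \<phi>)\<in>M. smooth_on (\<phi> ` (U \<inter> V)) (\<lambda>y. f (inv_into V \<phi> y)))"

text \<open>Joint smoothness of \<open>(t, x) \<mapsto> f t x\<close> on \<open>J \<times> U\<close>.\<close>
definition smooth_fun_family_on ::
  "('m, 'e::real_normed_vector) atlas \<Rightarrow> real set \<Rightarrow> 'm set \<Rightarrow> (real \<Rightarrow> 'm \<Rightarrow> real) \<Rightarrow> bool" where
  "smooth_fun_family_on M J U f \<longleftrightarrow>
     (\<forall>(V, \<phi>)\<in>M. smooth_on (J \<times> \<phi> ` (U \<inter> V)) (\<lambda>(t, y). f t (inv_into V \<phi> y)))"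

definition Cinf :: "('m, 'e::real_normed_vector) atlas \<Rightarrow> ('m \<Rightarrow> real) set" where
  "Cinf M = {f. smooth_fun_on M UNIV f}"

definition vector_field ::
  "('m, 'e::real_normed_vector) atlas \<Rightarrow> (('m \<Rightarrow> real) \<Rightarrow> ('m \<Rightarrow> real)) \<Rightarrow> bool" where
  "vector_field M X \<longleftrightarrow>
     (\<forall>f\<in>Cinf M. X f \<in> Cinf M) \<and>
     (\<forall>f\<in>Cinf M. \<forall>g\<in>Cinf M. \<forall>a. X (\<lambda>x. a * f x + g x) = (\<lambda>x. a * X f x + X g x)) \<and>
     (\<forall>f\<in>Cinf M. \<forall>g\<in>Cinf M. X (\<lambda>x. f x * g x) = (\<lambda>x. X f x * g x + f x * X g x))"

text \<open>
  The fibres of a vector bundle are linear subspaces of one real vector space \<open>'v\<close>, which is only a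
  container (no structure of \<open>'v\<close> relates different fibres): every vector bundle is of this form, take
  for \<open>'v\<close> the direct sum of all fibres. The smooth structure is given by local frames \<open>(U, ss)\<close>.
\<close>
record ('m, 'v) vbundle =
  fib :: "'m \<Rightarrow> 'v set"
  frames :: "('m set \<times> ('m \<Rightarrow> 'v) list) set"

definition basis_list :: "'v::real_vector set \<Rightarrow> 'v list \<Rightarrow> bool" where
  "basis_list S bs \<longleftrightarrow> distinct bs \<and> independent (set bs) \<and> span (set bs) = S"

definition smooth_section_on :: "('m, 'e::real_normed_vector) atlas \<Rightarrow> ('m, 'v::real_vector) vbundle \<Rightarrow>
    'm set \<Rightarrow> ('m \<Rightarrow> 'v) \<Rightarrow> bool" where
  "smooth_section_on M E U s \<longleftrightarrow>
     (\<forall>x\<in>U. s x \<in> fib E x) \<and>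
     (\<forall>(V, ss)\<in>frames E. \<exists>c. (\<forall>i<length ss. smooth_fun_on M (U \<inter> V) (c i)) \<and>
        (\<forall>x\<in>U \<inter> V. s x = (\<Sum>i<length ss. c i x *\<^sub>R (ss ! i) x)))"

definition smooth_section_family_on :: "('m, 'e::real_normed_vector) atlas \<Rightarrow>
    ('m, 'v::real_vector) vbundle \<Rightarrow> real set \<Rightarrow> 'm set \<Rightarrow> (real \<Rightarrow> 'm \<Rightarrow> 'v) \<Rightarrow> bool" where
  "smooth_section_family_on M E J U s \<longleftrightarrow>
     (\<forall>t\<in>J. \<forall>x\<in>U. s t x \<in> fib E x) \<and>
     (\<forall>(V, ss)\<in>frames E. \<exists>c. (\<forall>i<length ss. smooth_fun_family_on M J (U \<inter> V) (c i)) \<and>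
        (\<forall>t\<in>J. \<forall>x\<in>U \<inter> V. s t x = (\<Sum>i<length ss. c i t x *\<^sub>R (ss ! i) x)))"

text \<open>The last condition says that the transition matrices between any two frames are smooth.\<close>
definition vector_bundle ::
  "('m::topological_space, 'e::real_normed_vector) atlas \<Rightarrow> ('m, 'v::real_vector) vbundle \<Rightarrow> bool" where
  "vector_bundle M E \<longleftrightarrow>
     (\<forall>x. subspace (fib E x)) \<and>
     (\<Union>(U, ss)\<in>frames E. U) = UNIV \<and>
     (\<forall>(U, ss)\<in>frames E. open U \<and>
        (\<forall>x\<in>U. basis_list (fib E x) (map (\<lambda>s. s x) ss)) \<and>
        (\<forall>s\<in>set ss. smooth_section_on M E U s))"

definition line_bundle ::
  "('m::topological_space, 'e::real_normed_vector) atlas \<Rightarrow> ('m, 'v::real_vector) vbundle \<Rightarrow> bool" where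
  "line_bundle M L \<longleftrightarrow> vector_bundle M L \<and> (\<forall>x. dim (fib L x) = 1)"

definition Gam ::
  "('m, 'e::real_normed_vector) atlas \<Rightarrow> ('m, 'v::real_vector) vbundle \<Rightarrow> ('m \<Rightarrow> 'v) set" where
  "Gam M E = {s. smooth_section_on M E UNIV s}"

definition subbundle :: "('m::topological_space, 'e::real_normed_vector) atlas \<Rightarrow>
    ('m, 'v::real_vector) vbundle \<Rightarrow> ('m \<Rightarrow> 'v set) \<Rightarrow> bool" where
  "subbundle M E A \<longleftrightarrow>
     (\<forall>x. A x \<subseteq> fib E x) \<and>
     (\<forall>x. \<exists>U ss. open U \<and> x \<in> U \<and> (\<forall>s\<in>set ss. smooth_section_on M E U s) \<and>
        (\<forall>y\<in>U. basis_list (A y) (map (\<lambda>s. s y) ss)))"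

text \<open>A family of subbundles over an open interval \<open>I\<close> is smooth if locally it has frames that depend
  jointly smoothly on the parameter and the point.\<close>
definition smooth_subbundle_family :: "('m::topological_space, 'e::real_normed_vector) atlas \<Rightarrow>
    ('m, 'v::real_vector) vbundle \<Rightarrow> real set \<Rightarrow> (real \<Rightarrow> 'm \<Rightarrow> 'v set) \<Rightarrow> bool" where
  "smooth_subbundle_family M E I At \<longleftrightarrow>
     (\<forall>t\<in>I. subbundle M E (At t)) \<and>
     (\<forall>t\<in>I. \<forall>x. \<exists>J U ss. open J \<and> t \<in> J \<and> J \<subseteq> I \<and> open U \<and> x \<in> U \<and>
        (\<forall>s\<in>set ss. smooth_section_family_on M E J U s) \<and>
        (\<forall>r\<in>J. \<forall>y\<in>U. basis_list (At r y) (map (\<lambda>s. s r y) ss)))"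


section \<open>Courant--Jacobi algebroids\<close>

text \<open>Sections of the gauge algebroid \<open>DL\<close>.\<close>
definition derivation_of :: "('m, 'e::real_normed_vector) atlas \<Rightarrow> ('m, 'l::real_vector) vbundle \<Rightarrow>
    (('m \<Rightarrow> 'l) \<Rightarrow> ('m \<Rightarrow> 'l)) \<Rightarrow> bool" where
  "derivation_of M L \<Delta> \<longleftrightarrow>
     (\<forall>s\<in>Gam M L. \<Delta> s \<in> Gam M L) \<and>
     (\<forall>s\<in>Gam M L. \<forall>r\<in>Gam M L. \<forall>a. \<Delta> (\<lambda>x. a *\<^sub>R s x + r x) = (\<lambda>x. a *\<^sub>R \<Delta> s x + \<Delta> r x)) \<and>
     (\<exists>X. vector_field M X \<and>
        (\<forall>f\<in>Cinf M. \<forall>s\<in>Gam M L. \<Delta> (\<lambda>x. f x *\<^sub>R s x) = (\<lambda>x. X f x *\<^sub>R s x + f x *\<^sub>R \<Delta> s x)))"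

text \<open>
  \<open>nab D x u \<mu>\<close> is the value in \<open>L\<^sub>x\<close> of the derivation \<open>\<nabla>\<^sub>u \<in> (DL)\<^sub>x\<close>, \<open>u \<in> E\<^sub>x\<close>, on the section \<open>\<mu>\<close>.
\<close>
record ('m, 'e, 'v, 'l) cj_data =
  atl :: "('m, 'e) atlas"
  Ebun :: "('m, 'v) vbundle"
  Lbun :: "('m, 'l) vbundle"
  prd :: "'m \<Rightarrow> 'v \<Rightarrow> 'v \<Rightarrow> 'l"
  brk :: "('m \<Rightarrow> 'v) \<Rightarrow> ('m \<Rightarrow> 'v) \<Rightarrow> ('m \<Rightarrow> 'v)"
  nab :: "'m \<Rightarrow> 'v \<Rightarrow> ('m \<Rightarrow> 'l) \<Rightarrow> 'l"

abbreviation GamE ::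
  "('m, 'e::real_normed_vector, 'v::real_vector, 'l) cj_data \<Rightarrow> ('m \<Rightarrow> 'v) set" where
  "GamE D \<equiv> Gam (atl D) (Ebun D)"

abbreviation GamL ::
  "('m, 'e::real_normed_vector, 'v, 'l::real_vector) cj_data \<Rightarrow> ('m \<Rightarrow> 'l) set" where
  "GamL D \<equiv> Gam (atl D) (Lbun D)"

definition prdS :: "('m, 'e, 'v, 'l) cj_data \<Rightarrow> ('m \<Rightarrow> 'v) \<Rightarrow> ('m \<Rightarrow> 'v) \<Rightarrow> ('m \<Rightarrow> 'l)" where
  "prdS D e1 e2 = (\<lambda>x. prd D x (e1 x) (e2 x))"

definition nabS :: "('m, 'e, 'v, 'l) cj_data \<Rightarrow> ('m \<Rightarrow> 'v) \<Rightarrow> ('m \<Rightarrow> 'l) \<Rightarrow> ('m \<Rightarrow> 'l)" where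
  "nabS D e \<mu> = (\<lambda>x. nab D x (e x) \<mu>)"

definition courant_jacobi :: "('m::{t2_space, second_countable_topology}, 'e::real_normed_vector,
    'v::real_vector, 'l::real_vector) cj_data \<Rightarrow> bool" where
  "courant_jacobi D \<longleftrightarrow>
     smooth_atlas (atl D) \<and> vector_bundle (atl D) (Ebun D) \<and> line_bundle (atl D) (Lbun D) \<and>
     \<comment> \<open>non-degenerate symmetric product, a morphism of vector bundles\<close>
     (\<forall>x. \<forall>u\<in>fib (Ebun D) x. \<forall>v\<in>fib (Ebun D) x.
        prd D x u v \<in> fib (Lbun D) x \<and> prd D x u v = prd D x v u) \<and>
     (\<forall>x. \<forall>u\<in>fib (Ebun D) x. \<forall>v\<in>fib (Ebun D) x. \<forall>w\<in>fib (Ebun D) x. \<forall>a.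
        prd D x (a *\<^sub>R u + v) w = a *\<^sub>R prd D x u w + prd D x v w) \<and>
     (\<forall>x. \<forall>u\<in>fib (Ebun D) x. (\<forall>v\<in>fib (Ebun D) x. prd D x u v = 0) \<longrightarrow> u = 0) \<and>
     (\<forall>e1\<in>GamE D. \<forall>e2\<in>GamE D. prdS D e1 e2 \<in> GamL D) \<and>
     \<comment> \<open>bracket\<close>
     (\<forall>e1\<in>GamE D. \<forall>e2\<in>GamE D. brk D e1 e2 \<in> GamE D) \<and>
     (\<forall>e1\<in>GamE D. \<forall>e2\<in>GamE D. \<forall>e3\<in>GamE D. \<forall>a.
        brk D (\<lambda>x. a *\<^sub>R e1 x + e2 x) e3 = (\<lambda>x. a *\<^sub>R brk D e1 e3 x + brk D e2 e3 x) \<and>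
        brk D e3 (\<lambda>x. a *\<^sub>R e1 x + e2 x) = (\<lambda>x. a *\<^sub>R brk D e3 e1 x + brk D e3 e2 x)) \<and>
     (\<forall>e1\<in>GamE D. \<forall>e2\<in>GamE D. \<forall>e3\<in>GamE D.
        brk D e1 (brk D e2 e3) = (\<lambda>x. brk D (brk D e1 e2) e3 x + brk D e2 (brk D e1 e3) x)) \<and>
     \<comment> \<open>morphism of vector bundles from \<open>E\<close> to \<open>DL\<close>\<close>
     (\<forall>x. \<forall>u\<in>fib (Ebun D) x. \<forall>v\<in>fib (Ebun D) x. \<forall>a. \<forall>\<mu>\<in>GamL D.
        nab D x (a *\<^sub>R u + v) \<mu> = a *\<^sub>R nab D x u \<mu> + nab D x v \<mu>) \<and>
     (\<forall>e\<in>GamE D. derivation_of (atl D) (Lbun D) (nabS D e)) \<and>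
     \<comment> \<open>compatibility\<close>
     (\<forall>e1\<in>GamE D. \<forall>e2\<in>GamE D.
        prdS D (brk D e1 e2) e2 = prdS D e1 (brk D e2 e2) \<and>
        nabS D e1 (prdS D e2 e2) = (\<lambda>x. 2 *\<^sub>R prdS D (brk D e1 e2) e2 x))"

definition GamSub :: "('m, 'e::real_normed_vector, 'v::real_vector, 'l) cj_data \<Rightarrow>
    ('m \<Rightarrow> 'v set) \<Rightarrow> ('m \<Rightarrow> 'v) set" where
  "GamSub D A = {s \<in> GamE D. \<forall>x. s x \<in> A x}"

definition almost_dirac_jacobi :: "('m::topological_space, 'e::real_normed_vector, 'v::real_vector,
    'l::real_vector) cj_data \<Rightarrow> ('m \<Rightarrow> 'v set) \<Rightarrow> bool" where
  "almost_dirac_jacobi D A \<longleftrightarrow> subbundle (atl D) (Ebun D) A \<and>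
     (\<forall>x. A x = {u \<in> fib (Ebun D) x. \<forall>a\<in>A x. prd D x u a = 0})"

definition dirac_jacobi :: "('m::topological_space, 'e::real_normed_vector, 'v::real_vector,
    'l::real_vector) cj_data \<Rightarrow> ('m \<Rightarrow> 'v set) \<Rightarrow> bool" where
  "dirac_jacobi D A \<longleftrightarrow> almost_dirac_jacobi D A \<and>
     (\<forall>\<xi>\<in>GamSub D A. \<forall>\<zeta>\<in>GamSub D A. brk D \<xi> \<zeta> \<in> GamSub D A)"

definition complementary :: "('m, 'e, 'v::real_vector, 'l) cj_data \<Rightarrow>
    ('m \<Rightarrow> 'v set) \<Rightarrow> ('m \<Rightarrow> 'v set) \<Rightarrow> bool" where
  "complementary D A B \<longleftrightarrow>
     (\<forall>x. A x \<inter> B x = {0} \<and> fib (Ebun D) x = {a + b | a b. a \<in> A x \<and> b \<in> B x})"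


section \<open>Differential forms on \<open>A\<close>\<close>

text \<open>
  An element of \<open>\<wedge>\<^sup>k S\<^sup>* \<otimes> W\<close> is an alternating multilinear function on lists of length \<open>k\<close> over \<open>S\<close>,
  extended by \<open>0\<close> to all other lists. Degrees are integers, so that the only form of degree
  \<open>k < 0\<close> is \<open>0\<close>. A form is a section \<open>\<alpha>\<close>, with \<open>\<alpha> x vs\<close> its value at the point \<open>x\<close>.
\<close>
definition alt_forms ::
  "'v::real_vector set \<Rightarrow> 'w::real_vector set \<Rightarrow> int \<Rightarrow> ('v list \<Rightarrow> 'w) set" where
  "alt_forms S W k = {f.
     (\<forall>vs. f vs \<noteq> 0 \<longrightarrow> set vs \<subseteq> S \<and> int (length vs) = k) \<and>
     (\<forall>vs. set vs \<subseteq> S \<longrightarrow> f vs \<in> W) \<and>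
     (\<forall>vs i a. \<forall>u\<in>S. \<forall>v\<in>S. set vs \<subseteq> S \<and> i < length vs \<longrightarrow>
        f (vs[i := a *\<^sub>R u + v]) = a *\<^sub>R f (vs[i := u]) + f (vs[i := v])) \<and>
     (\<forall>vs i j. set vs \<subseteq> S \<and> i < j \<and> j < length vs \<and> vs ! i = vs ! j \<longrightarrow> f vs = 0)}"

type_synonym ('m, 'v, 'w) form = "'m \<Rightarrow> 'v list \<Rightarrow> 'w"

text \<open>\<open>\<Omega>\<^sup>k(A)\<close> and \<open>\<Omega>\<^sup>k(A;L)\<close>\<close>
definition Om :: "('m, 'e::real_normed_vector, 'v::real_vector, 'l) cj_data \<Rightarrow> ('m \<Rightarrow> 'v set) \<Rightarrow>
    int \<Rightarrow> ('m, 'v, real) form set" where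
  "Om D A k = {\<omega>. (\<forall>x. \<omega> x \<in> alt_forms (A x) UNIV k) \<and>
     (\<forall>Xs. set Xs \<subseteq> GamSub D A \<longrightarrow> (\<lambda>x. \<omega> x (map (\<lambda>X. X x) Xs)) \<in> Cinf (atl D))}"

definition OmL :: "('m, 'e::real_normed_vector, 'v::real_vector, 'l::real_vector) cj_data \<Rightarrow>
    ('m \<Rightarrow> 'v set) \<Rightarrow> int \<Rightarrow> ('m, 'v, 'l) form set" where
  "OmL D A k = {\<alpha>. (\<forall>x. \<alpha> x \<in> alt_forms (A x) (fib (Lbun D) x) k) \<and>
     (\<forall>Xs. set Xs \<subseteq> GamSub D A \<longrightarrow> (\<lambda>x. \<alpha> x (map (\<lambda>X. X x) Xs)) \<in> GamL D)}"

text \<open>Wedge product in the determinant convention; the summand \<open>j\<close> pairs the degree \<open>j\<close> component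
  of the first factor with the complementary component of the second.\<close>
definition wedge_at ::
  "('v list \<Rightarrow> real) \<Rightarrow> ('v list \<Rightarrow> 'w::real_vector) \<Rightarrow> 'v list \<Rightarrow> 'w" where
  "wedge_at \<omega> \<alpha> vs = (\<Sum>j\<le>length vs. (1 / (fact j * fact (length vs - j))) *\<^sub>R
     (\<Sum>p | p permutes {..<length vs}.
        (of_int (sign p) * \<omega> (take j (permute_list p vs))) *\<^sub>R \<alpha> (drop j (permute_list p vs))))"

definition wedge ::
  "('m, 'v, real) form \<Rightarrow> ('m, 'v, 'w::real_vector) form \<Rightarrow> ('m, 'v, 'w) form" where
  "wedge \<omega> \<alpha> = (\<lambda>x. wedge_at (\<omega> x) (\<alpha> x))"

definition form0 :: "('m \<Rightarrow> 'w::zero) \<Rightarrow> ('m, 'v, 'w) form" where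
  "form0 s = (\<lambda>x vs. if vs = [] then s x else 0)"

text \<open>The right-hand side of the formula for \<open>d\<^bsub>A,L\<^esub>\<close>, evaluated at \<open>x\<close>; \<open>nths Xs (- S)\<close> is \<open>Xs\<close> with
  the entries at positions in \<open>S\<close> omitted.\<close>
definition koszul :: "('m, 'e, 'v, 'l::real_vector) cj_data \<Rightarrow> ('m, 'v, 'l) form \<Rightarrow>
    ('m \<Rightarrow> 'v) list \<Rightarrow> 'm \<Rightarrow> 'l" where
  "koszul D \<alpha> Xs x =
     (\<Sum>i<length Xs. (-1) ^ i *\<^sub>R
        nabS D (Xs ! i) (\<lambda>y. \<alpha> y (map (\<lambda>X. X y) (nths Xs (- {i})))) x) +
     (\<Sum>j<length Xs. \<Sum>i<j. (-1) ^ (i + j) *\<^sub>R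
        \<alpha> x (map (\<lambda>X. X x) (brk D (Xs ! i) (Xs ! j) # nths Xs (- {i, j}))))"

definition extend_vec :: "('m, 'e::real_normed_vector, 'v::real_vector, 'l) cj_data \<Rightarrow>
    ('m \<Rightarrow> 'v set) \<Rightarrow> 'm \<Rightarrow> 'v \<Rightarrow> 'm \<Rightarrow> 'v" where
  "extend_vec D A x v = (SOME X. X \<in> GamSub D A \<and> X x = v)"

text \<open>The formula for \<open>d\<^bsub>A,L\<^esub> \<alpha>\<close> is \<open>C\<^sup>\<infinity>\<close>-multilinear in the sections, so its value at \<open>x\<close> depends only on
  their values at \<open>x\<close> and the choice of the extensions is immaterial.\<close>
definition dAL :: "('m, 'e::real_normed_vector, 'v::real_vector, 'l::real_vector) cj_data \<Rightarrow>
    ('m \<Rightarrow> 'v set) \<Rightarrow> ('m, 'v, 'l) form \<Rightarrow> ('m, 'v, 'l) form" where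
  "dAL D A \<alpha> = (\<lambda>x vs. if set vs \<subseteq> A x then koszul D \<alpha> (map (extend_vec D A x) vs) x else 0)"


section \<open>The identification of \<open>B\<close> with \<open>A\<^sup>\<dagger>\<close>\<close>

text \<open>\<open>unflat\<close> is the inverse of \<open>B \<rightarrow> A\<^sup>\<dagger>\<close>, \<open>b \<mapsto> \<langle>\<langle>b, -\<rangle>\<rangle>|\<^sub>A\<close>. Through it \<open>A\<^sup>\<dagger>\<close> is regarded as the summand \<open>B\<close>
  of \<open>E\<close>, which is how the Courant--Jacobi structure of \<open>E\<close> is transferred to \<open>A \<oplus> A\<^sup>\<dagger>\<close>.\<close>
definition unflat :: "('m, 'e, 'v, 'l) cj_data \<Rightarrow> ('m \<Rightarrow> 'v set) \<Rightarrow> ('m \<Rightarrow> 'v set) \<Rightarrow>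
    'm \<Rightarrow> ('v \<Rightarrow> 'l) \<Rightarrow> 'v" where
  "unflat D A B x f = (THE b. b \<in> B x \<and> (\<forall>a\<in>A x. prd D x b a = f a))"

definition unflatS :: "('m, 'e, 'v, 'l) cj_data \<Rightarrow> ('m \<Rightarrow> 'v set) \<Rightarrow> ('m \<Rightarrow> 'v set) \<Rightarrow>
    ('m, 'v, 'l) form \<Rightarrow> 'm \<Rightarrow> 'v" where
  "unflatS D A B \<alpha> = (\<lambda>x. unflat D A B x (\<lambda>a. \<alpha> x [a]))"

text \<open>The projection \<open>E \<rightarrow> A\<^sup>\<dagger>\<close> on sections: project to \<open>B\<close> along \<open>A\<close> and apply \<open>b \<mapsto> \<langle>\<langle>b, -\<rangle>\<rangle>|\<^sub>A\<close>.\<close>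
definition pr_dagger :: "('m, 'e, 'v::real_vector, 'l::real_vector) cj_data \<Rightarrow> ('m \<Rightarrow> 'v set) \<Rightarrow>
    ('m \<Rightarrow> 'v set) \<Rightarrow> ('m \<Rightarrow> 'v) \<Rightarrow> ('m, 'v, 'l) form" where
  "pr_dagger D A B e = (\<lambda>x vs. if length vs = 1 \<and> set vs \<subseteq> A x
     then prd D x (THE b. b \<in> B x \<and> e x - b \<in> A x) (hd vs) else 0)"

definition brk_dagger :: "('m, 'e, 'v::real_vector, 'l::real_vector) cj_data \<Rightarrow> ('m \<Rightarrow> 'v set) \<Rightarrow>
    ('m \<Rightarrow> 'v set) \<Rightarrow> ('m, 'v, 'l) form \<Rightarrow> ('m, 'v, 'l) form \<Rightarrow> ('m, 'v, 'l) form" where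
  "brk_dagger D A B \<alpha> \<beta> = pr_dagger D A B (brk D (unflatS D A B \<alpha>) (unflatS D A B \<beta>))"

definition nab_dagger :: "('m, 'e, 'v, 'l) cj_data \<Rightarrow> ('m \<Rightarrow> 'v set) \<Rightarrow> ('m \<Rightarrow> 'v set) \<Rightarrow>
    ('m, 'v, 'l) form \<Rightarrow> ('m \<Rightarrow> 'l) \<Rightarrow> ('m \<Rightarrow> 'l)" where
  "nab_dagger D A B \<alpha> = nabS D (unflatS D A B \<alpha>)"

definition graded_derivation :: "('m, 'e::real_normed_vector, 'v::real_vector, 'l) cj_data \<Rightarrow>
    ('m \<Rightarrow> 'v set) \<Rightarrow> int \<Rightarrow> (('m, 'v, real) form \<Rightarrow> ('m, 'v, real) form) \<Rightarrow> bool" where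
  "graded_derivation D A d X \<longleftrightarrow>
     (\<forall>j. \<forall>\<omega>\<in>Om D A j. X \<omega> \<in> Om D A (j + d)) \<and>
     (\<forall>j a. \<forall>\<omega>\<in>Om D A j. \<forall>\<tau>\<in>Om D A j.
        X (\<lambda>x vs. a * \<omega> x vs + \<tau> x vs) = (\<lambda>x vs. a * X \<omega> x vs + X \<tau> x vs)) \<and>
     (\<forall>j k. \<forall>\<omega>\<in>Om D A j. \<forall>\<tau>\<in>Om D A k. X (wedge \<omega> \<tau>) =
        (\<lambda>x vs. wedge (X \<omega>) \<tau> x vs + (-1) powi (d * j) * wedge \<omega> (X \<tau>) x vs))"

definition graded_module_derivation :: "('m, 'e::real_normed_vector, 'v::real_vector,
    'l::real_vector) cj_data \<Rightarrow> ('m \<Rightarrow> 'v set) \<Rightarrow> int \<Rightarrow>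
    (('m, 'v, 'l) form \<Rightarrow> ('m, 'v, 'l) form) \<Rightarrow> bool" where
  "graded_module_derivation D A d X \<longleftrightarrow>
     (\<forall>j. \<forall>\<alpha>\<in>OmL D A j. X \<alpha> \<in> OmL D A (j + d)) \<and>
     (\<forall>j a. \<forall>\<alpha>\<in>OmL D A j. \<forall>\<beta>\<in>OmL D A j.
        X (\<lambda>x vs. a *\<^sub>R \<alpha> x vs + \<beta> x vs) = (\<lambda>x vs. a *\<^sub>R X \<alpha> x vs + X \<beta> x vs)) \<and>
     (\<exists>Y. graded_derivation D A d Y \<and>
        (\<forall>j k. \<forall>\<omega>\<in>Om D A j. \<forall>\<alpha>\<in>OmL D A k. X (wedge \<omega> \<alpha>) =
           (\<lambda>x vs. wedge (Y \<omega>) \<alpha> x vs + (-1) powi (d * j) *\<^sub>R wedge \<omega> (X \<alpha>) x vs)))"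

text \<open>
  The defining properties of \<open>[-,-]\<^bsub>A\<^sup>\<dagger>,L\<^esub>\<close>. An element of \<open>\<Omega>\<^sup>k(A;L)\<close> has degree \<open>k - 1\<close> in \<open>\<Omega>\<^sup>\<bullet>(A;L)[1]\<close>, and
  the bracket has degree \<open>0\<close> there. It is \<open>\<real>\<close>-bilinear and a graded derivation in each entry: for the
  second entry this is the second condition, for the first it then follows from skew-symmetry.
\<close>
definition is_dagger_bracket :: "('m, 'e::real_normed_vector, 'v::real_vector, 'l::real_vector)
    cj_data \<Rightarrow> ('m \<Rightarrow> 'v set) \<Rightarrow> ('m \<Rightarrow> 'v set) \<Rightarrow>
    (('m, 'v, 'l) form \<Rightarrow> ('m, 'v, 'l) form \<Rightarrow> ('m, 'v, 'l) form) \<Rightarrow> bool" where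
  "is_dagger_bracket D A B br \<longleftrightarrow>
     (\<forall>k l. \<forall>\<alpha>\<in>OmL D A k. \<forall>\<beta>\<in>OmL D A l.
        br \<alpha> \<beta> = (\<lambda>x vs. - ((-1) powi ((k - 1) * (l - 1)) *\<^sub>R br \<beta> \<alpha> x vs))) \<and>
     (\<forall>k. \<forall>\<alpha>\<in>OmL D A k. graded_module_derivation D A (k - 1) (br \<alpha>)) \<and>
     (\<forall>\<alpha>\<in>OmL D A 1. \<forall>\<beta>\<in>OmL D A 1. br \<alpha> \<beta> = brk_dagger D A B \<alpha> \<beta>) \<and>
     (\<forall>\<alpha>\<in>OmL D A 1. \<forall>\<mu>\<in>GamL D. br \<alpha> (form0 \<mu>) = form0 (nab_dagger D A B \<alpha> \<mu>))"

definition Upsilon :: "('m, 'e, 'v, 'l) cj_data \<Rightarrow> ('m \<Rightarrow> 'v set) \<Rightarrow> ('m \<Rightarrow> 'v set) \<Rightarrow>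
    ('m, 'v, 'l) form \<Rightarrow> ('m, 'v, 'l) form \<Rightarrow> ('m, 'v, 'l) form \<Rightarrow> 'm \<Rightarrow> 'l" where
  "Upsilon D A B \<alpha>1 \<alpha>2 \<alpha>3 =
     prdS D (brk D (unflatS D A B \<alpha>1) (unflatS D A B \<alpha>2)) (unflatS D A B \<alpha>3)"


section \<open>The \<open>L\<^sub>\<infinity>[1]\<close>-algebra\<close>

text \<open>\<open>sharp \<alpha>\<^sub>x u \<nu> = \<alpha>\<^sup>\<sharp>(u \<otimes> \<nu>)\<close>\<close>
definition sharp ::
  "('v list \<Rightarrow> 'l) \<Rightarrow> 'v \<Rightarrow> ('l \<Rightarrow> real) \<Rightarrow> 'v list \<Rightarrow> real" where
  "sharp \<alpha> u \<nu> = (\<lambda>vs. \<nu> (\<alpha> (u # vs)))"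

text \<open>\<open>(\<alpha>1\<^sup>\<sharp> \<and> \<alpha>2\<^sup>\<sharp> \<and> \<alpha>3\<^sup>\<sharp>)((u\<^sub>0 \<otimes> \<nu>) \<and> (u\<^sub>1 \<otimes> \<nu>) \<and> (u\<^sub>2 \<otimes> \<nu>))\<close>\<close>
definition sharp3 :: "('v list \<Rightarrow> 'l) \<Rightarrow> ('v list \<Rightarrow> 'l) \<Rightarrow> ('v list \<Rightarrow> 'l) \<Rightarrow>
    'v list \<Rightarrow> ('l \<Rightarrow> real) \<Rightarrow> 'v list \<Rightarrow> real" where
  "sharp3 \<alpha>1 \<alpha>2 \<alpha>3 us \<nu> = (\<lambda>vs. \<Sum>p | p permutes {..<3::nat}. of_int (sign p) *
     wedge_at (sharp \<alpha>1 (us ! p 0) \<nu>)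
       (wedge_at (sharp \<alpha>2 (us ! p 1) \<nu>) (sharp \<alpha>3 (us ! p 2) \<nu>)) vs)"

text \<open>A basis \<open>us\<close> of \<open>A\<^sub>x\<close>, a generator \<open>l\<close> of \<open>L\<^sub>x\<close> with dual \<open>\<nu>\<close>, and sections \<open>\<theta>s\<close> of \<open>A\<^sup>\<dagger>\<close> which at
  \<open>x\<close> are the basis dual to \<open>u\<^sub>i \<otimes> \<nu>\<close>\<close>
definition adapted :: "('m, 'e::real_normed_vector, 'v::real_vector, 'l::real_vector) cj_data \<Rightarrow>
    ('m \<Rightarrow> 'v set) \<Rightarrow> 'm \<Rightarrow> 'v list \<times> 'l \<times> ('l \<Rightarrow> real) \<times> ('m, 'v, 'l) form list \<Rightarrow> bool" where
  "adapted D A x = (\<lambda>(us, l, \<nu>, \<theta>s). basis_list (A x) us \<and>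
     l \<in> fib (Lbun D) x \<and> l \<noteq> 0 \<and> (\<forall>c. \<nu> (c *\<^sub>R l) = c) \<and>
     length \<theta>s = length us \<and> set \<theta>s \<subseteq> OmL D A 1 \<and>
     (\<forall>i<length us. \<forall>j<length us. (\<theta>s ! i) x [us ! j] = (if i = j then l else 0)))"

text \<open>\<open>(\<alpha>1\<^sup>\<sharp> \<and> \<alpha>2\<^sup>\<sharp> \<and> \<alpha>3\<^sup>\<sharp> \<otimes> id\<^sub>L) \<Upsilon>\<close>. At \<open>x\<close> one has
  \<open>\<Upsilon> = \<Sum>\<^bsub>i<j<k\<^esub> (u\<^sub>i \<otimes> \<nu>) \<and> (u\<^sub>j \<otimes> \<nu>) \<and> (u\<^sub>k \<otimes> \<nu>) \<otimes> \<Upsilon>(\<theta>\<^sub>i, \<theta>\<^sub>j, \<theta>\<^sub>k)\<close> for adapted data, whose choice is immaterial.\<close>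
definition sharp3_Upsilon :: "('m, 'e::real_normed_vector, 'v::real_vector, 'l::real_vector)
    cj_data \<Rightarrow> ('m \<Rightarrow> 'v set) \<Rightarrow> ('m \<Rightarrow> 'v set) \<Rightarrow>
    ('m, 'v, 'l) form \<Rightarrow> ('m, 'v, 'l) form \<Rightarrow> ('m, 'v, 'l) form \<Rightarrow> ('m, 'v, 'l) form" where
  "sharp3_Upsilon D A B \<alpha>1 \<alpha>2 \<alpha>3 = (\<lambda>x vs.
     let (us, l, \<nu>, \<theta>s) = (SOME d. adapted D A x d) in
       \<Sum>k<length us. \<Sum>j<k. \<Sum>i<j.
         sharp3 (\<alpha>1 x) (\<alpha>2 x) (\<alpha>3 x) [us ! i, us ! j, us ! k] \<nu> vs *\<^sub>R
           Upsilon D A B (\<theta>s ! i) (\<theta>s ! j) (\<theta>s ! k) x)"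

text \<open>\<open>linf D A B br [(k\<^sub>1, \<alpha>\<^sub>1), \<dots>, (k\<^sub>n, \<alpha>\<^sub>n)] = \<mm>\<^sub>n(\<alpha>\<^sub>1, \<dots>, \<alpha>\<^sub>n)\<close> for \<open>\<alpha>\<^sub>i\<close> of form degree \<open>k\<^sub>i\<close>, where \<open>br\<close> is the
  bracket \<open>[-,-]\<^bsub>A\<^sup>\<dagger>,L\<^esub>\<close>.\<close>
fun linf :: "('m, 'e::real_normed_vector, 'v::real_vector, 'l::real_vector) cj_data \<Rightarrow>
    ('m \<Rightarrow> 'v set) \<Rightarrow> ('m \<Rightarrow> 'v set) \<Rightarrow>
    (('m, 'v, 'l) form \<Rightarrow> ('m, 'v, 'l) form \<Rightarrow> ('m, 'v, 'l) form) \<Rightarrow>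
    (int \<times> ('m, 'v, 'l) form) list \<Rightarrow> ('m, 'v, 'l) form" where
  "linf D A B br [(k, \<alpha>)] = dAL D A \<alpha>"
| "linf D A B br [(k, \<alpha>), (l, \<beta>)] = (\<lambda>x vs. (-1) powi k *\<^sub>R br \<alpha> \<beta> x vs)"
| "linf D A B br [(k, \<alpha>), (l, \<beta>), (m, \<gamma>)] =
     (\<lambda>x vs. - ((-1) powi l *\<^sub>R sharp3_Upsilon D A B \<alpha> \<beta> \<gamma> x vs))"
| "linf D A B br _ = (\<lambda>x vs. 0)"


section \<open>Cohomology and the Kuranishi map\<close>

definition cocycles :: "('m, 'e::real_normed_vector, 'v::real_vector, 'l::real_vector) cj_data \<Rightarrow>
    ('m \<Rightarrow> 'v set) \<Rightarrow> int \<Rightarrow> ('m, 'v, 'l) form set" where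
  "cocycles D A k = {\<alpha> \<in> OmL D A k. dAL D A \<alpha> = (\<lambda>x vs. 0)}"

definition cohomologous :: "('m, 'e::real_normed_vector, 'v::real_vector, 'l::real_vector) cj_data \<Rightarrow>
    ('m \<Rightarrow> 'v set) \<Rightarrow> int \<Rightarrow> (('m, 'v, 'l) form \<times> ('m, 'v, 'l) form) set" where
  "cohomologous D A k = {(\<alpha>, \<beta>). \<alpha> \<in> cocycles D A k \<and> \<beta> \<in> cocycles D A k \<and>
     (\<exists>\<gamma>\<in>OmL D A (k - 1). (\<lambda>x vs. \<alpha> x vs - \<beta> x vs) = dAL D A \<gamma>)}"

definition cohomology :: "('m, 'e::real_normed_vector, 'v::real_vector, 'l::real_vector) cj_data \<Rightarrow>
    ('m \<Rightarrow> 'v set) \<Rightarrow> int \<Rightarrow> ('m, 'v, 'l) form set set" where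
  "cohomology D A k = cocycles D A k // cohomologous D A k"

definition coh_class :: "('m, 'e::real_normed_vector, 'v::real_vector, 'l::real_vector) cj_data \<Rightarrow>
    ('m \<Rightarrow> 'v set) \<Rightarrow> int \<Rightarrow> ('m, 'v, 'l) form \<Rightarrow> ('m, 'v, 'l) form set" where
  "coh_class D A k \<alpha> = cohomologous D A k `` {\<alpha>}"

definition is_kuranishi_map :: "('m, 'e::real_normed_vector, 'v::real_vector, 'l::real_vector)
    cj_data \<Rightarrow> ('m \<Rightarrow> 'v set) \<Rightarrow> ('m \<Rightarrow> 'v set) \<Rightarrow>
    (('m, 'v, 'l) form \<Rightarrow> ('m, 'v, 'l) form \<Rightarrow> ('m, 'v, 'l) form) \<Rightarrow>
    (('m, 'v, 'l) form set \<Rightarrow> ('m, 'v, 'l) form set) \<Rightarrow> bool" where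
  "is_kuranishi_map D A B br Kur \<longleftrightarrow>
     Kur ` cohomology D A 2 \<subseteq> cohomology D A 3 \<and>
     (\<forall>w\<in>cocycles D A 2. Kur (coh_class D A 2 w) = coh_class D A 3 (linf D A B br [(2, w), (2, w)]))"


section \<open>Deformations\<close>

text \<open>\<open>Gr(\<eta>)\<close>, as a family of subspaces of \<open>E \<cong> A \<oplus> A\<^sup>\<dagger>\<close>\<close>
definition Gr :: "('m, 'e, 'v::real_vector, 'l) cj_data \<Rightarrow> ('m \<Rightarrow> 'v set) \<Rightarrow> ('m \<Rightarrow> 'v set) \<Rightarrow>
    ('m, 'v, 'l) form \<Rightarrow> 'm \<Rightarrow> 'v set" where
  "Gr D A B \<eta> = (\<lambda>x. {\<xi> + unflat D A B x (\<lambda>a. \<eta> x [\<xi>, a]) | \<xi>. \<xi> \<in> A x})"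

text \<open>Deformations are parametrised by \<open>t \<in> (-\<epsilon>, \<epsilon>)\<close>.\<close>
definition smooth_deformation :: "('m::topological_space, 'e::real_normed_vector, 'v::real_vector,
    'l::real_vector) cj_data \<Rightarrow> ('m \<Rightarrow> 'v set) \<Rightarrow> ('m \<Rightarrow> 'v set) \<Rightarrow> real \<Rightarrow>
    (real \<Rightarrow> 'm \<Rightarrow> 'v set) \<Rightarrow> bool" where
  "smooth_deformation D A B \<epsilon> At \<longleftrightarrow> \<epsilon> > 0 \<and>
     smooth_subbundle_family (atl D) (Ebun D) {-\<epsilon><..<\<epsilon>} At \<and>
     (\<forall>t\<in>{-\<epsilon><..<\<epsilon>}. dirac_jacobi D (At t) \<and> complementary D (At t) B) \<and>
     At 0 = A"

definition smooth_form_family :: "('m, 'e::real_normed_vector, 'v::real_vector, 'l::real_vector)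
    cj_data \<Rightarrow> ('m \<Rightarrow> 'v set) \<Rightarrow> int \<Rightarrow> real set \<Rightarrow> (real \<Rightarrow> ('m, 'v, 'l) form) \<Rightarrow> bool" where
  "smooth_form_family D A k I \<eta>t \<longleftrightarrow>
     (\<forall>t\<in>I. \<eta>t t \<in> OmL D A k) \<and>
     (\<forall>Xs. set Xs \<subseteq> GamSub D A \<longrightarrow> smooth_section_family_on (atl D) (Lbun D) I UNIV
        (\<lambda>t x. \<eta>t t x (map (\<lambda>X. X x) Xs)))"

text \<open>The derivative is taken in the line \<open>L\<^sub>x\<close>, on which the norm of \<open>'l\<close> induces the usual topology.\<close>
definition arises_from :: "('m, 'e::real_normed_vector, 'v::real_vector, 'l::real_normed_vector)
    cj_data \<Rightarrow> ('m \<Rightarrow> 'v set) \<Rightarrow> ('m \<Rightarrow> 'v set) \<Rightarrow> ('m, 'v, 'l) form \<Rightarrow> real \<Rightarrow>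
    (real \<Rightarrow> 'm \<Rightarrow> 'v set) \<Rightarrow> bool" where
  "arises_from D A B \<eta> \<epsilon> At \<longleftrightarrow> (\<exists>\<eta>t. smooth_form_family D A 2 {-\<epsilon><..<\<epsilon>} \<eta>t \<and>
     \<eta>t 0 = (\<lambda>x vs. 0) \<and> (\<forall>t\<in>{-\<epsilon><..<\<epsilon>}. At t = Gr D A B (\<eta>t t)) \<and>
     (\<forall>x vs. ((\<lambda>t. \<eta>t t x vs) has_vector_derivative \<eta> x vs) (at 0)))"

definition infinitesimal_deformation :: "('m, 'e::real_normed_vector, 'v::real_vector,
    'l::real_vector) cj_data \<Rightarrow> ('m \<Rightarrow> 'v set) \<Rightarrow> ('m, 'v, 'l) form \<Rightarrow> bool" where
  "infinitesimal_deformation D A \<eta> \<longleftrightarrow> \<eta> \<in> cocycles D A 2"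

definition obstructed :: "('m::topological_space, 'e::real_normed_vector, 'v::real_vector,
    'l::real_normed_vector) cj_data \<Rightarrow> ('m \<Rightarrow> 'v set) \<Rightarrow> ('m \<Rightarrow> 'v set) \<Rightarrow>
    ('m, 'v, 'l) form \<Rightarrow> bool" where
  "obstructed D A B \<eta> \<longleftrightarrow> \<not> (\<exists>\<epsilon> At. smooth_deformation D A B \<epsilon> At \<and> arises_from D A B \<eta> \<epsilon> At)"

end

theory Submission
  imports Defs
begin

text \<open>
  Write \<open>A\<^sub>t = Gr(\<eta>\<^sub>t)\<close>. Testing involutivity of \<open>A\<^sub>t\<close> on the sections \<open>\<xi> + \<eta>\<^sub>t(\<xi>, -)\<close> gives the Maurer--Cartan equation
  \<open>d \<eta>\<^sub>t + (1/2) [\<eta>\<^sub>t, \<eta>\<^sub>t] + (cubic term in \<eta>\<^sub>t) = 0\<close>. As \<open>\<eta>\<^sub>0 = 0\<close> and \<open>d \<eta> = 0\<close> for \<open>\<eta> = \<eta>'\<^sub>0\<close>, its \<open>t\<^sup>2\<close>-coefficient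
  reads \<open>d \<eta>''\<^sub>0 + [\<eta>, \<eta>] = 0\<close>, so that \<open>[\<eta>, \<eta>]\<close> is exact. The bracket of forms is only known through its defining
  properties. They make it local, and a 2-form is locally a sum of products \<open>\<theta> \<and> \<gamma>\<close> with \<open>\<theta> \<in> \<Omega>\<^sup>1(A)\<close> and
  \<open>\<gamma> \<in> \<Omega>\<^sup>1(A;L)\<close>, on which the derivation property and the Leibniz rules determine it. To interchange \<open>d/dt\<close> with a
  derivation of \<open>L\<close>, the derivation is expressed through partial derivatives by means of Hadamard's lemma.
\<close>

section \<open>Iterated differentiability\<close>

text \<open>Only the fibres of L carry a norm; the container \<open>'v\<close> of the fibres of E
  has no topology. Every limit in t is therefore taken in a line of L or for real coefficients,
  after an expansion in fixed sections of B. The charts take values in a finite-dimensional normed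
  space without further structure, so coordinates, bump functions and the symmetry of second
  derivatives are built for it from a chosen basis. The bracket of sections and the bracket of forms
  accept global arguments only, so local frames and coordinates are cut off by bump functions before
  use.

  The Maurer--Cartan equation comes from the trilinear expression <<[e1, e2], e3>> on three sections
  of the graph. It vanishes because the graph is Lagrangian and involutive, and its eight terms are
  sorted by the number of entries in B. The quadratic part is compared with the bracket at one point
  x, where a generator of L turns everything into real numbers. That the exact form [\<eta>, \<eta>]
  is closed is read off from the codomain of the Kuranishi map.\<close>

lemma Ck_on_cong:
  assumes "open S" "\<And>x. x \<in> S \<Longrightarrow> f x = g x"
  shows "Ck_on n S f \<longleftrightarrow> Ck_on n S g"
  using assms
proof (induction n arbitrary: f g)
  case 0
  then show ?case by (auto intro: continuous_on_cong)
next
  case (Suc n)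
  have diff: "f differentiable at x \<longleftrightarrow> g differentiable at x" if "x \<in> S" for x
    using has_derivative_transform_within_open[OF _ Suc.prems(1) that] Suc.prems(2)
    unfolding differentiable_def by metis
  \<comment> \<open>\<open>frechet_derivative\<close> chooses among all derivatives at x. Both
    functions have the same set of candidates there, so the choices agree even where neither is
    differentiable.\<close>
  have fr: "frechet_derivative f (at x) = frechet_derivative g (at x)" if "x \<in> S" for x
  proof -
    have "(f has_derivative f') (at x) \<longleftrightarrow> (g has_derivative f') (at x)" for f'
      using has_derivative_transform_within_open[OF _ Suc.prems(1) that] Suc.prems(2) by metis
    then show ?thesis
      unfolding frechet_derivative_def by simp
  qed
  have "Ck_on n S (\<lambda>x. frechet_derivative f (at x) v) \<longleftrightarrow>
      Ck_on n S (\<lambda>x. frechet_derivative g (at x) v)" for v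
    by (rule Suc.IH) (use Suc.prems fr in auto)
  with diff show ?case
    by auto
qed

lemma Ck_on_subset: "Ck_on n S f \<Longrightarrow> T \<subseteq> S \<Longrightarrow> Ck_on n T f"
  by (induction n arbitrary: f) (auto intro: continuous_on_subset)

lemma Ck_on_SucD: "Ck_on (Suc n) S f \<Longrightarrow> Ck_on n S f"
proof (induction n arbitrary: f)
  case 0
  then show ?case
    by (auto intro!: continuous_at_imp_continuous_on differentiable_imp_continuous_within)
qed auto

lemma Ck_on_continuous_on: "Ck_on n S f \<Longrightarrow> continuous_on S f"
  by (induction n) (auto dest: Ck_on_SucD simp del: Ck_on.simps(2))

text \<open>Uniqueness of the derivative allows an explicit formula in place of the chosen
  \<open>frechet_derivative\<close>; all closure properties below are proved through this
  rule.\<close>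

lemma Ck_on_SucI:
  assumes "open S" "\<And>x. x \<in> S \<Longrightarrow> (f has_derivative f' x) (at x)"
    and "\<And>v. Ck_on n S (\<lambda>x. f' x v)"
  shows "Ck_on (Suc n) S f"
proof -
  have "frechet_derivative f (at x) = f' x" if "x \<in> S" for x
    using frechet_derivative_at assms(2) that by metis
  then have "Ck_on n S (\<lambda>x. frechet_derivative f (at x) v)" for v
    using assms(3)[of v] Ck_on_cong[OF assms(1), of "\<lambda>x. frechet_derivative f (at x) v" "\<lambda>x. f' x v" n]
    by simp
  with assms(2) show ?thesis
    by (auto simp: differentiable_def)
qed

lemma Ck_on_SucE:
  assumes "Ck_on (Suc n) S f" "x \<in> S"
  shows "(f has_derivative frechet_derivative f (at x)) (at x)"
  using assms frechet_derivative_works by auto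

lemma Ck_on_const: "Ck_on n S (\<lambda>x. c)"
  by (induction n arbitrary: c) auto

lemma Ck_on_bounded_linear:
  assumes L: "bounded_linear L" and "open S" "Ck_on n S f"
  shows "Ck_on n S (\<lambda>x. L (f x))"
  using assms(3)
proof (induction n arbitrary: f)
  case 0
  then show ?case
    using L by (auto intro: bounded_linear.continuous_on)
next
  case (Suc n)
  show ?case
    by (rule Ck_on_SucI[OF \<open>open S\<close> bounded_linear.has_derivative[OF L Ck_on_SucE[OF Suc.prems]]])
      (use Suc in auto)
qed

lemma Ck_on_add:
  assumes "open S" "Ck_on n S f" "Ck_on n S g"
  shows "Ck_on n S (\<lambda>x. f x + g x)"
  using assms(2,3)
proof (induction n arbitrary: f g)
  case 0
  then show ?case by (auto intro: continuous_intros)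
next
  case (Suc n)
  show ?case
    by (rule Ck_on_SucI[OF \<open>open S\<close> has_derivative_add[OF Ck_on_SucE[OF Suc.prems(1)] Ck_on_SucE[OF Suc.prems(2)]]])
      (use Suc in auto)
qed

text \<open>The product rule yields two bilinear terms, each combining one function with a
  derivative of the other. Hence the induction must range over both functions at once.\<close>

lemma Ck_on_bilinear:
  assumes P: "bounded_bilinear P" and "open S" "Ck_on n S f" "Ck_on n S g"
  shows "Ck_on n S (\<lambda>x. P (f x) (g x))"
  using assms(3,4)
proof (induction n arbitrary: f g)
  case 0
  then show ?case
    using bounded_bilinear.continuous_on[OF P] by auto
next
  case (Suc n)
  note fg = Suc.prems[THEN Ck_on_SucD]
  show ?case
    by (rule Ck_on_SucI[OF \<open>open S\<close> bounded_bilinear.FDERIV[OF P Ck_on_SucE[OF Suc.prems(1)] Ck_on_SucE[OF Suc.prems(2)]]])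
      (use Suc fg in \<open>auto intro!: Ck_on_add[OF \<open>open S\<close>]\<close>)
qed

lemmas Ck_on_mult = Ck_on_bilinear[OF bounded_bilinear_mult]
lemmas Ck_on_scaleR = Ck_on_bilinear[OF bounded_bilinear_scaleR]

lemma Ck_on_sum:
  assumes "open S" "\<And>i. i \<in> I \<Longrightarrow> Ck_on n S (f i)"
  shows "Ck_on n S (\<lambda>x. \<Sum>i\<in>I. f i x)"
  using assms(2)
  by (induction I rule: infinite_finite_induct) (auto intro: Ck_on_const Ck_on_add[OF \<open>open S\<close>])

text \<open>Derivatives are taken at points of the full space, not within S, so each level of the
  recursion can be checked near every point separately.\<close>

lemma Ck_on_local:
  assumes "\<And>x. x \<in> S \<Longrightarrow> \<exists>T. open T \<and> x \<in> T \<and> Ck_on n T f"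
  shows "Ck_on n S f"
  using assms
proof (induction n arbitrary: f)
  case 0
  show ?case
  proof (simp, rule continuous_at_imp_continuous_on, rule ballI)
    fix x assume "x \<in> S"
    with 0 obtain T where "open T" "x \<in> T" "continuous_on T f" by force
    then show "isCont f x" by (simp add: continuous_on_eq_continuous_at)
  qed
next
  case (Suc n)
  have "f differentiable at x" if "x \<in> S" for x
    using Suc.prems[OF that] by auto
  moreover have "Ck_on n S (\<lambda>x. frechet_derivative f (at x) v)" for v
    by (rule Suc.IH) (use Suc.prems in force)
  ultimately show ?case by simp
qed

text \<open>The derivative of 1/f is -f'/f^2, a product of f' with two copies of 1/f, to which the
  induction hypothesis applies again.\<close>

lemma Ck_on_inverse:
  assumes "open S" "\<And>x. x \<in> S \<Longrightarrow> f x \<noteq> (0::real)" "Ck_on n S f"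
  shows "Ck_on n S (\<lambda>x. inverse (f x))"
  using assms(3)
proof (induction n)
  case 0
  then show ?case using assms(2) by (auto intro: continuous_intros)
next
  case (Suc n)
  have "((\<lambda>x. inverse (f x)) has_derivative
      (\<lambda>h. - (inverse (f x) * frechet_derivative f (at x) h * inverse (f x)))) (at x)" if "x \<in> S" for x
    using Deriv.has_derivative_inverse[OF assms(2)[OF that] Ck_on_SucE[OF Suc.prems that]] .
  moreover have "Ck_on n S (\<lambda>x. - (inverse (f x) * frechet_derivative f (at x) v * inverse (f x)))" for v
    by (intro Ck_on_bounded_linear[OF bounded_linear_minus[OF bounded_linear_ident] \<open>open S\<close>]
        Ck_on_mult[OF \<open>open S\<close>] Suc.IH Ck_on_SucD[OF Suc.prems]) (use Suc.prems in auto)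
  ultimately show ?case
    by (rule Ck_on_SucI[OF \<open>open S\<close>])
qed

lemma Ck_on_slice:
  assumes "open J" "open O'" "Ck_on n (J \<times> O') g" "t \<in> J"
  shows "Ck_on n O' (\<lambda>y. g (t, y))"
  using assms(3)
proof (induction n arbitrary: g)
  case 0
  then show ?case
    using \<open>t \<in> J\<close> by (auto intro!: continuous_on_compose2[of _ g O' "Pair t"] continuous_intros)
next
  case (Suc n)
  have "((\<lambda>y. g (t, y)) has_derivative (\<lambda>v. frechet_derivative g (at (t, y)) (0, v))) (at y)"
    if "y \<in> O'" for y
  proof -
    have "(g has_derivative frechet_derivative g (at (t, y))) (at (t, y))"
      using Ck_on_SucE[OF Suc.prems] that \<open>t \<in> J\<close> by auto
    moreover have "((\<lambda>y. (t, y)) has_derivative (\<lambda>v. (0, v))) (at y)"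
      by (auto intro!: derivative_eq_intros)
    ultimately show ?thesis
      using has_derivative_compose[of "\<lambda>y. (t, y)" "\<lambda>v. (0, v)" y UNIV g] by simp
  qed
  moreover have "Ck_on n O' (\<lambda>y. frechet_derivative g (at (t, y)) (0, v))" for v
    using Suc.IH[of "\<lambda>z. frechet_derivative g (at z) (0, v)"] Suc.prems by auto
  ultimately show ?case
    by (rule Ck_on_SucI[OF \<open>open O'\<close>])
qed

text \<open>Schwarz's theorem. The second difference over the parallelogram spanned by h v and h w
  does not depend on the order of v and w, and applying the mean value theorem twice expresses it
  through either of the two mixed derivatives.\<close>

lemma second_frechet_symmetric:
  fixes g :: "'a::real_normed_vector \<Rightarrow> real"
  assumes "open S" "Ck_on 2 S g" "z \<in> S"
  shows "frechet_derivative (\<lambda>z. frechet_derivative g (at z) v) (at z) w =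
    frechet_derivative (\<lambda>z. frechet_derivative g (at z) w) (at z) v"
proof -
  define d where "d u y = frechet_derivative g (at y) u" for u y
  define dd where "dd u u' y = frechet_derivative (d u) (at y) u'" for u u' y
  have C2: "Ck_on (Suc (Suc 0)) S g"
    using assms(2) by (simp add: numeral_2_eq_2)
  have g': "(g has_derivative (\<lambda>u. d u y)) (at y)" if "y \<in> S" for y
    using Ck_on_SucE[OF C2 that] by (simp add: d_def)
  have C1: "Ck_on (Suc 0) S (d u)" for u
    using C2 unfolding d_def by auto
  have d': "(d u has_derivative (\<lambda>u'. dd u u' y)) (at y)" if "y \<in> S" for y u
    using Ck_on_SucE[OF C1 that] by (simp add: dd_def)
  have cont: "continuous_on S (dd u u')" for u u'
    using C1[of u] unfolding dd_def by auto
  obtain r where r: "r > 0" "ball z r \<subseteq> S"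
    using assms(1,3) openE by blast
  \<comment> \<open>Small enough to keep the parallelogram with sides shorter than \<delta> v and
    \<delta> w inside the ball; the summand 1 excludes division by zero when both vectors
    vanish.\<close>
  define \<delta> where "\<delta> = r / (norm v + norm w + 1)"
  have \<delta>: "\<delta> > 0" using r by (simp add: \<delta>_def add_nonneg_pos)
  have inS: "z + a *\<^sub>R v + b *\<^sub>R w \<in> ball z r" if "\<bar>a\<bar> < \<delta>" "\<bar>b\<bar> < \<delta>" for a b
  proof -
    have "norm (a *\<^sub>R v + b *\<^sub>R w) \<le> \<bar>a\<bar> * norm v + \<bar>b\<bar> * norm w"
      using norm_triangle_ineq[of "a *\<^sub>R v" "b *\<^sub>R w"] by simp
    also have "\<dots> \<le> \<delta> * norm v + \<delta> * norm w"
      using that by (intro add_mono mult_right_mono) auto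
    also have "\<dots> = \<delta> * (norm v + norm w)" by (simp add: algebra_simps)
    also have "\<dots> < \<delta> * (norm v + norm w + 1)" using \<delta> by simp
    also have "\<dots> = r" unfolding \<delta>_def by (smt (verit) norm_ge_zero nonzero_eq_divide_eq)
    finally show ?thesis by (simp add: dist_norm norm_minus_commute algebra_simps)
  qed
  \<comment> \<open>The mean value theorem is applied along \<open>v'\<close> to the increment in
    direction \<open>w'\<close>, and then along \<open>w'\<close> to the resulting first
    derivative.\<close>
  have mv: "\<exists>a b. 0 < a \<and> a < h \<and> 0 < b \<and> b < h \<and>
      g (z + h *\<^sub>R v' + h *\<^sub>R w') - g (z + h *\<^sub>R v') - g (z + h *\<^sub>R w') + g z
        = h * h * dd v' w' (z + a *\<^sub>R v' + b *\<^sub>R w')"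
    if h: "0 < h" "h < \<delta>" and inS': "\<And>a b. \<bar>a\<bar> < \<delta> \<Longrightarrow> \<bar>b\<bar> < \<delta> \<Longrightarrow> z + a *\<^sub>R v' + b *\<^sub>R w' \<in> S" for h v' w'
  proof -
    let ?F = "\<lambda>a. g (z + a *\<^sub>R v' + h *\<^sub>R w') - g (z + a *\<^sub>R v')"
    have F': "(?F has_real_derivative d v' (z + a *\<^sub>R v' + h *\<^sub>R w') - d v' (z + a *\<^sub>R v')) (at a)"
      if "0 \<le> a" "a \<le> h" for a
    proof -
      have 1: "((\<lambda>a. z + a *\<^sub>R v' + c) has_derivative (\<lambda>k. k *\<^sub>R v')) (at a)" for c
        by (auto intro!: derivative_eq_intros)
      have "((\<lambda>a. g (z + a *\<^sub>R v' + b *\<^sub>R w')) has_derivative (\<lambda>k. d (k *\<^sub>R v') (z + a *\<^sub>R v' + b *\<^sub>R w'))) (at a)"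
        if "\<bar>b\<bar> < \<delta>" for b
        by (rule has_derivative_compose[OF 1 g'])
          (use inS'[of a b] \<open>0 \<le> a\<close> \<open>a \<le> h\<close> h that in auto)
      moreover have "(\<lambda>k. d (k *\<^sub>R v') (z + a *\<^sub>R v' + b *\<^sub>R w')) = (*) (d v' (z + a *\<^sub>R v' + b *\<^sub>R w'))"
        if "\<bar>b\<bar> < \<delta>" for b
      proof -
        have S: "z + a *\<^sub>R v' + b *\<^sub>R w' \<in> S"
          by (rule inS') (use \<open>0 \<le> a\<close> \<open>a \<le> h\<close> h that in auto)
        show ?thesis
          by (rule ext) (use linear_scale[OF has_derivative_linear[OF g'[OF S]], of _ v'] in simp)
      qed
      ultimately have "((\<lambda>a. g (z + a *\<^sub>R v' + b *\<^sub>R w')) has_real_derivative d v' (z + a *\<^sub>R v' + b *\<^sub>R w')) (at a)"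
        if "\<bar>b\<bar> < \<delta>" for b
        using that unfolding has_field_derivative_def by metis
      from this[of h] this[of 0] show ?thesis
        using h by (auto intro!: derivative_eq_intros)
    qed
    obtain a where a: "0 < a" "a < h"
      "?F h - ?F 0 = (h - 0) * (d v' (z + a *\<^sub>R v' + h *\<^sub>R w') - d v' (z + a *\<^sub>R v'))"
      using MVT2[OF h(1), of ?F, OF F'] by auto
    let ?G = "\<lambda>b. d v' (z + a *\<^sub>R v' + b *\<^sub>R w')"
    have G': "(?G has_real_derivative dd v' w' (z + a *\<^sub>R v' + b *\<^sub>R w')) (at b)"
      if "0 \<le> b" "b \<le> h" for b
    proof -
      have 1: "((\<lambda>b. z + a *\<^sub>R v' + b *\<^sub>R w') has_derivative (\<lambda>k. k *\<^sub>R w')) (at b)"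
        by (auto intro!: derivative_eq_intros)
      have S: "z + a *\<^sub>R v' + b *\<^sub>R w' \<in> S"
        using inS'[of a b] a h that by auto
      have "(\<lambda>k. dd v' (k *\<^sub>R w') (z + a *\<^sub>R v' + b *\<^sub>R w')) = (*) (dd v' w' (z + a *\<^sub>R v' + b *\<^sub>R w'))"
        by (rule ext) (use linear_scale[OF has_derivative_linear[OF d'[OF S, of v']], of _ w'] in simp)
      then show ?thesis
        using has_derivative_compose[OF 1 d'[OF S], of v']
        by (simp add: has_field_derivative_def)
    qed
    obtain b where b: "0 < b" "b < h" "?G h - ?G 0 = (h - 0) * dd v' w' (z + a *\<^sub>R v' + b *\<^sub>R w')"
      using MVT2[OF h(1), of ?G, OF G'] by auto
    have "?F h - ?F 0 = h * (?G h - ?G 0)"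
      using a(3) by simp
    also have "\<dots> = h * h * dd v' w' (z + a *\<^sub>R v' + b *\<^sub>R w')"
      unfolding b(3) by simp
    finally show ?thesis
      using a(1,2) b(1,2) by (intro exI[of _ a] exI[of _ b]) (simp add: diff_diff_eq2 diff_add_eq)
  qed
  have close: "\<exists>h0>0. h0 \<le> \<delta> \<and> (\<forall>a b. 0 < a \<and> a < h0 \<and> 0 < b \<and> b < h0 \<longrightarrow>
      \<bar>dd u u' (z + a *\<^sub>R v + b *\<^sub>R w) - dd u u' z\<bar> < e)" if "e > 0" for e u u'
  proof -
    obtain \<rho> where \<rho>: "\<rho> > 0" "\<And>y. y \<in> S \<Longrightarrow> dist y z < \<rho> \<Longrightarrow> dist (dd u u' y) (dd u u' z) < e"
      using cont[of u u'] assms(3) \<open>e > 0\<close> unfolding continuous_on_iff by metis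
    define h0 where "h0 = min \<delta> (\<rho> / (norm v + norm w + 1))"
    have n1: "norm v + norm w + 1 > 0" by (simp add: add_nonneg_pos)
    have h0: "h0 > 0" using \<delta> \<rho> n1 by (simp add: h0_def)
    have "\<bar>dd u u' (z + a *\<^sub>R v + b *\<^sub>R w) - dd u u' z\<bar> < e"
      if "0 < a" "a < h0" "0 < b" "b < h0" for a b
    proof -
      have "norm (a *\<^sub>R v + b *\<^sub>R w) \<le> a * norm v + b * norm w"
        using norm_triangle_ineq[of "a *\<^sub>R v" "b *\<^sub>R w"] that by simp
      also have "\<dots> \<le> h0 * norm v + h0 * norm w"
        using that by (intro add_mono mult_right_mono) auto
      also have "\<dots> < h0 * (norm v + norm w + 1)" using h0 by (simp add: algebra_simps)
      also have "\<dots> \<le> \<rho> / (norm v + norm w + 1) * (norm v + norm w + 1)"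
        using n1 unfolding h0_def by (intro mult_right_mono) auto
      also have "\<dots> = \<rho>" using n1 by simp
      finally have "dist (z + a *\<^sub>R v + b *\<^sub>R w) z < \<rho>" by (simp add: dist_norm add.assoc)
      moreover have "z + a *\<^sub>R v + b *\<^sub>R w \<in> S"
        using inS[of a b] that r by (auto simp: h0_def)
      ultimately show ?thesis
        using \<rho>(2) by (auto simp: dist_real_def)
    qed
    then show ?thesis using h0 by (intro exI[of _ h0]) (auto simp: h0_def)
  qed
  have "\<bar>dd v w z - dd w v z\<bar> \<le> e" if e: "e > 0" for e
  proof -
    obtain h1 where h1: "h1 > 0" "h1 \<le> \<delta>" "\<And>a b. 0 < a \<Longrightarrow> a < h1 \<Longrightarrow> 0 < b \<Longrightarrow> b < h1 \<Longrightarrow>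
      \<bar>dd v w (z + a *\<^sub>R v + b *\<^sub>R w) - dd v w z\<bar> < e/2"
      using close[of "e/2" v w] half_gt_zero[OF e] by blast
    obtain h2 where h2: "h2 > 0" "h2 \<le> \<delta>" "\<And>a b. 0 < a \<Longrightarrow> a < h2 \<Longrightarrow> 0 < b \<Longrightarrow> b < h2 \<Longrightarrow>
      \<bar>dd w v (z + a *\<^sub>R v + b *\<^sub>R w) - dd w v z\<bar> < e/2"
      using close[of "e/2" w v] half_gt_zero[OF e] by blast
    define h where "h = min h1 h2 / 2"
    have h: "0 < h" "h < \<delta>" "h < h1" "h < h2"
      using h1 h2 by (auto simp: h_def)
    obtain a b where ab: "0 < a" "a < h" "0 < b" "b < h"
      "g (z + h *\<^sub>R v + h *\<^sub>R w) - g (z + h *\<^sub>R v) - g (z + h *\<^sub>R w) + g z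
        = h * h * dd v w (z + a *\<^sub>R v + b *\<^sub>R w)"
      using mv[OF h(1,2), of v w] inS r by blast
    have inS': "z + a *\<^sub>R w + b *\<^sub>R v \<in> S" if "\<bar>a\<bar> < \<delta>" "\<bar>b\<bar> < \<delta>" for a b
      using subsetD[OF r(2) inS[OF that(2,1)]] by (simp add: add.assoc add.commute[of "_ *\<^sub>R w"])
    obtain a' b' where ab': "0 < a'" "a' < h" "0 < b'" "b' < h"
      "g (z + h *\<^sub>R w + h *\<^sub>R v) - g (z + h *\<^sub>R w) - g (z + h *\<^sub>R v) + g z
        = h * h * dd w v (z + a' *\<^sub>R w + b' *\<^sub>R v)"
      using mv[OF h(1,2), of w v] inS' by blast
    \<comment> \<open>The left-hand sides of the two expansions differ only in the order of their
      terms. The intermediate points differ, but both lie close enough to z for continuity to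
      finish.\<close>
    have "h * h * dd v w (z + a *\<^sub>R v + b *\<^sub>R w) = h * h * dd w v (z + b' *\<^sub>R v + a' *\<^sub>R w)"
    proof -
      have "g (z + h *\<^sub>R v + h *\<^sub>R w) - g (z + h *\<^sub>R v) - g (z + h *\<^sub>R w) + g z
          = h * h * dd w v (z + b' *\<^sub>R v + a' *\<^sub>R w)"
        using ab'(5) by (simp add: add.assoc add.commute[of "_ *\<^sub>R w"])
      with ab(5) show ?thesis by linarith
    qed
    then have "dd v w (z + a *\<^sub>R v + b *\<^sub>R w) = dd w v (z + b' *\<^sub>R v + a' *\<^sub>R w)"
      using h by simp
    then show ?thesis
      using h1(3)[of a b] h2(3)[of b' a'] ab ab' h by (simp add: abs_if split: if_splits)
  qed
  from this[of "\<bar>dd v w z - dd w v z\<bar> / 2"] have "dd v w z = dd w v z"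
    by auto
  then show ?thesis by (simp add: dd_def d_def[abs_def])
qed

section \<open>Coordinates in finite-dimensional normed spaces\<close>

lemma closed_span_add_bound:
  fixes S :: "'a::real_normed_vector set"
  assumes "closed (span S)" "a \<notin> span S"
  obtains K where "\<And>c w. w \<in> span S \<Longrightarrow> \<bar>c\<bar> \<le> K * norm (c *\<^sub>R a + w)" "K > 0"
proof -
  \<comment> \<open>Closedness leaves a ball around a that misses the span. Rescaling a combination
    by 1/c compares it with this radius, which gives the bound with K = 1/d.\<close>
  obtain d where d: "d > 0" "ball a d \<subseteq> - span S"
    using assms openE[of "- span S" a] by auto
  have "\<bar>c\<bar> \<le> (1 / d) * norm (c *\<^sub>R a + w)" if w: "w \<in> span S" for c w
  proof (cases "c = 0")
    case False
    have "- ((1 / c) *\<^sub>R w) \<in> span S"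
      using w by (intro span_neg span_scale)
    then have "- ((1 / c) *\<^sub>R w) \<notin> ball a d"
      using d(2) by blast
    then have "d \<le> norm (a - (- ((1 / c) *\<^sub>R w)))"
      by (simp add: dist_norm)
    also have "a - (- ((1 / c) *\<^sub>R w)) = (1 / c) *\<^sub>R (c *\<^sub>R a + w)"
      using False by (simp add: scaleR_add_right)
    also have "norm \<dots> = norm (c *\<^sub>R a + w) / \<bar>c\<bar>"
      by simp
    finally show ?thesis
      using False d(1) by (simp add: pos_le_divide_eq mult.commute)
  qed (use d in simp)
  with d show ?thesis using that[of "1/d"] by auto
qed

text \<open>Continuity of coordinates, by induction on the basis. The bounds for S make the
  coefficients of a convergent sequence Cauchy, so \<open>span S\<close> is closed; this bounds the
  coefficient of the new vector, and subtracting its contribution bounds the others.\<close>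

lemma independent_coefficients_bounded:
  fixes S :: "'a::real_normed_vector set"
  assumes "finite S" "independent S"
  shows "\<exists>K>0. \<forall>c. \<forall>b\<in>S. \<bar>c b\<bar> \<le> K * norm (\<Sum>b\<in>S. c b *\<^sub>R b)"
  using assms
proof (induction S rule: finite_induct)
  case empty
  then show ?case by (auto intro: exI[of _ 1])
next
  case (insert a S)
  then have ind: "independent S" "a \<notin> span S"
    using insert.hyps by (simp_all add: independent_insert)
  obtain K where K: "K > 0" "\<And>c b. b \<in> S \<Longrightarrow> \<bar>c b\<bar> \<le> K * norm (\<Sum>b\<in>S. c b *\<^sub>R b)"
    using insert.IH ind by blast
  have "closed (span S)"
    unfolding closed_sequential_limits
  proof safe
    fix v l assume v: "\<forall>n. v n \<in> span S" "v \<longlonglongrightarrow> l"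
    then obtain c where c: "\<And>n. v n = (\<Sum>b\<in>S. c n b *\<^sub>R b)"
      unfolding span_finite[OF insert.hyps(1)] image_iff by metis
    have "Cauchy (\<lambda>n. c n b)" if "b \<in> S" for b
    proof (rule CauchyI)
      fix e :: real assume "e > 0"
      obtain M where M: "\<And>m n. m \<ge> M \<Longrightarrow> n \<ge> M \<Longrightarrow> norm (v m - v n) < e / K"
        using CauchyD[OF LIMSEQ_imp_Cauchy[OF v(2)], of "e/K"] K(1) \<open>e > 0\<close> by auto
      have "norm (c m b - c n b) < e" if "m \<ge> M" "n \<ge> M" for m n
      proof -
        have "\<bar>c m b - c n b\<bar> \<le> K * norm (v m - v n)"
          using K(2)[OF \<open>b \<in> S\<close>, of "\<lambda>b. c m b - c n b"]
          by (simp add: c scaleR_diff_left sum_subtractf)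
        also have "\<dots> < e"
          using M[OF that] K(1) by (simp add: field_simps)
        finally show ?thesis by simp
      qed
      then show "\<exists>M. \<forall>m\<ge>M. \<forall>n\<ge>M. norm (c m b - c n b) < e" by blast
    qed
    then have "\<exists>k. (\<lambda>n. c n b) \<longlonglongrightarrow> k" if "b \<in> S" for b
      using that Cauchy_convergent_iff convergent_def by blast
    then obtain k where "\<And>b. b \<in> S \<Longrightarrow> (\<lambda>n. c n b) \<longlonglongrightarrow> k b" by metis
    then have "v \<longlonglongrightarrow> (\<Sum>b\<in>S. k b *\<^sub>R b)"
      unfolding c[abs_def] by (intro tendsto_sum tendsto_scaleR) auto
    then have "l = (\<Sum>b\<in>S. k b *\<^sub>R b)"
      using v(2) LIMSEQ_unique by blast
    then show "l \<in> span S"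
      by (auto intro: span_sum span_scale span_base)
  qed
  then obtain K' where K': "\<And>c w. w \<in> span S \<Longrightarrow> \<bar>c\<bar> \<le> K' * norm (c *\<^sub>R a + w)" "K' > 0"
    using closed_span_add_bound[of S a] ind by blast
  \<comment> \<open>\<open>K'\<close> bounds the new coefficient. The remaining part w has norm at
    most (1 + \<open>K'\<close> |a|) times that of the whole vector, so K times this factor bounds
    the old coefficients; the sum dominates both bounds.\<close>
  define K2 where "K2 = K' + K * (1 + K' * norm a)"
  have Kpos: "K * (1 + K' * norm a) > 0"
    using K(1) K'(2) by (simp add: add_pos_nonneg)
  have "\<bar>c b\<bar> \<le> K2 * norm (\<Sum>b\<in>insert a S. c b *\<^sub>R b)" if "b \<in> insert a S" for c b
  proof -
    define w where "w = (\<Sum>b\<in>S. c b *\<^sub>R b)"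
    define v where "v = c a *\<^sub>R a + w"
    have w: "w \<in> span S" unfolding w_def by (auto intro: span_sum span_scale span_base)
    have v: "(\<Sum>b\<in>insert a S. c b *\<^sub>R b) = v"
      using insert by (simp add: v_def w_def)
    have a: "\<bar>c a\<bar> \<le> K' * norm v" using K'(1)[OF w] by (simp add: v_def)
    have "norm w \<le> norm v + \<bar>c a\<bar> * norm a"
      using norm_triangle_ineq4[of v "c a *\<^sub>R a"] by (simp add: v_def)
    also have "\<dots> \<le> norm v + (K' * norm v) * norm a"
      using a by (intro add_left_mono mult_right_mono) auto
    finally have nw: "norm w \<le> (1 + K' * norm a) * norm v" by (simp add: algebra_simps)
    have "\<bar>c b\<bar> \<le> K2 * norm v"
    proof (cases "b = a")
      case True
      have "K' * norm v \<le> K2 * norm v"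
        unfolding K2_def using Kpos by (intro mult_right_mono) auto
      with a True show ?thesis by simp
    next
      case False
      then have "\<bar>c b\<bar> \<le> K * norm w" using K(2)[of b c] that by (simp add: w_def)
      also have "\<dots> \<le> K * ((1 + K' * norm a) * norm v)"
        using nw K(1) by (intro mult_left_mono) auto
      also have "\<dots> \<le> K2 * norm v"
      proof -
        have "K * ((1 + K' * norm a) * norm v) + K' * norm v = K2 * norm v"
          by (simp add: K2_def distrib_right)
        moreover have "K' * norm v \<ge> 0" using K' by simp
        ultimately show ?thesis by linarith
      qed
      finally show ?thesis .
    qed
    with v show ?thesis by simp
  qed
  moreover have "K2 > 0" using Kpos K' by (simp add: K2_def)
  ultimately show ?case by blast
qed

text \<open>Replaces a Euclidean structure on the model space. The basis may be empty, so
  zero-dimensional manifolds are covered.\<close>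

locale fin_dim =
  fixes Bs :: "'e::real_normed_vector set"
  assumes finite_basis: "finite Bs" and independent_basis: "independent Bs"
    and span_basis: "span Bs = UNIV"
begin

abbreviation coord :: "'e \<Rightarrow> 'e \<Rightarrow> real" where
  "coord b v \<equiv> representation Bs v b"

lemma coord_sum: "(\<Sum>b\<in>Bs. coord b v *\<^sub>R b) = v"
  using sum_representation_eq[OF independent_basis, of v Bs] finite_basis span_basis by auto

lemma bounded_linear_coord: "bounded_linear (coord b)"
proof (cases "b \<in> Bs")
  case True
  obtain K where K: "K > 0" "\<And>c b. b \<in> Bs \<Longrightarrow> \<bar>c b\<bar> \<le> K * norm (\<Sum>b\<in>Bs. c b *\<^sub>R b)"
    using independent_coefficients_bounded[OF finite_basis independent_basis] by blast
  show ?thesis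
  proof (rule bounded_linear_intro[where K = K])
    show "coord b (x + y) = coord b x + coord b y" for x y
      using representation_add[OF independent_basis] span_basis by auto
    show "coord b (r *\<^sub>R x) = r *\<^sub>R coord b x" for r x
      using representation_scale[OF independent_basis] span_basis by auto
    show "norm (coord b x) \<le> norm x * K" for x
      using K(2)[OF True, of "\<lambda>b. coord b x"] by (simp add: coord_sum mult.commute)
  qed
next
  case False
  then have "coord b = (\<lambda>_. 0)"
    using representation_ne_zero by fastforce
  then show ?thesis by simp
qed

lemma linear_coord_sum:
  assumes "linear L"
  shows "L v = (\<Sum>b\<in>Bs. coord b v *\<^sub>R L b)"
proof -
  have "L v = L (\<Sum>b\<in>Bs. coord b v *\<^sub>R b)" by (simp add: coord_sum)
  also have "\<dots> = (\<Sum>b\<in>Bs. coord b v *\<^sub>R L b)"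
    by (simp add: linear_sum[OF assms] linear_scale[OF assms])
  finally show ?thesis .
qed

lemma bounded_linear_if_linear: "linear L \<Longrightarrow> bounded_linear L"
  for L :: "'e \<Rightarrow> 'c::real_normed_vector"
proof -
  assume L: "linear L"
  have "bounded_linear (\<lambda>v. \<Sum>b\<in>Bs. coord b v *\<^sub>R L b)"
    by (intro bounded_linear_sum bounded_linear_scaleR_const bounded_linear_coord)
  then show ?thesis
    by (simp flip: linear_coord_sum[OF L])
qed

text \<open>One constant serves all linear maps. It converts smallness of finitely many partial
  derivatives into smallness of the operator norm, the form in which the mean value inequality asks
  for it.\<close>

lemma onorm_le_if_bounded_on_basis:
  obtains C where "C > 0"
    "\<And>(L::'e \<Rightarrow> 'c::real_normed_vector) \<epsilon>. linear L \<Longrightarrow> (\<And>b. b \<in> Bs \<Longrightarrow> norm (L b) \<le> \<epsilon>) \<Longrightarrow> \<epsilon> \<ge> 0 \<Longrightarrow> onorm L \<le> C * \<epsilon>"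
proof -
  \<comment> \<open>The summand 1 keeps C positive for an empty basis, so that it can be divided by
    later.\<close>
  define C where "C = (\<Sum>b\<in>Bs. onorm (coord b)) + 1"
  have nn: "onorm (coord b) \<ge> 0" for b
    using onorm_pos_le[OF bounded_linear_coord] .
  have "onorm L \<le> C * \<epsilon>" if L: "linear L" and b: "\<And>b. b \<in> Bs \<Longrightarrow> norm (L b) \<le> \<epsilon>" and "\<epsilon> \<ge> 0"
    for L :: "'e \<Rightarrow> 'c" and \<epsilon>
  proof (rule Operator_Norm.onorm_bound)
    show "0 \<le> C * \<epsilon>"
      unfolding C_def using nn \<open>\<epsilon> \<ge> 0\<close> by (intro mult_nonneg_nonneg add_nonneg_nonneg sum_nonneg) auto
  next
    fix v
    have "norm (L v) \<le> (\<Sum>b\<in>Bs. norm (coord b v *\<^sub>R L b))"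
      by (subst linear_coord_sum[OF L]) (rule norm_sum)
    also have "\<dots> \<le> (\<Sum>b\<in>Bs. (onorm (coord b) * norm v) * \<epsilon>)"
    proof (rule sum_mono)
      fix b' assume "b' \<in> Bs"
      have "\<bar>coord b' v\<bar> \<le> onorm (coord b') * norm v"
        using onorm[OF bounded_linear_coord, of v b'] by simp
      then have "\<bar>coord b' v\<bar> * norm (L b') \<le> (onorm (coord b') * norm v) * \<epsilon>"
        using b[OF \<open>b' \<in> Bs\<close>] nn[of b'] by (intro mult_mono) auto
      then show "norm (coord b' v *\<^sub>R L b') \<le> (onorm (coord b') * norm v) * \<epsilon>" by simp
    qed
    also have "\<dots> = (\<Sum>b\<in>Bs. onorm (coord b)) * (norm v * \<epsilon>)"
      by (simp add: sum_distrib_right sum_distrib_left algebra_simps)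
    also have "\<dots> \<le> C * \<epsilon> * norm v"
    proof -
      have "(\<Sum>b\<in>Bs. onorm (coord b)) * (norm v * \<epsilon>) + norm v * \<epsilon> = C * \<epsilon> * norm v"
        by (simp add: C_def distrib_right)
      moreover have "norm v * \<epsilon> \<ge> 0" using \<open>\<epsilon> \<ge> 0\<close> by simp
      ultimately show ?thesis by linarith
    qed
    finally show "norm (L v) \<le> C * \<epsilon> * norm v" .
  qed
  moreover have "C > 0" unfolding C_def using nn by (simp add: sum_nonneg add_nonneg_pos)
  ultimately show ?thesis using that by blast
qed

text \<open>In the chain rule the derivative of g is applied to a vector that itself varies with x.
  Expanding this vector in the basis leaves products of coordinates with compositions of f and the
  partial derivatives of g in fixed directions, and these are covered by the induction
  hypothesis.\<close>

lemma Ck_on_compose: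
  fixes g :: "'e \<Rightarrow> 'c::real_normed_vector" and f :: "'a::real_normed_vector \<Rightarrow> 'e"
  assumes "open S" "open T" "f ` S \<subseteq> T" "Ck_on n S f" "Ck_on n T g"
  shows "Ck_on n S (\<lambda>x. g (f x))"
  using assms(4,5)
proof (induction n arbitrary: g)
  case 0
  then show ?case
    using assms(3) by (auto intro!: continuous_on_compose2[of T g S f])
next
  case (Suc n)
  let ?D = "\<lambda>x v. \<Sum>b\<in>Bs. coord b (frechet_derivative f (at x) v) *\<^sub>R frechet_derivative g (at (f x)) b"
  have "((\<lambda>x. g (f x)) has_derivative ?D x) (at x)" if "x \<in> S" for x
  proof -
    have g': "(g has_derivative frechet_derivative g (at (f x))) (at (f x))"
      using Ck_on_SucE[OF Suc.prems(2)] that assms(3) by auto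
    have "frechet_derivative g (at (f x)) (frechet_derivative f (at x) v) = ?D x v" for v
      using linear_coord_sum[OF has_derivative_linear[OF g']] .
    then show ?thesis
      using has_derivative_compose[OF Ck_on_SucE[OF Suc.prems(1) that] g'] by simp
  qed
  moreover have "Ck_on n S (\<lambda>x. ?D x v)" for v
  proof (intro Ck_on_sum Ck_on_scaleR \<open>open S\<close> Ck_on_bounded_linear[OF bounded_linear_coord])
    show "Ck_on n S (\<lambda>x. frechet_derivative f (at x) v)"
      using Suc.prems(1) by auto
    show "Ck_on n S (\<lambda>x. frechet_derivative g (at (f x)) b)" for b
      using Suc.IH[OF Ck_on_SucD[OF Suc.prems(1)], of "\<lambda>y. frechet_derivative g (at y) b"] Suc.prems(2) by auto
  qed
  ultimately show ?case
    by (rule Ck_on_SucI[OF \<open>open S\<close>])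
qed

lemma Ck_on_linear:
  fixes L :: "'e \<Rightarrow> 'c::real_normed_vector"
  assumes "linear L" "open S" shows "Ck_on n S L"
proof -
  have L: "bounded_linear L" using assms by (simp add: bounded_linear_if_linear)
  show ?thesis
  proof (cases n)
    case 0
    then show ?thesis using bounded_linear.continuous_on[OF L continuous_on_id] by simp
  next
    case (Suc k)
    show ?thesis unfolding Suc
      by (rule Ck_on_SucI[OF \<open>open S\<close> bounded_linear_imp_has_derivative[OF L] Ck_on_const])
  qed
qed

end

interpretation real_fin_dim: fin_dim "{1::real}"
proof
  show "span {1::real} = UNIV"
    by (auto simp: span_singleton)
qed auto

section \<open>Bump functions and Hadamard's lemma\<close>

lemma tendsto_poly_exp_minus_at_top: "((\<lambda>s. poly p s * exp (- s)) \<longlongrightarrow> 0) at_top" for p :: "real poly"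
proof -
  have "((\<lambda>s. coeff p i * (s ^ i / exp s)) \<longlongrightarrow> coeff p i * 0) at_top" for i
    by (intro tendsto_mult_left tendsto_power_div_exp_0)
  then have "((\<lambda>s. \<Sum>i\<le>degree p. coeff p i * (s ^ i / exp s)) \<longlongrightarrow> (\<Sum>i\<le>degree p. coeff p i * 0)) at_top"
    by (intro tendsto_sum)
  moreover have "poly p s * exp (- s) = (\<Sum>i\<le>degree p. coeff p i * (s ^ i / exp s))" for s
    by (simp add: poly_altdef sum_distrib_right exp_minus divide_inverse mult.assoc)
  ultimately show ?thesis by simp
qed

text \<open>Every derivative of exp(-1/t), extended by 0 to t \<le> 0, is exp(-1/t) times a
  polynomial in 1/t. Carrying the polynomial along makes the class closed under
  differentiation.\<close>

definition flat_fun :: "real poly \<Rightarrow> real \<Rightarrow> real" where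
  "flat_fun p t = (if t > 0 then poly p (1 / t) * exp (- (1 / t)) else 0)"

lemma flat_fun_tendsto_0: "((\<lambda>t. flat_fun p t) \<longlongrightarrow> 0) (at 0)"
  unfolding filterlim_at_split
proof
  show "((\<lambda>t. flat_fun p t) \<longlongrightarrow> 0) (at_left 0)"
    by (rule tendsto_eventually) (auto simp: flat_fun_def eventually_at_left_field intro: exI[of _ "-1"])
  have "((\<lambda>t. poly p (1 / t) * exp (- (1 / t))) \<longlongrightarrow> 0) (at_right 0)"
    by (rule filterlim_compose[OF tendsto_poly_exp_minus_at_top])
      (simp add: filterlim_inverse_at_top_right flip: inverse_eq_divide)
  then show "((\<lambda>t. flat_fun p t) \<longlongrightarrow> 0) (at_right 0)"
    by (rule tendsto_cong[THEN iffD1, rotated])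
      (auto simp: flat_fun_def eventually_at_right_field intro: exI[of _ 1])
qed

text \<open>With s = 1/t one has d/dt = -s^2 d/ds, and differentiating p(s) exp(-s) gives s^2 (p -
  p')(s) exp(-s). At t = 0 the difference quotient is again a flat function, with polynomial s p(s),
  and tends to 0.\<close>

lemma flat_fun_has_derivative:
  "(flat_fun p has_real_derivative flat_fun (monom 1 2 * (p - pderiv p)) t) (at t)"
proof -
  consider "t > 0" | "t < 0" | "t = 0" by linarith
  then show ?thesis
  proof cases
    case 1
    have "((\<lambda>t. poly p (1 / t) * exp (- (1 / t))) has_real_derivative
        poly (monom 1 2 * (p - pderiv p)) (1 / t) * exp (- (1 / t))) (at t)"
      using 1 by (auto intro!: derivative_eq_intros simp: poly_monom field_simps power2_eq_square)
    then have "((\<lambda>t. poly p (1 / t) * exp (- (1 / t))) has_real_derivative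
        flat_fun (monom 1 2 * (p - pderiv p)) t) (at t)"
      using 1 by (simp add: flat_fun_def)
    then show ?thesis
      by (rule has_field_derivative_transform_within_open[of _ _ _ "{0<..}"])
        (use 1 in \<open>auto simp: flat_fun_def\<close>)
  next
    case 2
    have "((\<lambda>t. 0) has_real_derivative flat_fun (monom 1 2 * (p - pderiv p)) t) (at t)"
      using 2 by (simp add: flat_fun_def)
    then show ?thesis
      by (rule has_field_derivative_transform_within_open[of _ _ _ "{..<0}"])
        (use 2 in \<open>auto simp: flat_fun_def\<close>)
  next
    case 3
    have "((\<lambda>h. flat_fun (monom 1 1 * p) h) \<longlongrightarrow> 0) (at 0)"
      by (rule flat_fun_tendsto_0)
    moreover have "\<forall>\<^sub>F h in at 0. flat_fun (monom 1 1 * p) h = (flat_fun p (0 + h) - flat_fun p 0) / h"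
      by (rule eventually_at_filter[THEN iffD2], rule always_eventually)
        (auto simp: flat_fun_def poly_monom)
    ultimately have "((\<lambda>h. (flat_fun p (0 + h) - flat_fun p 0) / h) \<longlongrightarrow> 0) (at 0)"
      using tendsto_cong by fastforce
    with 3 show ?thesis
      by (simp add: DERIV_def flat_fun_def)
  qed
qed

lemma Ck_on_flat_fun: "Ck_on n UNIV (flat_fun p)"
proof (induction n arbitrary: p)
  case 0
  then show ?case
    by (auto intro!: continuous_at_imp_continuous_on DERIV_isCont[OF flat_fun_has_derivative])
next
  case (Suc n)
  show ?case
  proof (rule Ck_on_SucI)
    show "(flat_fun p has_derivative (\<lambda>v. flat_fun (monom 1 2 * (p - pderiv p)) t * v)) (at t)" for t
      using flat_fun_has_derivative[of p t] unfolding has_field_derivative_def by simp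
    show "Ck_on n UNIV (\<lambda>t. flat_fun (monom 1 2 * (p - pderiv p)) t * v)" for v
      by (intro Ck_on_mult Suc.IH Ck_on_const) auto
  qed auto
qed

text \<open>The usual transition function f(t) / (f(t) + f(1 - t)); its denominator is positive
  because t or 1 - t is.\<close>

definition smooth_step :: "real \<Rightarrow> real" where
  "smooth_step t = flat_fun 1 t * inverse (flat_fun 1 t + flat_fun 1 (1 - t))"

lemma smooth_step_eq: "t \<le> 0 \<Longrightarrow> smooth_step t = 0" "t \<ge> 1 \<Longrightarrow> smooth_step t = 1"
  by (auto simp: smooth_step_def flat_fun_def)

lemma Ck_on_smooth_step: "Ck_on n UNIV smooth_step"
proof -
  have pos: "flat_fun 1 t + flat_fun 1 (1 - t) \<noteq> 0" for t
    using exp_gt_zero[of "- (1 / t)"] exp_gt_zero[of "- (1 / (1 - t))"]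
    by (cases "t > 0"; cases "t < 1") (auto simp: flat_fun_def add_pos_pos intro!: less_imp_neq[symmetric])
  have "Ck_on n UNIV (\<lambda>t::real. 1 - t)"
    using Ck_on_add[OF open_UNIV Ck_on_const[of n UNIV "1::real"] real_fin_dim.Ck_on_linear[of uminus UNIV n]]
    by (simp add: linear_uminus)
  then have "Ck_on n UNIV (\<lambda>t. flat_fun 1 (1 - t))"
    by (rule real_fin_dim.Ck_on_compose[where T = UNIV, rotated 3]) (auto intro: Ck_on_flat_fun)
  then show ?thesis
    unfolding smooth_step_def[abs_def]
    by (intro Ck_on_mult Ck_on_inverse Ck_on_add Ck_on_flat_fun pos) auto
qed

context fin_dim
begin

text \<open>The box is a continuous image of a product of compact intervals, so Tychonoff's theorem
  gives its compactness. The factors at indices outside the basis do not enter the sum.\<close>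

lemma compact_box: "compact ((\<lambda>c. y0 + (\<Sum>b\<in>Bs. c b *\<^sub>R b)) ` {c. \<forall>b. c b \<in> {-R..R::real}})"
proof (rule compact_continuous_image)
  show "continuous_on {c. \<forall>b. c b \<in> {-R..R}} (\<lambda>c. y0 + (\<Sum>b\<in>Bs. c b *\<^sub>R b))"
    by (intro continuous_intros continuous_on_subset[OF continuous_on_product_coordinates]) auto
  have "compactin (product_topology (\<lambda>_. euclidean) UNIV) (PiE UNIV (\<lambda>_::'e. {-R..R}))"
    unfolding compactin_PiE by auto
  then show "compact {c::'e \<Rightarrow> real. \<forall>b. c b \<in> {-R..R}}"
    by (simp add: euclidean_product_topology PiE_UNIV_domain Pi_def)
qed

text \<open>The given norm need not be differentiable, so the bump is a function of the sum of
  squares Q of the coordinates, and its support is enclosed in a coordinate box instead of a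
  ball.\<close>

lemma bump_exists:
  assumes "r > 0"
  obtains \<psi> :: "'e \<Rightarrow> real" and K s where "\<And>n. Ck_on n UNIV \<psi>" "s > 0" "\<And>y. y \<in> ball y0 s \<Longrightarrow> \<psi> y = 1"
    "compact K" "K \<subseteq> ball y0 r" "\<And>y. y \<notin> K \<Longrightarrow> \<psi> y = 0"
proof -
  define N where "N = (\<Sum>b\<in>Bs. norm b) + 1"
  have N: "N > 0" by (simp add: N_def add_nonneg_pos sum_nonneg)
  \<comment> \<open>A vector whose coordinates are at most R in absolute value has norm at most R N
    = r/2, so the box fits into the ball.\<close>
  define R where "R = r / (2 * N)"
  have R: "R > 0" using N assms by (simp add: R_def)
  define Q where "Q y = (\<Sum>b\<in>Bs. coord b (y - y0) * coord b (y - y0))" for y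
  define K where "K = (\<lambda>c. y0 + (\<Sum>b\<in>Bs. c b *\<^sub>R b)) ` {c. \<forall>b. c b \<in> {-R..R}}"
  \<comment> \<open>The argument is at least 1 where Q \<le> R^2 / 2 and at most 0 where Q \<ge>
    R^2; outside the box some coordinate exceeds R, so the second case applies.\<close>
  define \<psi> where "\<psi> y = smooth_step (2 + (- 2 / R\<^sup>2) * Q y)" for y
  have Qc: "Ck_on n UNIV Q" for n
  proof -
    have "Ck_on n UNIV (\<lambda>y. y + (- y0))"
      by (intro Ck_on_add Ck_on_linear Ck_on_const linear_ident) auto
    then have "Ck_on n UNIV (\<lambda>y. coord b (y + - y0))" for b
      by (rule Ck_on_bounded_linear[OF bounded_linear_coord open_UNIV])
    then have "Ck_on n UNIV (\<lambda>y. coord b (y - y0))" for b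
      by simp
    then show ?thesis
      unfolding Q_def[abs_def] by (intro Ck_on_sum Ck_on_mult) auto
  qed
  have "Ck_on n UNIV (\<lambda>y. 2 + (- 2 / R\<^sup>2) * Q y)" for n
    by (intro Ck_on_add Ck_on_mult Ck_on_const Qc) auto
  then have smooth: "Ck_on n UNIV \<psi>" for n
    unfolding \<psi>_def[abs_def]
    using real_fin_dim.Ck_on_compose[OF open_UNIV open_UNIV _ _ Ck_on_smooth_step] by blast
  have "Q y0 = 0" by (simp add: Q_def representation_zero)
  have "continuous_on UNIV Q" using Ck_on_continuous_on[OF Qc[of 0]] .
  moreover have "R\<^sup>2 / 2 > 0" using R by simp
  ultimately have "\<exists>s>0. \<forall>y. dist y y0 < s \<longrightarrow> dist (Q y) (Q y0) < R\<^sup>2 / 2"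
    unfolding continuous_on_iff by blast
  then obtain s where s: "s > 0" "\<And>y. dist y y0 < s \<Longrightarrow> Q y < R\<^sup>2 / 2"
    unfolding \<open>Q y0 = 0\<close> by (force simp: dist_real_def)
  have one: "\<psi> y = 1" if "y \<in> ball y0 s" for y
  proof -
    have "Q y < R\<^sup>2 / 2" using s(2)[of y] that by (simp add: dist_commute)
    then have "2 / R\<^sup>2 * Q y \<le> 1" using R by (simp add: field_simps)
    then show ?thesis by (simp add: \<psi>_def smooth_step_eq)
  qed
  have cK: "compact K" unfolding K_def by (rule compact_box)
  have KB: "K \<subseteq> ball y0 r"
  proof
    fix y assume "y \<in> K"
    then obtain c where cR: "\<And>b. c b \<in> {-R..R}" and y: "y = y0 + (\<Sum>b\<in>Bs. c b *\<^sub>R b)"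
      unfolding K_def by blast
    have c: "\<bar>c b\<bar> \<le> R" for b using cR[of b] by auto
    have "norm (\<Sum>b\<in>Bs. c b *\<^sub>R b) \<le> (\<Sum>b\<in>Bs. R * norm b)"
      using c by (intro order_trans[OF norm_sum] sum_mono) (auto intro: mult_right_mono)
    also have "\<dots> \<le> R * N" using R by (simp add: N_def distrib_left flip: sum_distrib_left)
    also have "\<dots> < r" using N assms by (simp add: R_def)
    finally show "y \<in> ball y0 r" by (simp add: y dist_norm)
  qed
  have zero: "\<psi> y = 0" if "y \<notin> K" for y
  proof -
    have "\<exists>b\<in>Bs. \<bar>coord b (y - y0)\<bar> > R"
    proof (rule ccontr)
      assume "\<not> ?thesis"
      then have small: "\<bar>coord b (y - y0)\<bar> \<le> R" if "b \<in> Bs" for b using that by (simp add: not_less)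
      have "y = y0 + (\<Sum>b\<in>Bs. (if b \<in> Bs then coord b (y - y0) else 0) *\<^sub>R b)"
        using coord_sum[of "y - y0"] by simp
      moreover have "(if b \<in> Bs then coord b (y - y0) else 0) \<in> {-R..R}" for b
        using small[of b] R by (auto simp: abs_le_iff)
      then have "(\<lambda>b. if b \<in> Bs then coord b (y - y0) else 0) \<in> {c. \<forall>b. c b \<in> {-R..R}}"
        by blast
      ultimately have "y \<in> K" unfolding K_def by (rule image_eqI)
      with that show False by simp
    qed
    then obtain b where b: "b \<in> Bs" "\<bar>coord b (y - y0)\<bar> > R" by blast
    have "R\<^sup>2 \<le> \<bar>coord b (y - y0)\<bar>\<^sup>2" using b(2) R by (intro power_mono) auto
    also have "\<dots> = coord b (y - y0) * coord b (y - y0)" by (simp add: power2_eq_square)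
    also have "\<dots> \<le> Q y"
      unfolding Q_def by (rule member_le_sum) (use b finite_basis in auto)
    finally have "2 / R\<^sup>2 * Q y \<ge> 2" using R by (simp add: pos_le_divide_eq)
    then show ?thesis by (simp add: \<psi>_def smooth_step_eq)
  qed
  show ?thesis by (rule that[OF smooth s(1) one cK KB zero])
qed

text \<open>Average of F along the segment from y0 to y. Each derivative in y brings out one more
  factor s, so the weight \<open>s ^ m\<close> makes the class closed under differentiation.\<close>

definition ray_integral :: "'e \<Rightarrow> nat \<Rightarrow> ('e \<Rightarrow> real) \<Rightarrow> 'e \<Rightarrow> real" where
  "ray_integral y0 m F y = integral {0..1} (\<lambda>s. s ^ m * F (y0 + s *\<^sub>R (y - y0)))"

lemma ray_in_ball:
  fixes y :: 'e
  shows "y \<in> ball y0 r \<Longrightarrow> s \<in> {0..1} \<Longrightarrow> y0 + s *\<^sub>R (y - y0) \<in> ball y0 r"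
proof -
  assume "y \<in> ball y0 r" "s \<in> {0..1}"
  then have "norm (s *\<^sub>R (y - y0)) \<le> norm (y - y0)" "norm (y - y0) < r"
    by (auto simp: dist_norm norm_minus_commute mult_left_le_one_le)
  then show ?thesis by (simp add: dist_norm)
qed

lemma continuous_on_ray:
  fixes y :: 'e
  assumes "continuous_on (ball y0 r) F" "y \<in> ball y0 r"
  shows "continuous_on {0..1} (\<lambda>s. s ^ m * F (y0 + s *\<^sub>R (y - y0)))"
proof -
  have "continuous_on {0..1} (\<lambda>s. F (y0 + s *\<^sub>R (y - y0)))"
    by (rule continuous_on_compose2[OF assms(1)])
      (use ray_in_ball[OF assms(2)] in \<open>auto intro!: continuous_intros simp del: mem_ball\<close>)
  then show ?thesis by (intro continuous_intros)
qed

lemma ray_integrable: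
  fixes y :: 'e
  assumes "continuous_on (ball y0 r) F" "y \<in> ball y0 r"
  shows "(\<lambda>s. s ^ m * F (y0 + s *\<^sub>R (y - y0))) integrable_on {0..1::real}"
  by (rule integrable_continuous_interval[OF continuous_on_ray[OF assms]])

lemma continuous_on_ray2:
  fixes y0 :: 'e
  assumes "continuous_on (ball y0 r) F"
  shows "continuous_on (ball y0 r \<times> {0..1}) (\<lambda>(y, s). s ^ m * F (y0 + s *\<^sub>R (y - y0)))"
proof -
  have "continuous_on (ball y0 r \<times> {0..1}) (\<lambda>z. F (y0 + snd z *\<^sub>R (fst z - y0)))"
    by (rule continuous_on_compose2[OF assms])
      (use ray_in_ball in \<open>auto intro!: continuous_intros simp del: mem_ball\<close>)
  then show ?thesis unfolding case_prod_beta by (intro continuous_intros)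
qed

lemma continuous_on_ray_integral:
  assumes "continuous_on (ball y0 r) F"
  shows "continuous_on (ball y0 r) (ray_integral y0 m F)"
  using integral_continuous_on_param[of "ball y0 r" 0 1 "\<lambda>y s. s ^ m * F (y0 + s *\<^sub>R (y - y0))"]
    continuous_on_ray2[OF assms, of m]
  unfolding ray_integral_def[abs_def] by simp

text \<open>Compactness of [0, 1] gives one neighbourhood for all s, finiteness of the basis one for
  all directions b.\<close>

lemma ray_derivative_uniform:
  fixes y :: 'e
  assumes "\<And>v. continuous_on (ball y0 r) (\<lambda>z. DF z v)" "y \<in> ball y0 r" "\<epsilon> > 0"
  obtains \<delta> where "\<delta> > 0" "ball y \<delta> \<subseteq> ball y0 r"
    "\<And>b s y'. b \<in> Bs \<Longrightarrow> s \<in> {0..1} \<Longrightarrow> y' \<in> ball y \<delta> \<Longrightarrow>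
      \<bar>DF (y0 + s *\<^sub>R (y' - y0)) b - DF (y0 + s *\<^sub>R (y - y0)) b\<bar> \<le> (\<epsilon>::real)"
proof -
  have "\<exists>X. y \<in> X \<and> open X \<and> (\<forall>y'\<in>X \<inter> ball y0 r. \<forall>s\<in>{0..1}.
      \<bar>DF (y0 + s *\<^sub>R (y' - y0)) b - DF (y0 + s *\<^sub>R (y - y0)) b\<bar> \<le> \<epsilon>)" for b
  proof -
    obtain X where "y \<in> X" "open X" and X: "\<forall>y'\<in>X \<inter> ball y0 r. \<forall>s\<in>{0..1}.
        dist ((\<lambda>(y, s). s ^ 0 * DF (y0 + s *\<^sub>R (y - y0)) b) (y', s))
          ((\<lambda>(y, s). s ^ 0 * DF (y0 + s *\<^sub>R (y - y0)) b) (y, s)) \<le> \<epsilon>"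
      by (rule continuous_on_prod_compactE[OF continuous_on_ray2[OF assms(1)[of b], of 0] compact_Icc assms(2,3)])
    with X show ?thesis
      by (intro exI[of _ X]) (simp add: dist_real_def)
  qed
  then obtain X where X: "\<And>b. y \<in> X b" "\<And>b. open (X b)" "\<And>b y' s. y' \<in> X b \<Longrightarrow> y' \<in> ball y0 r \<Longrightarrow> s \<in> {0..1} \<Longrightarrow>
      \<bar>DF (y0 + s *\<^sub>R (y' - y0)) b - DF (y0 + s *\<^sub>R (y - y0)) b\<bar> \<le> \<epsilon>"
    by (metis IntI)
  have "open ((\<Inter>b\<in>Bs. X b) \<inter> ball y0 r)" "y \<in> (\<Inter>b\<in>Bs. X b) \<inter> ball y0 r"
    using X(1,2) assms(2) finite_basis by auto
  then obtain \<delta> where "\<delta> > 0" "ball y \<delta> \<subseteq> (\<Inter>b\<in>Bs. X b) \<inter> ball y0 r"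
    using openE by blast
  then show ?thesis using X(3) by (intro that[of \<delta>]) blast+
qed

text \<open>Differentiation under the integral sign: the linearisation error of the integrand is
  bounded by e times the displacement uniformly in s, and this estimate is integrated over
  [0, 1].\<close>

lemma ray_integral_has_derivative:
  assumes F': "\<And>z. z \<in> ball y0 r \<Longrightarrow> (F has_derivative DF z) (at z)"
    and cont: "\<And>v. continuous_on (ball y0 r) (\<lambda>z. DF z v)" and y: "y \<in> ball y0 r"
  shows "(ray_integral y0 m F has_derivative (\<lambda>v. ray_integral y0 (Suc m) (\<lambda>z. DF z v) y)) (at y)"
  unfolding has_derivative_at_alt
proof (intro conjI allI impI)
  let ?T = "\<lambda>v. ray_integral y0 (Suc m) (\<lambda>z. DF z v) y"
  let ?p = "\<lambda>s y. y0 + s *\<^sub>R (y - y0)"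
  have lin: "linear (DF z)" if "z \<in> ball y0 r" for z
    using has_derivative_linear[OF F'[OF that]] .
  have contF: "continuous_on (ball y0 r) F"
    by (intro continuous_at_imp_continuous_on ballI has_derivative_continuous[OF F'])
  note int = ray_integrable[OF cont y]
  show "bounded_linear ?T"
  proof (rule bounded_linear_if_linear, rule linearI)
    show "?T (u + v) = ?T u + ?T v" for u v
    proof -
      have "?T (u + v) = integral {0..1} (\<lambda>s. s ^ Suc m * DF (?p s y) u + s ^ Suc m * DF (?p s y) v)"
        unfolding ray_integral_def
        by (rule integral_cong) (simp add: linear_add[OF lin[OF ray_in_ball[OF y]]] distrib_left)
      also have "\<dots> = ?T u + ?T v"
        unfolding ray_integral_def by (rule integral_add[OF int int])
      finally show ?thesis .
    qed
    show "?T (c *\<^sub>R v) = c *\<^sub>R ?T v" for c v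
    proof -
      have "?T (c *\<^sub>R v) = integral {0..1} (\<lambda>s. c * (s ^ Suc m * DF (?p s y) v))"
        unfolding ray_integral_def
        by (rule integral_cong) (simp add: linear_scale[OF lin[OF ray_in_ball[OF y]]])
      also have "\<dots> = c *\<^sub>R ?T v"
        unfolding ray_integral_def by simp
      finally show ?thesis .
    qed
  qed
  fix e :: real assume e: "e > 0"
  obtain C where C: "C > 0" "\<And>(L::'e \<Rightarrow> real) \<epsilon>. linear L \<Longrightarrow> (\<And>b. b \<in> Bs \<Longrightarrow> norm (L b) \<le> \<epsilon>) \<Longrightarrow> \<epsilon> \<ge> 0 \<Longrightarrow> onorm L \<le> C * \<epsilon>"
    using onorm_le_if_bounded_on_basis by blast
  have eC: "e / C > 0" using e C by simp
  obtain \<delta> where \<delta>: "\<delta> > 0" "ball y \<delta> \<subseteq> ball y0 r"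
    "\<And>b s y'. b \<in> Bs \<Longrightarrow> s \<in> {0..1} \<Longrightarrow> y' \<in> ball y \<delta> \<Longrightarrow> \<bar>DF (?p s y') b - DF (?p s y) b\<bar> \<le> e / C"
    by (rule ray_derivative_uniform[where DF = DF, OF cont y eC]) blast
  have "norm (ray_integral y0 m F y' - ray_integral y0 m F y - ?T (y' - y)) \<le> e * norm (y' - y)"
    if "norm (y' - y) < \<delta>" for y'
  proof -
    have y': "y' \<in> ball y \<delta>" using that by (simp add: dist_norm norm_minus_commute)
    have pt: "\<bar>F (?p s y') - F (?p s y) - s * DF (?p s y) (y' - y)\<bar> \<le> e * norm (y' - y)"
      if s: "s \<in> {0..1}" for s
    proof -
      \<comment> \<open>This set contains the segment between the two points on the rays, and the
        derivative varies on it by at most e / C in each basis direction. The constant C then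
        cancels in the operator norm.\<close>
      let ?S = "(\<lambda>z. ?p s z) ` ball y \<delta>"
      have S: "?S \<subseteq> ball y0 r" using ray_in_ball[OF _ s] \<delta>(2) by blast
      have diff: "?p s y' - ?p s y = s *\<^sub>R (y' - y)" by (simp add: algebra_simps)
      have "norm (F (?p s y') - F (?p s y) - DF (?p s y) (?p s y' - ?p s y)) \<le> norm (?p s y' - ?p s y) * e"
      proof (rule differentiable_bound_linearization[where S = ?S])
        show "?p s y + t *\<^sub>R (?p s y' - ?p s y) \<in> ?S" if "t \<in> {0..1}" for t
        proof
          show "?p s y + t *\<^sub>R (?p s y' - ?p s y) = ?p s (y + t *\<^sub>R (y' - y))"
            by (simp add: algebra_simps)
          have "norm (t *\<^sub>R (y' - y)) \<le> norm (y' - y)"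
            using that by (simp add: mult_left_le_one_le)
          then show "y + t *\<^sub>R (y' - y) \<in> ball y \<delta>"
            using \<open>norm (y' - y) < \<delta>\<close> by (simp add: dist_norm)
        qed
        show "(F has_derivative DF z) (at z within ?S)" if "z \<in> ?S" for z
          using F' S that has_derivative_at_withinI by blast
        show "onorm (DF z - DF (?p s y)) \<le> e" if z: "z \<in> ?S" for z
        proof -
          have "linear (DF z)" "linear (DF (?p s y))"
            using lin S z \<delta>(1) by (auto intro!: lin ray_in_ball[OF y s])
          then have "linear (DF z - DF (?p s y))"
            unfolding fun_diff_def by (rule linear_compose_sub)
          then have "onorm (DF z - DF (?p s y)) \<le> C * (e / C)"
            by (rule C(2)) (use \<delta>(3)[OF _ s] z eC in auto)
          then show ?thesis using C(1) by simp
        qed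
        show "?p s y \<in> ?S" using \<delta>(1) by auto
      qed
      then have "\<bar>F (?p s y') - F (?p s y) - s * DF (?p s y) (y' - y)\<bar> \<le> \<bar>s\<bar> * norm (y' - y) * e"
        unfolding diff using linear_scale[OF lin[OF ray_in_ball[OF y s]]] by simp
      also have "\<dots> \<le> 1 * norm (y' - y) * e"
        using s e by (intro mult_right_mono) auto
      finally show ?thesis by (simp add: mult.commute)
    qed
    have y'r: "y' \<in> ball y0 r" using y' \<delta>(2) by blast
    note int_y = ray_integrable[OF contF y, of m] and int_y' = ray_integrable[OF contF y'r, of m]
    let ?I = "\<lambda>s. s ^ m * F (?p s y') - s ^ m * F (?p s y) - s ^ Suc m * DF (?p s y) (y' - y)"
    have "ray_integral y0 m F y' - ray_integral y0 m F y - ?T (y' - y) = integral {0..1} ?I"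
      unfolding ray_integral_def
      using integral_diff[OF integrable_diff[OF int_y' int_y] int[of "Suc m" "y' - y"]]
        integral_diff[OF int_y' int_y] by simp
    also have "norm \<dots> \<le> integral {0..1} (\<lambda>s::real. e * norm (y' - y))"
    proof (rule integral_norm_bound_integral)
      show "?I integrable_on {0..1}"
        by (intro integrable_diff int_y int_y' int)
      fix s :: real assume s: "s \<in> {0..1}"
      have "?I s = s ^ m * (F (?p s y') - F (?p s y) - s * DF (?p s y) (y' - y))"
        by (simp add: algebra_simps)
      then have "norm (?I s) = s ^ m * \<bar>F (?p s y') - F (?p s y) - s * DF (?p s y) (y' - y)\<bar>"
        using s by (simp add: abs_mult)
      also have "\<dots> \<le> 1 * (e * norm (y' - y))"
        using s pt[OF s] by (intro mult_mono) (auto simp: power_le_one)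
      finally show "norm (?I s) \<le> e * norm (y' - y)" by simp
    qed auto
    finally show ?thesis by simp
  qed
  then show "\<exists>d>0. \<forall>y'. norm (y' - y) < d \<longrightarrow>
      norm (ray_integral y0 m F y' - ray_integral y0 m F y - ?T (y' - y)) \<le> e * norm (y' - y)"
    using \<delta>(1) by blast
qed

lemma Ck_on_ray_integral:
  "Ck_on n (ball y0 r) F \<Longrightarrow> Ck_on n (ball y0 r) (ray_integral y0 m F)"
proof (induction n arbitrary: F m)
  case 0
  then show ?case using continuous_on_ray_integral by auto
next
  case (Suc n)
  have D: "Ck_on n (ball y0 r) (\<lambda>z. frechet_derivative F (at z) v)" for v
    using Suc.prems by auto
  show ?case
    by (rule Ck_on_SucI[OF open_ball ray_integral_has_derivative[OF Ck_on_SucE[OF Suc.prems]]])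
      (use Suc.IH[OF D] Ck_on_continuous_on[OF D] in auto)
qed

text \<open>The fundamental theorem of calculus along the ray, with the velocity y - y0 expanded in
  the basis. The cofactors of the coordinates are as smooth as the partial derivatives of F.\<close>

lemma Hadamard:
  assumes F: "Ck_on 1 (ball y0 r) F" and y: "y \<in> ball y0 r"
  shows "F y = F y0 + (\<Sum>b\<in>Bs. coord b (y - y0) * ray_integral y0 0 (\<lambda>z. frechet_derivative F (at z) b) y)"
proof -
  let ?p = "\<lambda>s. y0 + s *\<^sub>R (y - y0)"
  have F1: "Ck_on (Suc 0) (ball y0 r) F" using F by simp
  note F' = Ck_on_SucE[OF F1]
  have cont: "continuous_on (ball y0 r) (\<lambda>z. frechet_derivative F (at z) v)" for v
    using F1 by auto
  have "((\<lambda>s. F (?p s)) has_vector_derivative frechet_derivative F (at (?p s)) (y - y0)) (at s within {0..1})"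
    if s: "s \<in> {0..1}" for s
  proof -
    have "(?p has_derivative (\<lambda>h. h *\<^sub>R (y - y0))) (at s within {0..1})"
      by (auto intro!: derivative_eq_intros)
    from has_derivative_compose[OF this F'[OF ray_in_ball[OF y s]]]
    show ?thesis
      unfolding has_vector_derivative_def
      using linear_scale[OF has_derivative_linear[OF F'[OF ray_in_ball[OF y s]]]] by simp
  qed
  then have "((\<lambda>s. frechet_derivative F (at (?p s)) (y - y0)) has_integral F (?p 1) - F (?p 0)) {0..1}"
    by (intro fundamental_theorem_of_calculus) auto
  then have "F y - F y0 = integral {0..1} (\<lambda>s. frechet_derivative F (at (?p s)) (y - y0))"
    by (simp add: integral_unique)
  also have "\<dots> = integral {0..1} (\<lambda>s. \<Sum>b\<in>Bs. coord b (y - y0) * (s ^ 0 * frechet_derivative F (at (?p s)) b))"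
    by (rule integral_cong)
      (simp add: linear_coord_sum[OF has_derivative_linear[OF F'[OF ray_in_ball[OF y]]], of _ "y - y0"])
  also have "\<dots> = (\<Sum>b\<in>Bs. coord b (y - y0) * ray_integral y0 0 (\<lambda>z. frechet_derivative F (at z) b) y)"
    unfolding ray_integral_def
    using integrable_cmul[OF ray_integrable[OF cont y, of 0], simplified]
    by (simp add: integral_sum[OF finite_basis])
  finally show ?thesis by simp
qed

lemma ray_integral_center: "ray_integral y0 0 F y0 = F y0"
  by (simp add: ray_integral_def)

end

section \<open>Smooth functions on a manifold\<close>

lemma smooth_onD: "smooth_on S f \<Longrightarrow> Ck_on n S f"
  by (simp add: smooth_on_def)

lemma smooth_on_cong: "open S \<Longrightarrow> (\<And>x. x \<in> S \<Longrightarrow> f x = g x) \<Longrightarrow> smooth_on S f \<longleftrightarrow> smooth_on S g"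
  using Ck_on_cong unfolding smooth_on_def by metis

lemma smooth_on_frechet_derivative:
  "smooth_on S f \<Longrightarrow> smooth_on S (\<lambda>x. frechet_derivative f (at x) v)"
  unfolding smooth_on_def using Ck_on.simps(2) by blast

lemma smooth_on_has_derivative:
  "smooth_on S f \<Longrightarrow> x \<in> S \<Longrightarrow> (f has_derivative frechet_derivative f (at x)) (at x)"
  using Ck_on_SucE smooth_onD by blast

locale smooth_manifold =
  fixes M :: "('m::{t2_space, second_countable_topology}, 'e::real_normed_vector) atlas"
  assumes atlas: "smooth_atlas M"
begin

lemma model_basis: obtains Bs :: "'e set" where "fin_dim Bs"
proof -
  obtain S :: "'e set" where S: "finite S" "span S = UNIV"
    using conjunct1[OF atlas[unfolded smooth_atlas_def]] by blast
  obtain B where B: "B \<subseteq> S" "independent B" "S \<subseteq> span B"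
    using maximal_independent_subset by blast
  have "span B = UNIV"
    using S(2) span_minimal[OF B(3) subspace_span] by auto
  moreover have "finite B" using B(1) S(1) by (rule finite_subset)
  ultimately show ?thesis using B(2) that[of B] by (simp add: fin_dim_def)
qed

lemma chart_exists: obtains U \<phi> where "(U, \<phi>) \<in> M" "x \<in> U"
proof -
  have cover: "(\<Union>(U, \<phi>)\<in>M. U) = UNIV"
    using conjunct1[OF conjunct2[OF atlas[unfolded smooth_atlas_def]]] .
  have "x \<in> (\<Union>(U, \<phi>)\<in>M. U)"
    unfolding cover by (rule UNIV_I)
  then obtain p where "p \<in> M" "x \<in> (case p of (U, \<phi>) \<Rightarrow> U)"
    unfolding UN_iff by (rule bexE)
  then have "(fst p, snd p) \<in> M" "x \<in> fst p"
    by (simp_all add: case_prod_beta)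
  then show ?thesis by (rule that)
qed

context
  fixes U :: "'m set" and \<phi> :: "'m \<Rightarrow> 'e"
  assumes chart: "(U, \<phi>) \<in> M"
begin

lemma chart_open: "open U" "open (\<phi> ` U)"
  and chart_homeomorphism: "homeomorphism U (\<phi> ` U) \<phi> (inv_into U \<phi>)"
proof -
  have "\<forall>(U, \<phi>)\<in>M. open U \<and> open (\<phi> ` U) \<and> homeomorphism U (\<phi> ` U) \<phi> (inv_into U \<phi>)"
    using conjunct1[OF conjunct2[OF conjunct2[OF atlas[unfolded smooth_atlas_def]]]] .
  with chart show "open U" "open (\<phi> ` U)" "homeomorphism U (\<phi> ` U) \<phi> (inv_into U \<phi>)"
    by auto
qed

lemma inv_chart: "x \<in> U \<Longrightarrow> inv_into U \<phi> (\<phi> x) = x"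
  using chart_homeomorphism by (simp add: homeomorphism_def)

lemma chart_image_open:
  assumes "open W" shows "open (\<phi> ` (W \<inter> U))"
proof -
  have "\<phi> ` (W \<inter> U) = inv_into U \<phi> -` W \<inter> \<phi> ` U"
    using inv_chart by force
  moreover have "continuous_on (\<phi> ` U) (inv_into U \<phi>)"
    using chart_homeomorphism by (simp add: homeomorphism_def)
  ultimately show ?thesis
    using assms chart_open(2) continuous_on_open_vimage by metis
qed

lemma transition_smooth: "(V, \<psi>) \<in> M \<Longrightarrow> smooth_on (\<phi> ` (U \<inter> V)) (\<lambda>y. \<psi> (inv_into U \<phi> y))"
proof -
  have "\<forall>(U, \<phi>)\<in>M. \<forall>(V, \<psi>)\<in>M. smooth_on (\<phi> ` (U \<inter> V)) (\<lambda>y. \<psi> (inv_into U \<phi> y))"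
    using conjunct2[OF conjunct2[OF conjunct2[OF atlas[unfolded smooth_atlas_def]]]] .
  with chart show "(V, \<psi>) \<in> M \<Longrightarrow> smooth_on (\<phi> ` (U \<inter> V)) (\<lambda>y. \<psi> (inv_into U \<phi> y))"
    by fast
qed

lemma smooth_fun_onD: "smooth_fun_on M W f \<Longrightarrow> smooth_on (\<phi> ` (W \<inter> U)) (\<lambda>y. f (inv_into U \<phi> y))"
  using chart by (auto simp: smooth_fun_on_def)

end

text \<open>Smoothness demands all charts; composing with the transition maps reduces this to
  one.\<close>

lemma chart_smooth_imp_smooth_fun_on:
  assumes chart: "(U, \<phi>) \<in> M" and N: "open N" "N \<subseteq> U" and f: "smooth_on (\<phi> ` N) (\<lambda>y. f (inv_into U \<phi> y))"
  shows "smooth_fun_on M N f"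
  unfolding smooth_fun_on_def
proof clarify
  fix V \<psi> assume V: "(V, \<psi>) \<in> M"
  obtain Bs :: "'e set" where "fin_dim Bs" by (rule model_basis)
  then interpret fin_dim Bs .
  have openNV: "open (\<psi> ` (N \<inter> V))"
    using chart_image_open[OF V N(1)] .
  have inv: "inv_into V \<psi> (\<psi> x) = x" if "x \<in> V" for x
    using inv_chart[OF V that] .
  have openN: "open (\<phi> ` N)" using chart_image_open[OF chart N(1)] N(2) by (simp add: Int_absorb2)
  have "Ck_on n (\<psi> ` (N \<inter> V)) (\<lambda>y. f (inv_into U \<phi> (\<phi> (inv_into V \<psi> y))))" for n
  proof (rule Ck_on_compose[OF openNV openN])
    show "(\<lambda>y. \<phi> (inv_into V \<psi> y)) ` \<psi> ` (N \<inter> V) \<subseteq> \<phi> ` N"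
      using inv by auto
    have "smooth_on (\<psi> ` (V \<inter> U)) (\<lambda>y. \<phi> (inv_into V \<psi> y))"
      using transition_smooth[OF V chart] .
    then show "Ck_on n (\<psi> ` (N \<inter> V)) (\<lambda>y. \<phi> (inv_into V \<psi> y))"
      by (rule Ck_on_subset[OF smooth_onD]) (use N in blast)
    show "Ck_on n (\<phi> ` N) (\<lambda>y. f (inv_into U \<phi> y))"
      using f by (rule smooth_onD)
  qed
  moreover have "inv_into U \<phi> (\<phi> (inv_into V \<psi> y)) = inv_into V \<psi> y" if "y \<in> \<psi> ` (N \<inter> V)" for y
    using that inv inv_chart[OF chart] N(2) by auto
  ultimately show "smooth_on (\<psi> ` (N \<inter> V)) (\<lambda>y. f (inv_into V \<psi> y))"
    unfolding smooth_on_def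
    using Ck_on_cong[OF openNV, of "\<lambda>y. f (inv_into U \<phi> (\<phi> (inv_into V \<psi> y)))" "\<lambda>y. f (inv_into V \<psi> y)"] by simp
qed

lemma smooth_fun_on_subset: "smooth_fun_on M W f \<Longrightarrow> W' \<subseteq> W \<Longrightarrow> smooth_fun_on M W' f"
  unfolding smooth_fun_on_def smooth_on_def by (fast intro: Ck_on_subset)

lemma smooth_fun_on_local:
  assumes "\<And>x. x \<in> W \<Longrightarrow> \<exists>N. open N \<and> x \<in> N \<and> smooth_fun_on M N f"
  shows "smooth_fun_on M W f"
  unfolding smooth_fun_on_def smooth_on_def
proof clarify
  fix U \<phi> n assume U: "(U, \<phi>) \<in> M"
  show "Ck_on n (\<phi> ` (W \<inter> U)) (\<lambda>y. f (inv_into U \<phi> y))"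
  proof (rule Ck_on_local)
    fix y assume "y \<in> \<phi> ` (W \<inter> U)"
    then obtain x where x: "x \<in> W" "x \<in> U" "y = \<phi> x" by blast
    obtain N where N: "open N" "x \<in> N" "smooth_fun_on M N f"
      using assms[OF x(1)] by blast
    have "Ck_on n (\<phi> ` (N \<inter> U)) (\<lambda>y. f (inv_into U \<phi> y))"
      using smooth_fun_onD[OF U N(3)] by (rule smooth_onD)
    then show "\<exists>T. open T \<and> y \<in> T \<and> Ck_on n T (\<lambda>y. f (inv_into U \<phi> y))"
      using chart_image_open[OF U N(1)] N(2) x by blast
  qed
qed

lemma smooth_fun_on_cong:
  assumes "open W" "\<And>x. x \<in> W \<Longrightarrow> f x = g x" "smooth_fun_on M W f"
  shows "smooth_fun_on M W g"
  unfolding smooth_fun_on_def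
proof clarify
  fix U \<phi> assume U: "(U, \<phi>) \<in> M"
  have "smooth_on (\<phi> ` (W \<inter> U)) (\<lambda>y. f (inv_into U \<phi> y))"
    by (rule smooth_fun_onD[OF U assms(3)])
  then show "smooth_on (\<phi> ` (W \<inter> U)) (\<lambda>y. g (inv_into U \<phi> y))"
    by (subst (asm) smooth_on_cong[OF chart_image_open[OF U assms(1)]])
      (use assms(2) inv_chart[OF U] in auto)
qed

lemma smooth_fun_on_const: "smooth_fun_on M W (\<lambda>x. c)"
  by (simp add: smooth_fun_on_def smooth_on_def Ck_on_const case_prod_beta)

context
  fixes W :: "'m set" assumes openW: "open W"
begin

lemma smooth_fun_on_add:
  "smooth_fun_on M W f \<Longrightarrow> smooth_fun_on M W g \<Longrightarrow> smooth_fun_on M W (\<lambda>x. f x + g x)"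
  unfolding smooth_fun_on_def smooth_on_def
  using Ck_on_add[OF chart_image_open[OF _ openW]] by fast

lemma smooth_fun_on_mult:
  "smooth_fun_on M W f \<Longrightarrow> smooth_fun_on M W g \<Longrightarrow> smooth_fun_on M W (\<lambda>x. f x * g x)"
  unfolding smooth_fun_on_def smooth_on_def
  using Ck_on_mult[OF chart_image_open[OF _ openW]] by fast

lemma smooth_fun_on_diff:
  assumes "smooth_fun_on M W f" "smooth_fun_on M W g"
  shows "smooth_fun_on M W (\<lambda>x. f x - g x)"
  using smooth_fun_on_add[OF assms(1) smooth_fun_on_mult[OF smooth_fun_on_const[of _ "-1"] assms(2)]]
  by simp

lemma smooth_fun_on_sum:
  "(\<And>i. i \<in> I \<Longrightarrow> smooth_fun_on M W (f i)) \<Longrightarrow> smooth_fun_on M W (\<lambda>x. \<Sum>i\<in>I. f i x)"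
  by (induction I rule: infinite_finite_induct) (auto intro: smooth_fun_on_const smooth_fun_on_add)

lemma smooth_fun_on_inverse:
  assumes "smooth_fun_on M W f" "\<And>x. x \<in> W \<Longrightarrow> f x \<noteq> 0"
  shows "smooth_fun_on M W (\<lambda>x. inverse (f x))"
  unfolding smooth_fun_on_def smooth_on_def
proof clarify
  fix U \<phi> n assume U: "(U, \<phi>) \<in> M"
  show "Ck_on n (\<phi> ` (W \<inter> U)) (\<lambda>y. inverse (f (inv_into U \<phi> y)))"
    by (rule Ck_on_inverse[OF chart_image_open[OF U openW]])
      (use assms U inv_chart[OF U] in \<open>auto simp: smooth_fun_on_def smooth_on_def\<close>)
qed

lemma smooth_fun_on_divide:
  assumes "smooth_fun_on M W f" "smooth_fun_on M W g" "\<And>x. x \<in> W \<Longrightarrow> g x \<noteq> 0"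
  shows "smooth_fun_on M W (\<lambda>x. f x / g x)"
  unfolding divide_inverse using assms by (intro smooth_fun_on_mult smooth_fun_on_inverse)

text \<open>Orthogonalising against the last vector replaces Cramer's rule.\<close>
lemma smooth_coefficients:
  fixes v :: "nat \<Rightarrow> nat \<Rightarrow> 'm \<Rightarrow> real"
  assumes "\<And>i k. i < n \<Longrightarrow> k < m \<Longrightarrow> smooth_fun_on M W (v i k)"
    and "\<And>k. k < m \<Longrightarrow> smooth_fun_on M W (s k)"
    and "\<And>x d i. x \<in> W \<Longrightarrow> (\<And>k. k < m \<Longrightarrow> (\<Sum>i<n. d i * v i k x) = 0) \<Longrightarrow> i < n \<Longrightarrow> d i = 0"
    and "\<And>x k. x \<in> W \<Longrightarrow> k < m \<Longrightarrow> s k x = (\<Sum>i<n. c i x * v i k x)"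
    and "i < n"
  shows "smooth_fun_on M W (c i)"
  using assms
proof (induction n arbitrary: v s i)
  case 0
  then show ?case by simp
next
  case (Suc n)
  define N where "N x = (\<Sum>k<m. v n k x * v n k x)" for x
  define p where "p w x = (\<Sum>k<m. w k x * v n k x) / N x" for w :: "nat \<Rightarrow> 'm \<Rightarrow> real" and x
  have N0: "N x \<noteq> 0" if x: "x \<in> W" for x
  proof
    assume "N x = 0"
    then have z: "v n k x = 0" if "k < m" for k
      unfolding N_def using that by (subst (asm) sum_nonneg_eq_0_iff) auto
    have "(\<Sum>i<Suc n. (if i = n then 1 else 0) * v i k x) = 0" if "k < m" for k
      using z[OF that] by simp
    from Suc.prems(3)[OF x this, of n] show False by simp
  qed
  have N: "smooth_fun_on M W N"
    unfolding N_def[abs_def] using Suc.prems(1) by (intro smooth_fun_on_sum smooth_fun_on_mult) auto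
  have p: "smooth_fun_on M W (p w)" if "\<And>k. k < m \<Longrightarrow> smooth_fun_on M W (w k)" for w
    unfolding p_def[abs_def] using that Suc.prems(1) N0
    by (intro smooth_fun_on_divide smooth_fun_on_sum smooth_fun_on_mult N) auto
  define v' where "v' i k x = v i k x - p (v i) x * v n k x" for i k x
  define s' where "s' k x = s k x - p s x * v n k x" for k x
  \<comment> \<open>Pairing the expansion of s with the last vector expresses its coefficient
    through the earlier ones, which the induction makes smooth.\<close>
  have ps: "p s x = (\<Sum>i<n. c i x * p (v i) x) + c n x" if x: "x \<in> W" for x
  proof -
    have "(\<Sum>k<m. s k x * v n k x) = (\<Sum>k<m. \<Sum>i<Suc n. c i x * (v i k x * v n k x))"
      using Suc.prems(4)[OF x] by (intro sum.cong) (auto simp: sum_distrib_right distrib_right mult.assoc)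
    also have "\<dots> = (\<Sum>i<Suc n. c i x * (\<Sum>k<m. v i k x * v n k x))"
      by (subst sum.swap) (simp add: sum_distrib_left)
    also have "\<dots> = (\<Sum>i<n. c i x * (\<Sum>k<m. v i k x * v n k x)) + c n x * N x"
      by (simp add: N_def)
    finally have "(\<Sum>k<m. s k x * v n k x) = (\<Sum>i<n. c i x * (\<Sum>k<m. v i k x * v n k x)) + c n x * N x" .
    moreover have "(\<Sum>k<m. v i k x * v n k x) = p (v i) x * N x" for i
      using N0[OF x] by (simp add: p_def)
    ultimately have "(\<Sum>k<m. s k x * v n k x) = ((\<Sum>i<n. c i x * p (v i) x) + c n x) * N x"
      by (simp add: sum_distrib_right distrib_right mult.assoc)
    then show ?thesis
      using N0[OF x] by (simp add: p_def[of s])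
  qed
  have IH: "smooth_fun_on M W (c i)" if i: "i < n" for i
  proof (rule Suc.IH[of v' s'])
    show "smooth_fun_on M W (v' i k)" if "i < n" "k < m" for i k
      unfolding v'_def[abs_def] using that Suc.prems(1)
      by (intro smooth_fun_on_diff smooth_fun_on_mult p) auto
    show "smooth_fun_on M W (s' k)" if "k < m" for k
      unfolding s'_def[abs_def] using that Suc.prems(1,2)
      by (intro smooth_fun_on_diff smooth_fun_on_mult p) auto
    show "d i = 0" if x: "x \<in> W" and d: "\<And>k. k < m \<Longrightarrow> (\<Sum>i<n. d i * v' i k x) = 0" and i: "i < n" for x d i
    proof -
      \<comment> \<open>The last coefficient undoes the projections, so a relation between the
        projected vectors becomes a relation between the original ones.\<close>
      let ?d = "\<lambda>i. if i = n then - (\<Sum>i<n. d i * p (v i) x) else d i"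
      have "(\<Sum>i<Suc n. ?d i * v i k x) = (\<Sum>i<n. d i * v' i k x)" if "k < m" for k
        by (simp add: v'_def right_diff_distrib sum_subtractf sum_distrib_right mult.assoc)
      then have "?d i = 0"
        using Suc.prems(3)[OF x, of ?d i] d i by simp
      with i show ?thesis by simp
    qed
    show "s' k x = (\<Sum>i<n. c i x * v' i k x)" if "x \<in> W" "k < m" for x k
      using that Suc.prems(4)[of x k]
      by (simp add: s'_def v'_def ps right_diff_distrib distrib_right sum_subtractf sum_distrib_right mult.assoc)
  qed (use i in auto)
  show ?case
  proof (cases "i = n")
    case True
    have "smooth_fun_on M W (\<lambda>x. p s x - (\<Sum>i<n. c i x * p (v i) x))"
    proof (rule smooth_fun_on_diff)
      show "smooth_fun_on M W (p s)"
        by (rule p) (rule Suc.prems(2))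
      show "smooth_fun_on M W (\<lambda>x. \<Sum>i<n. c i x * p (v i) x)"
      proof (rule smooth_fun_on_sum)
        fix i assume "i \<in> {..<n}"
        then have i: "i < n" by simp
        show "smooth_fun_on M W (\<lambda>x. c i x * p (v i) x)"
          by (rule smooth_fun_on_mult[OF IH[OF i] p]) (use i Suc.prems(1) in auto)
      qed
    qed
    then show ?thesis
      by (rule smooth_fun_on_cong[OF openW, rotated]) (use ps True in auto)
  qed (use IH Suc.prems(5) in auto)
qed

end

lemma Cinf_iff: "f \<in> Cinf M \<longleftrightarrow> smooth_fun_on M UNIV f"
  by (simp add: Cinf_def)

lemma Cinf_smooth_fun_on: "f \<in> Cinf M \<Longrightarrow> smooth_fun_on M W f"
  using smooth_fun_on_subset by (auto simp: Cinf_iff)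

text \<open>C is the preimage of a compact box in a chart, hence compact, and closed because the
  manifold is Hausdorff. Its complement is therefore an open set on which \<rho> vanishes, so the
  extension by 0 is smooth.\<close>

lemma bump_function:
  assumes "open W" "x \<in> W"
  obtains \<rho> N C where "\<rho> \<in> Cinf M" "open N" "x \<in> N" "\<And>y. y \<in> N \<Longrightarrow> \<rho> y = 1"
    "closed C" "C \<subseteq> W" "\<And>y. y \<notin> C \<Longrightarrow> \<rho> y = 0" "N \<subseteq> W"
proof -
  obtain Bs :: "'e set" where "fin_dim Bs" by (rule model_basis)
  then interpret fin_dim Bs .
  obtain U \<phi> where U: "(U, \<phi>) \<in> M" "x \<in> U" by (rule chart_exists)
  note inv = inv_chart[OF U(1)] and hom = chart_homeomorphism[OF U(1)]
  have "open (\<phi> ` (W \<inter> U))" "\<phi> x \<in> \<phi> ` (W \<inter> U)"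
    using chart_image_open[OF U(1) assms(1)] assms(2) U(2) by auto
  then obtain r where r: "r > 0" "ball (\<phi> x) r \<subseteq> \<phi> ` (W \<inter> U)"
    using openE by blast
  obtain \<psi> :: "'e \<Rightarrow> real" and K s where \<psi>: "\<And>n. Ck_on n UNIV \<psi>" "s > 0" "\<And>y. y \<in> ball (\<phi> x) s \<Longrightarrow> \<psi> y = 1"
    "compact K" "K \<subseteq> ball (\<phi> x) r" "\<And>y. y \<notin> K \<Longrightarrow> \<psi> y = 0"
    by (rule bump_exists[OF r(1), of "\<phi> x"]) (rule that; assumption)
  define C where "C = inv_into U \<phi> ` K"
  define \<rho> where "\<rho> y = (if y \<in> U then \<psi> (\<phi> y) else 0)" for y
  define N where "N = \<phi> -` ball (\<phi> x) s \<inter> U"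
  have KU: "K \<subseteq> \<phi> ` (W \<inter> U)" using r(2) \<psi>(5) by blast
  have CW: "C \<subseteq> W \<inter> U"
    using KU inv unfolding C_def by force
  have "continuous_on K (inv_into U \<phi>)"
    using hom KU by (auto simp: homeomorphism_def intro: continuous_on_subset)
  then have "closed C"
    unfolding C_def using compact_continuous_image \<psi>(4) compact_imp_closed by blast
  have zero: "\<rho> y = 0" if "y \<notin> C" for y
    using that inv[of y] \<psi>(6)[of "\<phi> y"] unfolding \<rho>_def C_def by force
  have "open N"
    unfolding N_def using hom chart_open(1)[OF U(1)] continuous_on_open_vimage[of U \<phi>]
    by (auto simp: homeomorphism_def)
  have smU: "smooth_fun_on M U \<rho>"
  proof (rule chart_smooth_imp_smooth_fun_on[OF U(1) chart_open(1)[OF U(1)] order_refl])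
    show "smooth_on (\<phi> ` U) (\<lambda>y. \<rho> (inv_into U \<phi> y))"
      unfolding smooth_on_def
    proof
      fix n
      have "\<rho> (inv_into U \<phi> y) = \<psi> y" if "y \<in> \<phi> ` U" for y
        using that inv by (auto simp: \<rho>_def)
      then show "Ck_on n (\<phi> ` U) (\<lambda>y. \<rho> (inv_into U \<phi> y))"
        using Ck_on_cong[OF chart_open(2)[OF U(1)], of "\<lambda>y. \<rho> (inv_into U \<phi> y)" \<psi> n]
          Ck_on_subset[OF \<psi>(1)[of n] subset_UNIV] by simp
    qed
  qed
  have smC: "smooth_fun_on M (- C) \<rho>"
    by (rule smooth_fun_on_cong[OF _ _ smooth_fun_on_const[of _ 0]])
      (use zero \<open>closed C\<close> in auto)
  have "\<rho> \<in> Cinf M"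
    unfolding Cinf_iff
  proof (intro smooth_fun_on_local)
    fix y
    show "\<exists>N. open N \<and> y \<in> N \<and> smooth_fun_on M N \<rho>"
    proof (cases "y \<in> U")
      case True
      then show ?thesis using smU chart_open(1)[OF U(1)] by blast
    next
      case False
      then show ?thesis using smC CW \<open>closed C\<close> by (intro exI[of _ "- C"]) auto
    qed
  qed
  moreover have one: "\<rho> y = 1" if "y \<in> N" for y
    using that \<psi>(3) by (auto simp: N_def \<rho>_def)
  moreover have "N \<subseteq> W"
    using one zero CW by (metis IntD1 subset_iff zero_neq_one)
  moreover have "x \<in> N" using U(2) \<psi>(2) by (simp add: N_def)
  ultimately show ?thesis
    using that[of \<rho> N C] \<open>open N\<close> \<open>closed C\<close> CW zero by blast
qed

lemma Cinf_bump_mult: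
  assumes "\<rho> \<in> Cinf M" "closed C" "C \<subseteq> W" "\<And>y. y \<notin> C \<Longrightarrow> \<rho> y = 0" "open W" "smooth_fun_on M W f"
  shows "(\<lambda>x. \<rho> x * f x) \<in> Cinf M"
  unfolding Cinf_iff
proof (rule smooth_fun_on_local)
  fix x
  have "smooth_fun_on M W (\<lambda>x. \<rho> x * f x)"
    by (rule smooth_fun_on_mult[OF assms(5) Cinf_smooth_fun_on[OF assms(1)] assms(6)])
  moreover have "smooth_fun_on M (- C) (\<lambda>x. \<rho> x * f x)"
    by (rule smooth_fun_on_cong[OF _ _ smooth_fun_on_const[of _ 0]]) (use assms in auto)
  ultimately show "\<exists>N. open N \<and> x \<in> N \<and> smooth_fun_on M N (\<lambda>x. \<rho> x * f x)"
    using assms(2,3,5) by (metis ComplI open_Compl subsetD)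
qed

text \<open>A derivation at x is a tangent vector. Hadamard's lemma writes f near x as f(x) plus a
  sum of coordinates times smooth cofactors. The coordinates vanish at x, so only their derivatives
  survive the Leibniz rule, multiplied by the cofactors at x, which are the partial derivatives of
  f.\<close>

lemma point_derivation:
  assumes lin: "\<And>f g a. f \<in> Cinf M \<Longrightarrow> g \<in> Cinf M \<Longrightarrow> \<delta> (\<lambda>y. a * f y + g y) = a * \<delta> f + \<delta> g"
    and leib: "\<And>f g. f \<in> Cinf M \<Longrightarrow> g \<in> Cinf M \<Longrightarrow> \<delta> (\<lambda>y. f y * g y) = \<delta> f * g x + f x * \<delta> g"
    and U: "(U, \<phi>) \<in> M" "x \<in> U"
  shows "\<exists>w. \<forall>f\<in>Cinf M. \<delta> f = frechet_derivative (\<lambda>y. f (inv_into U \<phi> y)) (at (\<phi> x)) w"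
proof -
  obtain Bs :: "'e set" where "fin_dim Bs" by (rule model_basis)
  then interpret fin_dim Bs .
  note inv = inv_chart[OF U(1)] and hom = chart_homeomorphism[OF U(1)]
  obtain r where r: "r > 0" "ball (\<phi> x) r \<subseteq> \<phi> ` U"
    using openE[OF chart_open(2)[OF U(1)]] U(2) by blast
  define W where "W = \<phi> -` ball (\<phi> x) r \<inter> U"
  have W: "open W" "W \<subseteq> U" "x \<in> W"
    unfolding W_def using hom chart_open(1)[OF U(1)] continuous_on_open_vimage[of U \<phi>] U(2) r(1)
    by (auto simp: homeomorphism_def)
  have \<phi>W: "\<phi> ` W = ball (\<phi> x) r"
    using r(2) by (auto simp: W_def)
  have smW: "smooth_fun_on M W (\<lambda>y. F (\<phi> y))" if "\<And>n. Ck_on n (ball (\<phi> x) r) F" for F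
  proof (rule chart_smooth_imp_smooth_fun_on[OF U(1) W(1,2)])
    have "F (\<phi> (inv_into U \<phi> y)) = F y" if "y \<in> \<phi> ` W" for y
      using that inv W(2) by auto
    then show "smooth_on (\<phi> ` W) (\<lambda>y. F (\<phi> (inv_into U \<phi> y)))"
      using smooth_on_cong[of "\<phi> ` W" "\<lambda>y. F (\<phi> (inv_into U \<phi> y))" F] that
      by (simp add: \<phi>W smooth_on_def)
  qed
  obtain \<rho> N C where \<rho>: "\<rho> \<in> Cinf M" "open N" "x \<in> N" "\<And>y. y \<in> N \<Longrightarrow> \<rho> y = 1"
    "closed C" "C \<subseteq> W" "\<And>y. y \<notin> C \<Longrightarrow> \<rho> y = 0"
    using bump_function[OF W(1,3)] by metis
  have bumpI: "(\<lambda>y. \<rho> y * F (\<phi> y)) \<in> Cinf M" if "\<And>n. Ck_on n (ball (\<phi> x) r) F" for F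
    by (rule Cinf_bump_mult[OF \<rho>(1,5,6,7) W(1) smW[OF that]])
  define h where "h b y = \<rho> y * coord b (\<phi> y - \<phi> x)" for b y
  have h: "h b \<in> Cinf M" for b
  proof -
    have "Ck_on n (ball (\<phi> x) r) (\<lambda>y. coord b y + (- coord b (\<phi> x)))" for n
      by (intro Ck_on_add Ck_on_const Ck_on_linear bounded_linear.linear[OF bounded_linear_coord]) auto
    from bumpI[OF this] show ?thesis
      unfolding h_def[abs_def]
      using bounded_linear.linear[OF bounded_linear_coord, THEN linear_diff] by simp
  qed
  have \<rho>\<rho>: "(\<lambda>y. \<rho> y * \<rho> y) \<in> Cinf M"
    using smooth_fun_on_mult[OF open_UNIV] \<rho>(1) by (simp add: Cinf_iff)
  have zero: "(\<lambda>y. 0) \<in> Cinf M" by (simp add: Cinf_iff smooth_fun_on_const)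
  have d0: "\<delta> (\<lambda>y. 0) = 0" using lin[OF zero zero, of "-1"] by simp
  have dsum: "(\<lambda>y. \<Sum>i\<in>I. f i y) \<in> Cinf M \<and> \<delta> (\<lambda>y. \<Sum>i\<in>I. f i y) = (\<Sum>i\<in>I. \<delta> (f i))"
    if "finite I" "\<And>i. i \<in> I \<Longrightarrow> f i \<in> Cinf M" for I :: "'e set" and f
    using that
  proof (induction I rule: finite_induct)
    case empty
    then show ?case using d0 zero by simp
  next
    case (insert i I)
    then show ?case
      using lin[of "f i" "\<lambda>y. \<Sum>i\<in>I. f i y" 1] smooth_fun_on_add[OF open_UNIV, of "f i"]
      by (simp add: Cinf_iff)
  qed
  \<comment> \<open>The components of the tangent vector are the values of the derivation on the
    cut-off coordinate functions.\<close>
  define w where "w = (\<Sum>b\<in>Bs. \<delta> (h b) *\<^sub>R b)"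
  have "\<delta> f = frechet_derivative (\<lambda>y. f (inv_into U \<phi> y)) (at (\<phi> x)) w" if f: "f \<in> Cinf M" for f
  proof -
    let ?F = "\<lambda>y. f (inv_into U \<phi> y)"
    have F: "Ck_on n (ball (\<phi> x) r) ?F" for n
      using smooth_fun_onD[OF U(1) Cinf_smooth_fun_on[OF f, of UNIV]] r(2)
      by (intro Ck_on_subset[OF smooth_onD]) auto
    define G where "G b = ray_integral (\<phi> x) 0 (\<lambda>z. frechet_derivative ?F (at z) b)" for b
    have G: "Ck_on n (ball (\<phi> x) r) (G b)" for n b
      unfolding G_def using Ck_on_ray_integral F[of "Suc n"] by auto
    define g where "g b y = \<rho> y * G b (\<phi> y)" for b y
    have g: "g b \<in> Cinf M" for b
      unfolding g_def[abs_def] by (rule bumpI[OF G])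
    have \<rho>x: "\<rho> x = 1" using \<rho>(3,4) by blast
    \<comment> \<open>Two copies of \<rho> are needed because each factor of the products in
      Hadamard's lemma has to be made global by its own cut-off.\<close>
    have eq: "(\<lambda>y. \<rho> y * \<rho> y * f y) = (\<lambda>y. f x * (\<rho> y * \<rho> y) + (\<Sum>b\<in>Bs. h b y * g b y))"
    proof
      fix y
      show "\<rho> y * \<rho> y * f y = f x * (\<rho> y * \<rho> y) + (\<Sum>b\<in>Bs. h b y * g b y)"
      proof (cases "y \<in> W")
        case True
        then have y: "\<phi> y \<in> ball (\<phi> x) r" and yU: "y \<in> U" by (auto simp: W_def)
        have "f y = f x + (\<Sum>b\<in>Bs. coord b (\<phi> y - \<phi> x) * G b (\<phi> y))"
          using Hadamard[OF F y] inv[OF yU] inv[OF U(2)] unfolding G_def by simp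
        then show ?thesis
          by (simp add: h_def g_def algebra_simps sum_distrib_left)
      next
        case False
        then have "\<rho> y = 0" using \<rho>(6,7) by blast
        then show ?thesis by (simp add: h_def g_def)
      qed
    qed
    have hg: "(\<lambda>y. h b y * g b y) \<in> Cinf M" for b
      using smooth_fun_on_mult[OF open_UNIV] h[of b] g[of b] by (simp add: Cinf_iff)
    \<comment> \<open>The unknown value of \<delta> on the squared cut-off occurs with factor f x in
      both computations of the same quantity and cancels.\<close>
    have "\<delta> (\<lambda>y. \<rho> y * \<rho> y * f y) = \<delta> (\<lambda>y. \<rho> y * \<rho> y) * f x + \<delta> f"
      using leib[OF \<rho>\<rho> f] \<rho>x by simp
    moreover have "\<delta> (\<lambda>y. \<rho> y * \<rho> y * f y) = f x * \<delta> (\<lambda>y. \<rho> y * \<rho> y) + (\<Sum>b\<in>Bs. \<delta> (\<lambda>y. h b y * g b y))"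
      unfolding eq using lin[OF \<rho>\<rho>, of "\<lambda>y. \<Sum>b\<in>Bs. h b y * g b y" "f x"]
        dsum[OF finite_basis, of "\<lambda>b y. h b y * g b y"] hg by simp
    moreover have "\<delta> (\<lambda>y. h b y * g b y) = \<delta> (h b) * frechet_derivative ?F (at (\<phi> x)) b" for b
      using leib[OF h g, of b b] \<rho>x
      by (simp add: h_def representation_zero g_def G_def ray_integral_center)
    moreover have "frechet_derivative ?F (at (\<phi> x)) w = (\<Sum>b\<in>Bs. \<delta> (h b) * frechet_derivative ?F (at (\<phi> x)) b)"
    proof -
      have "linear (frechet_derivative ?F (at (\<phi> x)))"
        using Ck_on_SucE[OF F, of "\<phi> x"] r(1) has_derivative_linear by auto
      then show ?thesis by (simp add: w_def linear_sum linear_scale)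
    qed
    ultimately show ?thesis by simp
  qed
  then show ?thesis by blast
qed

end

section \<open>Sections of vector bundles\<close>

text \<open>Coordinates are indexed by position: a frame is a list of sections whose values vary
  with the point, so basis vectors cannot serve as indices.\<close>

definition list_coeff :: "'v::real_vector list \<Rightarrow> 'v \<Rightarrow> nat \<Rightarrow> real" where
  "list_coeff bs v = (SOME c. v = (\<Sum>i<length bs. c i *\<^sub>R bs ! i))"

lemma sum_list_index:
  assumes "distinct bs"
  shows "(\<Sum>i<length bs. f (bs ! i)) = (\<Sum>b\<in>set bs. f b)"
  using bij_betw_nth[OF assms refl refl] by (intro sum.reindex_bij_betw) auto

context
  fixes S :: "'v::real_vector set" and bs :: "'v list"
  assumes basis: "basis_list S bs"
begin

lemma list_coeff_sum: "v \<in> S \<Longrightarrow> (\<Sum>i<length bs. list_coeff bs v i *\<^sub>R bs ! i) = v"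
proof -
  assume "v \<in> S"
  then have "v \<in> span (set bs)" using basis by (simp add: basis_list_def)
  then obtain u where "v = (\<Sum>b\<in>set bs. u b *\<^sub>R b)"
    unfolding span_finite[OF finite_set] by blast
  then have "v = (\<Sum>i<length bs. u (bs ! i) *\<^sub>R bs ! i)"
    using sum_list_index[of bs "\<lambda>b. u b *\<^sub>R b"] basis by (simp add: basis_list_def)
  then show ?thesis
    unfolding list_coeff_def by (rule someI[where P = "\<lambda>c. v = (\<Sum>i<length bs. c i *\<^sub>R bs ! i)", symmetric])
qed

lemma basis_list_sum_in: "(\<Sum>i<length bs. c i *\<^sub>R bs ! i) \<in> S"
proof -
  have "S = span (set bs)" using basis by (simp add: basis_list_def)
  then show ?thesis by (auto intro: span_sum span_scale span_base nth_mem)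
qed

lemma basis_list_independent:
  assumes "(\<Sum>i<length bs. c i *\<^sub>R bs ! i) = 0" "i < length bs"
  shows "c i = 0"
proof -
  have d: "distinct bs" "independent (set bs)" using basis by (auto simp: basis_list_def)
  define u where "u b = c (THE i. i < length bs \<and> bs ! i = b)" for b
  have u: "u (bs ! i) = c i" if "i < length bs" for i
  proof -
    have "(THE j. j < length bs \<and> bs ! j = bs ! i) = i"
      using that d(1) by (intro the_equality) (auto simp: nth_eq_iff_index_eq)
    then show ?thesis by (simp add: u_def)
  qed
  have "(\<Sum>b\<in>set bs. u b *\<^sub>R b) = (\<Sum>i<length bs. u (bs ! i) *\<^sub>R bs ! i)"
    using sum_list_index[OF d(1), of "\<lambda>b. u b *\<^sub>R b"] by simp
  also have "\<dots> = 0" using u assms(1) by simp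
  finally have "u (bs ! i) = 0"
    using independentD[OF d(2) finite_set order_refl] assms(2) by auto
  with u assms(2) show ?thesis by simp
qed

lemma list_coeff_unique:
  assumes "v = (\<Sum>i<length bs. c i *\<^sub>R bs ! i)" "i < length bs"
  shows "list_coeff bs v i = c i"
proof -
  have "v \<in> S" using assms(1) basis_list_sum_in by simp
  then have "(\<Sum>i<length bs. (list_coeff bs v i - c i) *\<^sub>R bs ! i) = 0"
    using list_coeff_sum assms(1) by (simp add: scaleR_diff_left sum_subtractf)
  from basis_list_independent[OF this assms(2)] show ?thesis by simp
qed

lemma list_coeff_linear:
  assumes "u \<in> S" "v \<in> S" "i < length bs"
  shows "list_coeff bs (a *\<^sub>R u + v) i = a * list_coeff bs u i + list_coeff bs v i"
proof (rule list_coeff_unique[OF _ assms(3)])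
  show "a *\<^sub>R u + v = (\<Sum>i<length bs. (a * list_coeff bs u i + list_coeff bs v i) *\<^sub>R bs ! i)"
    by (simp add: scaleR_add_left sum.distrib list_coeff_sum[OF assms(2)]
        flip: scaleR_scaleR scaleR_sum_right)
      (simp add: list_coeff_sum[OF assms(1)])
qed

lemma basis_list_subspace: "subspace S"
  using basis subspace_span[of "set bs"] by (simp add: basis_list_def)

end

section \<open>Local frames and global sections of a vector bundle\<close>

locale smooth_bundle = smooth_manifold M
  for M :: "('m::{t2_space, second_countable_topology}, 'e::real_normed_vector) atlas" +
  fixes E :: "('m, 'v::real_vector) vbundle"
  assumes vb: "vector_bundle M E"
begin

abbreviation at_pt :: "('m \<Rightarrow> 'v) list \<Rightarrow> 'm \<Rightarrow> 'v list" where
  "at_pt ss x \<equiv> map (\<lambda>s. s x) ss"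

lemma fib_subspace: "subspace (fib E x)"
  using vb by (simp add: vector_bundle_def)

lemma frame_open: "(V, ss) \<in> frames E \<Longrightarrow> open V"
  and frame_basis: "(V, ss) \<in> frames E \<Longrightarrow> x \<in> V \<Longrightarrow> basis_list (fib E x) (at_pt ss x)"
  and frame_smooth: "(V, ss) \<in> frames E \<Longrightarrow> s \<in> set ss \<Longrightarrow> smooth_section_on M E V s"
proof -
  have "\<forall>(U, ss)\<in>frames E. open U \<and> (\<forall>x\<in>U. basis_list (fib E x) (at_pt ss x)) \<and>
      (\<forall>s\<in>set ss. smooth_section_on M E U s)"
    using conjunct2[OF conjunct2[OF vb[unfolded vector_bundle_def]]] .
  then show "(V, ss) \<in> frames E \<Longrightarrow> open V"
    "(V, ss) \<in> frames E \<Longrightarrow> x \<in> V \<Longrightarrow> basis_list (fib E x) (at_pt ss x)"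
    "(V, ss) \<in> frames E \<Longrightarrow> s \<in> set ss \<Longrightarrow> smooth_section_on M E V s"
    by auto
qed

lemma frame_exists: obtains V ss where "(V, ss) \<in> frames E" "x \<in> V"
proof -
  have cover: "(\<Union>(U, ss)\<in>frames E. U) = UNIV"
    using conjunct1[OF conjunct2[OF vb[unfolded vector_bundle_def]]] .
  have "x \<in> (\<Union>(U, ss)\<in>frames E. U)"
    unfolding cover by (rule UNIV_I)
  then obtain p where "p \<in> frames E" "x \<in> (case p of (U, ss) \<Rightarrow> U)"
    unfolding UN_iff by (rule bexE)
  then have "(fst p, snd p) \<in> frames E" "x \<in> fst p"
    by (simp_all add: case_prod_beta)
  then show ?thesis by (rule that)
qed

lemma smooth_section_on_fib: "smooth_section_on M E W s \<Longrightarrow> x \<in> W \<Longrightarrow> s x \<in> fib E x"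
  by (simp add: smooth_section_on_def)

lemma frame_expand:
  assumes "(V, ss) \<in> frames E" "x \<in> V" "v \<in> fib E x"
  shows "v = (\<Sum>i<length ss. list_coeff (at_pt ss x) v i *\<^sub>R (ss ! i) x)"
  using list_coeff_sum[OF frame_basis[OF assms(1,2)] assms(3)] by simp

text \<open>The definition of a smooth section only provides some smooth coefficients; uniqueness in
  a basis identifies them with the canonical ones.\<close>

lemma smooth_section_on_coeff:
  assumes "open W" "smooth_section_on M E W s" "(V, ss) \<in> frames E" "i < length ss"
  shows "smooth_fun_on M (W \<inter> V) (\<lambda>x. list_coeff (at_pt ss x) (s x) i)"
proof -
  obtain c where c: "\<And>i. i < length ss \<Longrightarrow> smooth_fun_on M (W \<inter> V) (c i)"
    "\<And>x. x \<in> W \<inter> V \<Longrightarrow> s x = (\<Sum>i<length ss. c i x *\<^sub>R (ss ! i) x)"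
    using assms(2,3) unfolding smooth_section_on_def by fast
  have "list_coeff (at_pt ss x) (s x) i = c i x" if "x \<in> W \<inter> V" for x
    using list_coeff_unique[OF frame_basis[OF assms(3)], of x "s x" "\<lambda>i. c i x" i] c(2)[OF that] that assms(4)
    by simp
  then show ?thesis
    using smooth_fun_on_cong[OF _ _ c(1)[OF assms(4)]] assms(1) frame_open[OF assms(3)] by (simp add: open_Int)
qed

lemma smooth_section_onI:
  assumes "\<And>x. x \<in> W \<Longrightarrow> s x \<in> fib E x"
    and "\<And>V ss i. (V, ss) \<in> frames E \<Longrightarrow> i < length ss \<Longrightarrow>
      smooth_fun_on M (W \<inter> V) (\<lambda>x. list_coeff (at_pt ss x) (s x) i)"
  shows "smooth_section_on M E W s"
  unfolding smooth_section_on_def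
proof (intro conjI ballI)
  show "x \<in> W \<Longrightarrow> s x \<in> fib E x" for x by (rule assms(1))
  fix p assume p: "p \<in> frames E"
  obtain V ss where Vss: "p = (V, ss)" by force
  show "case p of (V, ss) \<Rightarrow> \<exists>c. (\<forall>i<length ss. smooth_fun_on M (W \<inter> V) (c i)) \<and>
      (\<forall>x\<in>W \<inter> V. s x = (\<Sum>i<length ss. c i x *\<^sub>R (ss ! i) x))"
    unfolding Vss prod.case
    by (rule exI[of _ "\<lambda>i x. list_coeff (at_pt ss x) (s x) i"])
      (use assms frame_expand p Vss in auto)
qed

lemma smooth_section_on_subset:
  assumes "smooth_section_on M E W s" "W' \<subseteq> W"
  shows "smooth_section_on M E W' s"
proof -
  have "\<exists>c. (\<forall>i<length ss. smooth_fun_on M (W' \<inter> V) (c i)) \<and>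
      (\<forall>x\<in>W' \<inter> V. s x = (\<Sum>i<length ss. c i x *\<^sub>R (ss ! i) x))" if "(V, ss) \<in> frames E" for V ss
  proof -
    obtain c where "\<forall>i<length ss. smooth_fun_on M (W \<inter> V) (c i)"
      "\<forall>x\<in>W \<inter> V. s x = (\<Sum>i<length ss. c i x *\<^sub>R (ss ! i) x)"
      using assms(1) \<open>(V, ss) \<in> frames E\<close> unfolding smooth_section_on_def by fast
    then show ?thesis
      using assms(2) by (intro exI[of _ c]) (auto intro: smooth_fun_on_subset)
  qed
  moreover have "\<forall>x\<in>W'. s x \<in> fib E x"
    using smooth_section_on_fib[OF assms(1)] assms(2) by auto
  ultimately show ?thesis
    unfolding smooth_section_on_def by fast
qed

lemma smooth_section_on_local:
  assumes "\<And>x. x \<in> W \<Longrightarrow> \<exists>N. open N \<and> x \<in> N \<and> smooth_section_on M E N s"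
  shows "smooth_section_on M E W s"
proof (rule smooth_section_onI)
  show "s x \<in> fib E x" if "x \<in> W" for x
    using assms[OF that] smooth_section_on_fib by blast
  fix V ss i assume V: "(V, ss) \<in> frames E" "i < length ss"
  show "smooth_fun_on M (W \<inter> V) (\<lambda>x. list_coeff (at_pt ss x) (s x) i)"
  proof (rule smooth_fun_on_local)
    fix x assume x: "x \<in> W \<inter> V"
    obtain N where N: "open N" "x \<in> N" "smooth_section_on M E N s"
      using assms[of x] x by auto
    show "\<exists>N. open N \<and> x \<in> N \<and> smooth_fun_on M N (\<lambda>x. list_coeff (at_pt ss x) (s x) i)"
      by (rule exI[of _ "N \<inter> V"])
        (use smooth_section_on_coeff[OF N(1,3) V] N x frame_open[OF V(1)] in auto)
  qed
qed

lemma smooth_section_on_cong: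
  assumes "open W" "\<And>x. x \<in> W \<Longrightarrow> s x = r x" "smooth_section_on M E W s"
  shows "smooth_section_on M E W r"
proof (rule smooth_section_onI)
  show "r x \<in> fib E x" if "x \<in> W" for x
    using smooth_section_on_fib[OF assms(3) that] assms(2)[OF that] by simp
  fix V ss i assume V: "(V, ss) \<in> frames E" "i < length ss"
  show "smooth_fun_on M (W \<inter> V) (\<lambda>x. list_coeff (at_pt ss x) (r x) i)"
    by (rule smooth_fun_on_cong[OF _ _ smooth_section_on_coeff[OF assms(1,3) V]])
      (use assms(1,2) frame_open[OF V(1)] in auto)
qed

lemma smooth_section_on_zero: "smooth_section_on M E W (\<lambda>x. 0)"
  unfolding smooth_section_on_def
  using fib_subspace subspace_0 by (auto intro!: exI[of _ "\<lambda>i x. 0"] smooth_fun_on_const)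

lemma smooth_section_on_lincomb:
  assumes W: "open W" and f: "smooth_fun_on M W f" and s: "smooth_section_on M E W s" and r: "smooth_section_on M E W r"
  shows "smooth_section_on M E W (\<lambda>x. f x *\<^sub>R s x + r x)"
proof (rule smooth_section_onI)
  note sf = smooth_section_on_fib[OF s] and rf = smooth_section_on_fib[OF r]
  show "f x *\<^sub>R s x + r x \<in> fib E x" if "x \<in> W" for x
    using sf[OF that] rf[OF that] fib_subspace by (intro subspace_add subspace_scale)
  fix V ss i assume V: "(V, ss) \<in> frames E" "i < length ss"
  have WV: "open (W \<inter> V)" using W frame_open[OF V(1)] by (rule open_Int)
  have "smooth_fun_on M (W \<inter> V) (\<lambda>x. f x * list_coeff (at_pt ss x) (s x) i + list_coeff (at_pt ss x) (r x) i)"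
    by (intro smooth_fun_on_add smooth_fun_on_mult WV smooth_section_on_coeff[OF W s V]
        smooth_section_on_coeff[OF W r V] smooth_fun_on_subset[OF f]) auto
  then show "smooth_fun_on M (W \<inter> V) (\<lambda>x. list_coeff (at_pt ss x) (f x *\<^sub>R s x + r x) i)"
    by (rule smooth_fun_on_cong[OF WV, rotated])
      (use list_coeff_linear[OF frame_basis[OF V(1)] sf rf] V(2) in auto)
qed

lemma smooth_section_on_scale:
  "open W \<Longrightarrow> smooth_fun_on M W f \<Longrightarrow> smooth_section_on M E W s \<Longrightarrow> smooth_section_on M E W (\<lambda>x. f x *\<^sub>R s x)"
  using smooth_section_on_lincomb[OF _ _ _ smooth_section_on_zero] by simp

lemma smooth_section_on_add:
  "open W \<Longrightarrow> smooth_section_on M E W s \<Longrightarrow> smooth_section_on M E W r \<Longrightarrow> smooth_section_on M E W (\<lambda>x. s x + r x)"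
  using smooth_section_on_lincomb[OF _ smooth_fun_on_const[of _ 1]] by simp

lemma smooth_section_on_sum:
  "open W \<Longrightarrow> (\<And>i. i \<in> I \<Longrightarrow> smooth_section_on M E W (s i)) \<Longrightarrow> smooth_section_on M E W (\<lambda>x. \<Sum>i\<in>I. s i x)"
  by (induction I rule: infinite_finite_induct) (auto intro: smooth_section_on_zero smooth_section_on_add)

lemma Gam_iff: "s \<in> Gam M E \<longleftrightarrow> smooth_section_on M E UNIV s"
  by (simp add: Gam_def)

lemma Gam_fib: "s \<in> Gam M E \<Longrightarrow> s x \<in> fib E x"
  by (simp add: Gam_iff smooth_section_on_fib)

lemma Gam_smooth_section_on: "s \<in> Gam M E \<Longrightarrow> smooth_section_on M E W s"
  unfolding Gam_iff by (rule smooth_section_on_subset) auto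

lemma Gam_zero: "(\<lambda>x. 0) \<in> Gam M E"
  by (simp add: Gam_iff smooth_section_on_zero)

lemma Gam_add: "s \<in> Gam M E \<Longrightarrow> r \<in> Gam M E \<Longrightarrow> (\<lambda>x. s x + r x) \<in> Gam M E"
  unfolding Gam_iff by (rule smooth_section_on_add) auto

lemma Gam_scale: "f \<in> Cinf M \<Longrightarrow> s \<in> Gam M E \<Longrightarrow> (\<lambda>x. f x *\<^sub>R s x) \<in> Gam M E"
  unfolding Gam_iff Cinf_iff by (rule smooth_section_on_scale) auto

lemma Gam_scale_const: "s \<in> Gam M E \<Longrightarrow> (\<lambda>x. a *\<^sub>R s x) \<in> Gam M E"
  by (rule Gam_scale) (simp add: Cinf_iff smooth_fun_on_const)

lemma Gam_diff:
  assumes "s \<in> Gam M E" "r \<in> Gam M E" shows "(\<lambda>x. s x - r x) \<in> Gam M E"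
  using Gam_add[OF assms(1) Gam_scale_const[OF assms(2), of "-1"]] by simp

lemma Gam_sum: "(\<And>i. i \<in> I \<Longrightarrow> s i \<in> Gam M E) \<Longrightarrow> (\<lambda>x. \<Sum>i\<in>I. s i x) \<in> Gam M E"
  unfolding Gam_iff by (rule smooth_section_on_sum) auto

lemma Gam_bump_scale:
  assumes "\<rho> \<in> Cinf M" "closed C" "C \<subseteq> W" "\<And>y. y \<notin> C \<Longrightarrow> \<rho> y = 0" "open W" "smooth_section_on M E W s"
  shows "(\<lambda>x. \<rho> x *\<^sub>R s x) \<in> Gam M E"
  unfolding Gam_iff
proof (rule smooth_section_on_local)
  fix x
  have 1: "smooth_section_on M E W (\<lambda>x. \<rho> x *\<^sub>R s x)"
    by (rule smooth_section_on_scale[OF assms(5) Cinf_smooth_fun_on[OF assms(1)] assms(6)])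
  have 2: "smooth_section_on M E (- C) (\<lambda>x. \<rho> x *\<^sub>R s x)"
    by (rule smooth_section_on_cong[OF _ _ smooth_section_on_zero]) (use assms in auto)
  show "\<exists>N. open N \<and> x \<in> N \<and> smooth_section_on M E N (\<lambda>x. \<rho> x *\<^sub>R s x)"
  proof (cases "x \<in> W")
    case True
    then show ?thesis using 1 assms(5) by blast
  next
    case False
    then show ?thesis using 2 assms(2,3) by (intro exI[of _ "- C"]) auto
  qed
qed

text \<open>The frame spans the subspaces A y, whose rank may be smaller than that of E. In a local
  frame of E its members become linearly independent smooth columns, and
  \<open>smooth_coefficients\<close> solves for the coefficients.\<close>

lemma section_coeff_smooth:
  assumes U: "open U" and as: "\<And>a. a \<in> set as \<Longrightarrow> smooth_section_on M E U a"
    and basis: "\<And>y. y \<in> U \<Longrightarrow> basis_list (A y) (at_pt as y)"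
    and s: "smooth_section_on M E U s" "\<And>y. y \<in> U \<Longrightarrow> s y \<in> A y" and i: "i < length as"
  shows "smooth_fun_on M U (\<lambda>y. list_coeff (at_pt as y) (s y) i)"
proof (rule smooth_fun_on_local)
  fix x assume x: "x \<in> U"
  obtain V es where V: "(V, es) \<in> frames E" "x \<in> V" by (rule frame_exists)
  let ?W = "U \<inter> V"
  have W: "open ?W" using U frame_open[OF V(1)] by (rule open_Int)
  let ?v = "\<lambda>i k y. list_coeff (at_pt es y) ((as ! i) y) k"
  let ?s = "\<lambda>k y. list_coeff (at_pt es y) (s y) k"
  let ?c = "\<lambda>i y. list_coeff (at_pt as y) (s y) i"
  have comb: "list_coeff (at_pt es y) (\<Sum>i<length as. d i *\<^sub>R (as ! i) y) k = (\<Sum>i<length as. d i * ?v i k y)"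
    if y: "y \<in> ?W" and k: "k < length es" for y d k
  proof -
    note be = frame_basis[OF V(1), of y]
    have fib: "(as ! i) y \<in> fib E y" if "i < length as" for i
      using smooth_section_on_fib[OF as, of "as ! i" y] that y by simp
    have "(\<Sum>i\<in>I. d i *\<^sub>R (as ! i) y) \<in> fib E y \<and>
        list_coeff (at_pt es y) (\<Sum>i\<in>I. d i *\<^sub>R (as ! i) y) k = (\<Sum>i\<in>I. d i * ?v i k y)"
      if "finite I" "I \<subseteq> {..<length as}" for I
      using that
    proof (induction I rule: finite_induct)
      case empty
      have "list_coeff (at_pt es y) 0 k = 0"
        using list_coeff_unique[OF be, of 0 "\<lambda>_. 0" k] y k by simp
      then show ?case using fib_subspace subspace_0 by auto
    next
      case (insert i I)
      then have "(as ! i) y \<in> fib E y" using fib by simp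
      then show ?case
        using insert list_coeff_linear[OF be _ _ _, of "(as ! i) y" "\<Sum>i\<in>I. d i *\<^sub>R (as ! i) y" k "d i"] y k
          subspace_add[OF fib_subspace] subspace_scale[OF fib_subspace] by simp
    qed
    from this[of "{..<length as}"] show ?thesis by simp
  qed
  have "smooth_fun_on M ?W (?c i)"
  proof (rule smooth_coefficients[OF W, where v = ?v and s = ?s and n = "length as" and m = "length es" and c = ?c])
    show "smooth_fun_on M ?W (?v i k)" if "i < length as" "k < length es" for i k
      using smooth_section_on_coeff[OF U as V(1) that(2), of "as ! i"] that(1) by simp
    show "smooth_fun_on M ?W (?s k)" if "k < length es" for k
      by (rule smooth_section_on_coeff[OF U s(1) V(1) that])
    show "d i = 0" if y: "y \<in> ?W" and z: "\<And>k. k < length es \<Longrightarrow> (\<Sum>i<length as. d i * ?v i k y) = 0"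
      and i: "i < length as" for y d i
    proof -
      let ?z = "\<Sum>i<length as. d i *\<^sub>R (as ! i) y"
      have "?z \<in> fib E y"
        using y by (intro subspace_sum[OF fib_subspace] subspace_scale[OF fib_subspace])
          (auto intro!: smooth_section_on_fib[OF as])
      then have "?z = (\<Sum>k<length es. list_coeff (at_pt es y) ?z k *\<^sub>R (es ! k) y)"
        using frame_expand[OF V(1)] y by blast
      also have "\<dots> = 0" using comb[OF y] z by simp
      finally show ?thesis
        using basis_list_independent[OF basis, of y d i] y i by simp
    qed
    show "?s k y = (\<Sum>i<length as. ?c i y * ?v i k y)" if "y \<in> ?W" "k < length es" for y k
      using comb[OF that, of "\<lambda>i. ?c i y"] list_coeff_sum[OF basis s(2), of y] that by simp
  qed (use i in auto)
  then show "\<exists>N. open N \<and> x \<in> N \<and> smooth_fun_on M N (?c i)"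
    using W x V(2) by blast
qed

text \<open>Multiplying a local frame by a bump function gives global sections of A that are still a
  frame where the bump function equals 1. Brackets and forms can only be evaluated on such
  sections.\<close>

lemma global_frame_near:
  assumes "open U" "x \<in> U" "\<And>s. s \<in> set ss \<Longrightarrow> smooth_section_on M E U s"
    and "\<And>y. y \<in> U \<Longrightarrow> basis_list (A y) (at_pt ss y)" "\<And>y. subspace (A y)"
  obtains as N where "open N" "x \<in> N" "N \<subseteq> U" "set as \<subseteq> Gam M E" "\<And>a y. a \<in> set as \<Longrightarrow> a y \<in> A y"
    "\<And>y. y \<in> N \<Longrightarrow> basis_list (A y) (at_pt as y)"
proof -
  obtain \<rho> N C where \<rho>: "\<rho> \<in> Cinf M" "open N" "x \<in> N" "\<And>y. y \<in> N \<Longrightarrow> \<rho> y = 1"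
    "closed C" "C \<subseteq> U" "\<And>y. y \<notin> C \<Longrightarrow> \<rho> y = 0" "N \<subseteq> U"
    by (rule bump_function[OF assms(1,2)]) (rule that; assumption)
  define as where "as = map (\<lambda>s y. \<rho> y *\<^sub>R s y) ss"
  have "set as \<subseteq> Gam M E"
    unfolding as_def using Gam_bump_scale[OF \<rho>(1,5,6,7) assms(1,3)] by auto
  moreover have "a y \<in> A y" if a: "a \<in> set as" for a y
  proof -
    obtain s where s: "s \<in> set ss" "a = (\<lambda>y. \<rho> y *\<^sub>R s y)" using a unfolding as_def by auto
    show ?thesis
    proof (cases "y \<in> U")
      case True
      have "s y \<in> A y"
        using assms(4)[OF True] s(1) unfolding basis_list_def by (metis image_eqI list.set_map span_base)
      then show ?thesis using s(2) subspace_scale[OF assms(5)] by simp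
    next
      case False
      then have "\<rho> y = 0" using \<rho>(6,7) by blast
      then show ?thesis using s(2) subspace_0[OF assms(5)] by simp
    qed
  qed
  moreover have "at_pt as y = at_pt ss y" if "y \<in> N" for y
    using \<rho>(4)[OF that] by (simp add: as_def)
  ultimately show ?thesis
    using that[of N as] \<rho>(2,3,8) assms(4) by (metis subsetD)
qed

lemma subbundle_subspace:
  assumes "subbundle M E A" shows "subspace (A x)"
  using assms basis_list_subspace unfolding subbundle_def by metis

lemma subbundle_global_frame:
  assumes "subbundle M E A"
  obtains as N where "open N" "x \<in> N" "set as \<subseteq> Gam M E" "\<And>a y. a \<in> set as \<Longrightarrow> a y \<in> A y"
    "\<And>y. y \<in> N \<Longrightarrow> basis_list (A y) (at_pt as y)"
proof -
  obtain U ss where U: "open U" "x \<in> U" "\<And>s. s \<in> set ss \<Longrightarrow> smooth_section_on M E U s"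
    "\<And>y. y \<in> U \<Longrightarrow> basis_list (A y) (at_pt ss y)"
    using assms unfolding subbundle_def by metis
  show ?thesis
    by (rule global_frame_near[of U x ss A, OF U subbundle_subspace[OF assms]])
      (assumption | (rule that; assumption))+
qed

lemma fib_global_frame:
  obtains as N where "open N" "x \<in> N" "set as \<subseteq> Gam M E"
    "\<And>y. y \<in> N \<Longrightarrow> basis_list (fib E y) (at_pt as y)"
proof -
  obtain V ss where V: "(V, ss) \<in> frames E" "x \<in> V" by (rule frame_exists)
  show ?thesis
    by (rule global_frame_near[OF frame_open[OF V(1)] V(2) frame_smooth[OF V(1)] frame_basis[OF V(1)] fib_subspace])
      (assumption | (rule that; assumption))+
qed

lemma global_frame_extend:
  assumes "set as \<subseteq> Gam M E" "basis_list S (at_pt as x)" "v \<in> S"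
  shows "(\<lambda>y. \<Sum>i<length as. list_coeff (at_pt as x) v i *\<^sub>R (as ! i) y) \<in> Gam M E"
    "(\<Sum>i<length as. list_coeff (at_pt as x) v i *\<^sub>R (as ! i) x) = v"
  using list_coeff_sum[OF assms(2,3)] assms(1) by (auto intro!: Gam_sum Gam_scale_const)

lemma Gam_extend: "v \<in> fib E x \<Longrightarrow> \<exists>s\<in>Gam M E. s x = v"
proof -
  assume v: "v \<in> fib E x"
  obtain as where "set as \<subseteq> Gam M E" "basis_list (fib E x) (at_pt as x)"
    by (rule fib_global_frame[of x]) blast
  from global_frame_extend[OF this v] show ?thesis
    by (intro bexI[where P = "\<lambda>s. s x = v"])
qed

lemma subbundle_extend:
  assumes "subbundle M E A" "v \<in> A x"
  shows "\<exists>s\<in>Gam M E. (\<forall>y. s y \<in> A y) \<and> s x = v"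
proof -
  obtain as N where as: "open N" "x \<in> N" "set as \<subseteq> Gam M E" "\<And>a y. a \<in> set as \<Longrightarrow> a y \<in> A y"
    "\<And>y. y \<in> N \<Longrightarrow> basis_list (A y) (at_pt as y)"
    by (rule subbundle_global_frame[OF assms(1)]) (rule that; assumption)
  have "(\<Sum>i<length as. list_coeff (at_pt as x) v i *\<^sub>R (as ! i) y) \<in> A y" for y
    using as(4) by (intro subspace_sum[OF subbundle_subspace[OF assms(1)]] subspace_scale[OF subbundle_subspace[OF assms(1)]]) auto
  then show ?thesis
    by (intro bexI[OF _ global_frame_extend(1)[OF as(3) as(5)[OF as(2)] assms(2)]] conjI allI
        global_frame_extend(2)[OF as(3) as(5)[OF as(2)] assms(2)])
qed

end

section \<open>Smooth families of sections\<close>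

lemma smooth_on_partial_fst:
  assumes "smooth_on (J \<times> O') g" "t \<in> J" "z \<in> O'"
  shows "((\<lambda>r. g (r, z)) has_real_derivative frechet_derivative g (at (t, z)) (1, 0)) (at t)"
proof -
  have g': "(g has_derivative frechet_derivative g (at (t, z))) (at (t, z))"
    using smooth_on_has_derivative[OF assms(1)] assms(2,3) by simp
  have "((\<lambda>r. (r, z)) has_derivative (\<lambda>h. (h, 0))) (at t)"
    by (auto intro!: derivative_eq_intros)
  from has_derivative_compose[OF this g']
  have "((\<lambda>r. g (r, z)) has_derivative (\<lambda>h. frechet_derivative g (at (t, z)) (h, 0))) (at t)" .
  moreover have "(\<lambda>h. frechet_derivative g (at (t, z)) (h, 0)) = (*) (frechet_derivative g (at (t, z)) (1, 0))"
  proof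
    fix h
    have "frechet_derivative g (at (t, z)) (h *\<^sub>R (1, 0)) = h *\<^sub>R frechet_derivative g (at (t, z)) (1, 0)"
      by (rule linear_scale[OF has_derivative_linear[OF g']])
    then show "frechet_derivative g (at (t, z)) (h, 0) = frechet_derivative g (at (t, z)) (1, 0) * h"
      by (simp add: mult.commute)
  qed
  ultimately show ?thesis
    by (simp add: has_field_derivative_def)
qed

lemma smooth_on_partial_snd:
  assumes "smooth_on (J \<times> O') g" "t \<in> J" "z \<in> O'"
  shows "((\<lambda>z. g (t, z)) has_derivative (\<lambda>v. frechet_derivative g (at (t, z)) (0, v))) (at z)"
proof -
  have g': "(g has_derivative frechet_derivative g (at (t, z))) (at (t, z))"
    using smooth_on_has_derivative[OF assms(1)] assms(2,3) by simp
  have "((\<lambda>z. (t, z)) has_derivative (\<lambda>h. (0, h))) (at z)"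
    by (auto intro!: derivative_eq_intros)
  from has_derivative_compose[OF this g'] show ?thesis .
qed

context smooth_manifold
begin

lemma smooth_fun_family_onD:
  "smooth_fun_family_on M J W f \<Longrightarrow> (U, \<phi>) \<in> M \<Longrightarrow>
    smooth_on (J \<times> \<phi> ` (W \<inter> U)) (\<lambda>(t, y). f t (inv_into U \<phi> y))"
  by (auto simp: smooth_fun_family_on_def)

context
  fixes J :: "real set" and W :: "'m set" and f :: "real \<Rightarrow> 'm \<Rightarrow> real"
  assumes openJ: "open J" and openW: "open W" and family: "smooth_fun_family_on M J W f"
begin

lemma family_slice:
  assumes "t \<in> J" shows "smooth_fun_on M W (f t)"
  unfolding smooth_fun_on_def smooth_on_def
proof clarify
  fix U \<phi> n assume U: "(U, \<phi>) \<in> M"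
  show "Ck_on n (\<phi> ` (W \<inter> U)) (\<lambda>y. f t (inv_into U \<phi> y))"
    using Ck_on_slice[OF openJ chart_image_open[OF U openW] smooth_onD[OF smooth_fun_family_onD[OF family U]] assms]
    by simp
qed

lemma family_deriv_chart:
  assumes U: "(U, \<phi>) \<in> M" and t: "t \<in> J" and z: "z \<in> \<phi> ` (W \<inter> U)"
  shows "((\<lambda>r. f r (inv_into U \<phi> z)) has_real_derivative
      frechet_derivative (\<lambda>(t, y). f t (inv_into U \<phi> y)) (at (t, z)) (1, 0)) (at t)"
    and "deriv (\<lambda>r. f r (inv_into U \<phi> z)) t = frechet_derivative (\<lambda>(t, y). f t (inv_into U \<phi> y)) (at (t, z)) (1, 0)"
proof -
  show *: "((\<lambda>r. f r (inv_into U \<phi> z)) has_real_derivative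
      frechet_derivative (\<lambda>(t, y). f t (inv_into U \<phi> y)) (at (t, z)) (1, 0)) (at t)"
    using smooth_on_partial_fst[OF smooth_fun_family_onD[OF family U] t z] by simp
  show "deriv (\<lambda>r. f r (inv_into U \<phi> z)) t = frechet_derivative (\<lambda>(t, y). f t (inv_into U \<phi> y)) (at (t, z)) (1, 0)"
    by (rule DERIV_imp_deriv[OF *])
qed

lemma family_has_derivative:
  assumes "t \<in> J" "y \<in> W"
  shows "((\<lambda>r. f r y) has_real_derivative deriv (\<lambda>r. f r y) t) (at t)"
proof -
  obtain U \<phi> where U: "(U, \<phi>) \<in> M" "y \<in> U" by (rule chart_exists)
  have "\<phi> y \<in> \<phi> ` (W \<inter> U)" using U assms(2) by simp
  from family_deriv_chart[OF U(1) assms(1) this] show ?thesis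
    by (simp add: inv_chart[OF U])
qed

lemma family_deriv_smooth: "smooth_fun_family_on M J W (\<lambda>t y. deriv (\<lambda>r. f r y) t)"
  unfolding smooth_fun_family_on_def
proof clarify
  fix U \<phi> assume U: "(U, \<phi>) \<in> M"
  let ?g = "\<lambda>(t, y). f t (inv_into U \<phi> y)"
  have "smooth_on (J \<times> \<phi> ` (W \<inter> U)) (\<lambda>z. frechet_derivative ?g (at z) (1, 0))"
    by (rule smooth_on_frechet_derivative[OF smooth_fun_family_onD[OF family U]])
  then show "smooth_on (J \<times> \<phi> ` (W \<inter> U)) (\<lambda>(t, y). deriv (\<lambda>r. f r (inv_into U \<phi> y)) t)"
    by (rule smooth_on_cong[THEN iffD1, rotated 2])
      (use family_deriv_chart(2)[OF U] openJ chart_image_open[OF U openW] in \<open>auto intro!: open_Times\<close>)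
qed

text \<open>The derivatives in t and in the direction w commute: this is the symmetry of the second
  derivative of the function of (t, y), taken in the directions (1, 0) and (0, w).\<close>

lemma family_deriv_frechet:
  assumes U: "(U, \<phi>) \<in> M" and x: "x \<in> W" "x \<in> U" and t: "t \<in> J"
  shows "((\<lambda>r. frechet_derivative (\<lambda>z. f r (inv_into U \<phi> z)) (at (\<phi> x)) w) has_real_derivative
      frechet_derivative (\<lambda>z. deriv (\<lambda>r. f r (inv_into U \<phi> z)) t) (at (\<phi> x)) w) (at t)"
proof -
  let ?g = "\<lambda>(t, y). f t (inv_into U \<phi> y)"
  let ?O = "\<phi> ` (W \<inter> U)"
  let ?d = "\<lambda>v z. frechet_derivative ?g (at z) v"
  have O: "open ?O" "\<phi> x \<in> ?O" using chart_image_open[OF U openW] x by auto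
  have JO: "open (J \<times> ?O)" using openJ O(1) by (rule open_Times)
  note g = smooth_fun_family_onD[OF family U]
  have dg: "smooth_on (J \<times> ?O) (?d v)" for v
    by (rule smooth_on_frechet_derivative[OF g])
  have 1: "frechet_derivative (\<lambda>z. f r (inv_into U \<phi> z)) (at (\<phi> x)) w = ?d (0, w) (r, \<phi> x)" if "r \<in> J" for r
    using frechet_derivative_at[OF smooth_on_partial_snd[OF g that O(2)], symmetric] by simp
  have "((\<lambda>z. ?d (1, 0) (t, z)) has_derivative (\<lambda>v. frechet_derivative (?d (1, 0)) (at (t, \<phi> x)) (0, v))) (at (\<phi> x))"
    by (rule smooth_on_partial_snd[OF dg t O(2)])
  then have "((\<lambda>z. deriv (\<lambda>r. f r (inv_into U \<phi> z)) t) has_derivative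
      (\<lambda>v. frechet_derivative (?d (1, 0)) (at (t, \<phi> x)) (0, v))) (at (\<phi> x))"
    by (rule has_derivative_transform_within_open[OF _ O]) (simp add: family_deriv_chart(2)[OF U t])
  then have 2: "frechet_derivative (\<lambda>z. deriv (\<lambda>r. f r (inv_into U \<phi> z)) t) (at (\<phi> x)) w =
      frechet_derivative (?d (1, 0)) (at (t, \<phi> x)) (0, w)"
    using frechet_derivative_at by metis
  have "((\<lambda>r. ?d (0, w) (r, \<phi> x)) has_real_derivative frechet_derivative (?d (0, w)) (at (t, \<phi> x)) (1, 0)) (at t)"
    by (rule smooth_on_partial_fst[OF dg t O(2)])
  moreover have "frechet_derivative (?d (0, w)) (at (t, \<phi> x)) (1, 0) = frechet_derivative (?d (1, 0)) (at (t, \<phi> x)) (0, w)"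
    by (rule second_frechet_symmetric[OF JO smooth_onD[OF g]]) (use t O(2) in auto)
  ultimately have "((\<lambda>r. ?d (0, w) (r, \<phi> x)) has_real_derivative
      frechet_derivative (\<lambda>z. deriv (\<lambda>r. f r (inv_into U \<phi> z)) t) (at (\<phi> x)) w) (at t)"
    unfolding 2 by simp
  then show ?thesis
    by (rule has_field_derivative_transform_within_open[OF _ openJ t]) (simp add: 1)
qed

end

end

section \<open>Derivations of a vector bundle in local coordinates\<close>

context smooth_bundle
begin

context
  fixes \<Delta> assumes derivation: "derivation_of M E \<Delta>"
begin

lemma derivation_Gam: "s \<in> Gam M E \<Longrightarrow> \<Delta> s \<in> Gam M E"
  using derivation by (simp add: derivation_of_def)

lemma derivation_linear:
  "s \<in> Gam M E \<Longrightarrow> r \<in> Gam M E \<Longrightarrow> \<Delta> (\<lambda>x. a *\<^sub>R s x + r x) = (\<lambda>x. a *\<^sub>R \<Delta> s x + \<Delta> r x)"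
  using derivation by (simp add: derivation_of_def)

lemma derivation_zero: "\<Delta> (\<lambda>x. 0) = (\<lambda>x. 0)"
  using derivation_linear[OF Gam_zero Gam_zero, of "-1"] by simp

lemma derivation_sum:
  "finite I \<Longrightarrow> (\<And>i. i \<in> I \<Longrightarrow> s i \<in> Gam M E) \<Longrightarrow> \<Delta> (\<lambda>x. \<Sum>i\<in>I. s i x) = (\<lambda>x. \<Sum>i\<in>I. \<Delta> (s i) x)"
proof (induction I rule: finite_induct)
  case (insert i I)
  then show ?case
    using derivation_linear[of "s i" "\<lambda>x. \<Sum>i\<in>I. s i x" 1] Gam_sum[of I s] by simp
qed (simp add: derivation_zero)

lemma derivation_symbol:
  obtains X where "\<And>f g x a. f \<in> Cinf M \<Longrightarrow> g \<in> Cinf M \<Longrightarrow> X (\<lambda>y. a * f y + g y) x = a * X f x + X g x"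
    "\<And>f g x. f \<in> Cinf M \<Longrightarrow> g \<in> Cinf M \<Longrightarrow> X (\<lambda>y. f y * g y) x = X f x * g x + f x * X g x"
    "\<And>f s. f \<in> Cinf M \<Longrightarrow> s \<in> Gam M E \<Longrightarrow> \<Delta> (\<lambda>x. f x *\<^sub>R s x) = (\<lambda>x. X f x *\<^sub>R s x + f x *\<^sub>R \<Delta> s x)"
proof -
  obtain X where X: "vector_field M X"
    "\<forall>f\<in>Cinf M. \<forall>s\<in>Gam M E. \<Delta> (\<lambda>x. f x *\<^sub>R s x) = (\<lambda>x. X f x *\<^sub>R s x + f x *\<^sub>R \<Delta> s x)"
    using derivation unfolding derivation_of_def by blast
  show ?thesis
    by (rule that[of X]) (use X in \<open>auto simp: vector_field_def\<close>)
qed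

text \<open>A derivation is a first-order operator. The vector w and the values \<kappa> depend on
  the derivation, the chart and the frame but not on the section, so the formula can be applied to
  all members of a family at once.\<close>

lemma derivation_local_formula:
  assumes V: "(V, ls) \<in> frames E" "x \<in> V" and U: "(U, \<phi>) \<in> M" "x \<in> U"
  obtains w \<kappa> where "\<And>s c. s \<in> Gam M E \<Longrightarrow> (\<And>i. i < length ls \<Longrightarrow> smooth_fun_on M V (c i)) \<Longrightarrow>
    (\<And>y. y \<in> V \<Longrightarrow> s y = (\<Sum>i<length ls. c i y *\<^sub>R (ls ! i) y)) \<Longrightarrow>
    \<Delta> s x = (\<Sum>i<length ls. frechet_derivative (\<lambda>z. c i (inv_into U \<phi> z)) (at (\<phi> x)) w *\<^sub>R (ls ! i) x + c i x *\<^sub>R \<kappa> i)"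
proof -
  note openV = frame_open[OF V(1)]
  obtain X where X: "\<And>f g x a. f \<in> Cinf M \<Longrightarrow> g \<in> Cinf M \<Longrightarrow> X (\<lambda>y. a * f y + g y) x = a * X f x + X g x"
    "\<And>f g x. f \<in> Cinf M \<Longrightarrow> g \<in> Cinf M \<Longrightarrow> X (\<lambda>y. f y * g y) x = X f x * g x + f x * X g x"
    "\<And>f s. f \<in> Cinf M \<Longrightarrow> s \<in> Gam M E \<Longrightarrow> \<Delta> (\<lambda>x. f x *\<^sub>R s x) = (\<lambda>x. X f x *\<^sub>R s x + f x *\<^sub>R \<Delta> s x)"
    by (rule derivation_symbol) blast
  obtain w where w: "\<And>f. f \<in> Cinf M \<Longrightarrow> X f x = frechet_derivative (\<lambda>y. f (inv_into U \<phi> y)) (at (\<phi> x)) w"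
    using point_derivation[of "\<lambda>f. X f x" x U \<phi>, OF X(1,2) U] by blast
  obtain \<rho> N C where \<rho>: "\<rho> \<in> Cinf M" "open N" "x \<in> N" "\<And>y. y \<in> N \<Longrightarrow> \<rho> y = 1"
    "closed C" "C \<subseteq> V" "\<And>y. y \<notin> C \<Longrightarrow> \<rho> y = 0" "N \<subseteq> V"
    by (rule bump_function[OF openV V(2)]) (rule that; assumption)
  have \<rho>x: "\<rho> x = 1" using \<rho>(3,4) by blast
  define l where "l i = (\<lambda>y. \<rho> y *\<^sub>R (ls ! i) y)" for i
  have l: "l i \<in> Gam M E" if "i < length ls" for i
    unfolding l_def using that by (intro Gam_bump_scale[OF \<rho>(1,5,6,7) openV] frame_smooth[OF V(1)]) auto
  have \<rho>\<rho>: "(\<lambda>y. \<rho> y * \<rho> y) \<in> Cinf M"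
    using smooth_fun_on_mult[OF open_UNIV] \<rho>(1) by (simp add: Cinf_iff)
  \<comment> \<open>The subtracted term removes the contribution of the symbol on the squared
    cut-off, which arises because the section is multiplied by it before expanding.\<close>
  define \<kappa> where "\<kappa> i = \<Delta> (l i) x - X (\<lambda>y. \<rho> y * \<rho> y) x *\<^sub>R (ls ! i) x" for i
  show ?thesis
  proof (rule that[of w \<kappa>])
    fix s c assume s: "s \<in> Gam M E" and c: "\<And>i. i < length ls \<Longrightarrow> smooth_fun_on M V (c i)"
      and sc: "\<And>y. y \<in> V \<Longrightarrow> s y = (\<Sum>i<length ls. c i y *\<^sub>R (ls ! i) y)"
    have \<rho>c: "(\<lambda>y. \<rho> y * c i y) \<in> Cinf M" if "i < length ls" for i
      by (rule Cinf_bump_mult[OF \<rho>(1,5,6,7) openV c[OF that]])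
    have "X (\<lambda>y. \<rho> y * c i y) x = frechet_derivative (\<lambda>z. c i (inv_into U \<phi> z)) (at (\<phi> x)) w"
      if "i < length ls" for i
    proof -
      have "open (\<phi> ` (N \<inter> U))" "\<phi> x \<in> \<phi> ` (N \<inter> U)"
        using chart_image_open[OF U(1) \<rho>(2)] \<rho>(3) U(2) by auto
      moreover have "\<rho> (inv_into U \<phi> z) * c i (inv_into U \<phi> z) = c i (inv_into U \<phi> z)"
        if "z \<in> \<phi> ` (N \<inter> U)" for z
        using that \<rho>(4) inv_chart[OF U(1)] by auto
      ultimately have "((\<lambda>z. \<rho> (inv_into U \<phi> z) * c i (inv_into U \<phi> z)) has_derivative D) (at (\<phi> x)) \<longleftrightarrow>
          ((\<lambda>z. c i (inv_into U \<phi> z)) has_derivative D) (at (\<phi> x))" for D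
        using has_derivative_transform_within_open[of _ D "\<phi> x" UNIV "\<phi> ` (N \<inter> U)"] by (metis (no_types, lifting))
      then show ?thesis
        unfolding w[OF \<rho>c[OF that]] frechet_derivative_def by simp
    qed
    moreover have "\<Delta> (\<lambda>y. (\<rho> y * c i y) *\<^sub>R l i y) x = X (\<lambda>y. \<rho> y * c i y) x *\<^sub>R (ls ! i) x + c i x *\<^sub>R \<Delta> (l i) x"
      if "i < length ls" for i
      unfolding X(3)[OF \<rho>c[OF that] l[OF that]] using \<rho>x by (simp add: l_def)
    \<comment> \<open>One factor \<rho> makes the coefficient a global function, the other makes the
      frame member a global section; the Leibniz rule then applies to each summand.\<close>
    moreover have "\<Delta> (\<lambda>y. (\<rho> y * \<rho> y) *\<^sub>R s y) x = (\<Sum>i<length ls. \<Delta> (\<lambda>y. (\<rho> y * c i y) *\<^sub>R l i y) x)"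
    proof -
      have "(\<lambda>y. (\<rho> y * \<rho> y) *\<^sub>R s y) = (\<lambda>y. \<Sum>i<length ls. (\<rho> y * c i y) *\<^sub>R l i y)"
      proof
        fix y
        show "(\<rho> y * \<rho> y) *\<^sub>R s y = (\<Sum>i<length ls. (\<rho> y * c i y) *\<^sub>R l i y)"
        proof (cases "y \<in> V")
          case True
          then show ?thesis
            by (simp add: sc l_def scaleR_sum_right mult_ac)
        next
          case False
          then have "\<rho> y = 0" using \<rho>(6,7) by blast
          then show ?thesis by simp
        qed
      qed
      then show ?thesis
        using derivation_sum[of "{..<length ls}" "\<lambda>i y. (\<rho> y * c i y) *\<^sub>R l i y"] Gam_scale[OF \<rho>c l] by simp
    qed
    moreover have "\<Delta> (\<lambda>y. (\<rho> y * \<rho> y) *\<^sub>R s y) x = X (\<lambda>y. \<rho> y * \<rho> y) x *\<^sub>R s x + \<Delta> s x"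
      unfolding X(3)[OF \<rho>\<rho> s] using \<rho>x by simp
    ultimately have "\<Delta> s x = (\<Sum>i<length ls. frechet_derivative (\<lambda>z. c i (inv_into U \<phi> z)) (at (\<phi> x)) w *\<^sub>R (ls ! i) x
        + c i x *\<^sub>R \<Delta> (l i) x) - X (\<lambda>y. \<rho> y * \<rho> y) x *\<^sub>R s x"
      by (simp add: eq_diff_eq add.commute)
    also have "X (\<lambda>y. \<rho> y * \<rho> y) x *\<^sub>R s x = (\<Sum>i<length ls. c i x *\<^sub>R (X (\<lambda>y. \<rho> y * \<rho> y) x *\<^sub>R (ls ! i) x))"
      using sc[OF V(2)] by (simp add: scaleR_sum_right mult.commute)
    finally show "\<Delta> s x = (\<Sum>i<length ls. frechet_derivative (\<lambda>z. c i (inv_into U \<phi> z)) (at (\<phi> x)) w *\<^sub>R (ls ! i) x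
        + c i x *\<^sub>R \<kappa> i)"
      by (simp add: \<kappa>_def scaleR_diff_right sum_subtractf add_diff_eq)
  qed
qed

end

end

section \<open>Time derivatives of families of sections\<close>

locale normed_bundle = smooth_bundle M L
  for M :: "('m::{t2_space, second_countable_topology}, 'e::real_normed_vector) atlas"
    and L :: "('m, 'l::real_normed_vector) vbundle"
begin

context
  fixes J :: "real set" and s :: "real \<Rightarrow> 'm \<Rightarrow> 'l"
  assumes openJ: "open J" and family: "smooth_section_family_on M L J UNIV s"
begin

definition dot :: "real \<Rightarrow> 'm \<Rightarrow> 'l" where
  "dot t y = vector_derivative (\<lambda>r. s r y) (at t)"

lemma family_coefficients:
  assumes "(V, ls) \<in> frames L"
  obtains c where "\<And>i. i < length ls \<Longrightarrow> smooth_fun_family_on M J V (c i)"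
    "\<And>t x. t \<in> J \<Longrightarrow> x \<in> V \<Longrightarrow> s t x = (\<Sum>i<length ls. c i t x *\<^sub>R (ls ! i) x)"
proof -
  have "\<exists>c. (\<forall>i<length ls. smooth_fun_family_on M J (UNIV \<inter> V) (c i)) \<and>
      (\<forall>t\<in>J. \<forall>x\<in>UNIV \<inter> V. s t x = (\<Sum>i<length ls. c i t x *\<^sub>R (ls ! i) x))"
    using bspec[OF conjunct2[OF family[unfolded smooth_section_family_on_def]] assms]
    unfolding prod.case .
  then obtain c where "\<forall>i<length ls. smooth_fun_family_on M J (UNIV \<inter> V) (c i)"
    "\<forall>t\<in>J. \<forall>x\<in>UNIV \<inter> V. s t x = (\<Sum>i<length ls. c i t x *\<^sub>R (ls ! i) x)"
    by (elim exE conjE) (rule that; assumption)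
  then show ?thesis using that[of c] by simp
qed

lemma section_family_slice:
  assumes t: "t \<in> J" shows "s t \<in> Gam M L"
  unfolding Gam_iff smooth_section_on_def
proof (intro conjI ballI)
  show "s t x \<in> fib L x" for x
    using family t by (simp add: smooth_section_family_on_def)
  fix p assume p: "p \<in> frames L"
  obtain V ls where Vls: "p = (V, ls)" by force
  obtain c where c: "\<And>i. i < length ls \<Longrightarrow> smooth_fun_family_on M J V (c i)"
    "\<And>t x. t \<in> J \<Longrightarrow> x \<in> V \<Longrightarrow> s t x = (\<Sum>i<length ls. c i t x *\<^sub>R (ls ! i) x)"
    using family_coefficients p Vls by metis
  have "smooth_fun_on M V (c i t)" if "i < length ls" for i
    using family_slice[OF openJ frame_open c(1)[OF that] t] p Vls by blast
  then show "case p of (V, ss) \<Rightarrow> \<exists>c. (\<forall>i<length ss. smooth_fun_on M (UNIV \<inter> V) (c i)) \<and>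
      (\<forall>x\<in>UNIV \<inter> V. s t x = (\<Sum>i<length ss. c i x *\<^sub>R (ss ! i) x))"
    unfolding Vls prod.case using c(2)[OF t] by (intro exI[of _ "\<lambda>i. c i t"]) auto
qed

lemma dot_coefficients:
  assumes V: "(V, ls) \<in> frames L" "x \<in> V" and t: "t \<in> J"
    and c: "\<And>i. i < length ls \<Longrightarrow> smooth_fun_family_on M J V (c i)"
      "\<And>t x. t \<in> J \<Longrightarrow> x \<in> V \<Longrightarrow> s t x = (\<Sum>i<length ls. c i t x *\<^sub>R (ls ! i) x)"
  shows "((\<lambda>r. s r x) has_vector_derivative (\<Sum>i<length ls. deriv (\<lambda>r. c i r x) t *\<^sub>R (ls ! i) x)) (at t)"
    and "dot t x = (\<Sum>i<length ls. deriv (\<lambda>r. c i r x) t *\<^sub>R (ls ! i) x)"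
proof -
  have "((\<lambda>r. c i r x *\<^sub>R (ls ! i) x) has_vector_derivative deriv (\<lambda>r. c i r x) t *\<^sub>R (ls ! i) x) (at t)"
    if "i < length ls" for i
    using has_vector_derivative_scaleR[OF family_has_derivative[OF openJ frame_open[OF V(1)] c(1)[OF that] t V(2)]
        has_vector_derivative_const[of "(ls ! i) x"]] by simp
  then have "((\<lambda>r. \<Sum>i<length ls. c i r x *\<^sub>R (ls ! i) x) has_vector_derivative
      (\<Sum>i<length ls. deriv (\<lambda>r. c i r x) t *\<^sub>R (ls ! i) x)) (at t)"
    by (intro has_vector_derivative_sum) auto
  then show *: "((\<lambda>r. s r x) has_vector_derivative (\<Sum>i<length ls. deriv (\<lambda>r. c i r x) t *\<^sub>R (ls ! i) x)) (at t)"
    by (rule has_vector_derivative_transform_within_open[OF _ openJ t]) (simp add: c(2)[OF _ V(2)])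
  show "dot t x = (\<Sum>i<length ls. deriv (\<lambda>r. c i r x) t *\<^sub>R (ls ! i) x)"
    unfolding dot_def by (rule vector_derivative_at[OF *])
qed

lemma dot_has_vector_derivative:
  assumes "t \<in> J" shows "((\<lambda>r. s r x) has_vector_derivative dot t x) (at t)"
proof -
  obtain V ls where V: "(V, ls) \<in> frames L" "x \<in> V" by (rule frame_exists)
  obtain c where c: "\<And>i. i < length ls \<Longrightarrow> smooth_fun_family_on M J V (c i)"
    "\<And>t x. t \<in> J \<Longrightarrow> x \<in> V \<Longrightarrow> s t x = (\<Sum>i<length ls. c i t x *\<^sub>R (ls ! i) x)"
    using family_coefficients[OF V(1)] by metis
  show ?thesis
    using dot_coefficients[OF V assms c] by simp
qed

text \<open>The derivative is a smooth family again, so it can be differentiated a second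
  time.\<close>

lemma dot_family: "smooth_section_family_on M L J UNIV dot"
  unfolding smooth_section_family_on_def
proof (intro conjI ballI)
  fix t x assume t: "t \<in> J"
  obtain V ls where V: "(V, ls) \<in> frames L" "x \<in> V" by (rule frame_exists)
  obtain c where c: "\<And>i. i < length ls \<Longrightarrow> smooth_fun_family_on M J V (c i)"
    "\<And>t x. t \<in> J \<Longrightarrow> x \<in> V \<Longrightarrow> s t x = (\<Sum>i<length ls. c i t x *\<^sub>R (ls ! i) x)"
    using family_coefficients[OF V(1)] by metis
  have "(\<Sum>i<length ls. deriv (\<lambda>r. c i r x) t *\<^sub>R (at_pt ls x) ! i) \<in> fib L x"
    using basis_list_sum_in[OF frame_basis[OF V]] by simp
  moreover have "dot t x = (\<Sum>i<length ls. deriv (\<lambda>r. c i r x) t *\<^sub>R (ls ! i) x)"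
    by (rule dot_coefficients(2)[OF V t c])
  ultimately show "dot t x \<in> fib L x" by simp
next
  fix p assume p: "p \<in> frames L"
  obtain V ls where Vls: "p = (V, ls)" by force
  then have V: "(V, ls) \<in> frames L" using p by simp
  obtain c where c: "\<And>i. i < length ls \<Longrightarrow> smooth_fun_family_on M J V (c i)"
    "\<And>t x. t \<in> J \<Longrightarrow> x \<in> V \<Longrightarrow> s t x = (\<Sum>i<length ls. c i t x *\<^sub>R (ls ! i) x)"
    using family_coefficients[OF V] by metis
  show "case p of (V, ss) \<Rightarrow> \<exists>c. (\<forall>i<length ss. smooth_fun_family_on M J (UNIV \<inter> V) (c i)) \<and>
      (\<forall>t\<in>J. \<forall>x\<in>UNIV \<inter> V. dot t x = (\<Sum>i<length ss. c i t x *\<^sub>R (ss ! i) x))"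
    unfolding Vls prod.case
    by (rule exI[of _ "\<lambda>i t y. deriv (\<lambda>r. c i r y) t"])
      (use family_deriv_smooth[OF openJ frame_open[OF V] c(1)] dot_coefficients(2)[OF V _ _ c] in auto)
qed

end

text \<open>In the local formula the data w and \<kappa> are constant in time, so only partial
  derivatives of the coefficients have to be interchanged with d/dt.\<close>

lemma derivation_dot:
  assumes openJ: "open J" and family: "smooth_section_family_on M L J UNIV s" and t: "t \<in> J"
    and derivation: "derivation_of M L \<Delta>"
  shows "((\<lambda>r. \<Delta> (s r) x) has_vector_derivative \<Delta> (dot s t) x) (at t)"
proof -
  obtain V ls where V: "(V, ls) \<in> frames L" "x \<in> V" by (rule frame_exists)
  obtain U \<phi> where U: "(U, \<phi>) \<in> M" "x \<in> U" by (rule chart_exists)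
  obtain c where c: "\<And>i. i < length ls \<Longrightarrow> smooth_fun_family_on M J V (c i)"
    "\<And>t x. t \<in> J \<Longrightarrow> x \<in> V \<Longrightarrow> s t x = (\<Sum>i<length ls. c i t x *\<^sub>R (ls ! i) x)"
    using family_coefficients[OF openJ family V(1)] by metis
  note openV = frame_open[OF V(1)]
  obtain w \<kappa> where loc: "\<And>s c. s \<in> Gam M L \<Longrightarrow> (\<And>i. i < length ls \<Longrightarrow> smooth_fun_on M V (c i)) \<Longrightarrow>
    (\<And>y. y \<in> V \<Longrightarrow> s y = (\<Sum>i<length ls. c i y *\<^sub>R (ls ! i) y)) \<Longrightarrow>
    \<Delta> s x = (\<Sum>i<length ls. frechet_derivative (\<lambda>z. c i (inv_into U \<phi> z)) (at (\<phi> x)) w *\<^sub>R (ls ! i) x + c i x *\<^sub>R \<kappa> i)"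
    by (rule derivation_local_formula[OF derivation V U]) blast
  let ?F = "\<lambda>i r. frechet_derivative (\<lambda>z. c i r (inv_into U \<phi> z)) (at (\<phi> x)) w"
  let ?F' = "\<lambda>i. frechet_derivative (\<lambda>z. deriv (\<lambda>r. c i r (inv_into U \<phi> z)) t) (at (\<phi> x)) w"
  have 1: "\<Delta> (s r) x = (\<Sum>i<length ls. ?F i r *\<^sub>R (ls ! i) x + c i r x *\<^sub>R \<kappa> i)" if r: "r \<in> J" for r
    by (rule loc[where c = "\<lambda>i. c i r"])
      (use section_family_slice[OF openJ family r] family_slice[OF openJ openV c(1) r] c(2)[OF r] in auto)
  have dfam: "smooth_section_family_on M L J UNIV (dot s)"
    by (rule dot_family[OF openJ family])
  have 2: "\<Delta> (dot s t) x = (\<Sum>i<length ls. ?F' i *\<^sub>R (ls ! i) x + deriv (\<lambda>r. c i r x) t *\<^sub>R \<kappa> i)"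
    by (rule loc[where c = "\<lambda>i y. deriv (\<lambda>r. c i r y) t"])
      (use section_family_slice[OF openJ dfam t] family_slice[OF openJ openV family_deriv_smooth[OF openJ openV c(1)] t]
        dot_coefficients(2)[OF openJ family V(1) _ t c] in auto)
  have "((\<lambda>r. ?F i r *\<^sub>R (ls ! i) x + c i r x *\<^sub>R \<kappa> i) has_vector_derivative
      ?F' i *\<^sub>R (ls ! i) x + deriv (\<lambda>r. c i r x) t *\<^sub>R \<kappa> i) (at t)" if "i < length ls" for i
    using has_vector_derivative_add[OF
        has_vector_derivative_scaleR[OF family_deriv_frechet[OF openJ openV c(1)[OF that] U(1) V(2) U(2) t]
          has_vector_derivative_const[of "(ls ! i) x"]]
        has_vector_derivative_scaleR[OF family_has_derivative[OF openJ openV c(1)[OF that] t V(2)]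
          has_vector_derivative_const[of "\<kappa> i"]]] by simp
  then have "((\<lambda>r. \<Sum>i<length ls. ?F i r *\<^sub>R (ls ! i) x + c i r x *\<^sub>R \<kappa> i) has_vector_derivative \<Delta> (dot s t) x) (at t)"
    unfolding 2 by (intro has_vector_derivative_sum) auto
  then show ?thesis
    by (rule has_vector_derivative_transform_within_open[OF _ openJ t]) (simp add: 1)
qed

end

section \<open>Courant--Jacobi algebroids\<close>

lemma independent_family:
  fixes r :: "nat \<Rightarrow> 'v::real_vector"
  assumes "\<And>d j. (\<Sum>j<m. d j *\<^sub>R r j) = 0 \<Longrightarrow> j < m \<Longrightarrow> d j = 0"
  shows "inj_on r {..<m}" "independent (r ` {..<m})"
proof -
  show inj: "inj_on r {..<m}"
  proof (rule inj_onI, rule ccontr)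
    fix j k assume jk: "j \<in> {..<m}" "k \<in> {..<m}" "r j = r k" "j \<noteq> k"
    \<comment> \<open>If two members coincided, the difference of the two unit coefficient vectors
      would be a nontrivial relation.\<close>
    let ?d = "\<lambda>i. (if i = j then 1 else 0) - (if i = k then 1 else 0) :: real"
    have "(\<Sum>i<m. ?d i *\<^sub>R r i) = (\<Sum>i<m. (if i = j then r i else 0)) - (\<Sum>i<m. (if i = k then r i else 0))"
      by (simp add: scaleR_diff_left sum_subtractf if_distrib[of "\<lambda>c. c *\<^sub>R _"] cong: if_cong)
    also have "\<dots> = 0" using jk by simp
    finally have "(\<Sum>i<m. ?d i *\<^sub>R r i) = 0" .
    from assms[of ?d j, OF this] jk(1,4) show False by simp
  qed
  show "independent (r ` {..<m})"
  proof (rule independent_if_scalars_zero)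
    fix f x assume f: "(\<Sum>x\<in>r ` {..<m}. f x *\<^sub>R x) = 0" and x: "x \<in> r ` {..<m}"
    have "(\<Sum>j<m. f (r j) *\<^sub>R r j) = 0"
      using f by (simp add: sum.reindex[OF inj])
    then show "f x = 0" using assms[of "\<lambda>j. f (r j)"] x by auto
  qed simp
qed

lemma span_subset_if_card_le:
  fixes S R :: "'v::real_vector set"
  assumes "finite S" "independent R" "R \<subseteq> span S" "card S \<le> card R"
  shows "span S \<subseteq> span R"
proof
  fix v assume v: "v \<in> span S"
  show "v \<in> span R"
  proof (rule ccontr)
    assume nv: "v \<notin> span R"
    then have "independent (insert v R)"
      using assms(2) by (simp add: independent_insert)
    moreover have "insert v R \<subseteq> span S" using v assms(3) by simp
    ultimately have "finite (insert v R) \<and> card (insert v R) \<le> card S"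
      by (rule independent_span_bound[OF assms(1)])
    moreover have "v \<notin> R" using nv span_base by blast
    ultimately show False using assms(4) by (auto simp: card_insert_if)
  qed
qed

text \<open>Solvability of the linear system with matrix c. The given bases let its rows be read as
  vectors of A and its columns as vectors of B. Independence of the columns shows that A has
  dimension at most m; the m independent rows therefore span A, which contains the vector with
  components f.\<close>

lemma nondegenerate_matrix_surj:
  fixes as bs :: "'v::real_vector list" and c :: "nat \<Rightarrow> nat \<Rightarrow> real"
  assumes A: "basis_list A as" and B: "basis_list B bs"
    and rows: "\<And>d j. (\<And>i. i < length as \<Longrightarrow> (\<Sum>j<length bs. d j * c j i) = 0) \<Longrightarrow> j < length bs \<Longrightarrow> d j = 0"
    and cols: "\<And>d i. (\<And>j. j < length bs \<Longrightarrow> (\<Sum>i<length as. d i * c j i) = 0) \<Longrightarrow> i < length as \<Longrightarrow> d i = 0"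
  shows "\<exists>d. \<forall>i<length as. (\<Sum>j<length bs. d j * c j i) = f i"
proof -
  let ?n = "length as" and ?m = "length bs"
  define r where "r j = (\<Sum>i<?n. c j i *\<^sub>R as ! i)" for j
  define k where "k i = (\<Sum>j<?m. c j i *\<^sub>R bs ! j)" for i
  have rsum: "(\<Sum>j<?m. d j *\<^sub>R r j) = (\<Sum>i<?n. (\<Sum>j<?m. d j * c j i) *\<^sub>R as ! i)" for d
    unfolding r_def scaleR_sum_right scaleR_sum_left scaleR_scaleR by (rule sum.swap)
  have ksum: "(\<Sum>i<?n. d i *\<^sub>R k i) = (\<Sum>j<?m. (\<Sum>i<?n. d i * c j i) *\<^sub>R bs ! j)" for d
    unfolding k_def scaleR_sum_right scaleR_sum_left scaleR_scaleR by (rule sum.swap)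
  have r0: "d i = 0" if z: "(\<Sum>j<?m. d j *\<^sub>R r j) = 0" "i < ?m" for d i
    by (rule rows[OF basis_list_independent[OF A z(1)[unfolded rsum]] z(2)])
  have r: "inj_on r {..<?m}" "independent (r ` {..<?m})"
    by (rule independent_family, erule (1) r0)+
  have k0: "d i = 0" if z: "(\<Sum>j<?n. d j *\<^sub>R k j) = 0" "i < ?n" for d i
    by (rule cols[OF basis_list_independent[OF B z(1)[unfolded ksum]] z(2)])
  have k: "inj_on k {..<?n}" "independent (k ` {..<?n})"
    by (rule independent_family, erule (1) k0)+
  have spanA: "span (set as) = A" and spanB: "span (set bs) = B"
    and card: "card (set as) = ?n" "card (set bs) = ?m"
    using A B by (auto simp: basis_list_def distinct_card)
  have rA: "r ` {..<?m} \<subseteq> span (set as)" and kB: "k ` {..<?n} \<subseteq> span (set bs)"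
    unfolding r_def k_def by (auto intro!: span_sum span_scale intro: span_base)
  have "?n \<le> ?m"
    using independent_span_bound[OF finite_set k(2) kB] card card_image[OF k(1)] by simp
  then have "span (set as) \<subseteq> span (r ` {..<?m})"
    using span_subset_if_card_le[OF finite_set r(2) rA] card card_image[OF r(1)] by simp
  moreover have "(\<Sum>i<?n. f i *\<^sub>R as ! i) \<in> span (set as)"
    by (intro span_sum span_scale span_base) auto
  ultimately have "(\<Sum>i<?n. f i *\<^sub>R as ! i) \<in> span (r ` {..<?m})" by blast
  then obtain u where "(\<Sum>i<?n. f i *\<^sub>R as ! i) = (\<Sum>v\<in>r ` {..<?m}. u v *\<^sub>R v)"
    unfolding span_finite[OF finite_imageI[OF finite_lessThan]] by blast
  also have "\<dots> = (\<Sum>j<?m. u (r j) *\<^sub>R r j)"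
    by (simp add: sum.reindex[OF r(1)])
  finally have eq: "(\<Sum>i<?n. f i *\<^sub>R as ! i) = (\<Sum>i<?n. (\<Sum>j<?m. u (r j) * c j i) *\<^sub>R as ! i)"
    unfolding rsum .
  have "f i = (\<Sum>j<?m. u (r j) * c j i)" if "i < ?n" for i
    using list_coeff_unique[OF A refl that, of f] list_coeff_unique[OF A eq that] by simp
  then show ?thesis by (intro exI[of _ "\<lambda>j. u (r j)"]) simp
qed

section \<open>Product, bracket and derivations of a Courant--Jacobi algebroid\<close>

locale cj_algebroid =
  fixes D :: "('m::{t2_space, second_countable_topology}, 'e::real_normed_vector,
      'v::real_vector, 'l::real_normed_vector) cj_data"
  assumes cj: "courant_jacobi D"
begin

sublocale E: smooth_bundle "atl D" "Ebun D"
  by unfold_locales (use cj in \<open>simp_all add: courant_jacobi_def\<close>)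

sublocale L: normed_bundle "atl D" "Lbun D"
  by unfold_locales (use cj in \<open>simp_all add: courant_jacobi_def line_bundle_def\<close>)

lemma prd_fib: "u \<in> fib (Ebun D) x \<Longrightarrow> v \<in> fib (Ebun D) x \<Longrightarrow> prd D x u v \<in> fib (Lbun D) x"
  and prd_sym: "u \<in> fib (Ebun D) x \<Longrightarrow> v \<in> fib (Ebun D) x \<Longrightarrow> prd D x u v = prd D x v u"
  using cj by (simp_all add: courant_jacobi_def)

lemma prd_linear_left: "u \<in> fib (Ebun D) x \<Longrightarrow> v \<in> fib (Ebun D) x \<Longrightarrow> w \<in> fib (Ebun D) x \<Longrightarrow>
    prd D x (a *\<^sub>R u + v) w = a *\<^sub>R prd D x u w + prd D x v w"
  using cj by (simp add: courant_jacobi_def)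

lemma prd_linear_right: "u \<in> fib (Ebun D) x \<Longrightarrow> v \<in> fib (Ebun D) x \<Longrightarrow> w \<in> fib (Ebun D) x \<Longrightarrow>
    prd D x w (a *\<^sub>R u + v) = a *\<^sub>R prd D x w u + prd D x w v"
  using prd_linear_left[of u x v w a] prd_sym E.fib_subspace by (simp add: subspace_add subspace_scale)

lemma prd_add_left: "u \<in> fib (Ebun D) x \<Longrightarrow> v \<in> fib (Ebun D) x \<Longrightarrow> w \<in> fib (Ebun D) x \<Longrightarrow>
    prd D x (u + v) w = prd D x u w + prd D x v w"
  using prd_linear_left[of u x v w 1] by simp

lemma prd_add_right: "u \<in> fib (Ebun D) x \<Longrightarrow> v \<in> fib (Ebun D) x \<Longrightarrow> w \<in> fib (Ebun D) x \<Longrightarrow>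
    prd D x w (u + v) = prd D x w u + prd D x w v"
  using prd_linear_right[of u x v w 1] by simp

lemma prd_zero_left: "w \<in> fib (Ebun D) x \<Longrightarrow> prd D x 0 w = 0"
  using prd_linear_left[of 0 x 0 w 1] subspace_0[OF E.fib_subspace, of x] by simp

lemma prd_zero_right: "w \<in> fib (Ebun D) x \<Longrightarrow> prd D x w 0 = 0"
  using prd_linear_right[of 0 x 0 w 1] subspace_0[OF E.fib_subspace, of x] by simp

lemma prd_scale_left: "u \<in> fib (Ebun D) x \<Longrightarrow> w \<in> fib (Ebun D) x \<Longrightarrow> prd D x (a *\<^sub>R u) w = a *\<^sub>R prd D x u w"
  using prd_linear_left[of u x 0 w a] subspace_0[OF E.fib_subspace, of x] prd_zero_left by simp

lemma prd_scale_right: "u \<in> fib (Ebun D) x \<Longrightarrow> w \<in> fib (Ebun D) x \<Longrightarrow> prd D x w (a *\<^sub>R u) = a *\<^sub>R prd D x w u"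
  using prd_linear_right[of u x 0 w a] subspace_0[OF E.fib_subspace, of x] prd_zero_right by simp

lemma prd_sum_left:
  assumes "\<And>i. i \<in> I \<Longrightarrow> u i \<in> fib (Ebun D) x" "w \<in> fib (Ebun D) x"
  shows "prd D x (\<Sum>i\<in>I. c i *\<^sub>R u i) w = (\<Sum>i\<in>I. c i *\<^sub>R prd D x (u i) w)"
  using assms(1)
proof (induction I rule: infinite_finite_induct)
  case (insert i I)
  then have "(\<Sum>i\<in>I. c i *\<^sub>R u i) \<in> fib (Ebun D) x"
    by (intro subspace_sum[OF E.fib_subspace] subspace_scale[OF E.fib_subspace]) auto
  then show ?case
    using insert prd_linear_left[of "u i" x "\<Sum>i\<in>I. c i *\<^sub>R u i" w "c i"] assms(2) by simp
qed (auto simp: prd_zero_left assms(2))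

lemma prdS_Gam: "e1 \<in> GamE D \<Longrightarrow> e2 \<in> GamE D \<Longrightarrow> prdS D e1 e2 \<in> GamL D"
  and brk_Gam: "e1 \<in> GamE D \<Longrightarrow> e2 \<in> GamE D \<Longrightarrow> brk D e1 e2 \<in> GamE D"
  using cj by (simp_all add: courant_jacobi_def)

lemma brk_linear:
  assumes "e1 \<in> GamE D" "e2 \<in> GamE D" "e3 \<in> GamE D"
  shows "brk D (\<lambda>x. a *\<^sub>R e1 x + e2 x) e3 = (\<lambda>x. a *\<^sub>R brk D e1 e3 x + brk D e2 e3 x)"
    "brk D e3 (\<lambda>x. a *\<^sub>R e1 x + e2 x) = (\<lambda>x. a *\<^sub>R brk D e3 e1 x + brk D e3 e2 x)"
  using assms cj by (simp_all add: courant_jacobi_def)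

lemma brk_add:
  assumes "e1 \<in> GamE D" "e2 \<in> GamE D" "e3 \<in> GamE D"
  shows "brk D (\<lambda>x. e1 x + e2 x) e3 = (\<lambda>x. brk D e1 e3 x + brk D e2 e3 x)"
    "brk D e3 (\<lambda>x. e1 x + e2 x) = (\<lambda>x. brk D e3 e1 x + brk D e3 e2 x)"
  using brk_linear[OF assms, of 1] by simp_all

lemma nab_linear: "u \<in> fib (Ebun D) x \<Longrightarrow> v \<in> fib (Ebun D) x \<Longrightarrow> \<mu> \<in> GamL D \<Longrightarrow>
    nab D x (a *\<^sub>R u + v) \<mu> = a *\<^sub>R nab D x u \<mu> + nab D x v \<mu>"
  using cj by (simp add: courant_jacobi_def)

lemma nabS_derivation: "e \<in> GamE D \<Longrightarrow> derivation_of (atl D) (Lbun D) (nabS D e)"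
  using cj by (simp add: courant_jacobi_def)

lemma nab_zero: "\<mu> \<in> GamL D \<Longrightarrow> nab D x 0 \<mu> = 0"
  using nab_linear[of 0 x 0 \<mu> 1] subspace_0[OF E.fib_subspace, of x] by simp

lemma nab_sum:
  assumes "\<And>i. i \<in> I \<Longrightarrow> u i \<in> fib (Ebun D) x" "\<mu> \<in> GamL D"
  shows "nab D x (\<Sum>i\<in>I. c i *\<^sub>R u i) \<mu> = (\<Sum>i\<in>I. c i *\<^sub>R nab D x (u i) \<mu>)"
  using assms(1)
proof (induction I rule: infinite_finite_induct)
  case (insert i I)
  then have "(\<Sum>i\<in>I. c i *\<^sub>R u i) \<in> fib (Ebun D) x"
    by (intro subspace_sum[OF E.fib_subspace] subspace_scale[OF E.fib_subspace]) auto
  then show ?case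
    using insert nab_linear[of "u i" x "\<Sum>i\<in>I. c i *\<^sub>R u i" \<mu> "c i"] assms(2) by simp
qed (auto simp: nab_zero assms(2))

text \<open>Extending u to a section makes the operator of a single vector the value at x of a
  global derivation, so the results on derivations apply to it.\<close>

lemma nab_derivation:
  assumes "u \<in> fib (Ebun D) x"
  obtains \<Delta> where "derivation_of (atl D) (Lbun D) \<Delta>" "\<And>\<mu>. nab D x u \<mu> = \<Delta> \<mu> x"
proof -
  obtain e where "e \<in> GamE D" "e x = u" using E.Gam_extend[OF assms] by blast
  then show ?thesis using nabS_derivation by (intro that[of "nabS D e"]) (auto simp: nabS_def)
qed

lemma nab_section_linear:
  assumes "u \<in> fib (Ebun D) x" "s \<in> GamL D" "r \<in> GamL D"
  shows "nab D x u (\<lambda>y. a *\<^sub>R s y + r y) = a *\<^sub>R nab D x u s + nab D x u r"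
proof -
  obtain \<Delta> where "derivation_of (atl D) (Lbun D) \<Delta>" "\<And>\<mu>. nab D x u \<mu> = \<Delta> \<mu> x"
    using nab_derivation[OF assms(1)] by metis
  then show ?thesis using L.derivation_linear[OF _ assms(2,3)] by simp
qed

lemma nab_section_zero: "u \<in> fib (Ebun D) x \<Longrightarrow> nab D x u (\<lambda>y. 0) = 0"
  using nab_section_linear[OF _ L.Gam_zero L.Gam_zero, of u x 1] by simp

lemma nab_fib: "u \<in> fib (Ebun D) x \<Longrightarrow> \<mu> \<in> GamL D \<Longrightarrow> nab D x u \<mu> \<in> fib (Lbun D) x"
  by (metis nab_derivation L.derivation_Gam L.Gam_fib)

text \<open>For sections of a Lagrangian subbundle, vanishing of this expression is involutivity. It
  depends on the third entry through its value at x only, while the first two enter as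
  sections.\<close>

definition tri :: "('m \<Rightarrow> 'v) \<Rightarrow> ('m \<Rightarrow> 'v) \<Rightarrow> ('m \<Rightarrow> 'v) \<Rightarrow> 'm \<Rightarrow> 'l" where
  "tri e1 e2 e3 x = prd D x (brk D e1 e2 x) (e3 x)"

lemma compat:
  assumes "e1 \<in> GamE D" "e2 \<in> GamE D"
  shows "tri e1 e2 e2 x = tri e2 e2 e1 x" "nab D x (e1 x) (prdS D e2 e2) = 2 *\<^sub>R tri e1 e2 e2 x"
proof -
  have 1: "prdS D (brk D e1 e2) e2 = prdS D e1 (brk D e2 e2)"
    and 2: "nabS D e1 (prdS D e2 e2) = (\<lambda>x. 2 *\<^sub>R prdS D (brk D e1 e2) e2 x)"
    using cj assms by (simp_all add: courant_jacobi_def)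
  show "tri e1 e2 e2 x = tri e2 e2 e1 x"
    using fun_cong[OF 1, of x] prd_sym[of "e1 x" x "brk D e2 e2 x"] assms brk_Gam[OF assms(2,2)] E.Gam_fib
    by (simp add: tri_def prdS_def)
  show "nab D x (e1 x) (prdS D e2 e2) = 2 *\<^sub>R tri e1 e2 e2 x"
    using fun_cong[OF 2, of x] by (simp add: tri_def prdS_def nabS_def)
qed

lemma tri_add:
  assumes "e1 \<in> GamE D" "e2 \<in> GamE D" "e3 \<in> GamE D" "e4 \<in> GamE D"
  shows "tri (\<lambda>x. e1 x + e2 x) e3 e4 x = tri e1 e3 e4 x + tri e2 e3 e4 x"
    "tri e3 (\<lambda>x. e1 x + e2 x) e4 x = tri e3 e1 e4 x + tri e3 e2 e4 x"
    "tri e3 e4 (\<lambda>x. e1 x + e2 x) x = tri e3 e4 e1 x + tri e3 e4 e2 x"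
  using assms brk_Gam E.Gam_fib by (simp_all add: tri_def brk_add prd_add_left prd_add_right)

text \<open>Polarisation in e2 of the compatibility between derivation and product.\<close>

lemma metric:
  assumes e: "e1 \<in> GamE D" "e2 \<in> GamE D" "e3 \<in> GamE D"
  shows "nab D x (e1 x) (prdS D e2 e3) = tri e1 e2 e3 x + tri e1 e3 e2 x"
proof -
  have e23: "(\<lambda>x. e2 x + e3 x) \<in> GamE D" using e by (intro E.Gam_add)
  have fib: "e1 x \<in> fib (Ebun D) x" using e by (simp add: E.Gam_fib)
  note G = prdS_Gam[OF e(2,2)] prdS_Gam[OF e(2,3)] prdS_Gam[OF e(3,3)]
  have "prdS D (\<lambda>x. e2 x + e3 x) (\<lambda>x. e2 x + e3 x) =
      (\<lambda>x. 2 *\<^sub>R prdS D e2 e3 x + (1 *\<^sub>R prdS D e2 e2 x + prdS D e3 e3 x))"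
    using e E.Gam_fib prd_sym[of "e2 _" _ "e3 _"]
    by (auto simp: prdS_def prd_add_left prd_add_right subspace_add[OF E.fib_subspace] scaleR_2)
  then have "nab D x (e1 x) (prdS D (\<lambda>x. e2 x + e3 x) (\<lambda>x. e2 x + e3 x)) =
      2 *\<^sub>R nab D x (e1 x) (prdS D e2 e3) + (1 *\<^sub>R nab D x (e1 x) (prdS D e2 e2) + nab D x (e1 x) (prdS D e3 e3))"
    using nab_section_linear[OF fib G(2), of "\<lambda>x. 1 *\<^sub>R prdS D e2 e2 x + prdS D e3 e3 x" 2]
      nab_section_linear[OF fib G(1,3), of 1] L.Gam_add[OF L.Gam_scale_const[OF G(1), of 1] G(3)] by simp
  moreover have "nab D x (e1 x) (prdS D (\<lambda>x. e2 x + e3 x) (\<lambda>x. e2 x + e3 x)) =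
      2 *\<^sub>R (tri e1 e2 e2 x + tri e1 e2 e3 x + (tri e1 e3 e2 x + tri e1 e3 e3 x))"
    using compat(2)[OF e(1) e23, of x] tri_add[OF e(2,3,1), of "\<lambda>x. e2 x + e3 x" x] tri_add[OF e(2,3,1), of e2 x]
      tri_add[OF e(2,3,1), of e3 x] e e23 by simp
  ultimately have "2 *\<^sub>R nab D x (e1 x) (prdS D e2 e3) = 2 *\<^sub>R (tri e1 e2 e3 x + tri e1 e3 e2 x)"
    using compat(2)[OF e(1,2), of x] compat(2)[OF e(1,3), of x] by (simp add: scaleR_add_right)
  then show ?thesis by simp
qed

text \<open>Polarising the first compatibility condition and applying \<open>metric\<close> shows
  that the symmetric part of the bracket is controlled by the product. In particular the bracket is
  skew up to terms that involve only this product.\<close>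

lemma brk_sym:
  assumes e: "e1 \<in> GamE D" "e2 \<in> GamE D" "e3 \<in> GamE D"
  shows "tri e1 e2 e3 x + tri e2 e1 e3 x = nab D x (e3 x) (prdS D e1 e2)"
proof -
  have e12: "(\<lambda>x. e1 x + e2 x) \<in> GamE D" using e by (intro E.Gam_add)
  have "tri e3 (\<lambda>x. e1 x + e2 x) (\<lambda>x. e1 x + e2 x) x = tri (\<lambda>x. e1 x + e2 x) (\<lambda>x. e1 x + e2 x) e3 x"
    by (rule compat(1)[OF e(3) e12])
  then have "tri e3 e1 e1 x + tri e3 e1 e2 x + (tri e3 e2 e1 x + tri e3 e2 e2 x) =
      tri e1 e1 e3 x + tri e1 e2 e3 x + (tri e2 e1 e3 x + tri e2 e2 e3 x)"
    using tri_add[OF e(1,2,3) e12] tri_add[OF e(1,2,3) e(1)] tri_add[OF e(1,2,3) e(2)]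
      tri_add(1)[OF e(1,2) e12 e(3)] tri_add(2)[OF e(1,2,1,3)] tri_add(2)[OF e(1,2,2,3)] by simp
  then have "tri e1 e2 e3 x + tri e2 e1 e3 x = tri e3 e1 e2 x + tri e3 e2 e1 x"
    using compat(1)[OF e(3,1), of x] compat(1)[OF e(3,2), of x] by (simp add: algebra_simps)
  then show ?thesis using metric[OF e(3,1,2), of x] by simp
qed

lemma subbundle_fib: "subbundle (atl D) (Ebun D) A \<Longrightarrow> u \<in> A x \<Longrightarrow> u \<in> fib (Ebun D) x"
  by (auto simp: subbundle_def)

lemma GamSub_iff: "s \<in> GamSub D A \<longleftrightarrow> s \<in> GamE D \<and> (\<forall>x. s x \<in> A x)"
  by (simp add: GamSub_def)

end

section \<open>Complementary Lagrangian subbundles and the Maurer--Cartan equation\<close>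

text \<open>Linearity on a fibre only, because the ambient vector space is a mere container for all
  fibres.\<close>

definition fibre_linear :: "'v::real_vector set \<Rightarrow> ('v \<Rightarrow> 'w::real_vector) \<Rightarrow> bool" where
  "fibre_linear S f \<longleftrightarrow> (\<forall>u\<in>S. \<forall>v\<in>S. \<forall>c. f (c *\<^sub>R u + v) = c *\<^sub>R f u + f v)"

lemma fibre_linear_sum:
  assumes "subspace S" "fibre_linear S f" "\<And>i. i \<in> I \<Longrightarrow> u i \<in> S"
  shows "f (\<Sum>i\<in>I. c i *\<^sub>R u i) = (\<Sum>i\<in>I. c i *\<^sub>R f (u i))"
proof -
  have "0 \<in> S" using assms(1) by (rule subspace_0)
  then have "f (1 *\<^sub>R 0 + 0) = 1 *\<^sub>R f 0 + f 0" using assms(2) unfolding fibre_linear_def by blast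
  then have f0: "f 0 = 0" by simp
  show ?thesis
    using assms(3)
  proof (induction I rule: infinite_finite_induct)
    case (insert i I)
    have "(\<Sum>i\<in>I. c i *\<^sub>R u i) \<in> S"
      using insert.prems by (intro subspace_sum[OF assms(1)] subspace_scale[OF assms(1)]) auto
    then have "f (c i *\<^sub>R u i + (\<Sum>i\<in>I. c i *\<^sub>R u i)) = c i *\<^sub>R f (u i) + f (\<Sum>i\<in>I. c i *\<^sub>R u i)"
      using assms(2) insert.prems unfolding fibre_linear_def by auto
    then show ?case using insert by simp
  qed (simp_all add: f0)
qed

lemma alt_formsD:
  assumes "f \<in> alt_forms S W k"
  shows "f vs \<noteq> 0 \<Longrightarrow> set vs \<subseteq> S \<and> int (length vs) = k"
    and "set vs \<subseteq> S \<Longrightarrow> f vs \<in> W"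
    and "u \<in> S \<Longrightarrow> v \<in> S \<Longrightarrow> set vs \<subseteq> S \<Longrightarrow> i < length vs \<Longrightarrow>
      f (vs[i := a *\<^sub>R u + v]) = a *\<^sub>R f (vs[i := u]) + f (vs[i := v])"
    and "set vs \<subseteq> S \<Longrightarrow> i < j \<Longrightarrow> j < length vs \<Longrightarrow> vs ! i = vs ! j \<Longrightarrow> f vs = 0"
  using assms unfolding alt_forms_def by blast+

lemma alt_form1_linear: "f \<in> alt_forms S W k \<Longrightarrow> fibre_linear S (\<lambda>a. f [a])"
  unfolding fibre_linear_def using alt_formsD(3)[of f S W k _ _ "[_]" 0] by fastforce

lemma alt_form2_linear_right: "f \<in> alt_forms S W k \<Longrightarrow> u \<in> S \<Longrightarrow> fibre_linear S (\<lambda>a. f [u, a])"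
  unfolding fibre_linear_def using alt_formsD(3)[of f S W k _ _ "[u, u]" "Suc 0"] by simp

lemma alt_form2_linear_left: "f \<in> alt_forms S W k \<Longrightarrow> u \<in> S \<Longrightarrow> fibre_linear S (\<lambda>a. f [a, u])"
  unfolding fibre_linear_def using alt_formsD(3)[of f S W k _ _ "[u, u]" 0] by simp

lemma alt_form2_skew:
  assumes f: "f \<in> alt_forms S W k" and "subspace S" "u \<in> S" "v \<in> S"
  shows "f [u, v] = - f [v, u]"
proof -
  have uv: "u + v \<in> S" using assms by (simp add: subspace_add)
  have z: "f [w, w] = 0" if "w \<in> S" for w
    using alt_formsD(4)[OF f, of "[w, w]" 0 1] that by simp
  have "f [1 *\<^sub>R u + v, u + v] = 1 *\<^sub>R f [u, u + v] + f [v, u + v]"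
    using alt_form2_linear_left[OF f uv] assms(3,4) unfolding fibre_linear_def by blast
  moreover have "f [u, 1 *\<^sub>R u + v] = 1 *\<^sub>R f [u, u] + f [u, v]" "f [v, 1 *\<^sub>R u + v] = 1 *\<^sub>R f [v, u] + f [v, v]"
    using alt_form2_linear_right[OF f] assms(3,4) unfolding fibre_linear_def by blast+
  ultimately have "f [u, v] + f [v, u] = 0"
    using z[OF uv] z[OF assms(3)] z[OF assms(4)] by simp
  then show ?thesis by (simp add: eq_neg_iff_add_eq_0)
qed

section \<open>The duality between A and B\<close>

locale dj_pair = cj_algebroid D
  for D :: "('m::{t2_space, second_countable_topology}, 'e::real_normed_vector,
      'v::real_vector, 'l::real_normed_vector) cj_data" +
  fixes A B :: "'m \<Rightarrow> 'v set"
  assumes dj: "dirac_jacobi D A" and adj: "almost_dirac_jacobi D B" and compl: "complementary D A B"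
begin

lemma adjA: "almost_dirac_jacobi D A"
  using dj by (simp add: dirac_jacobi_def)

lemma A_sub: "subbundle (atl D) (Ebun D) A" and B_sub: "subbundle (atl D) (Ebun D) B"
  using adjA adj by (simp_all add: almost_dirac_jacobi_def)

lemmas A_fib = subbundle_fib[OF A_sub] and B_fib = subbundle_fib[OF B_sub]
lemmas A_subspace = E.subbundle_subspace[OF A_sub] and B_subspace = E.subbundle_subspace[OF B_sub]

lemma A_perp: "u \<in> A x \<longleftrightarrow> u \<in> fib (Ebun D) x \<and> (\<forall>a\<in>A x. prd D x u a = 0)"
proof -
  have "A x = {u \<in> fib (Ebun D) x. \<forall>a\<in>A x. prd D x u a = 0}"
    using adjA unfolding almost_dirac_jacobi_def by blast
  then show ?thesis by blast
qed

lemma B_perp: "u \<in> B x \<longleftrightarrow> u \<in> fib (Ebun D) x \<and> (\<forall>a\<in>B x. prd D x u a = 0)"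
proof -
  have "B x = {u \<in> fib (Ebun D) x. \<forall>a\<in>B x. prd D x u a = 0}"
    using adj unfolding almost_dirac_jacobi_def by blast
  then show ?thesis by blast
qed

lemma A_isotropic: "u \<in> A x \<Longrightarrow> v \<in> A x \<Longrightarrow> prd D x u v = 0"
  and B_isotropic: "b \<in> B x \<Longrightarrow> b' \<in> B x \<Longrightarrow> prd D x b b' = 0"
  using A_perp B_perp by blast+

lemma A_Int_B: "u \<in> A x \<Longrightarrow> u \<in> B x \<Longrightarrow> u = 0"
  using compl unfolding complementary_def by blast

text \<open>A vector orthogonal to A lies in A because A is Lagrangian, and A meets B only in
  0.\<close>

lemma pairing_nondegenerate_B: "b \<in> B x \<Longrightarrow> (\<And>a. a \<in> A x \<Longrightarrow> prd D x b a = 0) \<Longrightarrow> b = 0"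
  using A_Int_B A_perp B_fib by metis

lemma pairing_nondegenerate_A: "a \<in> A x \<Longrightarrow> (\<And>b. b \<in> B x \<Longrightarrow> prd D x b a = 0) \<Longrightarrow> a = 0"
  using A_Int_B B_perp A_fib B_fib prd_sym by metis

lemma prd_linear_B: "b \<in> fib (Ebun D) x \<Longrightarrow> fibre_linear (A x) (prd D x b)"
  using A_fib prd_linear_right by (simp add: fibre_linear_def)

lemma line_frame:
  obtains l N where "l \<in> GamL D" "open N" "x \<in> N" "\<And>y. y \<in> N \<Longrightarrow> basis_list (fib (Lbun D) y) [l y]"
proof -
  obtain as N where as: "open N" "x \<in> N" "set as \<subseteq> GamL D" "\<And>y. y \<in> N \<Longrightarrow> basis_list (fib (Lbun D) y) (map (\<lambda>s. s y) as)"
    by (rule L.fib_global_frame[of x]) (rule that; assumption)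
  have "dim (fib (Lbun D) x) = 1"
    using cj by (simp add: courant_jacobi_def line_bundle_def)
  moreover have "dim (fib (Lbun D) x) = length as"
    using as(4)[OF as(2)] dim_span_eq_card_independent[of "set (map (\<lambda>s. s x) as)"]
    by (simp add: basis_list_def distinct_card[of "map (\<lambda>s. s x) as", simplified])
  ultimately obtain l where l: "as = [l]" by (auto simp: length_Suc_conv)
  show ?thesis by (rule that[of l N]) (use as l in auto)
qed

text \<open>L has no preferred generator; a chosen generator l of a fibre turns identities in that
  line into identities of real numbers.\<close>

definition lc :: "'l \<Rightarrow> 'l \<Rightarrow> real" where
  "lc l v = list_coeff [l] v 0"

lemma lc_scale: "basis_list (fib (Lbun D) x) [l] \<Longrightarrow> v \<in> fib (Lbun D) x \<Longrightarrow> lc l v *\<^sub>R l = v"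
  using list_coeff_sum[of "fib (Lbun D) x" "[l]" v] by (simp add: lc_def)

lemma lc_smooth:
  assumes "open N" "l \<in> GamL D" "\<And>y. y \<in> N \<Longrightarrow> basis_list (fib (Lbun D) y) [l y]" "s \<in> GamL D"
  shows "smooth_fun_on (atl D) N (\<lambda>y. lc (l y) (s y))"
  using L.section_coeff_smooth[of N "[l]" "fib (Lbun D)" s 0] assms L.Gam_smooth_section_on L.Gam_fib
  by (simp add: lc_def)

text \<open>In bases of A and B and a generator of L the pairing becomes a real matrix.
  Nondegeneracy on both sides gives trivial kernels for rows and columns, so the system for b is
  solvable.\<close>

lemma pairing_surj:
  assumes f: "fibre_linear (A x) f" "\<And>a. a \<in> A x \<Longrightarrow> f a \<in> fib (Lbun D) x"
  shows "\<exists>b\<in>B x. \<forall>a\<in>A x. prd D x b a = f a"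
proof -
  obtain sa where "basis_list (A x) (map (\<lambda>s. s x) sa)"
    by (rule E.subbundle_global_frame[OF A_sub, of x]) blast
  then obtain as where as: "basis_list (A x) as" by blast
  obtain sb where "basis_list (B x) (map (\<lambda>s. s x) sb)"
    by (rule E.subbundle_global_frame[OF B_sub, of x]) blast
  then obtain bs where bs: "basis_list (B x) bs" by blast
  obtain sl where l': "basis_list (fib (Lbun D) x) [sl x]"
    by (rule line_frame[of x]) blast
  then obtain l where l: "basis_list (fib (Lbun D) x) [l]" by blast
  have asA: "as ! i \<in> A x" if "i < length as" for i
    using as that unfolding basis_list_def by (metis nth_mem span_base)
  have bsB: "bs ! j \<in> B x" if "j < length bs" for j
    using bs that unfolding basis_list_def by (metis nth_mem span_base)
  define c where "c j i = lc l (prd D x (bs ! j) (as ! i))" for j i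
  have c: "prd D x (bs ! j) (as ! i) = c j i *\<^sub>R l" if "j < length bs" "i < length as" for i j
    unfolding c_def using lc_scale[OF l] prd_fib B_fib[OF bsB[OF that(1)]] A_fib[OF asA[OF that(2)]] by simp
  have l0: "k = 0" if "k *\<^sub>R l = 0" for k
    using basis_list_independent[OF l, of "\<lambda>_. k" 0] that by simp
  have ext: "g a = h a" if "fibre_linear (A x) g" "fibre_linear (A x) h"
    "\<And>i. i < length as \<Longrightarrow> g (as ! i) = h (as ! i)" "a \<in> A x" for g h :: "'v \<Rightarrow> 'l" and a
    using fibre_linear_sum[OF A_subspace that(1), of "{..<length as}" "\<lambda>i. as ! i" "list_coeff as a"]
      fibre_linear_sum[OF A_subspace that(2), of "{..<length as}" "\<lambda>i. as ! i" "list_coeff as a"]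
      list_coeff_sum[OF as that(4)] that(3) asA by simp
  have comb_left: "prd D x (\<Sum>j<length bs. d j *\<^sub>R bs ! j) (as ! i) = (\<Sum>j<length bs. d j * c j i) *\<^sub>R l"
    if "i < length as" for d i
    using prd_sum_left[of "{..<length bs}" "\<lambda>j. bs ! j" x "as ! i" d] B_fib[OF bsB] A_fib[OF asA[OF that]] c that
    by (simp add: scaleR_sum_left)
  have lin: "fibre_linear (A x) (\<lambda>a. 0::'l)" by (simp add: fibre_linear_def)
  have combB: "(\<Sum>j<length bs. d j *\<^sub>R bs ! j) \<in> B x" for d
    by (rule basis_list_sum_in[OF bs])
  have combA: "(\<Sum>i<length as. d i *\<^sub>R as ! i) \<in> A x" for d
    by (rule basis_list_sum_in[OF as])
  have "\<exists>d. \<forall>i<length as. (\<Sum>j<length bs. d j * c j i) = lc l (f (as ! i))"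
  proof (rule nondegenerate_matrix_surj[OF as bs])
    fix d j assume z: "\<And>i. i < length as \<Longrightarrow> (\<Sum>j<length bs. d j * c j i) = 0" and j: "j < length bs"
    have "(\<Sum>j<length bs. d j *\<^sub>R bs ! j) = 0"
    proof (rule pairing_nondegenerate_B[OF combB])
      fix a assume a: "a \<in> A x"
      show "prd D x (\<Sum>j<length bs. d j *\<^sub>R bs ! j) a = 0"
        by (rule ext[OF prd_linear_B[OF B_fib[OF combB]] lin _ a]) (simp add: comb_left z)
    qed
    then show "d j = 0" using basis_list_independent[OF bs] j by blast
  next
    fix d i assume z: "\<And>j. j < length bs \<Longrightarrow> (\<Sum>i<length as. d i * c j i) = 0" and i: "i < length as"
    have bz: "prd D x (bs ! j) (\<Sum>i<length as. d i *\<^sub>R as ! i) = 0" if "j < length bs" for j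
      using fibre_linear_sum[OF A_subspace prd_linear_B[OF B_fib[OF bsB[OF that]]], of "{..<length as}" "\<lambda>i. as ! i" d]
        asA c[OF that] z[OF that] by (simp flip: scaleR_sum_left)
    have "(\<Sum>i<length as. d i *\<^sub>R as ! i) = 0"
    proof (rule pairing_nondegenerate_A[OF combA])
      fix b assume b: "b \<in> B x"
      show "prd D x b (\<Sum>i<length as. d i *\<^sub>R as ! i) = 0"
        using prd_sum_left[of "{..<length bs}" "\<lambda>j. bs ! j" x "\<Sum>i<length as. d i *\<^sub>R as ! i" "list_coeff bs b"]
          B_fib[OF bsB] A_fib[OF combA] bz by (simp add: list_coeff_sum[OF bs b])
    qed
    then show "d i = 0" using basis_list_independent[OF as] i by blast
  qed
  then obtain d where d: "\<And>i. i < length as \<Longrightarrow> (\<Sum>j<length bs. d j * c j i) = lc l (f (as ! i))" by blast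
  let ?b = "\<Sum>j<length bs. d j *\<^sub>R bs ! j"
  have "prd D x ?b a = f a" if "a \<in> A x" for a
    by (rule ext[OF prd_linear_B[OF B_fib[OF combB]] f(1) _ that])
      (simp add: comb_left d lc_scale[OF l f(2)[OF asA]])
  then show ?thesis using combB by blast
qed

lemma unflat_eqI:
  assumes "b \<in> B x" "\<And>a. a \<in> A x \<Longrightarrow> prd D x b a = f a"
  shows "unflat D A B x f = b"
  unfolding unflat_def
proof (rule the_equality)
  show "b \<in> B x \<and> (\<forall>a\<in>A x. prd D x b a = f a)" using assms by blast
  fix b' assume b': "b' \<in> B x \<and> (\<forall>a\<in>A x. prd D x b' a = f a)"
  have "(-1) *\<^sub>R b + b' = 0"
  proof (rule pairing_nondegenerate_B)
    show "(-1) *\<^sub>R b + b' \<in> B x"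
      using assms(1) b' by (intro subspace_add[OF B_subspace] subspace_scale[OF B_subspace]) auto
    show "prd D x ((-1) *\<^sub>R b + b') a = 0" if "a \<in> A x" for a
      using prd_linear_left[of b x b' a "-1"] assms b' B_fib A_fib that by simp
  qed
  then show "b' = b" by simp
qed

lemma unflat_works:
  assumes "fibre_linear (A x) f" "\<And>a. a \<in> A x \<Longrightarrow> f a \<in> fib (Lbun D) x"
  shows "unflat D A B x f \<in> B x" "a \<in> A x \<Longrightarrow> prd D x (unflat D A B x f) a = f a"
  using pairing_surj[OF assms] unflat_eqI by metis+

lemma OmL_alt: "\<alpha> \<in> OmL D A k \<Longrightarrow> \<alpha> x \<in> alt_forms (A x) (fib (Lbun D) x) k"
  and OmL_smooth: "\<alpha> \<in> OmL D A k \<Longrightarrow> set Xs \<subseteq> GamSub D A \<Longrightarrow> (\<lambda>x. \<alpha> x (map (\<lambda>X. X x) Xs)) \<in> GamL D"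
  by (simp_all add: OmL_def)

lemma unflatS_works:
  assumes "\<alpha> \<in> OmL D A 1"
  shows "unflatS D A B \<alpha> x \<in> B x" "a \<in> A x \<Longrightarrow> prd D x (unflatS D A B \<alpha> x) a = \<alpha> x [a]"
  unfolding unflatS_def
  using unflat_works[OF alt_form1_linear[OF OmL_alt[OF assms]], of x] alt_formsD(2)[OF OmL_alt[OF assms], of "[_]" x]
  by simp_all

text \<open>Smoothness of the inverse of the bundle map from B to the dual of A. The coefficients of
  the section in a frame of B solve a system with smooth entries and trivial kernel.\<close>

lemma unflatS_Gam:
  assumes \<alpha>: "\<alpha> \<in> OmL D A 1"
  shows "unflatS D A B \<alpha> \<in> GamSub D B"
proof -
  let ?b = "unflatS D A B \<alpha>"
  have "smooth_section_on (atl D) (Ebun D) UNIV ?b"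
  proof (rule E.smooth_section_on_local)
    fix x
    obtain as N1 where as: "open N1" "x \<in> N1" "set as \<subseteq> GamE D" "\<And>a y. a \<in> set as \<Longrightarrow> a y \<in> A y"
      "\<And>y. y \<in> N1 \<Longrightarrow> basis_list (A y) (map (\<lambda>s. s y) as)"
      by (rule E.subbundle_global_frame[OF A_sub, of x]) (rule that; assumption)
    obtain bs N2 where bs: "open N2" "x \<in> N2" "set bs \<subseteq> GamE D" "\<And>a y. a \<in> set bs \<Longrightarrow> a y \<in> B y"
      "\<And>y. y \<in> N2 \<Longrightarrow> basis_list (B y) (map (\<lambda>s. s y) bs)"
      by (rule E.subbundle_global_frame[OF B_sub, of x]) (rule that; assumption)
    obtain l N3 where l: "l \<in> GamL D" "open N3" "x \<in> N3" "\<And>y. y \<in> N3 \<Longrightarrow> basis_list (fib (Lbun D) y) [l y]"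
      by (rule line_frame[of x]) (rule that; assumption)
    let ?W = "N1 \<inter> N2 \<inter> N3"
    have W: "open ?W" "x \<in> ?W" using as(1,2) bs(1,2) l(2,3) by auto
    have lb: "basis_list (fib (Lbun D) y) [l y]" if "y \<in> ?W" for y using l(4) that by blast
    have asG: "as ! i \<in> GamSub D A" if "i < length as" for i
      using as(3,4) nth_mem[OF that] by (auto simp: GamSub_iff)
    have bsG: "bs ! j \<in> GamSub D B" if "j < length bs" for j
      using bs(3,4) nth_mem[OF that] by (auto simp: GamSub_iff)
    define c where "c j y = list_coeff (map (\<lambda>s. s y) bs) (?b y) j" for j y
    have bc: "?b y = (\<Sum>j<length bs. c j y *\<^sub>R (bs ! j) y)" if "y \<in> ?W" for y
      using list_coeff_sum[OF bs(5) unflatS_works(1)[OF \<alpha>], of y] that by (simp add: c_def)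
    have comb: "prd D y (\<Sum>j<length bs. d j *\<^sub>R (bs ! j) y) ((as ! i) y) =
        (\<Sum>j<length bs. d j * lc (l y) (prdS D (bs ! j) (as ! i) y)) *\<^sub>R l y"
      if y: "y \<in> ?W" and i: "i < length as" for y d i
    proof -
      have fib: "(as ! i) y \<in> fib (Ebun D) y" "\<And>j. j < length bs \<Longrightarrow> (bs ! j) y \<in> fib (Ebun D) y"
        using asG[OF i] bsG by (auto simp: GamSub_iff E.Gam_fib)
      have "prdS D (bs ! j) (as ! i) y = lc (l y) (prdS D (bs ! j) (as ! i) y) *\<^sub>R l y" if "j < length bs" for j
        using lc_scale[OF lb[OF y]] prd_fib fib that by (simp add: prdS_def)
      then have "(\<Sum>j<length bs. d j *\<^sub>R prdS D (bs ! j) (as ! i) y) =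
          (\<Sum>j<length bs. d j *\<^sub>R (lc (l y) (prdS D (bs ! j) (as ! i) y) *\<^sub>R l y))"
        by (intro sum.cong) auto
      then show ?thesis
        using prd_sum_left[of "{..<length bs}" "\<lambda>j. (bs ! j) y" y "(as ! i) y" d] fib
        by (simp add: prdS_def scaleR_sum_left)
    qed
    have l0: "k = 0" if "k *\<^sub>R l y = 0" "y \<in> ?W" for k y
      using basis_list_independent[OF lb[OF that(2)], of "\<lambda>_. k" 0] that(1) by simp
    \<comment> \<open>The unknowns are indexed by the frame of B, the equations by the frame of A;
      the two frames play the parts of vectors and components in
      \<open>smooth_coefficients\<close>.\<close>
    have csm: "smooth_fun_on (atl D) ?W (c j)" if j: "j < length bs" for j
    proof (rule E.smooth_coefficients[OF W(1), where n = "length bs" and m = "length as" and c = c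
          and v = "\<lambda>j i y. lc (l y) (prdS D (bs ! j) (as ! i) y)" and s = "\<lambda>i y. lc (l y) (\<alpha> y [(as ! i) y])"])
      show "smooth_fun_on (atl D) ?W (\<lambda>y. lc (l y) (prdS D (bs ! j) (as ! i) y))"
        if "j < length bs" "i < length as" for j i
        by (rule lc_smooth[OF W(1) l(1) lb prdS_Gam])
          (use asG[OF that(2)] bsG[OF that(1)] in \<open>auto simp: GamSub_iff\<close>)
      show "smooth_fun_on (atl D) ?W (\<lambda>y. lc (l y) (\<alpha> y [(as ! i) y]))" if "i < length as" for i
        by (rule lc_smooth[OF W(1) l(1) lb]) (use OmL_smooth[OF \<alpha>, of "[as ! i]"] asG[OF that] in auto)
      show "d j = 0" if y: "y \<in> ?W" and z: "\<And>i. i < length as \<Longrightarrow> (\<Sum>j<length bs. d j * lc (l y) (prdS D (bs ! j) (as ! i) y)) = 0"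
        and j: "j < length bs" for y d j
      proof -
        let ?z = "\<Sum>j<length bs. d j *\<^sub>R (bs ! j) y"
        have yb: "y \<in> N2" and ya: "y \<in> N1" using y by auto
        have zB: "?z \<in> B y" using basis_list_sum_in[OF bs(5)[OF yb], of d] by simp
        have "?z = 0"
        proof (rule pairing_nondegenerate_B[OF zB])
          fix a assume a: "a \<in> A y"
          have eqa: "(\<Sum>i<length as. list_coeff (map (\<lambda>s. s y) as) a i *\<^sub>R (as ! i) y) = a"
            using list_coeff_sum[OF as(5)[OF ya] a] by simp
          have "prd D y ?z (\<Sum>i<length as. list_coeff (map (\<lambda>s. s y) as) a i *\<^sub>R (as ! i) y) =
              (\<Sum>i<length as. list_coeff (map (\<lambda>s. s y) as) a i *\<^sub>R prd D y ?z ((as ! i) y))"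
            by (rule fibre_linear_sum[OF A_subspace prd_linear_B[OF B_fib[OF zB]]]) (use as(4) in simp)
          then have "prd D y ?z a = (\<Sum>i<length as. list_coeff (map (\<lambda>s. s y) as) a i *\<^sub>R prd D y ?z ((as ! i) y))"
            by (simp only: eqa)
          also have "\<dots> = 0" using comb[OF y, of _ d] z by simp
          finally show "prd D y ?z a = 0" .
        qed
        then show "d j = 0"
          using basis_list_independent[OF bs(5)[OF yb], of d j] j by simp
      qed
      show "lc (l y) (\<alpha> y [(as ! i) y]) = (\<Sum>j<length bs. c j y * lc (l y) (prdS D (bs ! j) (as ! i) y))"
        if y: "y \<in> ?W" and i: "i < length as" for y i
      proof -
        have aA: "(as ! i) y \<in> A y" using as(4) i by simp
        have "\<alpha> y [(as ! i) y] = (\<Sum>j<length bs. c j y * lc (l y) (prdS D (bs ! j) (as ! i) y)) *\<^sub>R l y"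
          using comb[OF y i, of "\<lambda>j. c j y"] unflatS_works(2)[OF \<alpha> aA] bc[OF y] by simp
        then show ?thesis
          using list_coeff_unique[OF lb[OF y], of "\<alpha> y [(as ! i) y]" "\<lambda>_. \<Sum>j<length bs. c j y * lc (l y) (prdS D (bs ! j) (as ! i) y)" 0]
          by (simp add: lc_def)
      qed
    qed (use j in auto)
    have "smooth_section_on (atl D) (Ebun D) ?W (\<lambda>y. \<Sum>j<length bs. c j y *\<^sub>R (bs ! j) y)"
      using csm bsG by (intro E.smooth_section_on_sum[OF W(1)] E.smooth_section_on_scale[OF W(1)] E.Gam_smooth_section_on)
        (auto simp: GamSub_iff)
    then have "smooth_section_on (atl D) (Ebun D) ?W ?b"
      by (rule E.smooth_section_on_cong[OF W(1), rotated]) (simp add: bc)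
    then show "\<exists>N. open N \<and> x \<in> N \<and> smooth_section_on (atl D) (Ebun D) N ?b"
      using W by blast
  qed
  then show ?thesis
    using unflatS_works(1)[OF \<alpha>] by (simp add: GamSub_iff E.Gam_iff)
qed

lemma GamSub_A_extend: "u \<in> A x \<Longrightarrow> \<exists>X. X \<in> GamSub D A \<and> X x = u"
  using E.subbundle_extend[OF A_sub] by (fastforce simp: GamSub_iff)

lemma extend_vec: "u \<in> A x \<Longrightarrow> extend_vec D A x u \<in> GamSub D A \<and> extend_vec D A x u x = u"
  unfolding extend_vec_def by (rule someI_ex[OF GamSub_A_extend])

lemma brk_A: "\<xi> \<in> GamSub D A \<Longrightarrow> \<zeta> \<in> GamSub D A \<Longrightarrow> brk D \<xi> \<zeta> \<in> GamSub D A"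
  using dj by (simp add: dirac_jacobi_def)

section \<open>Sections of the graph of a 2-form and the Maurer--Cartan equation\<close>

definition contr :: "('m, 'v, 'l) form \<Rightarrow> ('m \<Rightarrow> 'v) \<Rightarrow> ('m, 'v, 'l) form" where
  "contr \<alpha> \<xi> = (\<lambda>y vs. \<alpha> y (\<xi> y # vs))"

text \<open>The B-component of the section of \<open>Gr D A B \<alpha>\<close> that lies over
  \<xi>.\<close>

definition bsec :: "('m, 'v, 'l) form \<Rightarrow> ('m \<Rightarrow> 'v) \<Rightarrow> 'm \<Rightarrow> 'v" where
  "bsec \<alpha> \<xi> = unflatS D A B (contr \<alpha> \<xi>)"

lemma contr_OmL:
  assumes \<alpha>: "\<alpha> \<in> OmL D A 2" and \<xi>: "\<xi> \<in> GamSub D A"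
  shows "contr \<alpha> \<xi> \<in> OmL D A 1"
proof -
  have "contr \<alpha> \<xi> x \<in> alt_forms (A x) (fib (Lbun D) x) 1" for x
  proof -
    note alt = alt_formsD[OF OmL_alt[OF \<alpha>, of x]]
    have \<xi>x: "\<xi> x \<in> A x" using \<xi> by (simp add: GamSub_iff)
    show ?thesis
      unfolding alt_forms_def contr_def mem_Collect_eq
    proof (intro conjI allI impI ballI)
      fix vs
      show "\<alpha> x (\<xi> x # vs) \<noteq> 0 \<Longrightarrow> set vs \<subseteq> A x" "\<alpha> x (\<xi> x # vs) \<noteq> 0 \<Longrightarrow> int (length vs) = 1"
        using alt(1)[of "\<xi> x # vs"] by auto
      show "set vs \<subseteq> A x \<Longrightarrow> \<alpha> x (\<xi> x # vs) \<in> fib (Lbun D) x"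
        using alt(2)[of "\<xi> x # vs"] \<xi>x by simp
      show "\<alpha> x (\<xi> x # vs[i := a *\<^sub>R u + v]) = a *\<^sub>R \<alpha> x (\<xi> x # vs[i := u]) + \<alpha> x (\<xi> x # vs[i := v])"
        if "u \<in> A x" "v \<in> A x" "set vs \<subseteq> A x \<and> i < length vs" for i a u v
        using alt(3)[of u v "\<xi> x # vs" "Suc i" a] that \<xi>x by simp
      show "\<alpha> x (\<xi> x # vs) = 0" if "set vs \<subseteq> A x \<and> i < j \<and> j < length vs \<and> vs ! i = vs ! j" for i j
        using alt(4)[of "\<xi> x # vs" "Suc i" "Suc j"] that \<xi>x by simp
    qed
  qed
  moreover have "(\<lambda>x. contr \<alpha> \<xi> x (map (\<lambda>X. X x) Xs)) \<in> GamL D" if "set Xs \<subseteq> GamSub D A" for Xs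
    using OmL_smooth[OF \<alpha>, of "\<xi> # Xs"] that \<xi> by (simp add: contr_def)
  ultimately show ?thesis by (simp add: OmL_def)
qed

lemma bsec_Gam: "\<alpha> \<in> OmL D A 2 \<Longrightarrow> \<xi> \<in> GamSub D A \<Longrightarrow> bsec \<alpha> \<xi> \<in> GamSub D B"
  unfolding bsec_def by (rule unflatS_Gam[OF contr_OmL])

lemma bsec_pairing: "\<alpha> \<in> OmL D A 2 \<Longrightarrow> \<xi> \<in> GamSub D A \<Longrightarrow> a \<in> A x \<Longrightarrow> prd D x (bsec \<alpha> \<xi> x) a = \<alpha> x [\<xi> x, a]"
  unfolding bsec_def using unflatS_works(2)[OF contr_OmL] by (simp add: contr_def)

lemma tri_A: "\<xi> \<in> GamSub D A \<Longrightarrow> \<zeta> \<in> GamSub D A \<Longrightarrow> \<kappa> \<in> GamSub D A \<Longrightarrow> tri \<xi> \<zeta> \<kappa> x = 0"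
  using brk_A A_isotropic by (simp add: tri_def GamSub_iff)

lemma prdS_B: "b \<in> GamSub D B \<Longrightarrow> b' \<in> GamSub D B \<Longrightarrow> prdS D b b' = (\<lambda>x. 0)"
  using B_isotropic by (auto simp: GamSub_iff prdS_def)

text \<open>Sections of B are isotropic, so the derivative of their product in \<open>metric\<close>
  is that of the zero section.\<close>

lemma tri_skew_B:
  assumes "e \<in> GamE D" "b \<in> GamSub D B" "b' \<in> GamSub D B"
  shows "tri e b b' x = - tri e b' b x"
  using metric[OF assms(1), of b b' x] assms prdS_B[OF assms(2,3)] nab_section_zero[OF E.Gam_fib[OF assms(1)]]
  by (simp add: GamSub_iff eq_neg_iff_add_eq_0)

text \<open>The third entry enters pointwise, and skew-symmetry carries this over to the second.
  Hence both entries from B may be replaced by sections with the same values at x.\<close>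

lemma tri_cong_B:
  assumes "e \<in> GamE D" "b1 \<in> GamSub D B" "b2 \<in> GamSub D B" "b1' \<in> GamSub D B" "b2' \<in> GamSub D B"
    and "b1 x = b1' x" "b2 x = b2' x"
  shows "tri e b1 b2 x = tri e b1' b2' x"
proof -
  have "tri e b1 b2 x = tri e b1 b2' x" using assms(7) by (simp add: tri_def)
  also have "\<dots> = - tri e b2' b1 x" by (rule tri_skew_B[OF assms(1,2,5)])
  also have "\<dots> = - tri e b2' b1' x" using assms(6) by (simp add: tri_def)
  also have "\<dots> = tri e b1' b2' x" using tri_skew_B[OF assms(1,4,5)] by simp
  finally show ?thesis .
qed

lemma tri_swap_B:
  assumes "b1 \<in> GamSub D B" "b2 \<in> GamSub D B" "b3 \<in> GamSub D B"
  shows "tri b1 b2 b3 x = - tri b2 b1 b3 x"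
  using brk_sym[of b1 b2 b3 x] assms prdS_B[OF assms(1,2)] nab_section_zero[OF B_fib, of "b3 x" x]
  by (simp add: GamSub_iff eq_neg_iff_add_eq_0)

text \<open>The part of the Maurer--Cartan expression that is quadratic in \<open>\<alpha>\<close>; it is half of the bracket of \<open>\<alpha>\<close> with itself.\<close>
definition quad :: "('m, 'v, 'l) form \<Rightarrow> ('m \<Rightarrow> 'v) \<Rightarrow> ('m \<Rightarrow> 'v) \<Rightarrow> ('m \<Rightarrow> 'v) \<Rightarrow> 'm \<Rightarrow> 'l" where
  "quad \<alpha> \<xi>1 \<xi>2 \<xi>3 x =
     nab D x (bsec \<alpha> \<xi>1 x) (\<lambda>y. \<alpha> y [\<xi>2 y, \<xi>3 y]) - nab D x (bsec \<alpha> \<xi>2 x) (\<lambda>y. \<alpha> y [\<xi>1 y, \<xi>3 y])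
     + nab D x (bsec \<alpha> \<xi>3 x) (\<lambda>y. \<alpha> y [\<xi>1 y, \<xi>2 y])
     + tri \<xi>1 (bsec \<alpha> \<xi>2) (bsec \<alpha> \<xi>3) x + tri \<xi>2 (bsec \<alpha> \<xi>3) (bsec \<alpha> \<xi>1) x + tri \<xi>3 (bsec \<alpha> \<xi>1) (bsec \<alpha> \<xi>2) x"

lemma koszul3:
  "koszul D \<alpha> [\<xi>1, \<xi>2, \<xi>3] x =
     nab D x (\<xi>1 x) (\<lambda>y. \<alpha> y [\<xi>2 y, \<xi>3 y]) - nab D x (\<xi>2 x) (\<lambda>y. \<alpha> y [\<xi>1 y, \<xi>3 y])
     + nab D x (\<xi>3 x) (\<lambda>y. \<alpha> y [\<xi>1 y, \<xi>2 y])
     - \<alpha> x [brk D \<xi>1 \<xi>2 x, \<xi>3 x] + \<alpha> x [brk D \<xi>1 \<xi>3 x, \<xi>2 x] - \<alpha> x [brk D \<xi>2 \<xi>3 x, \<xi>1 x]"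
  by (simp add: koszul_def nabS_def eval_nat_numeral nths_Cons lessThan_Suc)

text \<open>The graph is involutive and Lagrangian, so \<open>tri\<close> vanishes on three of its
  sections. Of the eight terms, the one without entries in B vanishes by involutivity of A; one
  entry in B gives the Koszul formula, two give \<open>quad\<close>, and three the cubic
  term.\<close>

lemma Maurer_Cartan:
  assumes \<alpha>: "\<alpha> \<in> OmL D A 2" and gr: "dirac_jacobi D (Gr D A B \<alpha>)"
    and \<xi>: "\<xi>1 \<in> GamSub D A" "\<xi>2 \<in> GamSub D A" "\<xi>3 \<in> GamSub D A"
  shows "koszul D \<alpha> [\<xi>1, \<xi>2, \<xi>3] x + quad \<alpha> \<xi>1 \<xi>2 \<xi>3 x + tri (bsec \<alpha> \<xi>1) (bsec \<alpha> \<xi>2) (bsec \<alpha> \<xi>3) x = 0"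
proof -
  let ?b1 = "bsec \<alpha> \<xi>1" and ?b2 = "bsec \<alpha> \<xi>2" and ?b3 = "bsec \<alpha> \<xi>3"
  note b = bsec_Gam[OF \<alpha> \<xi>(1)] bsec_Gam[OF \<alpha> \<xi>(2)] bsec_Gam[OF \<alpha> \<xi>(3)]
  have G: "\<xi>1 \<in> GamE D" "\<xi>2 \<in> GamE D" "\<xi>3 \<in> GamE D" "?b1 \<in> GamE D" "?b2 \<in> GamE D" "?b3 \<in> GamE D"
    using \<xi> b by (simp_all add: GamSub_iff)
  have in_gr: "(\<lambda>x. \<xi> x + bsec \<alpha> \<xi> x) \<in> GamSub D (Gr D A B \<alpha>)" if "\<xi> \<in> GamSub D A" for \<xi>
    using that bsec_Gam[OF \<alpha> that]
    by (auto simp: GamSub_iff E.Gam_add Gr_def bsec_def unflatS_def contr_def)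
  note s = in_gr[OF \<xi>(1)] in_gr[OF \<xi>(2)] in_gr[OF \<xi>(3)]
  have "brk D (\<lambda>x. \<xi>1 x + ?b1 x) (\<lambda>x. \<xi>2 x + ?b2 x) \<in> GamSub D (Gr D A B \<alpha>)"
    using gr s(1,2) by (simp add: dirac_jacobi_def)
  moreover have "Gr D A B \<alpha> x = {u \<in> fib (Ebun D) x. \<forall>a\<in>Gr D A B \<alpha> x. prd D x u a = 0}"
    using gr unfolding dirac_jacobi_def almost_dirac_jacobi_def by blast
  ultimately have "tri (\<lambda>x. \<xi>1 x + ?b1 x) (\<lambda>x. \<xi>2 x + ?b2 x) (\<lambda>x. \<xi>3 x + ?b3 x) x = 0"
    using s(3) unfolding tri_def GamSub_iff by blast
  moreover have s2: "(\<lambda>x. \<xi>2 x + ?b2 x) \<in> GamE D" "(\<lambda>x. \<xi>3 x + ?b3 x) \<in> GamE D"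
    using s by (simp_all add: GamSub_iff)
  ultimately have expand: "tri \<xi>1 \<xi>2 \<xi>3 x + tri \<xi>1 \<xi>2 ?b3 x + (tri \<xi>1 ?b2 \<xi>3 x + tri \<xi>1 ?b2 ?b3 x)
      + (tri ?b1 \<xi>2 \<xi>3 x + tri ?b1 \<xi>2 ?b3 x + (tri ?b1 ?b2 \<xi>3 x + tri ?b1 ?b2 ?b3 x)) = 0"
    by (simp add: tri_add(1)[OF G(1,4) s2] tri_add(2)[OF G(2,5) G(1) s2(2)] tri_add(2)[OF G(2,5) G(4) s2(2)]
        tri_add(3)[OF G(3,6) G(1,2)] tri_add(3)[OF G(3,6) G(1,5)] tri_add(3)[OF G(3,6) G(4,2)] tri_add(3)[OF G(3,6) G(4,5)])
  have pair: "prdS D (bsec \<alpha> \<xi>) \<zeta> = (\<lambda>y. \<alpha> y [\<xi> y, \<zeta> y])" if "\<xi> \<in> GamSub D A" "\<zeta> \<in> GamSub D A" for \<xi> \<zeta>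
    using bsec_pairing[OF \<alpha> that(1)] that(2) by (simp add: prdS_def GamSub_iff)
  have skew: "\<alpha> x [u, v] = - \<alpha> x [v, u]" if "u \<in> A x" "v \<in> A x" for u v
    by (rule alt_form2_skew[OF OmL_alt[OF \<alpha>] A_subspace that])
  have psym: "prdS D e e' = prdS D e' e" if "e \<in> GamE D" "e' \<in> GamE D" for e e'
    using prd_sym E.Gam_fib[OF that(1)] E.Gam_fib[OF that(2)] by (auto simp: prdS_def)
  \<comment> \<open>The bracket of two sections of A stays in A, so pairing with a B-component just
    evaluates the form.\<close>
  have tb: "tri \<xi> \<zeta> (bsec \<alpha> \<kappa>) x = \<alpha> x [\<kappa> x, brk D \<xi> \<zeta> x]"
    if "\<xi> \<in> GamSub D A" "\<zeta> \<in> GamSub D A" "\<kappa> \<in> GamSub D A" for \<xi> \<zeta> \<kappa>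
    using bsec_pairing[OF \<alpha> that(3), of "brk D \<xi> \<zeta> x" x] brk_A[OF that(1,2)] bsec_Gam[OF \<alpha> that(3)]
      prd_sym[OF A_fib B_fib, of "brk D \<xi> \<zeta> x" x "bsec \<alpha> \<kappa> x"] by (simp add: tri_def GamSub_iff)
  \<comment> \<open>From here on the entries are permuted into the order used by the Koszul formula
    and by \<open>quad\<close>. Each exchange costs a derivative of the pairing of a B-component
    with a section of A, which is a value of \<alpha>.\<close>
  have e1: "tri \<xi>1 ?b2 \<xi>3 x = nab D x (\<xi>1 x) (\<lambda>y. \<alpha> y [\<xi>2 y, \<xi>3 y]) - tri \<xi>1 \<xi>3 ?b2 x"
    using metric[OF G(1,5,3), of x] pair[OF \<xi>(2,3)] by simp
  have e2: "tri ?b1 \<xi>2 \<xi>3 x = nab D x (\<xi>3 x) (\<lambda>y. \<alpha> y [\<xi>1 y, \<xi>2 y]) - tri \<xi>2 ?b1 \<xi>3 x"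
    using brk_sym[OF G(4,2,3), of x] pair[OF \<xi>(1,2)] by (simp add: eq_diff_eq)
  have e3: "tri \<xi>2 ?b1 \<xi>3 x = nab D x (\<xi>2 x) (\<lambda>y. \<alpha> y [\<xi>1 y, \<xi>3 y]) - tri \<xi>2 \<xi>3 ?b1 x"
    using metric[OF G(2,4,3), of x] pair[OF \<xi>(1,3)] by simp
  have e4: "tri ?b1 ?b2 \<xi>3 x = nab D x (?b1 x) (\<lambda>y. \<alpha> y [\<xi>2 y, \<xi>3 y]) - tri ?b1 \<xi>3 ?b2 x"
    using metric[OF G(4,5,3), of x] pair[OF \<xi>(2,3)] by simp
  have e5: "tri ?b1 \<xi>3 ?b2 x = nab D x (?b2 x) (\<lambda>y. \<alpha> y [\<xi>1 y, \<xi>3 y]) - tri \<xi>3 ?b1 ?b2 x"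
    using brk_sym[OF G(4,3,5), of x] pair[OF \<xi>(1,3)] by (simp add: eq_diff_eq)
  have e6: "tri ?b1 \<xi>2 ?b3 x = nab D x (?b3 x) (\<lambda>y. \<alpha> y [\<xi>1 y, \<xi>2 y]) - tri \<xi>2 ?b1 ?b3 x"
    using brk_sym[OF G(4,2,6), of x] pair[OF \<xi>(1,2)] by (simp add: eq_diff_eq)
  have e7: "tri \<xi>2 ?b1 ?b3 x = - tri \<xi>2 ?b3 ?b1 x"
    by (rule tri_skew_B[OF G(2) b(1,3)])
  have br: "brk D \<xi>1 \<xi>2 x \<in> A x" "brk D \<xi>1 \<xi>3 x \<in> A x" "brk D \<xi>2 \<xi>3 x \<in> A x" "\<xi>1 x \<in> A x" "\<xi>2 x \<in> A x" "\<xi>3 x \<in> A x"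
    using brk_A \<xi> by (simp_all add: GamSub_iff)
  show ?thesis
    using expand unfolding koszul3 quad_def e1 e2 e3 e4 e5 e6 e7 tri_A[OF \<xi>] tb[OF \<xi>(1,2,3)] tb[OF \<xi>(1,3,2)] tb[OF \<xi>(2,3,1)]
      skew[OF br(1,6)] skew[OF br(2,5)] skew[OF br(3,4)]
    by (simp add: algebra_simps)
qed

end

section \<open>Forms of low degree\<close>

text \<open>\<open>wedge_at\<close> runs over all ways to split the list; for homogeneous factors a
  single split can give a nonzero contribution.\<close>

lemma wedge_at_degree:
  assumes \<omega>: "\<And>vs. \<omega> vs \<noteq> 0 \<Longrightarrow> length vs = i" and \<alpha>: "\<And>vs. \<alpha> vs \<noteq> 0 \<Longrightarrow> length vs = k"
  shows "wedge_at \<omega> \<alpha> vs = (if length vs = i + k then (1 / (fact i * fact k)) *\<^sub>R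
    (\<Sum>p | p permutes {..<length vs}.
        (of_int (sign p) * \<omega> (take i (permute_list p vs))) *\<^sub>R \<alpha> (drop i (permute_list p vs))) else 0)"
proof -
  let ?n = "length vs"
  let ?f = "\<lambda>j. (1 / (fact j * fact (?n - j))) *\<^sub>R (\<Sum>p | p permutes {..<?n}.
        (of_int (sign p) * \<omega> (take j (permute_list p vs))) *\<^sub>R \<alpha> (drop j (permute_list p vs)))"
  have z: "?f j = 0" if "j \<le> ?n" "\<not> (j = i \<and> ?n = i + k)" for j
  proof -
    have "\<omega> (take j (permute_list p vs)) = 0 \<or> \<alpha> (drop j (permute_list p vs)) = 0" for p
    proof (rule ccontr)
      assume "\<not> ?thesis"
      then have "length (take j (permute_list p vs)) = i" "length (drop j (permute_list p vs)) = k"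
        using \<omega> \<alpha> by blast+
      with that show False by auto
    qed
    then have "(of_int (sign p) * \<omega> (take j (permute_list p vs))) *\<^sub>R \<alpha> (drop j (permute_list p vs)) = 0" for p
      by fastforce
    then show ?thesis by (simp only: sum.neutral_const scaleR_zero_right)
  qed
  show ?thesis
  proof (cases "?n = i + k")
    case True
    have "wedge_at \<omega> \<alpha> vs = (\<Sum>j\<in>{i}. ?f j)"
      unfolding wedge_at_def by (rule sum.mono_neutral_right) (use z True in auto)
    then show ?thesis using True by simp
  next
    case False
    then show ?thesis unfolding wedge_at_def using z by simp
  qed
qed

lemma sum_permutes_1: "(\<Sum>p | p permutes {..<Suc 0}. f p) = f id"
  by (simp add: lessThan_Suc)

lemma sum_permutes_2: "(\<Sum>p | p permutes {..<Suc (Suc 0)}. f p) = f id + f (Transposition.transpose (Suc 0) 0)"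
  by (simp add: lessThan_Suc sum_over_permutations_insert)

lemma sum_permutes_3: "(\<Sum>p | p permutes {..<Suc (Suc (Suc 0))}. f p) =
    f id + f (Transposition.transpose (Suc 0) 0) + (f (Transposition.transpose (Suc (Suc 0)) (Suc 0)) + f (Transposition.transpose (Suc (Suc 0)) (Suc 0) \<circ> Transposition.transpose (Suc 0) 0))
    + (f (Transposition.transpose (Suc (Suc 0)) 0) + f (Transposition.transpose (Suc (Suc 0)) 0 \<circ> Transposition.transpose (Suc 0) 0))"
  by (simp add: lessThan_Suc sum_over_permutations_insert ac_simps)

lemmas permutes_eval = sum_permutes_1 sum_permutes_2 sum_permutes_3 sign_compose permutation_swap_id sign_swap_id
  permute_list_def Transposition.transpose_def

definition degree_form :: "nat \<Rightarrow> ('v list \<Rightarrow> 'w::zero) \<Rightarrow> bool" where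
  "degree_form k f \<longleftrightarrow> (\<forall>vs. f vs \<noteq> 0 \<longrightarrow> length vs = k)"

lemma alt_forms_degree: "f \<in> alt_forms S W (int k) \<Longrightarrow> degree_form k f"
  unfolding degree_form_def using alt_formsD(1) by fastforce

lemma degree_formD: "degree_form k f \<Longrightarrow> f vs \<noteq> 0 \<Longrightarrow> length vs = k"
  by (simp add: degree_form_def)

lemma wedge_at_deg:
  assumes "degree_form i \<omega>" "degree_form k \<alpha>"
  shows "wedge_at \<omega> \<alpha> vs = (if length vs = i + k then (1 / (fact i * fact k)) *\<^sub>R
    (\<Sum>p | p permutes {..<length vs}.
        (of_int (sign p) * \<omega> (take i (permute_list p vs))) *\<^sub>R \<alpha> (drop i (permute_list p vs))) else 0)"
  by (rule wedge_at_degree[OF degree_formD[OF assms(1)] degree_formD[OF assms(2)]])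

lemma wedge_00:
  assumes "degree_form 0 \<omega>" "degree_form 0 \<alpha>"
  shows "wedge_at \<omega> \<alpha> [] = \<omega> [] *\<^sub>R \<alpha> []"
  by (simp add: wedge_at_deg[OF assms(1,2)] permutes_eval)

lemma wedge_01:
  assumes "degree_form 0 \<omega>" "degree_form (Suc 0) \<alpha>"
  shows "wedge_at \<omega> \<alpha> [u] = \<omega> [] *\<^sub>R \<alpha> [u]"
  by (simp add: wedge_at_deg[OF assms(1,2)] permutes_eval)

lemma wedge_10:
  assumes "degree_form (Suc 0) \<omega>" "degree_form 0 \<alpha>"
  shows "wedge_at \<omega> \<alpha> [u] = \<omega> [u] *\<^sub>R \<alpha> []"
  by (simp add: wedge_at_deg[OF assms(1,2)] permutes_eval)

lemma wedge_11:
  assumes "degree_form (Suc 0) \<omega>" "degree_form (Suc 0) \<alpha>"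
  shows "wedge_at \<omega> \<alpha> [u, v] = \<omega> [u] *\<^sub>R \<alpha> [v] - \<omega> [v] *\<^sub>R \<alpha> [u]"
  by (simp add: wedge_at_deg[OF assms(1,2)] permutes_eval)

text \<open>Both permutations contribute equally by skew-symmetry, which cancels the factor 1/2. The
  assumption concerns the given pair only, so it can be met by vectors inside or outside the
  fibre.\<close>

lemma wedge_02:
  assumes "degree_form 0 \<omega>" "degree_form (Suc (Suc 0)) \<alpha>" "\<alpha> [v, u] = - \<alpha> [u, v]"
  shows "wedge_at \<omega> \<alpha> [u, v] = \<omega> [] *\<^sub>R \<alpha> [u, v]"
  by (simp add: wedge_at_deg[OF assms(1,2)] permutes_eval assms(3) flip: scaleR_2)

lemma wedge_20:
  assumes "degree_form (Suc (Suc 0)) \<omega>" "degree_form 0 \<alpha>" "\<omega> [v, u] = - \<omega> [u, v]"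
  shows "wedge_at \<omega> \<alpha> [u, v] = \<omega> [u, v] *\<^sub>R \<alpha> []"
  by (simp add: wedge_at_deg[OF assms(1,2)] permutes_eval assms(3) flip: scaleR_2)

lemma scaleR_halves:
  "(c / 2) *\<^sub>R v + (c / 2) *\<^sub>R v = c *\<^sub>R v" "(c / 2) *\<^sub>R v + ((c / 2) *\<^sub>R v + z) = c *\<^sub>R v + z"
  for v :: "'v::real_vector"
  by (simp_all flip: scaleR_add_left add.assoc)

lemma wedge_12:
  assumes "degree_form (Suc 0) \<omega>" "degree_form (Suc (Suc 0)) \<alpha>"
    and "\<alpha> [v, u] = - \<alpha> [u, v]" "\<alpha> [w, u] = - \<alpha> [u, w]" "\<alpha> [w, v] = - \<alpha> [v, w]"
  shows "wedge_at \<omega> \<alpha> [u, v, w] = \<omega> [u] *\<^sub>R \<alpha> [v, w] - \<omega> [v] *\<^sub>R \<alpha> [u, w] + \<omega> [w] *\<^sub>R \<alpha> [u, v]"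
proof -
  \<comment> \<open>The normalisation is 1 / (1! 2!), and skew-symmetry lets the six permutations
    coincide in pairs.\<close>
  have "wedge_at \<omega> \<alpha> [u, v, w] = (1/2) *\<^sub>R (2 *\<^sub>R (\<omega> [u] *\<^sub>R \<alpha> [v, w] - \<omega> [v] *\<^sub>R \<alpha> [u, w] + \<omega> [w] *\<^sub>R \<alpha> [u, v]))"
    by (subst wedge_at_deg[OF assms(1,2)]) (simp add: permutes_eval assms(3-5) algebra_simps scaleR_2 scaleR_halves)
  then show ?thesis by simp
qed

lemma wedge_21:
  assumes "degree_form (Suc (Suc 0)) \<omega>" "degree_form (Suc 0) \<alpha>"
    and "\<omega> [v, u] = - \<omega> [u, v]" "\<omega> [w, u] = - \<omega> [u, w]" "\<omega> [w, v] = - \<omega> [v, w]"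
  shows "wedge_at \<omega> \<alpha> [u, v, w] = \<omega> [u, v] *\<^sub>R \<alpha> [w] - \<omega> [u, w] *\<^sub>R \<alpha> [v] + \<omega> [v, w] *\<^sub>R \<alpha> [u]"
proof -
  have "wedge_at \<omega> \<alpha> [u, v, w] = (1/2) *\<^sub>R (2 *\<^sub>R (\<omega> [u, v] *\<^sub>R \<alpha> [w] - \<omega> [u, w] *\<^sub>R \<alpha> [v] + \<omega> [v, w] *\<^sub>R \<alpha> [u]))"
    by (subst wedge_at_deg[OF assms(1,2)]) (simp add: permutes_eval assms(3-5) algebra_simps scaleR_2 scaleR_halves)
  then show ?thesis by simp
qed

lemma alt_forms_0I: "f [] \<in> W \<Longrightarrow> 0 \<in> W \<Longrightarrow> degree_form 0 f \<Longrightarrow> f \<in> alt_forms S W 0"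
proof -
  assume W: "f [] \<in> W" "0 \<in> W" and deg: "degree_form 0 f"
  have z: "f vs = 0" if "vs \<noteq> []" for vs
    using degree_formD[OF deg, of vs] that by auto
  have zu: "f (vs[i := w]) = 0" if "i < length vs" for vs i w
    by (rule z) (use that in auto)
  have "f vs \<in> W" for vs
    using W z[of vs] by (cases "vs = []") auto
  then show "f \<in> alt_forms S W 0"
    unfolding alt_forms_def mem_Collect_eq
  proof (intro conjI allI impI ballI)
    fix vs assume "f vs \<noteq> 0"
    then have "vs = []" using z by blast
    then show "set vs \<subseteq> S" "int (length vs) = 0" by auto
  next
    fix vs i j assume "set vs \<subseteq> S \<and> i < j \<and> j < length vs \<and> vs ! i = vs ! j"
    then have "vs \<noteq> []" by auto
    then show "f vs = 0" by (rule z)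
  qed (simp_all add: zu)
qed

lemma alt_forms_1I:
  assumes deg: "degree_form (Suc 0) f" and out: "\<And>a. a \<notin> S \<Longrightarrow> f [a] = 0" and W: "\<And>a. a \<in> S \<Longrightarrow> f [a] \<in> W" "0 \<in> W"
    and lin: "fibre_linear S (\<lambda>a. f [a])"
  shows "f \<in> alt_forms S W 1"
proof -
  have 1: "\<exists>a. vs = [a] \<and> a \<in> S" if "f vs \<noteq> 0" for vs
    using degree_formD[OF deg that] that out by (auto simp: length_Suc_conv)
  have 2: "f vs \<in> W" for vs using 1[of vs] W by metis
  show ?thesis
    unfolding alt_forms_def mem_Collect_eq
  proof (intro conjI allI impI ballI)
    fix vs :: "'a list" and i a u v assume uv: "u \<in> S" "v \<in> S" and vs: "set vs \<subseteq> S \<and> i < length vs"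
    show "f (vs[i := a *\<^sub>R u + v]) = a *\<^sub>R f (vs[i := u]) + f (vs[i := v])"
    proof (cases "length vs = Suc 0")
      case True
      then show ?thesis using uv vs lin by (auto simp: length_Suc_conv fibre_linear_def)
    next
      case False
      then have "f (vs[i := w]) = 0" for w using degree_formD[OF deg, of "vs[i := w]"] by auto
      then show ?thesis by simp
    qed
  next
    fix vs i j assume *: "set vs \<subseteq> S \<and> i < j \<and> j < length vs \<and> vs ! i = vs ! j"
    show "f vs = 0" using * 1[of vs] by fastforce
  qed (use 1 2 in fastforce)+
qed

lemma alt_forms_2I:
  assumes deg: "degree_form (Suc (Suc 0)) f" and out: "\<And>a b. a \<notin> S \<or> b \<notin> S \<Longrightarrow> f [a, b] = 0"
    and W: "\<And>a b. a \<in> S \<Longrightarrow> b \<in> S \<Longrightarrow> f [a, b] \<in> W" "0 \<in> W"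
    and lin: "\<And>b. b \<in> S \<Longrightarrow> fibre_linear S (\<lambda>a. f [a, b])" "\<And>b. b \<in> S \<Longrightarrow> fibre_linear S (\<lambda>a. f [b, a])"
    and alt: "\<And>a. a \<in> S \<Longrightarrow> f [a, a] = 0"
  shows "f \<in> alt_forms S W 2"
proof -
  have 1: "\<exists>a b. vs = [a, b] \<and> a \<in> S \<and> b \<in> S" if "f vs \<noteq> 0" for vs
    using degree_formD[OF deg that] that out by (auto simp: length_Suc_conv)
  have 2: "f vs \<in> W" for vs using 1[of vs] W by metis
  show ?thesis
    unfolding alt_forms_def mem_Collect_eq
  proof (intro conjI allI impI ballI)
    fix vs :: "'a list" and i a u v assume uv: "u \<in> S" "v \<in> S" and vs: "set vs \<subseteq> S \<and> i < length vs"
    show "f (vs[i := a *\<^sub>R u + v]) = a *\<^sub>R f (vs[i := u]) + f (vs[i := v])"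
    proof (cases "length vs = Suc (Suc 0)")
      case True
      then obtain b c where bc: "vs = [b, c]" by (auto simp: length_Suc_conv)
      with vs have "i = 0 \<or> i = Suc 0" "b \<in> S" "c \<in> S" by auto
      then show ?thesis using uv bc lin[of b] lin[of c] by (auto simp: fibre_linear_def)
    next
      case False
      then have "f (vs[i := w]) = 0" for w using degree_formD[OF deg, of "vs[i := w]"] by auto
      then show ?thesis by simp
    qed
  next
    fix vs i j assume *: "set vs \<subseteq> S \<and> i < j \<and> j < length vs \<and> vs ! i = vs ! j"
    show "f vs = 0"
    proof (rule ccontr)
      assume nz: "f vs \<noteq> 0"
      then obtain a b where ab: "vs = [a, b]" "a \<in> S" using 1 by blast
      with * have "i = 0" "j = Suc 0" by auto
      with * ab nz alt show False by auto
    qed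
  qed (use 1 2 in fastforce)+
qed

section \<open>Spaces of forms on A and local decomposition of 2-forms\<close>

context dj_pair
begin

lemma Om_alt: "\<omega> \<in> Om D A k \<Longrightarrow> \<omega> x \<in> alt_forms (A x) UNIV k"
  and Om_smooth: "\<omega> \<in> Om D A k \<Longrightarrow> set Xs \<subseteq> GamSub D A \<Longrightarrow> (\<lambda>x. \<omega> x (map (\<lambda>X. X x) Xs)) \<in> Cinf (atl D)"
  by (simp_all add: Om_def)

lemma Om_degree: "\<omega> \<in> Om D A (int k) \<Longrightarrow> degree_form k (\<omega> x)"
  and OmL_degree: "\<alpha> \<in> OmL D A (int k) \<Longrightarrow> degree_form k (\<alpha> x)"
  using alt_forms_degree Om_alt OmL_alt by blast+

lemma OmL_degrees:
  "\<alpha> \<in> OmL D A 0 \<Longrightarrow> degree_form 0 (\<alpha> x)" "\<alpha> \<in> OmL D A 1 \<Longrightarrow> degree_form (Suc 0) (\<alpha> x)"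
  "\<alpha> \<in> OmL D A 2 \<Longrightarrow> degree_form (Suc (Suc 0)) (\<alpha> x)" "\<alpha> \<in> OmL D A 3 \<Longrightarrow> degree_form (Suc (Suc (Suc 0))) (\<alpha> x)"
  "\<omega> \<in> Om D A 0 \<Longrightarrow> degree_form 0 (\<omega> x)" "\<omega> \<in> Om D A 1 \<Longrightarrow> degree_form (Suc 0) (\<omega> x)"
  "\<omega> \<in> Om D A 2 \<Longrightarrow> degree_form (Suc (Suc 0)) (\<omega> x)"
  using OmL_degree[of \<alpha> 0] OmL_degree[of \<alpha> "Suc 0"] OmL_degree[of \<alpha> "Suc (Suc 0)"] OmL_degree[of \<alpha> "Suc (Suc (Suc 0))"]
    Om_degree[of \<omega> 0] Om_degree[of \<omega> "Suc 0"] Om_degree[of \<omega> "Suc (Suc 0)"] by (simp_all add: numeral_2_eq_2 numeral_3_eq_3)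

lemma OmL_skew: "\<alpha> \<in> OmL D A 2 \<Longrightarrow> u \<in> A x \<Longrightarrow> v \<in> A x \<Longrightarrow> \<alpha> x [u, v] = - \<alpha> x [v, u]"
  by (rule alt_form2_skew[OF OmL_alt A_subspace])

lemma Om_skew: "\<omega> \<in> Om D A 2 \<Longrightarrow> u \<in> A x \<Longrightarrow> v \<in> A x \<Longrightarrow> \<omega> x [u, v] = - \<omega> x [v, u]"
  by (rule alt_form2_skew[OF Om_alt A_subspace])

lemma OmL_outside: "\<alpha> \<in> OmL D A k \<Longrightarrow> \<not> set vs \<subseteq> A x \<Longrightarrow> \<alpha> x vs = 0"
  using alt_formsD(1)[OF OmL_alt] by blast

lemma Om_outside: "\<omega> \<in> Om D A k \<Longrightarrow> \<not> set vs \<subseteq> A x \<Longrightarrow> \<omega> x vs = 0"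
  using alt_formsD(1)[OF Om_alt] by blast

lemma zero_in_L: "0 \<in> fib (Lbun D) x"
  using subspace_0[OF L.fib_subspace] .

lemma L_lincomb: "u \<in> fib (Lbun D) x \<Longrightarrow> v \<in> fib (Lbun D) x \<Longrightarrow> a *\<^sub>R u + v \<in> fib (Lbun D) x"
  by (simp add: subspace_add subspace_scale L.fib_subspace)

lemma OmL_lincomb:
  assumes "\<alpha> \<in> OmL D A k" "\<beta> \<in> OmL D A k"
  shows "(\<lambda>x vs. a *\<^sub>R \<alpha> x vs + \<beta> x vs) \<in> OmL D A k"
proof -
  have "(\<lambda>vs. a *\<^sub>R \<alpha> x vs + \<beta> x vs) \<in> alt_forms (A x) (fib (Lbun D) x) k" for x
  proof -
    note f = alt_formsD[OF OmL_alt[OF assms(1), of x]] and g = alt_formsD[OF OmL_alt[OF assms(2), of x]]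
    show ?thesis
      unfolding alt_forms_def mem_Collect_eq
    proof (intro conjI allI impI ballI)
      fix vs assume "a *\<^sub>R \<alpha> x vs + \<beta> x vs \<noteq> 0"
      then have "\<alpha> x vs \<noteq> 0 \<or> \<beta> x vs \<noteq> 0" by auto
      then show "set vs \<subseteq> A x" "int (length vs) = k" using f(1) g(1) by blast+
    next
      fix vs assume "set vs \<subseteq> A x"
      then show "a *\<^sub>R \<alpha> x vs + \<beta> x vs \<in> fib (Lbun D) x" by (intro L_lincomb f(2) g(2))
    next
      fix vs i b u v assume "u \<in> A x" "v \<in> A x" "set vs \<subseteq> A x \<and> i < length vs"
      then show "a *\<^sub>R \<alpha> x (vs[i := b *\<^sub>R u + v]) + \<beta> x (vs[i := b *\<^sub>R u + v]) =
          b *\<^sub>R (a *\<^sub>R \<alpha> x (vs[i := u]) + \<beta> x (vs[i := u])) + (a *\<^sub>R \<alpha> x (vs[i := v]) + \<beta> x (vs[i := v]))"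
        using f(3)[of u v vs i b] g(3)[of u v vs i b] by (simp add: algebra_simps)
    next
      fix vs i j assume "set vs \<subseteq> A x \<and> i < j \<and> j < length vs \<and> vs ! i = vs ! j"
      then show "a *\<^sub>R \<alpha> x vs + \<beta> x vs = 0" using f(4)[of vs i j] g(4)[of vs i j] by simp
    qed
  qed
  moreover have "(\<lambda>x. a *\<^sub>R \<alpha> x (map (\<lambda>X. X x) Xs) + \<beta> x (map (\<lambda>X. X x) Xs)) \<in> GamL D" if "set Xs \<subseteq> GamSub D A" for Xs
    using L.Gam_add[OF L.Gam_scale_const[OF OmL_smooth[OF assms(1) that]] OmL_smooth[OF assms(2) that]] .
  ultimately show ?thesis by (simp add: OmL_def)
qed

lemma OmL_zero: "(\<lambda>x vs. 0) \<in> OmL D A k"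
  using L.Gam_zero zero_in_L by (auto simp: OmL_def alt_forms_def)

lemma OmL_scale: "\<alpha> \<in> OmL D A k \<Longrightarrow> (\<lambda>x vs. a *\<^sub>R \<alpha> x vs) \<in> OmL D A k"
  using OmL_lincomb[OF _ OmL_zero, of \<alpha> k a] by simp

lemma OmL_add: "\<alpha> \<in> OmL D A k \<Longrightarrow> \<beta> \<in> OmL D A k \<Longrightarrow> (\<lambda>x vs. \<alpha> x vs + \<beta> x vs) \<in> OmL D A k"
  using OmL_lincomb[of \<alpha> k \<beta> 1] by simp

lemma OmL_sum:
  "(\<And>i. i < n \<Longrightarrow> \<alpha> i \<in> OmL D A k) \<Longrightarrow> (\<lambda>x vs. \<Sum>i<n::nat. \<alpha> i x vs) \<in> OmL D A k"
  by (induction n) (auto intro: OmL_zero OmL_add)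

lemma form0_OmL: "\<mu> \<in> GamL D \<Longrightarrow> form0 \<mu> \<in> OmL D A 0"
proof -
  assume \<mu>: "\<mu> \<in> GamL D"
  have "form0 \<mu> x \<in> alt_forms (A x) (fib (Lbun D) x) 0" for x
    by (rule alt_forms_0I) (use L.Gam_fib[OF \<mu>] zero_in_L in \<open>auto simp: form0_def degree_form_def\<close>)
  moreover have "(\<lambda>x. form0 \<mu> x (map (\<lambda>X. X x) Xs)) \<in> GamL D" for Xs :: "('m \<Rightarrow> 'v) list"
    using \<mu> L.Gam_zero by (cases Xs) (auto simp: form0_def)
  ultimately show ?thesis by (simp add: OmL_def)
qed

lemma form0_Om: "f \<in> Cinf (atl D) \<Longrightarrow> form0 f \<in> Om D A 0"
proof -
  assume f: "f \<in> Cinf (atl D)"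
  have "form0 f x \<in> alt_forms (A x) UNIV 0" for x
    by (rule alt_forms_0I) (auto simp: form0_def degree_form_def)
  moreover have "(\<lambda>x. form0 f x (map (\<lambda>X. X x) Xs)) \<in> Cinf (atl D)" for Xs :: "('m \<Rightarrow> 'v) list"
    using f E.smooth_fun_on_const by (cases Xs) (auto simp: form0_def E.Cinf_iff)
  ultimately show ?thesis by (simp add: Om_def)
qed

lemma form0_degree: "degree_form 0 (form0 \<mu> x)"
  by (simp add: degree_form_def form0_def)

lemma wedge_degree:
  "(\<And>x. degree_form i (\<omega> x)) \<Longrightarrow> (\<And>x. degree_form k (\<alpha> x)) \<Longrightarrow> degree_form (i + k) (wedge \<omega> \<alpha> x)"
  unfolding degree_form_def[of "i + k"] wedge_def using wedge_at_deg by metis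

context
  fixes \<theta> :: "('m, 'v, real) form" assumes \<theta>: "\<theta> \<in> Om D A 1"
begin

lemma Om1_linear: "fibre_linear (A x) (\<lambda>a. \<theta> x [a])"
  by (rule alt_form1_linear[OF Om_alt[OF \<theta>]])

lemma wedge_form0_apply: "wedge \<theta> (form0 \<mu>) x [u] = \<theta> x [u] *\<^sub>R \<mu> x"
  unfolding wedge_def by (subst wedge_10[OF OmL_degrees(6)[OF \<theta>] form0_degree]) (simp add: form0_def)

lemma wedge_form0_OmL:
  assumes \<mu>: "\<mu> \<in> GamL D"
  shows "wedge \<theta> (form0 \<mu>) \<in> OmL D A 1"
proof -
  have deg: "degree_form (Suc 0) (wedge \<theta> (form0 \<mu>) x)" for x
    using wedge_degree[OF OmL_degrees(6)[OF \<theta>] form0_degree] by simp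
  have "wedge \<theta> (form0 \<mu>) x \<in> alt_forms (A x) (fib (Lbun D) x) 1" for x
  proof (rule alt_forms_1I[OF deg])
    show "wedge \<theta> (form0 \<mu>) x [a] = 0" if "a \<notin> A x" for a
      using Om_outside[OF \<theta>, of "[a]" x] that by (simp add: wedge_form0_apply)
    show "wedge \<theta> (form0 \<mu>) x [a] \<in> fib (Lbun D) x" for a
      using L.Gam_fib[OF \<mu>] L.fib_subspace by (simp add: wedge_form0_apply subspace_scale)
    show "fibre_linear (A x) (\<lambda>a. wedge \<theta> (form0 \<mu>) x [a])"
      using Om1_linear[of x] by (simp add: wedge_form0_apply fibre_linear_def scaleR_add_left)
  qed (rule zero_in_L)
  moreover have "(\<lambda>x. wedge \<theta> (form0 \<mu>) x (map (\<lambda>X. X x) Xs)) \<in> GamL D" if Xs: "set Xs \<subseteq> GamSub D A" for Xs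
  proof (cases "length Xs = Suc 0")
    case True
    then obtain X where "Xs = [X]" by (auto simp: length_Suc_conv)
    then show ?thesis
      using L.Gam_scale[OF Om_smooth[OF \<theta> Xs] \<mu>] by (simp add: wedge_form0_apply)
  next
    case False
    then have "wedge \<theta> (form0 \<mu>) x (map (\<lambda>X. X x) Xs) = 0" for x
      using degree_formD[OF deg[of x], of "map (\<lambda>X. X x) Xs"] by auto
    then show ?thesis using L.Gam_zero by simp
  qed
  ultimately show ?thesis by (simp add: OmL_def)
qed

context
  fixes \<gamma> :: "('m, 'v, 'l) form" assumes \<gamma>: "\<gamma> \<in> OmL D A 1"
begin

lemma wedge_11_apply: "wedge \<theta> \<gamma> x [u, v] = \<theta> x [u] *\<^sub>R \<gamma> x [v] - \<theta> x [v] *\<^sub>R \<gamma> x [u]"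
  unfolding wedge_def by (rule wedge_11[OF OmL_degrees(6)[OF \<theta>] OmL_degrees(2)[OF \<gamma>]])

lemma wedge_11_OmL: "wedge \<theta> \<gamma> \<in> OmL D A 2"
proof -
  have deg: "degree_form (Suc (Suc 0)) (wedge \<theta> \<gamma> x)" for x
    using wedge_degree[OF OmL_degrees(6)[OF \<theta>] OmL_degrees(2)[OF \<gamma>]] by simp
  have lin: "fibre_linear (A x) (\<lambda>a. \<gamma> x [a])" for x
    by (rule alt_form1_linear[OF OmL_alt[OF \<gamma>]])
  have "wedge \<theta> \<gamma> x \<in> alt_forms (A x) (fib (Lbun D) x) 2" for x
  proof (rule alt_forms_2I[OF deg])
    show "wedge \<theta> \<gamma> x [a, b] = 0" if "a \<notin> A x \<or> b \<notin> A x" for a b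
      using that Om_outside[OF \<theta>, of "[_]" x] OmL_outside[OF \<gamma>, of "[_]" x] by (auto simp: wedge_11_apply)
    show "wedge \<theta> \<gamma> x [a, b] \<in> fib (Lbun D) x" if "a \<in> A x" "b \<in> A x" for a b
      using alt_formsD(2)[OF OmL_alt[OF \<gamma>], of "[_]" x] that L.fib_subspace
      by (simp add: wedge_11_apply subspace_diff subspace_scale)
    show "fibre_linear (A x) (\<lambda>a. wedge \<theta> \<gamma> x [a, b])" "fibre_linear (A x) (\<lambda>a. wedge \<theta> \<gamma> x [b, a])" for b
      using Om1_linear[of x] lin[of x] by (simp_all add: wedge_11_apply fibre_linear_def algebra_simps)
  qed (auto simp: wedge_11_apply zero_in_L)
  moreover have "(\<lambda>x. wedge \<theta> \<gamma> x (map (\<lambda>X. X x) Xs)) \<in> GamL D" if Xs: "set Xs \<subseteq> GamSub D A" for Xs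
  proof (cases "length Xs = Suc (Suc 0)")
    case True
    then obtain X Y where XY: "Xs = [X, Y]" by (auto simp: length_Suc_conv)
    then have "[X] \<noteq> []" "set [X] \<subseteq> GamSub D A" "set [Y] \<subseteq> GamSub D A" using Xs by auto
    then show ?thesis
      using L.Gam_diff[OF L.Gam_scale[OF Om_smooth[OF \<theta>, of "[X]"] OmL_smooth[OF \<gamma>, of "[Y]"]]
          L.Gam_scale[OF Om_smooth[OF \<theta>, of "[Y]"] OmL_smooth[OF \<gamma>, of "[X]"]]]
      by (simp add: wedge_11_apply XY)
  next
    case False
    then have "wedge \<theta> \<gamma> x (map (\<lambda>X. X x) Xs) = 0" for x
      using degree_formD[OF deg[of x], of "map (\<lambda>X. X x) Xs"] by auto
    then show ?thesis using L.Gam_zero by simp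
  qed
  ultimately show ?thesis by (simp add: OmL_def)
qed

end

end

text \<open>Identifies multiplication by a function with a wedge product, so that the derivation
  property of the bracket can be applied to cut-offs.\<close>

lemma wedge_form0_2:
  assumes f: "f \<in> Cinf (atl D)" and \<beta>: "\<beta> \<in> OmL D A 2"
  shows "wedge (form0 f) \<beta> = (\<lambda>x vs. f x *\<^sub>R \<beta> x vs)"
proof (intro ext)
  fix x vs
  note deg = form0_degree[of f x] OmL_degrees(3)[OF \<beta>, of x]
  show "wedge (form0 f) \<beta> x vs = f x *\<^sub>R \<beta> x vs"
  proof (cases "length vs = Suc (Suc 0)")
    case True
    then obtain u v where uv: "vs = [u, v]" by (auto simp: length_Suc_conv)
    have "\<beta> x [v, u] = - \<beta> x [u, v]"
    proof (cases "u \<in> A x \<and> v \<in> A x")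
      case True
      then show ?thesis using OmL_skew[OF \<beta>] by blast
    next
      case False
      then show ?thesis using OmL_outside[OF \<beta>, of "[u, v]" x] OmL_outside[OF \<beta>, of "[v, u]" x] by auto
    qed
    from wedge_02[OF deg this] show ?thesis by (simp add: uv wedge_def form0_def)
  next
    case False
    have "degree_form (0 + Suc (Suc 0)) (wedge (form0 f) \<beta> x)"
      by (rule wedge_degree[where \<omega> = "form0 f" and \<alpha> = \<beta>, OF form0_degree OmL_degrees(3)[OF \<beta>]])
    then have "wedge (form0 f) \<beta> x vs = 0" "\<beta> x vs = 0"
      using False deg(2) unfolding degree_form_def by auto
    then show ?thesis by simp
  qed
qed

text \<open>Global 1-forms that are dual to a frame near x: the coordinate functionals multiplied by
  a bump function.\<close>

lemma dual_frame:
  obtains as \<theta>s N where "set as \<subseteq> GamSub D A" "\<And>i. i < length as \<Longrightarrow> \<theta>s i \<in> Om D A 1" "open N" "x \<in> N"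
    "\<And>y v. y \<in> N \<Longrightarrow> v \<in> A y \<Longrightarrow> (\<Sum>i<length as. \<theta>s i y [v] *\<^sub>R (as ! i) y) = v"
proof -
  obtain as W where as: "open W" "x \<in> W" "set as \<subseteq> GamE D" "\<And>a y. a \<in> set as \<Longrightarrow> a y \<in> A y"
    "\<And>y. y \<in> W \<Longrightarrow> basis_list (A y) (map (\<lambda>s. s y) as)"
    by (rule E.subbundle_global_frame[OF A_sub, of x]) (rule that; assumption)
  obtain \<rho> N C where \<rho>: "\<rho> \<in> Cinf (atl D)" "open N" "x \<in> N" "\<And>y. y \<in> N \<Longrightarrow> \<rho> y = 1"
    "closed C" "C \<subseteq> W" "\<And>y. y \<notin> C \<Longrightarrow> \<rho> y = 0" "N \<subseteq> W"
    by (rule E.bump_function[OF as(1,2)]) (rule that; assumption)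
  \<comment> \<open>The factor \<rho> makes the form vanish where the sections need not form a basis
    and \<open>list_coeff\<close> has no meaning.\<close>
  define \<theta> where "\<theta> i y vs = (if length vs = Suc 0 \<and> set vs \<subseteq> A y then \<rho> y * list_coeff (map (\<lambda>s. s y) as) (hd vs) i else 0)"
    for i y vs
  have \<theta>a: "\<theta> i y [v] = \<rho> y * list_coeff (map (\<lambda>s. s y) as) v i" if "v \<in> A y" for i y v
    using that by (simp add: \<theta>_def)
  have "\<theta> i \<in> Om D A 1" if i: "i < length as" for i
  proof -
    have "\<theta> i y \<in> alt_forms (A y) UNIV 1" for y
    proof (rule alt_forms_1I)
      show "fibre_linear (A y) (\<lambda>a. \<theta> i y [a])"
      proof (cases "y \<in> W")
        case True
        then show ?thesis
          using list_coeff_linear[OF as(5)[OF True]] i subspace_add[OF A_subspace] subspace_scale[OF A_subspace]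
          by (simp add: fibre_linear_def \<theta>a algebra_simps)
      next
        case False
        then have "\<rho> y = 0" using \<rho>(6,7) by blast
        then show ?thesis by (simp add: fibre_linear_def \<theta>_def)
      qed
    qed (auto simp: \<theta>_def degree_form_def)
    moreover have "(\<lambda>y. \<theta> i y (map (\<lambda>X. X y) Xs)) \<in> Cinf (atl D)" if Xs: "set Xs \<subseteq> GamSub D A" for Xs
    proof (cases "length Xs = Suc 0")
      case True
      then obtain X where X: "Xs = [X]" by (auto simp: length_Suc_conv)
      have "X \<in> GamE D" "\<And>y. X y \<in> A y" using Xs X by (auto simp: GamSub_iff)
      then have "smooth_fun_on (atl D) W (\<lambda>y. list_coeff (map (\<lambda>s. s y) as) (X y) i)"
        using as(3) by (intro E.section_coeff_smooth[OF as(1) _ as(5) _ _ i] E.Gam_smooth_section_on) auto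
      from E.Cinf_bump_mult[OF \<rho>(1,5,6,7) as(1) this] show ?thesis
        using \<open>\<And>y. X y \<in> A y\<close> by (simp add: X \<theta>a)
    next
      case False
      then show ?thesis using E.smooth_fun_on_const by (simp add: \<theta>_def E.Cinf_iff)
    qed
    ultimately show ?thesis by (simp add: Om_def)
  qed
  moreover have "(\<Sum>i<length as. \<theta> i y [v] *\<^sub>R (as ! i) y) = v" if "y \<in> N" "v \<in> A y" for y v
    using list_coeff_sum[OF as(5) that(2)] \<rho>(4)[OF that(1)] \<rho>(8) that by (simp add: \<theta>a subset_iff)
  moreover have "set as \<subseteq> GamSub D A" using as(3,4) by (auto simp: GamSub_iff)
  ultimately show ?thesis using that[of as \<theta> N] \<rho>(2,3) by blast
qed

text \<open>For a 2-form, summing the wedge products of the dual forms with the contractions along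
  the frame counts it twice; this is the origin of the factor 1/2 in \<gamma>. Duality holds near x
  only, and so does the decomposition.\<close>

lemma decompose:
  assumes \<eta>: "\<eta> \<in> OmL D A 2"
  obtains n \<theta> \<gamma> N where "\<And>k. k < n \<Longrightarrow> \<theta> k \<in> Om D A 1" "\<And>k. k < n \<Longrightarrow> \<gamma> k \<in> OmL D A 1" "open N" "x \<in> N"
    "\<And>y vs. y \<in> N \<Longrightarrow> \<eta> y vs = (\<Sum>k<n::nat. wedge (\<theta> k) (\<gamma> k) y vs)"
proof -
  obtain as \<theta> N where f: "set as \<subseteq> GamSub D A" "\<And>i. i < length as \<Longrightarrow> \<theta> i \<in> Om D A 1" "open N" "x \<in> N"
    "\<And>y v. y \<in> N \<Longrightarrow> v \<in> A y \<Longrightarrow> (\<Sum>i<length as. \<theta> i y [v] *\<^sub>R (as ! i) y) = v"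
    by (rule dual_frame[of x]) (rule that; assumption)
  define \<gamma> where "\<gamma> k = (\<lambda>y vs. (1/2) *\<^sub>R contr \<eta> (as ! k) y vs)" for k
  have asG: "as ! k \<in> GamSub D A" if "k < length as" for k using f(1) that by auto
  have \<gamma>: "\<gamma> k \<in> OmL D A 1" if "k < length as" for k
    unfolding \<gamma>_def by (rule OmL_scale[OF contr_OmL[OF \<eta> asG[OF that]]])
  have "\<eta> y vs = (\<Sum>k<length as. wedge (\<theta> k) (\<gamma> k) y vs)" if y: "y \<in> N" for y vs
  proof (cases "length vs = Suc (Suc 0) \<and> set vs \<subseteq> A y")
    case True
    then obtain u v where uv: "vs = [u, v]" "u \<in> A y" "v \<in> A y" by (auto simp: length_Suc_conv)
    have asA: "(as ! k) y \<in> A y" if "k < length as" for k using asG[OF that] by (simp add: GamSub_iff)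
    have half: "(\<Sum>k<length as. \<theta> k y [a] *\<^sub>R \<eta> y [(as ! k) y, b]) = \<eta> y [a, b]" if "a \<in> A y" "b \<in> A y" for a b
      using fibre_linear_sum[OF A_subspace alt_form2_linear_left[OF OmL_alt[OF \<eta>] that(2)], of "{..<length as}"
          "\<lambda>k. (as ! k) y" "\<lambda>k. \<theta> k y [a]"] asA f(5)[OF y that(1)] by simp
    have "(\<Sum>k<length as. wedge (\<theta> k) (\<gamma> k) y vs) =
        (\<Sum>k<length as. (1/2) *\<^sub>R (\<theta> k y [u] *\<^sub>R \<eta> y [(as ! k) y, v]) - (1/2) *\<^sub>R (\<theta> k y [v] *\<^sub>R \<eta> y [(as ! k) y, u]))"
      by (rule sum.cong[OF refl]) (simp add: uv(1) wedge_11_apply[OF f(2) \<gamma>], simp add: \<gamma>_def contr_def)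
    also have "\<dots> = (1/2) *\<^sub>R \<eta> y [u, v] - (1/2) *\<^sub>R \<eta> y [v, u]"
      unfolding sum_subtractf scaleR_sum_right[symmetric] half[OF uv(2,3)] half[OF uv(3,2)] ..
    also have "\<dots> = \<eta> y vs"
      using OmL_skew[OF \<eta> uv(3,2)] uv(1) by (simp flip: scaleR_add_left)
    finally show ?thesis by simp
  next
    case False
    then have z: "\<beta> y vs = 0" if "\<beta> \<in> OmL D A 2" for \<beta>
      using degree_formD[OF OmL_degrees(3)[OF that], of y vs] OmL_outside[OF that, of vs y] by blast
    have "wedge (\<theta> k) (\<gamma> k) y vs = 0" if "k < length as" for k
      by (rule z[OF wedge_11_OmL[OF f(2)[OF that] \<gamma>[OF that]]])
    then show ?thesis using z[OF \<eta>] by simp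
  qed
  then show ?thesis using that[of "length as" \<theta> \<gamma> N] f(2,3,4) \<gamma> by blast
qed

end

section \<open>The bracket of two 2-forms\<close>

text \<open>The primed and unprimed data belong to two decomposable forms \<open>\<theta> \<wedge> \<gamma>\<close>; capital letters refer to the
  sections \<open>p'\<close>, \<open>q'\<close> of the second.\<close>
lemma schouten_identity:
  fixes t g t' g' XPt XQt Xpt' Xqt' NPg NQg Npg' Nqg' a b c d :: "'i \<Rightarrow> real" and Dp Dq DP DQ :: real
  defines "SPp \<equiv> \<lambda>i. (XPt i + t i * DP) - (Xpt' i + t' i * Dp) + a i"
    and "SPq \<equiv> \<lambda>i. NPg i - (Xqt' i + t' i * Dq) + b i"
    and "SQp \<equiv> \<lambda>i. (XQt i + t i * DQ) - Npg' i + c i"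
    and "SQq \<equiv> \<lambda>i. NQg i - Nqg' i + d i"
  defines "KP \<equiv> \<lambda>u v. - ((SPp u - t u * DP) * g v - (SPp v - t v * DP) * g u + t u * SPq v - t v * SPq u)"
    and "KQ \<equiv> \<lambda>u v. - ((SQp u - t u * DQ) * g v - (SQp v - t v * DQ) * g u + t u * SQq v - t v * SQq u)"
  defines "E \<equiv> \<lambda>u v. KP u v + (t' u * (t v * Dq - g v * Dp) - t' v * (t u * Dq - g u * Dp))"
  defines "n \<equiv> \<lambda>u v w. t u * (Xqt' v * g' w + t' v * Nqg' w - (Xqt' w * g' v + t' w * Nqg' v))
      - g u * (Xpt' v * g' w + t' v * Npg' w - (Xpt' w * g' v + t' w * Npg' v))"
    and "n' \<equiv> \<lambda>u v w. t' u * (XQt v * g w + t v * NQg w - (XQt w * g v + t w * NQg v))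
      - g' u * (XPt v * g w + t v * NPg w - (XPt w * g v + t w * NPg v))"
    and "T \<equiv> \<lambda>u v w. - (t v * t' w * d u) + t v * g' w * b u + g v * t' w * c u - g v * g' w * a u"
    and "T' \<equiv> \<lambda>u v w. t' v * t w * d u - t' v * g w * c u - g' v * t w * b u + g' v * g w * a u"
  shows "E u v * g' w - E u w * g' v + E v w * g' u - (t' u * KQ v w - t' v * KQ u w + t' w * KQ u v) =
    (n u v w - n v u w + n w u v + T u v w + T v w u + T w u v) +
    (n' u v w - n' v u w + n' w u v + T' u v w + T' v w u + T' w u v)"
  unfolding E_def KP_def KQ_def SPp_def SPq_def SQp_def SQq_def n_def n'_def T_def T'_def
  by (simp add: algebra_simps)

section \<open>Locality and pointwise dependence of the quadratic term\<close>

context dj_pair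
begin

text \<open>A is isotropic, so the A-component removed by the projection pairs to 0 with A anyway.
  Brackets of 1-forms thus become values of \<open>tri\<close>.\<close>

lemma pr_dagger_apply:
  assumes e: "e x \<in> fib (Ebun D) x" and a: "a \<in> A x"
  shows "pr_dagger D A B e x [a] = prd D x (e x) a"
proof -
  have fib: "fib (Ebun D) x = {a + b | a b. a \<in> A x \<and> b \<in> B x}"
    using conjunct2[OF spec[OF compl[unfolded complementary_def]]] .
  from e obtain a' b where ab: "e x = a' + b" "a' \<in> A x" "b \<in> B x"
    unfolding fib by blast
  have "(THE b. b \<in> B x \<and> e x - b \<in> A x) = b"
  proof (rule the_equality)
    show "b \<in> B x \<and> e x - b \<in> A x" using ab by simp
    fix c assume c: "c \<in> B x \<and> e x - c \<in> A x"
    have "(e x - c) - a' \<in> A x" using c ab(2) subspace_diff[OF A_subspace] by blast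
    moreover have "(e x - c) - a' = b - c" using ab(1) by simp
    moreover have "b - c \<in> B x" using c ab(3) subspace_diff[OF B_subspace] by blast
    ultimately have "b - c = 0" using A_Int_B by metis
    then show "c = b" by simp
  qed
  then show ?thesis
    using a ab prd_add_left[of a' x b a] A_fib B_fib A_isotropic[of a' x a] by (simp add: pr_dagger_def)
qed

lemma nab_leibniz:
  assumes "u \<in> fib (Ebun D) x"
  obtains X where "\<And>f s. f \<in> Cinf (atl D) \<Longrightarrow> s \<in> GamL D \<Longrightarrow> nab D x u (\<lambda>y. f y *\<^sub>R s y) = X f *\<^sub>R s x + f x *\<^sub>R nab D x u s"
proof -
  obtain \<Delta> where \<Delta>: "derivation_of (atl D) (Lbun D) \<Delta>" "\<And>\<mu>. nab D x u \<mu> = \<Delta> \<mu> x"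
    using nab_derivation[OF assms] by metis
  obtain X where "\<And>f s. f \<in> Cinf (atl D) \<Longrightarrow> s \<in> GamL D \<Longrightarrow> \<Delta> (\<lambda>x. f x *\<^sub>R s x) = (\<lambda>x. X f x *\<^sub>R s x + f x *\<^sub>R \<Delta> s x)"
    by (rule L.derivation_symbol[OF \<Delta>(1)]) blast
  then show ?thesis using \<Delta>(2) that[of "\<lambda>f. X f x"] by simp
qed

text \<open>Multiplied by a bump function the two sections coincide globally. In the Leibniz rule
  the symbol terms agree because the sections agree at x, and the bump function is 1 there.\<close>

lemma nab_local:
  assumes "u \<in> fib (Ebun D) x" "s \<in> GamL D" "s' \<in> GamL D" "open N" "x \<in> N" "\<And>y. y \<in> N \<Longrightarrow> s y = s' y"
  shows "nab D x u s = nab D x u s'"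
proof -
  obtain \<rho> N' C where \<rho>: "\<rho> \<in> Cinf (atl D)" "open N'" "x \<in> N'" "\<And>y. y \<in> N' \<Longrightarrow> \<rho> y = 1"
    "closed C" "C \<subseteq> N" "\<And>y. y \<notin> C \<Longrightarrow> \<rho> y = 0" "N' \<subseteq> N"
    by (rule E.bump_function[OF assms(4,5)]) (rule that; assumption)
  obtain X where X: "\<And>f s. f \<in> Cinf (atl D) \<Longrightarrow> s \<in> GamL D \<Longrightarrow> nab D x u (\<lambda>y. f y *\<^sub>R s y) = X f *\<^sub>R s x + f x *\<^sub>R nab D x u s"
    by (rule nab_leibniz[OF assms(1)]) blast
  have "(\<lambda>y. \<rho> y *\<^sub>R s y) = (\<lambda>y. \<rho> y *\<^sub>R s' y)"
  proof
    show "\<rho> y *\<^sub>R s y = \<rho> y *\<^sub>R s' y" for y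
      using assms(6)[of y] \<rho>(6,7) by (cases "y \<in> N") auto
  qed
  then have "X \<rho> *\<^sub>R s x + \<rho> x *\<^sub>R nab D x u s = X \<rho> *\<^sub>R s' x + \<rho> x *\<^sub>R nab D x u s'"
    using X[OF \<rho>(1) assms(2)] X[OF \<rho>(1) assms(3)] by simp
  then show ?thesis using assms(6)[OF assms(5)] \<rho>(4)[OF \<rho>(3)] by simp
qed

lemma tri_B_left:
  assumes "e \<in> GamE D" "s \<in> GamSub D B" "s' \<in> GamSub D B" "b1 \<in> GamSub D B" "b2 \<in> GamSub D B"
    and "s x = a *\<^sub>R b1 x + c *\<^sub>R b2 x"
  shows "tri e s s' x = a *\<^sub>R tri e b1 s' x + c *\<^sub>R tri e b2 s' x"
    "tri e s' s x = a *\<^sub>R tri e s' b1 x + c *\<^sub>R tri e s' b2 x"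
proof -
  have fib: "brk D e s' x \<in> fib (Ebun D) x" "b1 x \<in> fib (Ebun D) x" "b2 x \<in> fib (Ebun D) x"
    using assms brk_Gam[of e s'] by (auto simp: GamSub_iff E.Gam_fib)
  show 2: "tri e s' s x = a *\<^sub>R tri e s' b1 x + c *\<^sub>R tri e s' b2 x"
    unfolding tri_def assms(6)
    using prd_linear_right[OF fib(2) _ fib(1), of "c *\<^sub>R b2 x" a] prd_scale_right[OF fib(3,1)] fib(3)
    by (simp add: subspace_scale[OF E.fib_subspace])
  show "tri e s s' x = a *\<^sub>R tri e b1 s' x + c *\<^sub>R tri e b2 s' x"
    using 2 tri_skew_B[OF assms(1,2,3)] tri_skew_B[OF assms(1,4,3)] tri_skew_B[OF assms(1,5,3)]
    by (simp add: scaleR_right.minus)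
qed

text \<open>Moves the last entry to the front. With c and d from B and \<xi> from A, the remaining
  \<open>tri\<close> depends on c and d through their values at x only.\<close>

lemma tri_shift:
  assumes "c \<in> GamE D" "d \<in> GamE D" "\<xi> \<in> GamE D"
  shows "tri c d \<xi> x = nab D x (c x) (prdS D d \<xi>) - nab D x (d x) (prdS D c \<xi>) + tri \<xi> c d x"
  using metric[OF assms, of x] brk_sym[OF assms(1,3,2), of x] by (simp add: algebra_simps)

text \<open>Polarisation of \<open>quad\<close> before symmetrising: the first form enters through
  its B-components under the derivative, the second as the form differentiated. The sum over both
  orders is compared with the bracket.\<close>

definition quadB :: "('m, 'v, 'l) form \<Rightarrow> ('m, 'v, 'l) form \<Rightarrow> ('m \<Rightarrow> 'v) \<Rightarrow> ('m \<Rightarrow> 'v) \<Rightarrow> ('m \<Rightarrow> 'v) \<Rightarrow> 'm \<Rightarrow> 'l" where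
  "quadB \<alpha> \<beta> \<xi>1 \<xi>2 \<xi>3 x =
     nab D x (bsec \<alpha> \<xi>1 x) (\<lambda>y. \<beta> y [\<xi>2 y, \<xi>3 y]) - nab D x (bsec \<alpha> \<xi>2 x) (\<lambda>y. \<beta> y [\<xi>1 y, \<xi>3 y])
     + nab D x (bsec \<alpha> \<xi>3 x) (\<lambda>y. \<beta> y [\<xi>1 y, \<xi>2 y])
     + tri \<xi>1 (bsec \<alpha> \<xi>2) (bsec \<beta> \<xi>3) x + tri \<xi>2 (bsec \<alpha> \<xi>3) (bsec \<beta> \<xi>1) x + tri \<xi>3 (bsec \<alpha> \<xi>1) (bsec \<beta> \<xi>2) x"

lemma quad_eq: "quad \<alpha> = quadB \<alpha> \<alpha>"
  by (auto simp: quad_def quadB_def fun_eq_iff)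

lemma bsec_add:
  assumes "\<alpha> \<in> OmL D A 2" "\<beta> \<in> OmL D A 2" "\<xi> \<in> GamSub D A"
  shows "bsec (\<lambda>x vs. \<alpha> x vs + \<beta> x vs) \<xi> x = bsec \<alpha> \<xi> x + bsec \<beta> \<xi> x"
proof -
  have b: "bsec \<alpha> \<xi> x \<in> B x" "bsec \<beta> \<xi> x \<in> B x"
    using bsec_Gam assms by (auto simp: GamSub_iff)
  show ?thesis
    unfolding bsec_def[of "\<lambda>x vs. \<alpha> x vs + \<beta> x vs"] unflatS_def
  proof (rule unflat_eqI)
    show "bsec \<alpha> \<xi> x + bsec \<beta> \<xi> x \<in> B x" using b by (rule subspace_add[OF B_subspace])
    show "prd D x (bsec \<alpha> \<xi> x + bsec \<beta> \<xi> x) a = contr (\<lambda>x vs. \<alpha> x vs + \<beta> x vs) \<xi> x [a]" if "a \<in> A x" for a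
      using prd_add_left[OF B_fib[OF b(1)] B_fib[OF b(2)] A_fib[OF that]] bsec_pairing[OF assms(1,3) that]
        bsec_pairing[OF assms(2,3) that] by (simp add: contr_def)
  qed
qed

lemma OmL2_section: "\<alpha> \<in> OmL D A 2 \<Longrightarrow> \<xi> \<in> GamSub D A \<Longrightarrow> \<zeta> \<in> GamSub D A \<Longrightarrow> (\<lambda>y. \<alpha> y [\<xi> y, \<zeta> y]) \<in> GamL D"
  using OmL_smooth[of \<alpha> 2 "[\<xi>, \<zeta>]"] by simp

context
  fixes \<xi>1 \<xi>2 \<xi>3 :: "'m \<Rightarrow> 'v" and x :: 'm
  assumes \<xi>: "\<xi>1 \<in> GamSub D A" "\<xi>2 \<in> GamSub D A" "\<xi>3 \<in> GamSub D A"
begin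

lemma \<xi>_Gam: "\<xi>1 \<in> GamE D" "\<xi>2 \<in> GamE D" "\<xi>3 \<in> GamE D"
  using \<xi> by (simp_all add: GamSub_iff)

lemma quadB_add_left:
  assumes "\<alpha> \<in> OmL D A 2" "\<alpha>' \<in> OmL D A 2" "\<beta> \<in> OmL D A 2"
  shows "quadB (\<lambda>x vs. \<alpha> x vs + \<alpha>' x vs) \<beta> \<xi>1 \<xi>2 \<xi>3 x = quadB \<alpha> \<beta> \<xi>1 \<xi>2 \<xi>3 x + quadB \<alpha>' \<beta> \<xi>1 \<xi>2 \<xi>3 x"
proof -
  note S = OmL_add[OF assms(1,2)]
  have n: "nab D x (bsec (\<lambda>x vs. \<alpha> x vs + \<alpha>' x vs) \<xi> x) s = nab D x (bsec \<alpha> \<xi> x) s + nab D x (bsec \<alpha>' \<xi> x) s"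
    if "\<xi> \<in> GamSub D A" "s \<in> GamL D" for \<xi> s
    using nab_linear[of "bsec \<alpha> \<xi> x" x "bsec \<alpha>' \<xi> x" s 1] bsec_Gam[OF assms(1) that(1)] bsec_Gam[OF assms(2) that(1)] that
    by (simp add: bsec_add[OF assms(1,2) that(1)] GamSub_iff E.Gam_fib)
  have t: "tri e (bsec (\<lambda>x vs. \<alpha> x vs + \<alpha>' x vs) \<xi>) (bsec \<beta> \<zeta>) x = tri e (bsec \<alpha> \<xi>) (bsec \<beta> \<zeta>) x + tri e (bsec \<alpha>' \<xi>) (bsec \<beta> \<zeta>) x"
    if "\<xi> \<in> GamSub D A" "\<zeta> \<in> GamSub D A" "e \<in> GamE D" for e \<xi> \<zeta>
    using tri_B_left(1)[OF that(3) bsec_Gam[OF S that(1)] bsec_Gam[OF assms(3) that(2)] bsec_Gam[OF assms(1) that(1)]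
        bsec_Gam[OF assms(2) that(1)], of x 1 1] by (simp add: bsec_add[OF assms(1,2) that(1)])
  show ?thesis
    unfolding quadB_def using \<xi> \<xi>_Gam OmL2_section[OF assms(3)] by (simp add: n t)
qed

lemma quadB_add_right:
  assumes "\<alpha> \<in> OmL D A 2" "\<alpha>' \<in> OmL D A 2" "\<beta> \<in> OmL D A 2"
  shows "quadB \<beta> (\<lambda>x vs. \<alpha> x vs + \<alpha>' x vs) \<xi>1 \<xi>2 \<xi>3 x = quadB \<beta> \<alpha> \<xi>1 \<xi>2 \<xi>3 x + quadB \<beta> \<alpha>' \<xi>1 \<xi>2 \<xi>3 x"
proof -
  note S = OmL_add[OF assms(1,2)]
  have n: "nab D x (bsec \<beta> \<kappa> x) (\<lambda>y. \<alpha> y [\<xi> y, \<zeta> y] + \<alpha>' y [\<xi> y, \<zeta> y]) =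
      nab D x (bsec \<beta> \<kappa> x) (\<lambda>y. \<alpha> y [\<xi> y, \<zeta> y]) + nab D x (bsec \<beta> \<kappa> x) (\<lambda>y. \<alpha>' y [\<xi> y, \<zeta> y])"
    if "\<xi> \<in> GamSub D A" "\<zeta> \<in> GamSub D A" "\<kappa> \<in> GamSub D A" for \<kappa> \<xi> \<zeta>
    using nab_section_linear[OF _ OmL2_section[OF assms(1) that(1,2)] OmL2_section[OF assms(2) that(1,2)], of "bsec \<beta> \<kappa> x" x 1]
      bsec_Gam[OF assms(3) that(3)] by (simp add: GamSub_iff E.Gam_fib)
  have t: "tri e (bsec \<beta> \<zeta>) (bsec (\<lambda>x vs. \<alpha> x vs + \<alpha>' x vs) \<xi>) x = tri e (bsec \<beta> \<zeta>) (bsec \<alpha> \<xi>) x + tri e (bsec \<beta> \<zeta>) (bsec \<alpha>' \<xi>) x"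
    if "\<xi> \<in> GamSub D A" "\<zeta> \<in> GamSub D A" "e \<in> GamE D" for e \<xi> \<zeta>
    using tri_B_left(2)[OF that(3) bsec_Gam[OF S that(1)] bsec_Gam[OF assms(3) that(2)] bsec_Gam[OF assms(1) that(1)]
        bsec_Gam[OF assms(2) that(1)], of x 1 1] by (simp add: bsec_add[OF assms(1,2) that(1)])
  show ?thesis
    unfolding quadB_def using \<xi> \<xi>_Gam by (simp add: n t)
qed

text \<open>Needed because decompositions exist near a point only: derivatives are local, and the
  \<open>tri\<close> terms see the B-components at x alone.\<close>

lemma quad_local:
  assumes \<eta>: "\<eta> \<in> OmL D A 2" "\<eta>' \<in> OmL D A 2" and N: "open N" "x \<in> N" "\<And>y vs. y \<in> N \<Longrightarrow> \<eta> y vs = \<eta>' y vs"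
  shows "quad \<eta> \<xi>1 \<xi>2 \<xi>3 x = quad \<eta>' \<xi>1 \<xi>2 \<xi>3 x"
proof -
  have b: "bsec \<eta> \<xi> x = bsec \<eta>' \<xi> x" for \<xi>
    using N(3)[OF N(2)] by (simp add: bsec_def unflatS_def contr_def)
  have n: "nab D x (bsec \<eta>' \<kappa> x) (\<lambda>y. \<eta> y [\<xi> y, \<zeta> y]) = nab D x (bsec \<eta>' \<kappa> x) (\<lambda>y. \<eta>' y [\<xi> y, \<zeta> y])"
    if "\<xi> \<in> GamSub D A" "\<zeta> \<in> GamSub D A" "\<kappa> \<in> GamSub D A" for \<kappa> \<xi> \<zeta>
    using bsec_Gam[OF \<eta>(2) that(3)] N(3)
    by (intro nab_local[OF _ OmL2_section[OF \<eta>(1) that(1,2)] OmL2_section[OF \<eta>(2) that(1,2)] N(1,2)])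
      (auto simp: GamSub_iff E.Gam_fib)
  have t: "tri e (bsec \<eta> \<xi>) (bsec \<eta> \<zeta>) x = tri e (bsec \<eta>' \<xi>) (bsec \<eta>' \<zeta>) x"
    if "\<xi> \<in> GamSub D A" "\<zeta> \<in> GamSub D A" "e \<in> GamE D" for e \<xi> \<zeta>
    using that bsec_Gam \<eta> b by (intro tri_cong_B) auto
  show ?thesis
    unfolding quad_def b using \<xi> \<xi>_Gam by (simp add: n t)
qed

end

context
  fixes \<theta> \<gamma> l x
  assumes \<theta>: "\<theta> \<in> Om D A 1" and \<gamma>: "\<gamma> \<in> OmL D A 1" and l: "l \<in> GamL D" "basis_list (fib (Lbun D) x) [l x]"
begin

text \<open>The contraction of \<theta> \<and> \<gamma> is \<theta>(\<xi>) \<gamma> -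
  \<gamma>(\<xi>) \<theta>. At x the value \<gamma>(\<xi>) is a real multiple of the generator l, so
  the second summand is a multiple of the section of B that corresponds to \<theta> \<otimes>
  l.\<close>

lemma bsec_wedge:
  assumes "\<xi> \<in> GamSub D A"
  shows "bsec (wedge \<theta> \<gamma>) \<xi> x = \<theta> x [\<xi> x] *\<^sub>R unflatS D A B \<gamma> x + (- lc (l x) (\<gamma> x [\<xi> x])) *\<^sub>R unflatS D A B (wedge \<theta> (form0 l)) x"
    (is "_ = ?t *\<^sub>R ?q + (- ?g) *\<^sub>R ?p")
proof -
  note W = wedge_form0_OmL[OF \<theta> l(1)]
  have pq: "?p \<in> B x" "?q \<in> B x" using unflatS_works(1)[OF W] unflatS_works(1)[OF \<gamma>] by simp_all
  have \<xi>x: "\<xi> x \<in> A x" using assms by (simp add: GamSub_iff)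
  have g: "\<gamma> x [\<xi> x] = ?g *\<^sub>R l x"
    using lc_scale[OF l(2)] alt_formsD(2)[OF OmL_alt[OF \<gamma>], of "[\<xi> x]" x] \<xi>x by simp
  show ?thesis
    unfolding bsec_def unflatS_def[of D A B "contr _ _"]
  proof (rule unflat_eqI)
    show "?t *\<^sub>R ?q + (- ?g) *\<^sub>R ?p \<in> B x"
      using pq by (intro subspace_add[OF B_subspace] subspace_scale[OF B_subspace])
    fix a assume a: "a \<in> A x"
    have "prd D x (?t *\<^sub>R ?q + (- ?g) *\<^sub>R ?p) a = ?t *\<^sub>R prd D x ?q a + (- ?g) *\<^sub>R prd D x ?p a"
      by (subst prd_linear_left[OF B_fib[OF pq(2)] subspace_scale[OF E.fib_subspace B_fib[OF pq(1)]] A_fib[OF a]],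
          subst prd_scale_left[OF B_fib[OF pq(1)] A_fib[OF a]], rule refl)
    also have "\<dots> = ?t *\<^sub>R \<gamma> x [a] + (- ?g) *\<^sub>R (\<theta> x [a] *\<^sub>R l x)"
      by (simp only: unflatS_works(2)[OF W a] unflatS_works(2)[OF \<gamma> a] wedge_form0_apply[OF \<theta>])
    also have "(- ?g) *\<^sub>R (\<theta> x [a] *\<^sub>R l x) = - (\<theta> x [a] *\<^sub>R (?g *\<^sub>R l x))"
      by (simp add: mult.commute)
    also have "?g *\<^sub>R l x = \<gamma> x [\<xi> x]"
      by (rule g[symmetric])
    also have "?t *\<^sub>R \<gamma> x [a] + - (\<theta> x [a] *\<^sub>R \<gamma> x [\<xi> x]) = contr (wedge \<theta> \<gamma>) \<xi> x [a]"
      by (simp add: contr_def wedge_11_apply[OF \<theta> \<gamma>])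
    finally show "prd D x (?t *\<^sub>R ?q + (- ?g) *\<^sub>R ?p) a = contr (wedge \<theta> \<gamma>) \<xi> x [a]" .
  qed
qed

end

end

section \<open>Consequences of the defining properties of the bracket of forms\<close>

locale dj_bracket = dj_pair D A B
  for D :: "('m::{t2_space, second_countable_topology}, 'e::real_normed_vector,
      'v::real_vector, 'l::real_normed_vector) cj_data" and A B +
  fixes br :: "('m, 'v, 'l) form \<Rightarrow> ('m, 'v, 'l) form \<Rightarrow> ('m, 'v, 'l) form"
  assumes bracket: "is_dagger_bracket D A B br"
begin

lemma form0_Nil: "form0 \<mu> x [] = \<mu> x"
  by (simp add: form0_def)

lemma br_skew: "\<alpha> \<in> OmL D A k \<Longrightarrow> \<beta> \<in> OmL D A j \<Longrightarrow> br \<alpha> \<beta> x vs = - ((-1) powi ((k - 1) * (j - 1)) *\<^sub>R br \<beta> \<alpha> x vs)"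
proof -
  assume "\<alpha> \<in> OmL D A k" "\<beta> \<in> OmL D A j"
  then have "br \<alpha> \<beta> = (\<lambda>x vs. - ((-1) powi ((k - 1) * (j - 1)) *\<^sub>R br \<beta> \<alpha> x vs))"
    using bracket unfolding is_dagger_bracket_def by blast
  then show ?thesis by (rule fun_cong[OF fun_cong])
qed

lemma br_derivation: "\<alpha> \<in> OmL D A k \<Longrightarrow> graded_module_derivation D A (k - 1) (br \<alpha>)"
  using bracket unfolding is_dagger_bracket_def by blast

lemma br_OmL: "\<alpha> \<in> OmL D A k \<Longrightarrow> \<beta> \<in> OmL D A j \<Longrightarrow> br \<alpha> \<beta> \<in> OmL D A (j + (k - 1))"
  using br_derivation unfolding graded_module_derivation_def by blast

lemma br_add:
  assumes "\<alpha> \<in> OmL D A k" "\<beta> \<in> OmL D A j" "\<beta>' \<in> OmL D A j"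
  shows "br \<alpha> (\<lambda>x vs. \<beta> x vs + \<beta>' x vs) x vs = br \<alpha> \<beta> x vs + br \<alpha> \<beta>' x vs"
proof -
  have "br \<alpha> (\<lambda>x vs. 1 *\<^sub>R \<beta> x vs + \<beta>' x vs) = (\<lambda>x vs. 1 *\<^sub>R br \<alpha> \<beta> x vs + br \<alpha> \<beta>' x vs)"
    using br_derivation[OF assms(1)] assms(2,3) unfolding graded_module_derivation_def by blast
  from fun_cong[OF fun_cong[OF this], of x vs] show ?thesis by simp
qed

lemma br_symbol:
  assumes "\<alpha> \<in> OmL D A k"
  obtains Y where "\<And>j \<omega>. \<omega> \<in> Om D A j \<Longrightarrow> Y \<omega> \<in> Om D A (j + (k - 1))"
    "\<And>i j \<omega> \<beta> x vs. \<omega> \<in> Om D A i \<Longrightarrow> \<beta> \<in> OmL D A j \<Longrightarrow>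
      br \<alpha> (wedge \<omega> \<beta>) x vs = wedge (Y \<omega>) \<beta> x vs + (-1) powi ((k - 1) * i) *\<^sub>R wedge \<omega> (br \<alpha> \<beta>) x vs"
proof -
  obtain Y where Y: "graded_derivation D A (k - 1) Y"
    "\<forall>j l. \<forall>\<omega>\<in>Om D A j. \<forall>\<beta>\<in>OmL D A l. br \<alpha> (wedge \<omega> \<beta>) =
       (\<lambda>x vs. wedge (Y \<omega>) \<beta> x vs + (-1) powi ((k - 1) * j) *\<^sub>R wedge \<omega> (br \<alpha> \<beta>) x vs)"
    using br_derivation[OF assms] unfolding graded_module_derivation_def by blast
  show ?thesis
  proof (rule that[of Y])
    show "\<And>j \<omega>. \<omega> \<in> Om D A j \<Longrightarrow> Y \<omega> \<in> Om D A (j + (k - 1))"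
      using Y(1) unfolding graded_derivation_def by blast
    fix i j \<omega> \<beta> x vs assume "\<omega> \<in> Om D A i" "\<beta> \<in> OmL D A j"
    then have "br \<alpha> (wedge \<omega> \<beta>) =
       (\<lambda>x vs. wedge (Y \<omega>) \<beta> x vs + (-1) powi ((k - 1) * i) *\<^sub>R wedge \<omega> (br \<alpha> \<beta>) x vs)"
      using Y(2) by blast
    then show "br \<alpha> (wedge \<omega> \<beta>) x vs = wedge (Y \<omega>) \<beta> x vs + (-1) powi ((k - 1) * i) *\<^sub>R wedge \<omega> (br \<alpha> \<beta>) x vs"
      by (rule fun_cong[OF fun_cong])
  qed
qed

lemma br_11:
  assumes "\<alpha> \<in> OmL D A 1" "\<beta> \<in> OmL D A 1" "a \<in> A x"
  shows "br \<alpha> \<beta> x [a] = prd D x (brk D (unflatS D A B \<alpha>) (unflatS D A B \<beta>) x) a"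
proof -
  have "br \<alpha> \<beta> = brk_dagger D A B \<alpha> \<beta>"
    using bracket assms(1,2) unfolding is_dagger_bracket_def by blast
  moreover have "brk D (unflatS D A B \<alpha>) (unflatS D A B \<beta>) \<in> GamE D"
    using unflatS_Gam assms(1,2) by (intro brk_Gam) (auto simp: GamSub_iff)
  ultimately show ?thesis
    using pr_dagger_apply[of "brk D (unflatS D A B \<alpha>) (unflatS D A B \<beta>)" x a, OF _ assms(3)]
    by (simp add: brk_dagger_def E.Gam_fib)
qed

lemma br_10: "\<alpha> \<in> OmL D A 1 \<Longrightarrow> \<mu> \<in> GamL D \<Longrightarrow> br \<alpha> (form0 \<mu>) = form0 (nabS D (unflatS D A B \<alpha>) \<mu>)"
  using bracket unfolding is_dagger_bracket_def nab_dagger_def by blast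

lemma br_22_sym: "\<alpha> \<in> OmL D A 2 \<Longrightarrow> \<beta> \<in> OmL D A 2 \<Longrightarrow> br \<alpha> \<beta> x vs = br \<beta> \<alpha> x vs"
  using br_skew[of \<alpha> 2 \<beta> 2 x vs] by simp

text \<open>With f = 1 - \<rho> one has \<beta> = f \<beta>, since \<beta> vanishes where f differs
  from 1. The derivation property gives a term with the factor \<beta> and a term with the factor f,
  and both factors vanish at x.\<close>

lemma br_local:
  assumes \<alpha>: "\<alpha> \<in> OmL D A 2" and \<beta>: "\<beta> \<in> OmL D A 2" and N: "open N" "x \<in> N" "\<And>y vs. y \<in> N \<Longrightarrow> \<beta> y vs = 0"
  shows "br \<alpha> \<beta> x vs = 0"
proof -
  obtain \<rho> N' C where \<rho>: "\<rho> \<in> Cinf (atl D)" "open N'" "x \<in> N'" "\<And>y. y \<in> N' \<Longrightarrow> \<rho> y = 1"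
    "closed C" "C \<subseteq> N" "\<And>y. y \<notin> C \<Longrightarrow> \<rho> y = 0" "N' \<subseteq> N"
    by (rule E.bump_function[OF N(1,2)]) (rule that; assumption)
  define f where "f y = 1 - \<rho> y" for y
  have f: "f \<in> Cinf (atl D)"
    unfolding f_def[abs_def] E.Cinf_iff
    by (intro E.smooth_fun_on_diff E.smooth_fun_on_const E.Cinf_smooth_fun_on[OF \<rho>(1)] open_UNIV)
  have fx: "f x = 0" using \<rho>(4)[OF \<rho>(3)] by (simp add: f_def)
  have "f y *\<^sub>R \<beta> y vs = \<beta> y vs" for y vs
  proof (cases "y \<in> N")
    case False
    then have "\<rho> y = 0" using \<rho>(6,7) by blast
    then show ?thesis by (simp add: f_def)
  qed (simp add: N(3))
  then have \<beta>f: "wedge (form0 f) \<beta> = \<beta>"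
    unfolding wedge_form0_2[OF f \<beta>] by simp
  obtain Y where Y: "\<And>j \<omega>. \<omega> \<in> Om D A j \<Longrightarrow> Y \<omega> \<in> Om D A (j + (2 - 1))"
    "\<And>i j \<omega> \<beta> x vs. \<omega> \<in> Om D A i \<Longrightarrow> \<beta> \<in> OmL D A j \<Longrightarrow>
      br \<alpha> (wedge \<omega> \<beta>) x vs = wedge (Y \<omega>) \<beta> x vs + (-1) powi ((2 - 1) * i) *\<^sub>R wedge \<omega> (br \<alpha> \<beta>) x vs"
    by (rule br_symbol[OF \<alpha>]) (rule that; assumption)
  have "\<beta> x = (\<lambda>vs. 0)" using N(2,3) by auto
  then have "wedge \<omega> \<beta> x vs = 0" for \<omega> by (simp add: wedge_def wedge_at_def)
  moreover have "form0 f x ws = 0" for ws :: "'v list" using fx by (simp add: form0_def)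
  then have "wedge (form0 f) \<kappa> x vs = 0" for \<kappa> :: "('m, 'v, 'l) form" by (simp add: wedge_def wedge_at_def)
  ultimately show ?thesis
    using Y(2)[OF form0_Om[OF f] \<beta>, of x vs] unfolding \<beta>f by simp
qed

context
  fixes \<theta> \<gamma> l x
  assumes \<theta>: "\<theta> \<in> Om D A 1" and \<gamma>: "\<gamma> \<in> OmL D A 1" and l: "l \<in> GamL D" "basis_list (fib (Lbun D) x) [l x]"
begin

text \<open>The symbol of the bracket with c is only known to exist. Testing it on \<theta>
  \<otimes> l, where the bracket is a bracket of 1-forms, determines its value Y on \<theta>; the
  derivation property then gives the bracket with \<theta> \<and> \<gamma>.\<close>

lemma br_1_wedge:
  assumes c: "c \<in> OmL D A 1"
  shows "\<exists>Y::'v \<Rightarrow> real. (\<forall>u\<in>A x. Y u *\<^sub>R l x = prd D x (brk D (unflatS D A B c) (unflatS D A B (wedge \<theta> (form0 l))) x) u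
        - \<theta> x [u] *\<^sub>R nab D x (unflatS D A B c x) l) \<and>
      (\<forall>u\<in>A x. \<forall>v\<in>A x. br (wedge \<theta> \<gamma>) c x [u, v] = - (Y u *\<^sub>R \<gamma> x [v] - Y v *\<^sub>R \<gamma> x [u]
        + \<theta> x [u] *\<^sub>R br c \<gamma> x [v] - \<theta> x [v] *\<^sub>R br c \<gamma> x [u]))"
proof -
  obtain Y where Y: "\<And>j \<omega>. \<omega> \<in> Om D A j \<Longrightarrow> Y \<omega> \<in> Om D A (j + (1 - 1))"
    "\<And>i j \<omega> \<beta> x vs. \<omega> \<in> Om D A i \<Longrightarrow> \<beta> \<in> OmL D A j \<Longrightarrow>
      br c (wedge \<omega> \<beta>) x vs = wedge (Y \<omega>) \<beta> x vs + (-1) powi ((1 - 1) * i) *\<^sub>R wedge \<omega> (br c \<beta>) x vs"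
    by (rule br_symbol[OF c]) (rule that; assumption)
  have Y\<theta>: "Y \<theta> \<in> Om D A 1" using Y(1)[OF \<theta>] by simp
  have c\<gamma>: "br c \<gamma> \<in> OmL D A 1" using br_OmL[OF c \<gamma>] by simp
  have "Y \<theta> x [u] *\<^sub>R l x = prd D x (brk D (unflatS D A B c) (unflatS D A B (wedge \<theta> (form0 l))) x) u
        - \<theta> x [u] *\<^sub>R nab D x (unflatS D A B c x) l" if "u \<in> A x" for u
    using Y(2)[OF \<theta> form0_OmL[OF l(1)], of x "[u]"] br_11[OF c wedge_form0_OmL[OF \<theta> l(1)] that]
    by (simp add: br_10[OF c l(1)] wedge_form0_apply[OF \<theta>] wedge_form0_apply[OF Y\<theta>] nabS_def algebra_simps)
  moreover have "br (wedge \<theta> \<gamma>) c x [u, v] = - (Y \<theta> x [u] *\<^sub>R \<gamma> x [v] - Y \<theta> x [v] *\<^sub>R \<gamma> x [u]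
        + \<theta> x [u] *\<^sub>R br c \<gamma> x [v] - \<theta> x [v] *\<^sub>R br c \<gamma> x [u])" for u v
    using br_skew[OF wedge_11_OmL[OF \<theta> \<gamma>] c, of x "[u, v]"] Y(2)[OF \<theta> \<gamma>, of x "[u, v]"]
    by (simp add: wedge_11_apply[OF \<theta> c\<gamma>] wedge_11_apply[OF Y\<theta> \<gamma>] algebra_simps)
  ultimately show ?thesis by (intro exI[of _ "\<lambda>u. Y \<theta> x [u]"]) blast
qed

text \<open>The same test on \<theta> \<otimes> l, now for the bracket with the section l. Its
  symbol has degree -1, so it turns \<theta> into a function.\<close>

lemma br_wedge_0:
  assumes u: "u \<in> A x"
  shows "br (wedge \<theta> \<gamma>) (form0 l) x [u] = \<theta> x [u] *\<^sub>R nab D x (unflatS D A B \<gamma> x) l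
    - lc (l x) (\<gamma> x [u]) *\<^sub>R nab D x (unflatS D A B (wedge \<theta> (form0 l)) x) l"
proof -
  note W = wedge_form0_OmL[OF \<theta> l(1)] and f0 = form0_OmL[OF l(1)]
  obtain Y where Y: "\<And>j \<omega>. \<omega> \<in> Om D A j \<Longrightarrow> Y \<omega> \<in> Om D A (j + (0 - 1))"
    "\<And>i j \<omega> \<beta> x vs. \<omega> \<in> Om D A i \<Longrightarrow> \<beta> \<in> OmL D A j \<Longrightarrow>
      br (form0 l) (wedge \<omega> \<beta>) x vs = wedge (Y \<omega>) \<beta> x vs + (-1) powi ((0 - 1) * i) *\<^sub>R wedge \<omega> (br (form0 l) \<beta>) x vs"
    by (rule br_symbol[OF f0]) (rule that; assumption)
  have Y\<theta>: "Y \<theta> \<in> Om D A 0" using Y(1)[OF \<theta>] by simp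
  \<comment> \<open>This bracket is a form of degree -1, so it vanishes.\<close>
  have "br (form0 l) (form0 l) y vs = 0" for y vs
    using alt_formsD(1)[OF OmL_alt[OF br_OmL[OF f0 f0]], of y vs] by auto
  then have "wedge \<theta> (br (form0 l) (form0 l)) x [] = 0"
    by (simp add: wedge_def wedge_at_def)
  moreover have "wedge (Y \<theta>) (form0 l) x [] = Y \<theta> x [] *\<^sub>R l x"
    unfolding wedge_def by (subst wedge_00[OF OmL_degrees(5)[OF Y\<theta>] form0_degree]) (simp add: form0_def)
  ultimately have "Y \<theta> x [] *\<^sub>R l x = br (form0 l) (wedge \<theta> (form0 l)) x []"
    using Y(2)[OF \<theta> f0, of x "[]"] by simp
  also have "\<dots> = - nab D x (unflatS D A B (wedge \<theta> (form0 l)) x) l"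
    using br_skew[OF f0 W, of x "[]"] by (simp add: br_10[OF W l(1)] form0_Nil nabS_def)
  finally have Y0: "Y \<theta> x [] *\<^sub>R l x = - nab D x (unflatS D A B (wedge \<theta> (form0 l)) x) l" .
  have \<gamma>0: "br (form0 l) \<gamma> \<in> OmL D A 0" using br_OmL[OF f0 \<gamma>] by simp
  have "br (form0 l) \<gamma> x [] = - nab D x (unflatS D A B \<gamma> x) l"
    using br_skew[OF f0 \<gamma>, of x "[]"] by (simp add: br_10[OF \<gamma> l(1)] form0_Nil nabS_def)
  then have "wedge \<theta> (br (form0 l) \<gamma>) x [u] = - (\<theta> x [u] *\<^sub>R nab D x (unflatS D A B \<gamma> x) l)"
    unfolding wedge_def by (subst wedge_10[OF OmL_degrees(6)[OF \<theta>] OmL_degrees(1)[OF \<gamma>0]]) simp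
  moreover have "wedge (Y \<theta>) \<gamma> x [u] = Y \<theta> x [] *\<^sub>R \<gamma> x [u]"
    unfolding wedge_def by (rule wedge_01[OF OmL_degrees(5)[OF Y\<theta>] OmL_degrees(2)[OF \<gamma>]])
  moreover have "\<gamma> x [u] = lc (l x) (\<gamma> x [u]) *\<^sub>R l x"
    using lc_scale[OF l(2)] alt_formsD(2)[OF OmL_alt[OF \<gamma>], of "[u]" x] u by simp
  then have "Y \<theta> x [] *\<^sub>R \<gamma> x [u] = lc (l x) (\<gamma> x [u]) *\<^sub>R (Y \<theta> x [] *\<^sub>R l x)"
    by (metis scaleR_left_commute)
  moreover have "br (wedge \<theta> \<gamma>) (form0 l) x [u] = br (form0 l) (wedge \<theta> \<gamma>) x [u]"
    using br_skew[OF wedge_11_OmL[OF \<theta> \<gamma>] f0, of x "[u]"] by (simp add: power_int_minus)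
  ultimately show ?thesis
    using Y(2)[OF \<theta> \<gamma>, of x "[u]"] by (simp add: Y0 power_int_minus)
qed

text \<open>The bracket with a 2-form has degree 1, so passing it over \<theta> costs a sign. Again
  the value of its symbol on \<theta>, here called E, is found from \<theta> \<otimes> l.\<close>

lemma br_2_wedge:
  assumes \<alpha>: "\<alpha> \<in> OmL D A 2"
  shows "\<exists>E::'v \<Rightarrow> 'v \<Rightarrow> real. (\<forall>u\<in>A x. \<forall>v\<in>A x. E u v *\<^sub>R l x = br \<alpha> (wedge \<theta> (form0 l)) x [u, v]
        + (\<theta> x [u] *\<^sub>R br \<alpha> (form0 l) x [v] - \<theta> x [v] *\<^sub>R br \<alpha> (form0 l) x [u])) \<and>
      (\<forall>u\<in>A x. \<forall>v\<in>A x. \<forall>w\<in>A x. br \<alpha> (wedge \<theta> \<gamma>) x [u, v, w] =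
        E u v *\<^sub>R \<gamma> x [w] - E u w *\<^sub>R \<gamma> x [v] + E v w *\<^sub>R \<gamma> x [u]
        - (\<theta> x [u] *\<^sub>R br \<alpha> \<gamma> x [v, w] - \<theta> x [v] *\<^sub>R br \<alpha> \<gamma> x [u, w] + \<theta> x [w] *\<^sub>R br \<alpha> \<gamma> x [u, v]))"
proof -
  obtain Y where Y: "\<And>j \<omega>. \<omega> \<in> Om D A j \<Longrightarrow> Y \<omega> \<in> Om D A (j + (2 - 1))"
    "\<And>i j \<omega> \<beta> x vs. \<omega> \<in> Om D A i \<Longrightarrow> \<beta> \<in> OmL D A j \<Longrightarrow>
      br \<alpha> (wedge \<omega> \<beta>) x vs = wedge (Y \<omega>) \<beta> x vs + (-1) powi ((2 - 1) * i) *\<^sub>R wedge \<omega> (br \<alpha> \<beta>) x vs"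
    by (rule br_symbol[OF \<alpha>]) (rule that; assumption)
  have Y\<theta>: "Y \<theta> \<in> Om D A 2" using Y(1)[OF \<theta>] by simp
  have \<alpha>\<gamma>: "br \<alpha> \<gamma> \<in> OmL D A 2" using br_OmL[OF \<alpha> \<gamma>] by simp
  have \<alpha>l: "br \<alpha> (form0 l) \<in> OmL D A 1" using br_OmL[OF \<alpha> form0_OmL[OF l(1)]] by simp
  have "Y \<theta> x [u, v] *\<^sub>R l x = br \<alpha> (wedge \<theta> (form0 l)) x [u, v]
        + (\<theta> x [u] *\<^sub>R br \<alpha> (form0 l) x [v] - \<theta> x [v] *\<^sub>R br \<alpha> (form0 l) x [u])"
    if "u \<in> A x" "v \<in> A x" for u v
  proof -
    have "wedge (Y \<theta>) (form0 l) x [u, v] = Y \<theta> x [u, v] *\<^sub>R l x"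
      unfolding wedge_def
      by (subst wedge_20[OF OmL_degrees(7)[OF Y\<theta>] form0_degree Om_skew[OF Y\<theta> that(2,1)]]) (simp add: form0_def)
    then show ?thesis
      using Y(2)[OF \<theta> form0_OmL[OF l(1)], of x "[u, v]"] by (simp add: wedge_11_apply[OF \<theta> \<alpha>l])
  qed
  moreover have "br \<alpha> (wedge \<theta> \<gamma>) x [u, v, w] =
        Y \<theta> x [u, v] *\<^sub>R \<gamma> x [w] - Y \<theta> x [u, w] *\<^sub>R \<gamma> x [v] + Y \<theta> x [v, w] *\<^sub>R \<gamma> x [u]
        - (\<theta> x [u] *\<^sub>R br \<alpha> \<gamma> x [v, w] - \<theta> x [v] *\<^sub>R br \<alpha> \<gamma> x [u, w] + \<theta> x [w] *\<^sub>R br \<alpha> \<gamma> x [u, v])"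
    if "u \<in> A x" "v \<in> A x" "w \<in> A x" for u v w
    using Y(2)[OF \<theta> \<gamma>, of x "[u, v, w]"]
      wedge_21[OF OmL_degrees(7)[OF Y\<theta>] OmL_degrees(2)[OF \<gamma>] Om_skew[OF Y\<theta> that(2,1)] Om_skew[OF Y\<theta> that(3,1)] Om_skew[OF Y\<theta> that(3,2)]]
      wedge_12[OF OmL_degrees(6)[OF \<theta>] OmL_degrees(3)[OF \<alpha>\<gamma>] OmL_skew[OF \<alpha>\<gamma> that(2,1)] OmL_skew[OF \<alpha>\<gamma> that(3,1)] OmL_skew[OF \<alpha>\<gamma> that(3,2)]]
    by (simp add: wedge_def)
  ultimately show ?thesis by (intro exI[of _ "\<lambda>u v. Y \<theta> x [u, v]"]) blast
qed

end

end

section \<open>Decomposable 2-forms expanded at a point\<close>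

context dj_pair
begin

lemma prdS_unflatS:
  assumes "\<alpha> \<in> OmL D A 1" "\<xi> \<in> GamSub D A"
  shows "prdS D (unflatS D A B \<alpha>) \<xi> = (\<lambda>y. \<alpha> y [\<xi> y])"
  using unflatS_works(2)[OF assms(1)] assms(2) by (auto simp: prdS_def GamSub_iff)

context
  fixes \<theta> \<gamma> l x
  assumes \<theta>: "\<theta> \<in> Om D A 1" and \<gamma>: "\<gamma> \<in> OmL D A 1" and l: "l \<in> GamL D" "basis_list (fib (Lbun D) x) [l x]"
begin

lemma Om1_section: "\<xi> \<in> GamSub D A \<Longrightarrow> (\<lambda>y. \<theta> y [\<xi> y]) \<in> Cinf (atl D)"
  using Om_smooth[OF \<theta>, of "[\<xi>]"] by simp

lemma OmL1_section: "\<xi> \<in> GamSub D A \<Longrightarrow> (\<lambda>y. \<gamma> y [\<xi> y]) \<in> GamL D"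
  using OmL_smooth[OF \<gamma>, of "[\<xi>]"] by simp

lemma OmL1_lc: "\<xi> \<in> GamSub D A \<Longrightarrow> \<gamma> x [\<xi> x] = lc (l x) (\<gamma> x [\<xi> x]) *\<^sub>R l x"
  using lc_scale[OF l(2)] L.Gam_fib[OF OmL1_section, of \<xi> x] by simp

lemma nab_lc: "u \<in> fib (Ebun D) x \<Longrightarrow> s \<in> GamL D \<Longrightarrow> nab D x u s = lc (l x) (nab D x u s) *\<^sub>R l x"
  using lc_scale[OF l(2) nab_fib] by simp

lemma nab_wedge:
  assumes u: "u \<in> fib (Ebun D) x" and X: "\<forall>f\<in>Cinf (atl D). \<forall>s\<in>GamL D. nab D x u (\<lambda>y. f y *\<^sub>R s y) = X f *\<^sub>R s x + f x *\<^sub>R nab D x u s"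
    and \<zeta>: "\<zeta> \<in> GamSub D A" and \<kappa>: "\<kappa> \<in> GamSub D A"
  shows "nab D x u (\<lambda>y. wedge \<theta> \<gamma> y [\<zeta> y, \<kappa> y]) =
    (X (\<lambda>y. \<theta> y [\<zeta> y]) * lc (l x) (\<gamma> x [\<kappa> x]) + \<theta> x [\<zeta> x] * lc (l x) (nab D x u (\<lambda>y. \<gamma> y [\<kappa> y]))
     - (X (\<lambda>y. \<theta> y [\<kappa> y]) * lc (l x) (\<gamma> x [\<zeta> x]) + \<theta> x [\<kappa> x] * lc (l x) (nab D x u (\<lambda>y. \<gamma> y [\<zeta> y])))) *\<^sub>R l x"
proof -
  have one: "nab D x u (\<lambda>y. \<theta> y [\<zeta> y] *\<^sub>R \<gamma> y [\<kappa> y]) =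
      (X (\<lambda>y. \<theta> y [\<zeta> y]) * lc (l x) (\<gamma> x [\<kappa> x]) + \<theta> x [\<zeta> x] * lc (l x) (nab D x u (\<lambda>y. \<gamma> y [\<kappa> y]))) *\<^sub>R l x"
    if \<zeta>: "\<zeta> \<in> GamSub D A" and \<kappa>: "\<kappa> \<in> GamSub D A" for \<zeta> \<kappa>
  proof -
    have "nab D x u (\<lambda>y. \<theta> y [\<zeta> y] *\<^sub>R \<gamma> y [\<kappa> y]) =
        X (\<lambda>y. \<theta> y [\<zeta> y]) *\<^sub>R (lc (l x) (\<gamma> x [\<kappa> x]) *\<^sub>R l x) + \<theta> x [\<zeta> x] *\<^sub>R (lc (l x) (nab D x u (\<lambda>y. \<gamma> y [\<kappa> y])) *\<^sub>R l x)"
      unfolding X[rule_format, OF Om1_section[OF \<zeta>] OmL1_section[OF \<kappa>]]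
      using OmL1_lc[OF \<kappa>] nab_lc[OF u OmL1_section[OF \<kappa>]] by simp
    then show ?thesis by (simp add: scaleR_add_left)
  qed
  have G: "(\<lambda>y. \<theta> y [\<zeta> y] *\<^sub>R \<gamma> y [\<kappa> y]) \<in> GamL D" "(\<lambda>y. \<theta> y [\<kappa> y] *\<^sub>R \<gamma> y [\<zeta> y]) \<in> GamL D"
    using L.Gam_scale[OF Om1_section[OF \<zeta>] OmL1_section[OF \<kappa>]] L.Gam_scale[OF Om1_section[OF \<kappa>] OmL1_section[OF \<zeta>]] by simp_all
  have "nab D x u (\<lambda>y. wedge \<theta> \<gamma> y [\<zeta> y, \<kappa> y]) = nab D x u (\<lambda>y. (-1) *\<^sub>R (\<theta> y [\<kappa> y] *\<^sub>R \<gamma> y [\<zeta> y]) + \<theta> y [\<zeta> y] *\<^sub>R \<gamma> y [\<kappa> y])"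
    by (simp add: wedge_11_apply[OF \<theta> \<gamma>])
  also have "\<dots> = nab D x u (\<lambda>y. \<theta> y [\<zeta> y] *\<^sub>R \<gamma> y [\<kappa> y]) - nab D x u (\<lambda>y. \<theta> y [\<kappa> y] *\<^sub>R \<gamma> y [\<zeta> y])"
    unfolding nab_section_linear[OF u G(2,1)] by simp
  finally show ?thesis
    unfolding one[OF \<zeta> \<kappa>] one[OF \<kappa> \<zeta>] by (simp only: scaleR_diff_left)
qed

lemma unflatS_B: "unflatS D A B \<gamma> \<in> GamSub D B" "unflatS D A B (wedge \<theta> (form0 l)) \<in> GamSub D B"
  by (rule unflatS_Gam[OF \<gamma>], rule unflatS_Gam[OF wedge_form0_OmL[OF \<theta> l(1)]])

lemma nab_bsec_wedge:
  assumes \<xi>: "\<xi> \<in> GamSub D A" and s: "s \<in> GamL D"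
  shows "nab D x (bsec (wedge \<theta> \<gamma>) \<xi> x) s = \<theta> x [\<xi> x] *\<^sub>R nab D x (unflatS D A B \<gamma> x) s
    - lc (l x) (\<gamma> x [\<xi> x]) *\<^sub>R nab D x (unflatS D A B (wedge \<theta> (form0 l)) x) s"
proof -
  let ?p = "unflatS D A B (wedge \<theta> (form0 l)) x" and ?q = "unflatS D A B \<gamma> x" and ?g = "lc (l x) (\<gamma> x [\<xi> x])"
  have fib: "?p \<in> fib (Ebun D) x" "?q \<in> fib (Ebun D) x"
    using unflatS_B by (auto simp: GamSub_iff E.Gam_fib)
  have m: "(- ?g) *\<^sub>R ?p \<in> fib (Ebun D) x"
    by (rule subspace_scale[OF E.fib_subspace fib(1)])
  have "nab D x ((- ?g) *\<^sub>R ?p + 0) s = (- ?g) *\<^sub>R nab D x ?p s + nab D x 0 s"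
    by (rule nab_linear[OF fib(1) subspace_0[OF E.fib_subspace] s])
  then have "nab D x ((- ?g) *\<^sub>R ?p) s = (- ?g) *\<^sub>R nab D x ?p s" by (simp add: nab_zero[OF s])
  then show ?thesis
    unfolding bsec_wedge[OF \<theta> \<gamma> l \<xi>] nab_linear[OF fib(2) m s] by simp
qed

lemma tri_bsec_wedge:
  assumes "e \<in> GamE D" "\<xi> \<in> GamSub D A" "s \<in> GamSub D B"
  shows "tri e (bsec (wedge \<theta> \<gamma>) \<xi>) s x = \<theta> x [\<xi> x] *\<^sub>R tri e (unflatS D A B \<gamma>) s x
      - lc (l x) (\<gamma> x [\<xi> x]) *\<^sub>R tri e (unflatS D A B (wedge \<theta> (form0 l))) s x"
    "tri e s (bsec (wedge \<theta> \<gamma>) \<xi>) x = \<theta> x [\<xi> x] *\<^sub>R tri e s (unflatS D A B \<gamma>) x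
      - lc (l x) (\<gamma> x [\<xi> x]) *\<^sub>R tri e s (unflatS D A B (wedge \<theta> (form0 l))) x"
  using tri_B_left[OF assms(1) bsec_Gam[OF wedge_11_OmL[OF \<theta> \<gamma>] assms(2)] assms(3) unflatS_B bsec_wedge[OF \<theta> \<gamma> l assms(2)]]
  by simp_all

end

end

context dj_bracket
begin

text \<open>Both sides are multiples of the generator of L at x. The left side is unravelled by
  applying the derivation property in each entry, the right side by expanding the B-components; what
  remains is the polynomial identity \<open>schouten_identity\<close> in real numbers.\<close>

lemma br_decomposable:
  assumes \<theta>: "\<theta> \<in> Om D A 1" and \<gamma>: "\<gamma> \<in> OmL D A 1" and \<theta>': "\<theta>' \<in> Om D A 1" and \<gamma>': "\<gamma>' \<in> OmL D A 1"
    and \<xi>: "\<xi>1 \<in> GamSub D A" "\<xi>2 \<in> GamSub D A" "\<xi>3 \<in> GamSub D A"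
  shows "br (wedge \<theta> \<gamma>) (wedge \<theta>' \<gamma>') x [\<xi>1 x, \<xi>2 x, \<xi>3 x] =
    quadB (wedge \<theta> \<gamma>) (wedge \<theta>' \<gamma>') \<xi>1 \<xi>2 \<xi>3 x + quadB (wedge \<theta>' \<gamma>') (wedge \<theta> \<gamma>) \<xi>1 \<xi>2 \<xi>3 x"
proof -
  obtain l where l: "l \<in> GamL D" "basis_list (fib (Lbun D) x) [l x]"
    by (rule line_frame[of x]) blast
  define \<alpha> where "\<alpha> = wedge \<theta> \<gamma>"
  define \<alpha>' where "\<alpha>' = wedge \<theta>' \<gamma>'"
  define \<beta> where "\<beta> = wedge \<theta> (form0 l)"
  define \<beta>' where "\<beta>' = wedge \<theta>' (form0 l)"
  have \<alpha>: "\<alpha> \<in> OmL D A 2" "\<alpha>' \<in> OmL D A 2"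
    unfolding \<alpha>_def \<alpha>'_def by (rule wedge_11_OmL[OF \<theta> \<gamma>], rule wedge_11_OmL[OF \<theta>' \<gamma>'])
  have \<beta>: "\<beta> \<in> OmL D A 1" "\<beta>' \<in> OmL D A 1"
    unfolding \<beta>_def \<beta>'_def by (rule wedge_form0_OmL[OF \<theta> l(1)], rule wedge_form0_OmL[OF \<theta>' l(1)])
  \<comment> \<open>The sections of B that correspond to \<theta> \<otimes> l and \<gamma>; P and Q
    are their counterparts for the second form. All B-components at x are combinations of these
    four.\<close>
  define p where "p = unflatS D A B \<beta>"
  define q where "q = unflatS D A B \<gamma>"
  define P where "P = unflatS D A B \<beta>'"
  define Q where "Q = unflatS D A B \<gamma>'"
  have B: "p \<in> GamSub D B" "q \<in> GamSub D B" "P \<in> GamSub D B" "Q \<in> GamSub D B"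
    unfolding p_def q_def P_def Q_def using unflatS_Gam \<beta> \<gamma> \<gamma>' by blast+
  have G: "p \<in> GamE D" "q \<in> GamE D" "P \<in> GamE D" "Q \<in> GamE D"
    using B by (simp_all add: GamSub_iff)
  note fib = G[THEN E.Gam_fib, of x]
  define t where "t \<xi> = \<theta> x [\<xi> x]" for \<xi>
  define t' where "t' \<xi> = \<theta>' x [\<xi> x]" for \<xi>
  define g where "g \<xi> = lc (l x) (\<gamma> x [\<xi> x])" for \<xi>
  define g' where "g' \<xi> = lc (l x) (\<gamma>' x [\<xi> x])" for \<xi>
  \<comment> \<open>The action on functions of the derivations along p, q, P and Q at x. It appears
    as soon as a section is written as a function times l.\<close>
  obtain Xp where Xp: "\<forall>f\<in>Cinf (atl D). \<forall>s\<in>GamL D. nab D x (p x) (\<lambda>y. f y *\<^sub>R s y) = Xp f *\<^sub>R s x + f x *\<^sub>R nab D x (p x) s"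
    by (rule nab_leibniz[OF fib(1)]) blast
  obtain Xq where Xq: "\<forall>f\<in>Cinf (atl D). \<forall>s\<in>GamL D. nab D x (q x) (\<lambda>y. f y *\<^sub>R s y) = Xq f *\<^sub>R s x + f x *\<^sub>R nab D x (q x) s"
    by (rule nab_leibniz[OF fib(2)]) blast
  obtain XP where XP: "\<forall>f\<in>Cinf (atl D). \<forall>s\<in>GamL D. nab D x (P x) (\<lambda>y. f y *\<^sub>R s y) = XP f *\<^sub>R s x + f x *\<^sub>R nab D x (P x) s"
    by (rule nab_leibniz[OF fib(3)]) blast
  obtain XQ where XQ: "\<forall>f\<in>Cinf (atl D). \<forall>s\<in>GamL D. nab D x (Q x) (\<lambda>y. f y *\<^sub>R s y) = XQ f *\<^sub>R s x + f x *\<^sub>R nab D x (Q x) s"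
    by (rule nab_leibniz[OF fib(4)]) blast
  define d where "d c = lc (l x) (nab D x (c x) l)" for c
  define n where "n c \<xi> = lc (l x) (nab D x (c x) (\<lambda>y. \<gamma> y [\<xi> y]))" for c \<xi>
  define n' where "n' c \<xi> = lc (l x) (nab D x (c x) (\<lambda>y. \<gamma>' y [\<xi> y]))" for c \<xi>
  define f where "f \<xi> = (\<lambda>y. \<theta> y [\<xi> y])" for \<xi>
  define f' where "f' \<xi> = (\<lambda>y. \<theta>' y [\<xi> y])" for \<xi>
  define \<tau> where "\<tau> \<xi> c e = lc (l x) (tri \<xi> c e x)" for \<xi> c e
  have \<tau>: "tri \<xi> c e x = \<tau> \<xi> c e *\<^sub>R l x" if "\<xi> \<in> GamE D" "c \<in> GamE D" "e \<in> GamE D" for \<xi> c e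
    unfolding \<tau>_def tri_def using lc_scale[OF l(2)] prd_fib brk_Gam[OF that(1,2)] that(3) E.Gam_fib by simp
  have d: "nab D x (c x) l = d c *\<^sub>R l x" if "c \<in> GamE D" for c
    unfolding d_def by (rule nab_lc[OF \<theta> \<gamma> l E.Gam_fib[OF that] l(1)])
  have n: "nab D x (c x) (\<lambda>y. \<gamma> y [\<xi> y]) = n c \<xi> *\<^sub>R l x" if "c \<in> GamE D" "\<xi> \<in> GamSub D A" for c \<xi>
    unfolding n_def by (rule nab_lc[OF \<theta> \<gamma> l E.Gam_fib[OF that(1)] OmL1_section[OF \<theta> \<gamma> l that(2)]])
  have n': "nab D x (c x) (\<lambda>y. \<gamma>' y [\<xi> y]) = n' c \<xi> *\<^sub>R l x" if "c \<in> GamE D" "\<xi> \<in> GamSub D A" for c \<xi>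
    unfolding n'_def by (rule nab_lc[OF \<theta>' \<gamma>' l E.Gam_fib[OF that(1)] OmL1_section[OF \<theta>' \<gamma>' l that(2)]])
  have g: "\<gamma> x [\<xi> x] = g \<xi> *\<^sub>R l x" "\<gamma>' x [\<xi> x] = g' \<xi> *\<^sub>R l x" if "\<xi> \<in> GamSub D A" for \<xi>
    unfolding g_def g'_def by (rule OmL1_lc[OF \<theta> \<gamma> l that], rule OmL1_lc[OF \<theta>' \<gamma>' l that])
  have cancel: "a = b" if "a *\<^sub>R l x = b *\<^sub>R l x" for a b
    using basis_list_independent[OF l(2), of "\<lambda>_. a - b" 0] that by (simp add: scaleR_diff_left)
  \<comment> \<open>Exchanging the two entries from B leaves four scalar functions, those with P or
    Q before p or q; they become a, b, c and d in the identity.\<close>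
  have skew: "\<tau> \<xi> c e = - \<tau> \<xi> e c" if "\<xi> \<in> GamSub D A" "c \<in> GamSub D B" "e \<in> GamSub D B" for \<xi> c e
    using tri_skew_B[of \<xi> c e x] \<tau>[of \<xi> c e] \<tau>[of \<xi> e c] that cancel[of "\<tau> \<xi> c e" "- \<tau> \<xi> e c"] by (simp add: GamSub_iff)
  have pair_p: "prdS D p \<xi> = (\<lambda>y. f \<xi> y *\<^sub>R l y)" "prdS D P \<xi> = (\<lambda>y. f' \<xi> y *\<^sub>R l y)"
    "prdS D q \<xi> = (\<lambda>y. \<gamma> y [\<xi> y])" "prdS D Q \<xi> = (\<lambda>y. \<gamma>' y [\<xi> y])" if "\<xi> \<in> GamSub D A" for \<xi>
    unfolding p_def P_def q_def Q_def using prdS_unflatS that \<beta> \<gamma> \<gamma>'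
    by (simp_all add: \<beta>_def \<beta>'_def wedge_form0_apply[OF \<theta>] wedge_form0_apply[OF \<theta>'] f_def f'_def)
  have fC: "f \<xi> \<in> Cinf (atl D)" "f' \<xi> \<in> Cinf (atl D)" if "\<xi> \<in> GamSub D A" for \<xi>
    unfolding f_def f'_def by (rule Om1_section[OF \<theta> \<gamma> l that], rule Om1_section[OF \<theta>' \<gamma>' l that])
  have ft: "f \<xi> x = t \<xi>" "f' \<xi> x = t' \<xi>" for \<xi> by (simp_all add: f_def f'_def t_def t'_def)
  define SPp where "SPp \<xi> = (XP (f \<xi>) + t \<xi> * d P) - (Xp (f' \<xi>) + t' \<xi> * d p) + \<tau> \<xi> P p" for \<xi>
  define SPq where "SPq \<xi> = n P \<xi> - (Xq (f' \<xi>) + t' \<xi> * d q) + \<tau> \<xi> P q" for \<xi>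
  define SQp where "SQp \<xi> = (XQ (f \<xi>) + t \<xi> * d Q) - n' p \<xi> + \<tau> \<xi> Q p" for \<xi>
  define SQq where "SQq \<xi> = n Q \<xi> - n' q \<xi> + \<tau> \<xi> Q q" for \<xi>
  \<comment> \<open>Coefficients of the four brackets between 1-forms of the second and first pair.
    \<open>tri_shift\<close> splits each into derivatives of pairings and a pointwise remainder
    \<tau>.\<close>
  have S: "tri P p \<xi> x = SPp \<xi> *\<^sub>R l x" "tri P q \<xi> x = SPq \<xi> *\<^sub>R l x"
    "tri Q p \<xi> x = SQp \<xi> *\<^sub>R l x" "tri Q q \<xi> x = SQq \<xi> *\<^sub>R l x" if "\<xi> \<in> GamSub D A" for \<xi>
  proof -
    have \<xi>G: "\<xi> \<in> GamE D" using that by (simp add: GamSub_iff)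
    note sh = tri_shift[OF _ _ \<xi>G, of _ _ x]
    note simps = pair_p[OF that] XP[rule_format, OF fC(1)[OF that] l(1)] Xp[rule_format, OF fC(2)[OF that] l(1)] Xq[rule_format, OF fC(2)[OF that] l(1)]
      XQ[rule_format, OF fC(1)[OF that] l(1)] ft d[OF G(1)] d[OF G(2)] d[OF G(3)] d[OF G(4)] n[OF G(3) that] n[OF G(4) that]
      n'[OF G(1) that] n'[OF G(2) that] \<tau>[OF \<xi>G G(3,1)] \<tau>[OF \<xi>G G(3,2)] \<tau>[OF \<xi>G G(4,1)] \<tau>[OF \<xi>G G(4,2)]
    show "tri P p \<xi> x = SPp \<xi> *\<^sub>R l x" "tri P q \<xi> x = SPq \<xi> *\<^sub>R l x"
      "tri Q p \<xi> x = SQp \<xi> *\<^sub>R l x" "tri Q q \<xi> x = SQq \<xi> *\<^sub>R l x"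
      unfolding sh[OF G(3,1)] sh[OF G(3,2)] sh[OF G(4,1)] sh[OF G(4,2)] simps SPp_def SPq_def SQp_def SQq_def
      by (simp_all add: scaleR_add_left scaleR_diff_left)
  qed
  \<comment> \<open>\<open>KP\<close> and \<open>KQ\<close> anticipate the coefficients of the
    brackets of the first 2-form with \<theta>' \<otimes> l and with \<gamma>'.\<close>
  define KP where "KP u v = - ((SPp u - t u * d P) * g v - (SPp v - t v * d P) * g u + t u * SPq v - t v * SPq u)" for u v
  define KQ where "KQ u v = - ((SQp u - t u * d Q) * g v - (SQp v - t v * d Q) * g u + t u * SQq v - t v * SQq u)" for u v
  have Ax: "\<xi> x \<in> A x" if "\<xi> \<in> GamSub D A" for \<xi> using that by (simp add: GamSub_iff)
  obtain YP where YP: "\<forall>u\<in>A x. YP u *\<^sub>R l x = prd D x (brk D P p x) u - \<theta> x [u] *\<^sub>R nab D x (P x) l"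
    "\<forall>u\<in>A x. \<forall>v\<in>A x. br \<alpha> \<beta>' x [u, v] = - (YP u *\<^sub>R \<gamma> x [v] - YP v *\<^sub>R \<gamma> x [u] + \<theta> x [u] *\<^sub>R br \<beta>' \<gamma> x [v] - \<theta> x [v] *\<^sub>R br \<beta>' \<gamma> x [u])"
    using br_1_wedge[OF \<theta> \<gamma> l \<beta>(2)] unfolding \<alpha>_def p_def P_def \<beta>_def by blast
  obtain YQ where YQ: "\<forall>u\<in>A x. YQ u *\<^sub>R l x = prd D x (brk D Q p x) u - \<theta> x [u] *\<^sub>R nab D x (Q x) l"
    "\<forall>u\<in>A x. \<forall>v\<in>A x. br \<alpha> \<gamma>' x [u, v] = - (YQ u *\<^sub>R \<gamma> x [v] - YQ v *\<^sub>R \<gamma> x [u] + \<theta> x [u] *\<^sub>R br \<gamma>' \<gamma> x [v] - \<theta> x [v] *\<^sub>R br \<gamma>' \<gamma> x [u])"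
    using br_1_wedge[OF \<theta> \<gamma> l \<gamma>'] unfolding \<alpha>_def p_def Q_def \<beta>_def by blast
  have YPv: "YP (\<xi> x) = SPp \<xi> - t \<xi> * d P" if "\<xi> \<in> GamSub D A" for \<xi>
  proof (rule cancel)
    have "prd D x (brk D P p x) (\<xi> x) = SPp \<xi> *\<^sub>R l x" using S(1)[OF that] by (simp add: tri_def)
    then show "YP (\<xi> x) *\<^sub>R l x = (SPp \<xi> - t \<xi> * d P) *\<^sub>R l x"
      using YP(1) Ax[OF that] by (simp add: d[OF G(3)] t_def scaleR_diff_left)
  qed
  have YQv: "YQ (\<xi> x) = SQp \<xi> - t \<xi> * d Q" if "\<xi> \<in> GamSub D A" for \<xi>
  proof (rule cancel)
    have "prd D x (brk D Q p x) (\<xi> x) = SQp \<xi> *\<^sub>R l x" using S(3)[OF that] by (simp add: tri_def)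
    then show "YQ (\<xi> x) *\<^sub>R l x = (SQp \<xi> - t \<xi> * d Q) *\<^sub>R l x"
      using YQ(1) Ax[OF that] by (simp add: d[OF G(4)] t_def scaleR_diff_left)
  qed
  have br1: "br \<beta>' \<gamma> x [\<xi> x] = SPq \<xi> *\<^sub>R l x" "br \<gamma>' \<gamma> x [\<xi> x] = SQq \<xi> *\<^sub>R l x" if "\<xi> \<in> GamSub D A" for \<xi>
    using br_11[OF \<beta>(2) \<gamma> Ax[OF that]] br_11[OF \<gamma>' \<gamma> Ax[OF that]] S(2,4)[OF that]
    by (simp_all add: tri_def P_def Q_def q_def)
  have KPv: "br \<alpha> \<beta>' x [\<xi> x, \<zeta> x] = KP \<xi> \<zeta> *\<^sub>R l x" and KQv: "br \<alpha> \<gamma>' x [\<xi> x, \<zeta> x] = KQ \<xi> \<zeta> *\<^sub>R l x"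
    if "\<xi> \<in> GamSub D A" "\<zeta> \<in> GamSub D A" for \<xi> \<zeta>
    using YP(2) YQ(2) Ax[OF that(1)] Ax[OF that(2)]
    by (simp_all add: YPv[OF that(1)] YPv[OF that(2)] YQv[OF that(1)] YQv[OF that(2)] br1[OF that(1)] br1[OF that(2)] g(1)[OF that(1)] g(1)[OF that(2)]
        KP_def KQ_def t_def[symmetric] scaleR_add_left scaleR_diff_left scaleR_left.minus)
  \<comment> \<open>E is the value on \<theta>' of the symbol of the bracket with the first 2-form;
    it is computed below from \<open>KP\<close> and the bracket with l.\<close>
  obtain E where E: "\<forall>u\<in>A x. \<forall>v\<in>A x. E u v *\<^sub>R l x = br \<alpha> \<beta>' x [u, v]
        + (\<theta>' x [u] *\<^sub>R br \<alpha> (form0 l) x [v] - \<theta>' x [v] *\<^sub>R br \<alpha> (form0 l) x [u])"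
    "\<forall>u\<in>A x. \<forall>v\<in>A x. \<forall>w\<in>A x. br \<alpha> \<alpha>' x [u, v, w] =
        E u v *\<^sub>R \<gamma>' x [w] - E u w *\<^sub>R \<gamma>' x [v] + E v w *\<^sub>R \<gamma>' x [u]
        - (\<theta>' x [u] *\<^sub>R br \<alpha> \<gamma>' x [v, w] - \<theta>' x [v] *\<^sub>R br \<alpha> \<gamma>' x [u, w] + \<theta>' x [w] *\<^sub>R br \<alpha> \<gamma>' x [u, v])"
    using br_2_wedge[OF \<theta>' \<gamma>' l \<alpha>(1)] unfolding \<alpha>'_def \<beta>'_def by blast
  have M: "br \<alpha> (form0 l) x [\<xi> x] = (t \<xi> * d q - g \<xi> * d p) *\<^sub>R l x" if "\<xi> \<in> GamSub D A" for \<xi>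
    using br_wedge_0[OF \<theta> \<gamma> l Ax[OF that]]
    by (simp add: \<alpha>_def[symmetric] p_def[symmetric] q_def[symmetric] \<beta>_def[symmetric] d[OF G(1)] d[OF G(2)] t_def g_def scaleR_diff_left)
  have Ev: "E (\<xi> x) (\<zeta> x) = KP \<xi> \<zeta> + (t' \<xi> * (t \<zeta> * d q - g \<zeta> * d p) - t' \<zeta> * (t \<xi> * d q - g \<xi> * d p))"
    if "\<xi> \<in> GamSub D A" "\<zeta> \<in> GamSub D A" for \<xi> \<zeta>
  proof (rule cancel)
    have "E (\<xi> x) (\<zeta> x) *\<^sub>R l x = KP \<xi> \<zeta> *\<^sub>R l x +
        ((t' \<xi> * (t \<zeta> * d q - g \<zeta> * d p)) *\<^sub>R l x - (t' \<zeta> * (t \<xi> * d q - g \<xi> * d p)) *\<^sub>R l x)"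
      unfolding E(1)[rule_format, OF Ax[OF that(1)] Ax[OF that(2)]] KPv[OF that] M[OF that(1)] M[OF that(2)]
        t'_def[symmetric] scaleR_scaleR ..
    then show "E (\<xi> x) (\<zeta> x) *\<^sub>R l x =
        (KP \<xi> \<zeta> + (t' \<xi> * (t \<zeta> * d q - g \<zeta> * d p) - t' \<zeta> * (t \<xi> * d q - g \<xi> * d p))) *\<^sub>R l x"
      by (simp only: scaleR_add_left scaleR_diff_left)
  qed
  let ?E = "\<lambda>\<xi> \<zeta>. KP \<xi> \<zeta> + (t' \<xi> * (t \<zeta> * d q - g \<zeta> * d p) - t' \<zeta> * (t \<xi> * d q - g \<xi> * d p))"
  have lhs: "br \<alpha> \<alpha>' x [\<xi>1 x, \<xi>2 x, \<xi>3 x] = (?E \<xi>1 \<xi>2 * g' \<xi>3 - ?E \<xi>1 \<xi>3 * g' \<xi>2 + ?E \<xi>2 \<xi>3 * g' \<xi>1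
      - (t' \<xi>1 * KQ \<xi>2 \<xi>3 - t' \<xi>2 * KQ \<xi>1 \<xi>3 + t' \<xi>3 * KQ \<xi>1 \<xi>2)) *\<^sub>R l x"
    unfolding E(2)[rule_format, OF Ax[OF \<xi>(1)] Ax[OF \<xi>(2)] Ax[OF \<xi>(3)]]
    by (simp only: Ev[OF \<xi>(1,2)] Ev[OF \<xi>(1,3)] Ev[OF \<xi>(2,3)] KQv[OF \<xi>(1,2)] KQv[OF \<xi>(1,3)] KQv[OF \<xi>(2,3)]
        g(2)[OF \<xi>(1)] g(2)[OF \<xi>(2)] g(2)[OF \<xi>(3)] t'_def[symmetric] scaleR_scaleR)
      (simp only: scaleR_add_left scaleR_diff_left)
  let ?n = "\<lambda>u v w. t u * (Xq (f' v) * g' w + t' v * n' q w - (Xq (f' w) * g' v + t' w * n' q v))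
      - g u * (Xp (f' v) * g' w + t' v * n' p w - (Xp (f' w) * g' v + t' w * n' p v))"
  let ?n' = "\<lambda>u v w. t' u * (XQ (f v) * g w + t v * n Q w - (XQ (f w) * g v + t w * n Q v))
      - g' u * (XP (f v) * g w + t v * n P w - (XP (f w) * g v + t w * n P v))"
  let ?T = "\<lambda>u v w. - (t v * t' w * \<tau> u Q q) + t v * g' w * \<tau> u P q + g v * t' w * \<tau> u Q p - g v * g' w * \<tau> u P p"
  let ?T' = "\<lambda>u v w. t' v * t w * \<tau> u Q q - t' v * g w * \<tau> u Q p - g' v * t w * \<tau> u P q + g' v * g w * \<tau> u P p"
  have nv: "nab D x (bsec \<alpha> u x) (\<lambda>y. \<alpha>' y [v y, w y]) = ?n u v w *\<^sub>R l x"
    if u: "u \<in> GamSub D A" and v: "v \<in> GamSub D A" and w: "w \<in> GamSub D A" for u v w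
  proof -
    have "nab D x (bsec \<alpha> u x) (\<lambda>y. \<alpha>' y [v y, w y]) =
        t u *\<^sub>R nab D x (q x) (\<lambda>y. \<alpha>' y [v y, w y]) - g u *\<^sub>R nab D x (p x) (\<lambda>y. \<alpha>' y [v y, w y])"
      unfolding \<alpha>_def t_def g_def p_def q_def \<beta>_def
      by (rule nab_bsec_wedge[OF \<theta> \<gamma> l u OmL2_section[OF \<alpha>(2) v w]])
    also have "\<dots> = ?n u v w *\<^sub>R l x"
      unfolding \<alpha>'_def nab_wedge[OF \<theta>' \<gamma>' l fib(2) Xq v w] nab_wedge[OF \<theta>' \<gamma>' l fib(1) Xp v w]
      by (simp only: f'_def[symmetric] t'_def[symmetric] g'_def[symmetric] n'_def[symmetric] scaleR_scaleR)
        (simp only: scaleR_diff_left)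
    finally show ?thesis .
  qed
  have nv': "nab D x (bsec \<alpha>' u x) (\<lambda>y. \<alpha> y [v y, w y]) = ?n' u v w *\<^sub>R l x"
    if u: "u \<in> GamSub D A" and v: "v \<in> GamSub D A" and w: "w \<in> GamSub D A" for u v w
  proof -
    have "nab D x (bsec \<alpha>' u x) (\<lambda>y. \<alpha> y [v y, w y]) =
        t' u *\<^sub>R nab D x (Q x) (\<lambda>y. \<alpha> y [v y, w y]) - g' u *\<^sub>R nab D x (P x) (\<lambda>y. \<alpha> y [v y, w y])"
      unfolding \<alpha>'_def t'_def g'_def P_def Q_def \<beta>'_def
      by (rule nab_bsec_wedge[OF \<theta>' \<gamma>' l u OmL2_section[OF \<alpha>(1) v w]])
    also have "\<dots> = ?n' u v w *\<^sub>R l x"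
      unfolding \<alpha>_def nab_wedge[OF \<theta> \<gamma> l fib(4) XQ v w] nab_wedge[OF \<theta> \<gamma> l fib(3) XP v w]
      by (simp only: f_def[symmetric] t_def[symmetric] g_def[symmetric] n_def[symmetric] scaleR_scaleR)
        (simp only: scaleR_diff_left)
    finally show ?thesis .
  qed
  have \<alpha>b: "bsec \<alpha> v \<in> GamSub D B" "bsec \<alpha>' v \<in> GamSub D B" if "v \<in> GamSub D A" for v
    using bsec_Gam \<alpha> that by blast+
  have tb: "tri e (bsec \<alpha> v) s x = t v *\<^sub>R tri e q s x - g v *\<^sub>R tri e p s x" "tri e s (bsec \<alpha> v) x = t v *\<^sub>R tri e s q x - g v *\<^sub>R tri e s p x"
    "tri e (bsec \<alpha>' v) s x = t' v *\<^sub>R tri e Q s x - g' v *\<^sub>R tri e P s x" "tri e s (bsec \<alpha>' v) x = t' v *\<^sub>R tri e s Q x - g' v *\<^sub>R tri e s P x"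
    if "e \<in> GamE D" "v \<in> GamSub D A" "s \<in> GamSub D B" for e v s
    unfolding \<alpha>_def \<alpha>'_def t_def g_def t'_def g'_def p_def q_def P_def Q_def \<beta>_def \<beta>'_def
    by (rule tri_bsec_wedge[OF \<theta> \<gamma> l that] tri_bsec_wedge[OF \<theta>' \<gamma>' l that])+
  have Tv: "tri u (bsec \<alpha> v) (bsec \<alpha>' w) x = ?T u v w *\<^sub>R l x" "tri u (bsec \<alpha>' v) (bsec \<alpha> w) x = ?T' u v w *\<^sub>R l x"
    if u: "u \<in> GamSub D A" and v: "v \<in> GamSub D A" and w: "w \<in> GamSub D A" for u v w
  proof -
    have uG: "u \<in> GamE D" using u by (simp add: GamSub_iff)
    note \<tau>s = \<tau>[OF uG G(2,4)] \<tau>[OF uG G(2,3)] \<tau>[OF uG G(1,4)] \<tau>[OF uG G(1,3)]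
      \<tau>[OF uG G(4,2)] \<tau>[OF uG G(3,2)] \<tau>[OF uG G(4,1)] \<tau>[OF uG G(3,1)]
      skew[OF u B(2,4)] skew[OF u B(2,3)] skew[OF u B(1,4)] skew[OF u B(1,3)]
    show "tri u (bsec \<alpha> v) (bsec \<alpha>' w) x = ?T u v w *\<^sub>R l x"
      by (simp add: tb(1)[OF uG v \<alpha>b(2)[OF w]] tb(4)[OF uG w B(2)] tb(4)[OF uG w B(1)] \<tau>s algebra_simps)
    show "tri u (bsec \<alpha>' v) (bsec \<alpha> w) x = ?T' u v w *\<^sub>R l x"
      by (simp add: tb(3)[OF uG v \<alpha>b(1)[OF w]] tb(2)[OF uG w B(4)] tb(2)[OF uG w B(3)] \<tau>s algebra_simps)
  qed
  have "quadB \<alpha> \<alpha>' \<xi>1 \<xi>2 \<xi>3 x + quadB \<alpha>' \<alpha> \<xi>1 \<xi>2 \<xi>3 x =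
      ((?n \<xi>1 \<xi>2 \<xi>3 - ?n \<xi>2 \<xi>1 \<xi>3 + ?n \<xi>3 \<xi>1 \<xi>2 + ?T \<xi>1 \<xi>2 \<xi>3 + ?T \<xi>2 \<xi>3 \<xi>1 + ?T \<xi>3 \<xi>1 \<xi>2) +
       (?n' \<xi>1 \<xi>2 \<xi>3 - ?n' \<xi>2 \<xi>1 \<xi>3 + ?n' \<xi>3 \<xi>1 \<xi>2 + ?T' \<xi>1 \<xi>2 \<xi>3 + ?T' \<xi>2 \<xi>3 \<xi>1 + ?T' \<xi>3 \<xi>1 \<xi>2)) *\<^sub>R l x"
    unfolding quadB_def nv[OF \<xi>(1,2,3)] nv[OF \<xi>(2,1,3)] nv[OF \<xi>(3,1,2)] nv'[OF \<xi>(1,2,3)] nv'[OF \<xi>(2,1,3)] nv'[OF \<xi>(3,1,2)]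
      Tv(1)[OF \<xi>(1,2,3)] Tv(1)[OF \<xi>(2,3,1)] Tv(1)[OF \<xi>(3,1,2)] Tv(2)[OF \<xi>(1,2,3)] Tv(2)[OF \<xi>(2,3,1)] Tv(2)[OF \<xi>(3,1,2)]
    by (simp only: scaleR_add_left scaleR_diff_left)
  also have "\<dots> = (?E \<xi>1 \<xi>2 * g' \<xi>3 - ?E \<xi>1 \<xi>3 * g' \<xi>2 + ?E \<xi>2 \<xi>3 * g' \<xi>1
      - (t' \<xi>1 * KQ \<xi>2 \<xi>3 - t' \<xi>2 * KQ \<xi>1 \<xi>3 + t' \<xi>3 * KQ \<xi>1 \<xi>2)) *\<^sub>R l x"
    unfolding KP_def KQ_def SPp_def SPq_def SQp_def SQq_def
    by (rule arg_cong[where f = "\<lambda>c. c *\<^sub>R l x"], rule schouten_identity[symmetric, where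
        t = t and g = g and t' = t' and g' = g' and XPt = "\<lambda>\<xi>. XP (f \<xi>)" and XQt = "\<lambda>\<xi>. XQ (f \<xi>)" and
        Xpt' = "\<lambda>\<xi>. Xp (f' \<xi>)" and Xqt' = "\<lambda>\<xi>. Xq (f' \<xi>)" and NPg = "n P" and NQg = "n Q" and Npg' = "n' p" and Nqg' = "n' q"
        and a = "\<lambda>\<xi>. \<tau> \<xi> P p" and b = "\<lambda>\<xi>. \<tau> \<xi> P q" and c = "\<lambda>\<xi>. \<tau> \<xi> Q p" and d = "\<lambda>\<xi>. \<tau> \<xi> Q q"
        and Dp = "d p" and Dq = "d q" and DP = "d P" and DQ = "d Q"])
  finally show ?thesis
    using lhs unfolding \<alpha>_def \<alpha>'_def by simp
qed

text \<open>The defect between the bracket and the symmetrised \<open>quadB\<close> is biadditive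
  and symmetric, and it vanishes on decomposable forms. A 2-form is a sum of these near x, and both
  constructions are local. On the diagonal the symmetrised expression is twice
  \<open>quad\<close>.\<close>

lemma br_quad:
  assumes \<eta>: "\<eta> \<in> OmL D A 2" and \<xi>: "\<xi>1 \<in> GamSub D A" "\<xi>2 \<in> GamSub D A" "\<xi>3 \<in> GamSub D A"
  shows "br \<eta> \<eta> x [\<xi>1 x, \<xi>2 x, \<xi>3 x] = 2 *\<^sub>R quad \<eta> \<xi>1 \<xi>2 \<xi>3 x"
proof -
  obtain n \<theta> \<gamma> N where dec: "\<And>k. k < n \<Longrightarrow> \<theta> k \<in> Om D A 1" "\<And>k. k < n \<Longrightarrow> \<gamma> k \<in> OmL D A 1" "open N" "x \<in> N"
    "\<And>y vs. y \<in> N \<Longrightarrow> \<eta> y vs = (\<Sum>k<n::nat. wedge (\<theta> k) (\<gamma> k) y vs)"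
    by (rule decompose[OF \<eta>, of x]) (rule that; assumption)
  let ?vs = "[\<xi>1 x, \<xi>2 x, \<xi>3 x]"
  \<comment> \<open>Additivity is shown for the second argument; symmetry carries it to the
    first.\<close>
  define Z where "Z \<alpha> \<beta> = br \<alpha> \<beta> x ?vs - (quadB \<alpha> \<beta> \<xi>1 \<xi>2 \<xi>3 x + quadB \<beta> \<alpha> \<xi>1 \<xi>2 \<xi>3 x)" for \<alpha> \<beta>
  have Z_add: "Z \<alpha> (\<lambda>x vs. \<beta> x vs + \<beta>' x vs) = Z \<alpha> \<beta> + Z \<alpha> \<beta>'"
    if "\<alpha> \<in> OmL D A 2" "\<beta> \<in> OmL D A 2" "\<beta>' \<in> OmL D A 2" for \<alpha> \<beta> \<beta>'
    unfolding Z_def br_add[OF that] quadB_add_left[OF \<xi> that(2,3,1)] quadB_add_right[OF \<xi> that(2,3,1)] by simp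
  have Z_sym: "Z \<alpha> \<beta> = Z \<beta> \<alpha>" if "\<alpha> \<in> OmL D A 2" "\<beta> \<in> OmL D A 2" for \<alpha> \<beta>
    unfolding Z_def br_22_sym[OF that] by (simp add: add.commute)
  have Z_zero: "Z \<alpha> (\<lambda>x vs. 0) = 0" if "\<alpha> \<in> OmL D A 2" for \<alpha>
    using Z_add[OF that OmL_zero OmL_zero] by simp
  let ?w = "\<lambda>k. wedge (\<theta> k) (\<gamma> k)"
  have w: "?w k \<in> OmL D A 2" if "k < n" for k
    by (rule wedge_11_OmL[OF dec(1)[OF that] dec(2)[OF that]])
  have Z_sum: "Z \<alpha> (\<lambda>x vs. \<Sum>k<m. ?w k x vs) = 0"
    if "\<alpha> \<in> OmL D A 2" "m \<le> n" "\<And>k. k < n \<Longrightarrow> Z \<alpha> (?w k) = 0" for \<alpha> m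
    using that(2)
  proof (induction m)
    case (Suc m)
    then show ?case
      using Z_add[OF that(1) OmL_sum[of m ?w] w[of m]] w that(3) by simp
  qed (simp add: Z_zero[OF that(1)])
  define \<eta>' where "\<eta>' = (\<lambda>x vs. \<Sum>k<n. ?w k x vs)"
  have \<eta>': "\<eta>' \<in> OmL D A 2" unfolding \<eta>'_def by (rule OmL_sum[OF w])
  have "Z (?w j) (?w k) = 0" if "j < n" "k < n" for j k
    unfolding Z_def using br_decomposable[OF dec(1)[OF that(1)] dec(2)[OF that(1)] dec(1)[OF that(2)] dec(2)[OF that(2)] \<xi>, of x] by simp
  then have "Z (?w j) \<eta>' = 0" if "j < n" for j
    unfolding \<eta>'_def using that by (intro Z_sum w) auto
  then have "Z \<eta>' (?w j) = 0" if "j < n" for j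
    using Z_sym[OF w[OF that] \<eta>'] that by simp
  then have Z0: "Z \<eta>' \<eta>' = 0"
    using Z_sum[OF \<eta>' order_refl] unfolding \<eta>'_def[symmetric] by simp
  have eqN: "\<eta> y vs = \<eta>' y vs" if "y \<in> N" for y vs using dec(5)[OF that] by (simp add: \<eta>'_def)
  \<comment> \<open>The sum of decomposables is a global form that agrees with \<eta> near x only.
    Their difference vanishes there, so \<open>br_local\<close> removes it from the second entry,
    and symmetry from the first.\<close>
  define \<delta> where "\<delta> = (\<lambda>x vs. (-1) *\<^sub>R \<eta>' x vs + \<eta> x vs)"
  have \<delta>: "\<delta> \<in> OmL D A 2" unfolding \<delta>_def by (rule OmL_lincomb[OF \<eta>' \<eta>])
  have \<delta>0: "\<delta> y vs = 0" if "y \<in> N" for y vs using eqN[OF that] by (simp add: \<delta>_def)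
  have \<eta>\<delta>: "\<eta> = (\<lambda>x vs. \<eta>' x vs + \<delta> x vs)" by (simp add: \<delta>_def fun_eq_iff)
  have loc: "br \<alpha> \<eta> x vs = br \<alpha> \<eta>' x vs" if "\<alpha> \<in> OmL D A 2" for \<alpha> vs
    using br_add[OF that \<eta>' \<delta>, of x vs] br_local[OF that \<delta> dec(3,4) \<delta>0, of vs] unfolding \<eta>\<delta>[symmetric] by simp
  have "br \<eta> \<eta> x ?vs = br \<eta>' \<eta>' x ?vs"
    using loc[OF \<eta>] br_22_sym[OF \<eta> \<eta>'] loc[OF \<eta>'] by simp
  also have "\<dots> = 2 *\<^sub>R quad \<eta>' \<xi>1 \<xi>2 \<xi>3 x"
    using Z0 by (simp add: Z_def quad_eq scaleR_2)
  also have "quad \<eta>' \<xi>1 \<xi>2 \<xi>3 x = quad \<eta> \<xi>1 \<xi>2 \<xi>3 x"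
    using quad_local[OF \<xi> \<eta> \<eta>' dec(3,4) eqN] by simp
  finally show ?thesis .
qed

end

section \<open>The second order term of a deformation\<close>

lemma tendsto_difference_quotient:
  fixes f :: "real \<Rightarrow> 'a::real_normed_vector"
  assumes "(f has_vector_derivative f') (at 0)" "f 0 = 0"
  shows "((\<lambda>t. (1 / t) *\<^sub>R f t) \<longlongrightarrow> f') (at 0)"
proof (rule LIM_I)
  fix r :: real assume r: "0 < r"
  have "\<forall>e>0. \<exists>d>0. \<forall>t. t \<noteq> 0 \<and> \<bar>t\<bar> < d \<longrightarrow> norm (f t - t *\<^sub>R f') / \<bar>t\<bar> < e"
    using assms unfolding has_vector_derivative_def has_derivative_at' by simp
  then obtain d where d: "d > 0" "\<And>t. t \<noteq> 0 \<Longrightarrow> \<bar>t\<bar> < d \<Longrightarrow> norm (f t - t *\<^sub>R f') / \<bar>t\<bar> < r"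
    using r by blast
  have "norm ((1 / t) *\<^sub>R f t - f') = norm (f t - t *\<^sub>R f') / \<bar>t\<bar>" if "t \<noteq> 0" for t
  proof -
    have "(1 / t) *\<^sub>R f t - f' = (1 / t) *\<^sub>R (f t - t *\<^sub>R f')"
      using that by (simp add: scaleR_diff_right)
    then show ?thesis by simp
  qed
  then show "\<exists>d>0. \<forall>t. t \<noteq> 0 \<and> norm (t - 0) < d \<longrightarrow> norm ((1 / t) *\<^sub>R f t - f') < r"
    using d by (intro exI[of _ d]) simp
qed

text \<open>Second-order Taylor expansion of a vector-valued function, with the second derivative
  assumed at 0 only. The mean value inequality takes the place of an intermediate point.\<close>

lemma tendsto_second_difference_quotient:
  fixes f f1 :: "real \<Rightarrow> 'a::real_normed_vector"
  assumes I: "open I" "0 \<in> I" and f: "\<And>t. t \<in> I \<Longrightarrow> (f has_vector_derivative f1 t) (at t)"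
    and f1: "(f1 has_vector_derivative f2) (at 0)" and zero: "f 0 = 0" "f1 0 = 0"
  shows "((\<lambda>t. (1 / t\<^sup>2) *\<^sub>R f t) \<longlongrightarrow> (1 / 2) *\<^sub>R f2) (at 0)"
proof (rule LIM_I)
  fix r :: real assume r: "0 < r"
  obtain d where d: "d > 0" "\<And>t. norm t < d \<Longrightarrow> norm (f1 t - t *\<^sub>R f2) \<le> (r / 2) * norm t"
  proof -
    have "\<forall>e>0. \<exists>d>0. \<forall>t. norm t < d \<longrightarrow> norm (f1 t - t *\<^sub>R f2) \<le> e * norm t"
      using f1 zero unfolding has_vector_derivative_def has_derivative_at_alt by simp
    from this[rule_format, of "r / 2"] r show ?thesis using that by auto
  qed
  obtain d' where d': "d' > 0" "ball 0 d' \<subseteq> I"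
    using I open_contains_ball by blast
  have "norm ((1 / t\<^sup>2) *\<^sub>R f t - (1 / 2) *\<^sub>R f2) < r" if t: "t \<noteq> 0" "norm t < min d d'" for t
  proof -
    \<comment> \<open>Subtracting the expected quadratic term leaves the derivative f1(s) - s f2,
      which is at most (r/2) |s| near 0.\<close>
    let ?g = "\<lambda>t. f t - (t\<^sup>2 / 2) *\<^sub>R f2"
    have "norm (?g t - ?g 0) \<le> (r / 2 * norm t) * norm (t - 0)"
    proof (rule differentiable_bound[of "cball 0 (norm t)" _ "\<lambda>s h. h *\<^sub>R (f1 s - s *\<^sub>R f2)"])
      fix s :: real assume s: "s \<in> cball 0 (norm t)"
      then have sI: "s \<in> I" "norm s < d" using t d'(2) by auto
      have "((\<lambda>t. (t\<^sup>2 / 2) *\<^sub>R f2) has_vector_derivative (s *\<^sub>R f2)) (at s)"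
        by (rule has_vector_derivative_eq_rhs, rule has_vector_derivative_scaleR[OF _ has_vector_derivative_const])
          (auto intro!: derivative_eq_intros)
      then have "(?g has_vector_derivative (f1 s - s *\<^sub>R f2)) (at s)"
        by (rule has_vector_derivative_diff[OF f[OF sI(1)]])
      then show "(?g has_derivative (\<lambda>h. h *\<^sub>R (f1 s - s *\<^sub>R f2))) (at s within cball 0 (norm t))"
        unfolding has_vector_derivative_def by (rule has_derivative_at_withinI)
      have "norm (f1 s - s *\<^sub>R f2) \<le> r / 2 * norm t"
        using order_trans[OF d(2)[OF sI(2)] mult_left_mono[of "norm s" "norm t" "r / 2"]] s r by simp
      then show "onorm (\<lambda>h. h *\<^sub>R (f1 s - s *\<^sub>R f2)) \<le> r / 2 * norm t"
        by (intro onorm_le) (metis norm_scaleR real_norm_def mult.commute mult_left_mono abs_ge_zero)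
    qed auto
    then have "norm (?g t) \<le> (r / 2) * t\<^sup>2"
      using zero by (simp add: power2_eq_square)
    then have "norm (?g t) / t\<^sup>2 \<le> r / 2"
      using t(1) by (simp add: divide_le_eq)
    moreover have eq: "(1 / t\<^sup>2) *\<^sub>R f t - (1 / 2) *\<^sub>R f2 = (1 / t\<^sup>2) *\<^sub>R ?g t"
      using t(1) by (simp add: scaleR_diff_right)
    have "norm ((1 / t\<^sup>2) *\<^sub>R f t - (1 / 2) *\<^sub>R f2) = norm (?g t) / t\<^sup>2"
      unfolding eq by simp
    ultimately show ?thesis using r by linarith
  qed
  then show "\<exists>s>0. \<forall>t. t \<noteq> 0 \<and> norm (t - 0) < s \<longrightarrow> norm ((1 / t\<^sup>2) *\<^sub>R f t - (1 / 2) *\<^sub>R f2) < r"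
    using d(1) d'(1) by (intro exI[of _ "min d d'"]) auto
qed

lemma second_derivative_unique:
  fixes f g f1 g1 :: "real \<Rightarrow> 'a::real_normed_vector"
  assumes I: "open I" "a \<in> I" and "\<And>t. t \<in> I \<Longrightarrow> (f has_vector_derivative f1 t) (at t)"
    and "\<And>t. t \<in> I \<Longrightarrow> (g has_vector_derivative g1 t) (at t)" and eq: "\<And>t. t \<in> I \<Longrightarrow> f t = g t"
    and "(f1 has_vector_derivative f2) (at a)" "(g1 has_vector_derivative g2) (at a)"
  shows "f2 = g2"
proof -
  have "f1 t = g1 t" if "t \<in> I" for t
    using vector_derivative_unique_at[OF assms(3)[OF that]]
      has_vector_derivative_transform_within_open[OF assms(4)[OF that] I(1) that] eq by metis
  then show ?thesis
    using vector_derivative_unique_at[OF assms(6)] has_vector_derivative_transform_within_open[OF assms(7) I] by metis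
qed

lemma tendsto_scaleR_cancel:
  fixes v :: "'a::real_normed_vector"
  assumes "((\<lambda>t. a t *\<^sub>R v) \<longlongrightarrow> b *\<^sub>R v) F" "v \<noteq> 0"
  shows "(a \<longlongrightarrow> b) F"
proof -
  have "((\<lambda>t. norm (a t *\<^sub>R v - b *\<^sub>R v) / norm v) \<longlongrightarrow> 0 / norm v) F"
    using assms by (intro tendsto_divide tendsto_norm_zero Lim_null[THEN iffD1] tendsto_const) auto
  then have "((\<lambda>t. norm (a t - b)) \<longlongrightarrow> 0) F"
    using assms(2) by (simp flip: scaleR_diff_left)
  then show ?thesis unfolding Lim_null[of a] tendsto_norm_zero_iff .
qed

section \<open>The second derivative of a family of 2-forms\<close>

context dj_pair
begin

text \<open>B-components are vectors of \<open>'v\<close>, where no limits can be taken. Here all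
  dependence on \<alpha> is placed in real coefficients, while the sections p remain fixed.\<close>

lemma bsec_expansion:
  fixes x
  obtains n :: nat and p a l where "\<And>k. k < n \<Longrightarrow> p k \<in> GamSub D B" "\<And>k. k < n \<Longrightarrow> a k \<in> A x"
    "basis_list (fib (Lbun D) x) [l]"
    "\<forall>\<alpha>\<in>OmL D A 2. \<forall>\<xi>\<in>GamSub D A. bsec \<alpha> \<xi> x = (\<Sum>k<n. lc l (\<alpha> x [\<xi> x, a k]) *\<^sub>R p k x)"
proof -
  obtain as \<theta> N where f: "set as \<subseteq> GamSub D A" "\<And>i. i < length as \<Longrightarrow> \<theta> i \<in> Om D A 1" "open N" "x \<in> N"
    "\<And>y v. y \<in> N \<Longrightarrow> v \<in> A y \<Longrightarrow> (\<Sum>i<length as. \<theta> i y [v] *\<^sub>R (as ! i) y) = v"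
    by (rule dual_frame[of x]) (rule that; assumption)
  obtain l N' where l: "l \<in> GamL D" "open N'" "x \<in> N'" "\<And>y. y \<in> N' \<Longrightarrow> basis_list (fib (Lbun D) y) [l y]"
    by (rule line_frame[of x]) (rule that; assumption)
  define p where "p k = unflatS D A B (wedge (\<theta> k) (form0 l))" for k
  have W: "wedge (\<theta> k) (form0 l) \<in> OmL D A 1" if "k < length as" for k
    by (rule wedge_form0_OmL[OF f(2)[OF that] l(1)])
  have p: "p k \<in> GamSub D B" if "k < length as" for k
    unfolding p_def by (rule unflatS_Gam[OF W[OF that]])
  have as: "(as ! k) x \<in> A x" if "k < length as" for k
    using f(1) that nth_mem by (fastforce simp: GamSub_iff)
  have "bsec \<alpha> \<xi> x = (\<Sum>k<length as. lc (l x) (\<alpha> x [\<xi> x, (as ! k) x]) *\<^sub>R p k x)"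
    if \<alpha>: "\<alpha> \<in> OmL D A 2" and \<xi>: "\<xi> \<in> GamSub D A" for \<alpha> \<xi>
    unfolding bsec_def unflatS_def[of D A B "contr _ _"]
  proof (rule unflat_eqI)
    have \<xi>x: "\<xi> x \<in> A x" using \<xi> by (simp add: GamSub_iff)
    show "(\<Sum>k<length as. lc (l x) (\<alpha> x [\<xi> x, (as ! k) x]) *\<^sub>R p k x) \<in> B x"
      using p by (intro subspace_sum[OF B_subspace] subspace_scale[OF B_subspace]) (auto simp: GamSub_iff)
    fix v assume v: "v \<in> A x"
    have "prd D x (\<Sum>k<length as. lc (l x) (\<alpha> x [\<xi> x, (as ! k) x]) *\<^sub>R p k x) v =
        (\<Sum>k<length as. lc (l x) (\<alpha> x [\<xi> x, (as ! k) x]) *\<^sub>R prd D x (p k x) v)"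
      using p by (intro prd_sum_left[OF _ A_fib[OF v]]) (auto simp: GamSub_iff E.Gam_fib)
    also have "\<dots> = (\<Sum>k<length as. \<theta> k x [v] *\<^sub>R \<alpha> x [\<xi> x, (as ! k) x])"
    proof (rule sum.cong[OF refl])
      fix k assume "k \<in> {..<length as}"
      then have k: "k < length as" by simp
      have "prd D x (p k x) v = \<theta> k x [v] *\<^sub>R l x"
        unfolding p_def using unflatS_works(2)[OF W[OF k] v] wedge_form0_apply[OF f(2)[OF k]] by simp
      moreover have "lc (l x) (\<alpha> x [\<xi> x, (as ! k) x]) *\<^sub>R l x = \<alpha> x [\<xi> x, (as ! k) x]"
        using lc_scale[OF l(4)[OF l(3)]] alt_formsD(2)[OF OmL_alt[OF \<alpha>], of "[\<xi> x, (as ! k) x]" x] \<xi>x as[OF k] by simp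
      ultimately show "lc (l x) (\<alpha> x [\<xi> x, (as ! k) x]) *\<^sub>R prd D x (p k x) v = \<theta> k x [v] *\<^sub>R \<alpha> x [\<xi> x, (as ! k) x]"
        by (metis scaleR_left_commute)
    qed
    also have "\<dots> = \<alpha> x [\<xi> x, \<Sum>k<length as. \<theta> k x [v] *\<^sub>R (as ! k) x]"
      by (rule fibre_linear_sum[OF A_subspace alt_form2_linear_right[OF OmL_alt[OF \<alpha>] \<xi>x], symmetric]) (simp add: as)
    also have "\<dots> = contr \<alpha> \<xi> x [v]"
      by (simp add: f(5)[OF f(4) v] contr_def)
    finally show "prd D x (\<Sum>k<length as. lc (l x) (\<alpha> x [\<xi> x, (as ! k) x]) *\<^sub>R p k x) v = contr \<alpha> \<xi> x [v]" .
  qed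
  then show ?thesis
    using that[of "length as" p "\<lambda>k. (as ! k) x" "l x"] p as l(3,4) by blast
qed

lemma tri_B_sum:
  assumes e: "e \<in> GamE D" and s: "s \<in> GamSub D B" "s' \<in> GamSub D B" and p: "\<And>k. k < (n::nat) \<Longrightarrow> p k \<in> GamSub D B"
    and sx: "s x = (\<Sum>k<n. c k *\<^sub>R p k x)"
  shows "tri e s' s x = (\<Sum>k<n. c k *\<^sub>R tri e s' (p k) x)" "tri e s s' x = (\<Sum>k<n. c k *\<^sub>R tri e (p k) s' x)"
proof -
  have b: "brk D e s' x \<in> fib (Ebun D) x"
    using brk_Gam[OF e, of s'] s(2) by (simp add: GamSub_iff E.Gam_fib)
  have px: "p k x \<in> fib (Ebun D) x" if "k < n" for k
    using p[OF that] by (simp add: GamSub_iff E.Gam_fib)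
  have "prd D x (\<Sum>k<n. c k *\<^sub>R p k x) (brk D e s' x) = (\<Sum>k<n. c k *\<^sub>R prd D x (p k x) (brk D e s' x))"
    using px by (intro prd_sum_left[OF _ b]) simp
  moreover have "s x \<in> fib (Ebun D) x" using s(1) by (simp add: GamSub_iff E.Gam_fib)
  ultimately show 1: "tri e s' s x = (\<Sum>k<n. c k *\<^sub>R tri e s' (p k) x)"
    using prd_sym[OF b] px sx by (simp add: tri_def)
  have "tri e s s' x = - tri e s' s x" by (rule tri_skew_B[OF e s])
  also have "\<dots> = (\<Sum>k<n. c k *\<^sub>R (- tri e s' (p k) x))" unfolding 1 by (simp add: sum_negf)
  also have "\<dots> = (\<Sum>k<n. c k *\<^sub>R tri e (p k) s' x)"
    using tri_skew_B[OF e s(2) p] by (intro sum.cong) auto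
  finally show "tri e s s' x = (\<Sum>k<n. c k *\<^sub>R tri e (p k) s' x)" .
qed

context
  fixes \<eta>t \<epsilon> \<eta>
  assumes \<epsilon>: "\<epsilon> > 0" and family: "smooth_form_family D A 2 {-\<epsilon><..<\<epsilon>} \<eta>t" and \<eta>0: "\<eta>t 0 = (\<lambda>x vs. 0)"
    and \<eta>: "\<eta> \<in> OmL D A 2" and der: "\<And>x vs. ((\<lambda>t. \<eta>t t x vs) has_vector_derivative \<eta> x vs) (at 0)"
begin

abbreviation (input) "Ival \<equiv> {-\<epsilon><..<\<epsilon>}"

abbreviation (input) "eval2 \<xi> \<zeta> \<equiv> (\<lambda>t y. \<eta>t t y [\<xi> y, \<zeta> y])"

definition second_form :: "('m, 'v, 'l) form" where
  "second_form x vs = (if length vs = 2 \<and> set vs \<subseteq> A x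
     then vector_derivative (\<lambda>t. vector_derivative (\<lambda>r. \<eta>t r x vs) (at t)) (at 0) else 0)"

lemma Ival: "open Ival" "0 \<in> Ival"
  using \<epsilon> by auto

lemma \<eta>t_OmL: "t \<in> Ival \<Longrightarrow> \<eta>t t \<in> OmL D A 2"
  using family unfolding smooth_form_family_def by blast

lemma eval2_family: "\<xi> \<in> GamSub D A \<Longrightarrow> \<zeta> \<in> GamSub D A \<Longrightarrow>
    smooth_section_family_on (atl D) (Lbun D) Ival UNIV (eval2 \<xi> \<zeta>)"
  using spec[OF conjunct2[OF family[unfolded smooth_form_family_def]], of "[\<xi>, \<zeta>]"] by simp

lemma eval2_dot_0:
  assumes "\<xi> \<in> GamSub D A" "\<zeta> \<in> GamSub D A"
  shows "L.dot (eval2 \<xi> \<zeta>) 0 = (\<lambda>y. \<eta> y [\<xi> y, \<zeta> y])"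
proof
  show "L.dot (eval2 \<xi> \<zeta>) 0 y = \<eta> y [\<xi> y, \<zeta> y]" for y
    unfolding L.dot_def[OF Ival(1) eval2_family[OF assms]] by (rule vector_derivative_at[OF der])
qed

lemma second_form_eval2:
  assumes "\<xi> \<in> GamSub D A" "\<zeta> \<in> GamSub D A"
  shows "L.dot (L.dot (eval2 \<xi> \<zeta>)) 0 = (\<lambda>y. second_form y [\<xi> y, \<zeta> y])"
proof
  note fam = eval2_family[OF assms]
  show "L.dot (L.dot (eval2 \<xi> \<zeta>)) 0 y = second_form y [\<xi> y, \<zeta> y]" for y
    unfolding L.dot_def[OF Ival(1) L.dot_family[OF Ival(1) fam]] L.dot_def[OF Ival(1) fam]
    using assms by (simp add: second_form_def GamSub_iff)
qed

lemma eval2_derivative_1: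
  assumes "\<xi> \<in> GamSub D A" "\<zeta> \<in> GamSub D A" "t \<in> Ival"
  shows "((\<lambda>r. eval2 \<xi> \<zeta> r x) has_vector_derivative L.dot (eval2 \<xi> \<zeta>) t x) (at t)"
  by (rule L.dot_has_vector_derivative[OF Ival(1) eval2_family[OF assms(1,2)] assms(3)])

lemma eval2_derivative_2:
  assumes "\<xi> \<in> GamSub D A" "\<zeta> \<in> GamSub D A"
  shows "((\<lambda>t. L.dot (eval2 \<xi> \<zeta>) t x) has_vector_derivative second_form x [\<xi> x, \<zeta> x]) (at 0)"
proof -
  have "((\<lambda>t. L.dot (eval2 \<xi> \<zeta>) t x) has_vector_derivative L.dot (L.dot (eval2 \<xi> \<zeta>)) 0 x) (at 0)"
    by (rule L.dot_has_vector_derivative[OF Ival(1) L.dot_family[OF Ival(1) eval2_family[OF assms]] Ival(2)])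
  then show ?thesis unfolding second_form_eval2[OF assms] .
qed

lemma nab_derivative_1:
  assumes "\<xi> \<in> GamSub D A" "\<zeta> \<in> GamSub D A" "u \<in> fib (Ebun D) x" "t \<in> Ival"
  shows "((\<lambda>r. nab D x u (eval2 \<xi> \<zeta> r)) has_vector_derivative nab D x u (L.dot (eval2 \<xi> \<zeta>) t)) (at t)"
proof -
  obtain \<Delta> where \<Delta>: "derivation_of (atl D) (Lbun D) \<Delta>" "\<And>\<mu>. nab D x u \<mu> = \<Delta> \<mu> x"
    using nab_derivation[OF assms(3)] by metis
  show ?thesis unfolding \<Delta>(2) by (rule L.derivation_dot[OF Ival(1) eval2_family[OF assms(1,2)] assms(4) \<Delta>(1)])
qed

lemma nab_derivative_2:
  assumes "\<xi> \<in> GamSub D A" "\<zeta> \<in> GamSub D A" "u \<in> fib (Ebun D) x"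
  shows "((\<lambda>t. nab D x u (L.dot (eval2 \<xi> \<zeta>) t)) has_vector_derivative nab D x u (\<lambda>y. second_form y [\<xi> y, \<zeta> y])) (at 0)"
proof -
  obtain \<Delta> where \<Delta>: "derivation_of (atl D) (Lbun D) \<Delta>" "\<And>\<mu>. nab D x u \<mu> = \<Delta> \<mu> x"
    using nab_derivation[OF assms(3)] by metis
  have "((\<lambda>t. \<Delta> (L.dot (eval2 \<xi> \<zeta>) t) x) has_vector_derivative \<Delta> (L.dot (L.dot (eval2 \<xi> \<zeta>)) 0) x) (at 0)"
    by (rule L.derivation_dot[OF Ival(1) L.dot_family[OF Ival(1) eval2_family[OF assms(1,2)]] Ival(2) \<Delta>(1)])
  then show ?thesis unfolding second_form_eval2[OF assms(1,2)] \<Delta>(2) .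
qed

text \<open>A linear relation that holds for all members of the family is inherited by the second
  derivative. The relation is stated for arbitrary pairs of sections, so it serves both entries and
  also alternation.\<close>

lemma second_form_linear:
  assumes "\<xi> \<in> GamSub D A" "\<zeta> \<in> GamSub D A" "\<xi>1 \<in> GamSub D A" "\<zeta>1 \<in> GamSub D A" "\<xi>2 \<in> GamSub D A" "\<zeta>2 \<in> GamSub D A"
    and "\<And>t. t \<in> Ival \<Longrightarrow> \<eta>t t x [\<xi> x, \<zeta> x] = c *\<^sub>R \<eta>t t x [\<xi>1 x, \<zeta>1 x] + \<eta>t t x [\<xi>2 x, \<zeta>2 x]"
  shows "second_form x [\<xi> x, \<zeta> x] = c *\<^sub>R second_form x [\<xi>1 x, \<zeta>1 x] + second_form x [\<xi>2 x, \<zeta>2 x]"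
proof (rule second_derivative_unique[OF Ival])
  fix t assume t: "t \<in> Ival"
  show "((\<lambda>r. eval2 \<xi> \<zeta> r x) has_vector_derivative L.dot (eval2 \<xi> \<zeta>) t x) (at t)"
    by (rule eval2_derivative_1[OF assms(1,2) t])
  show "((\<lambda>r. c *\<^sub>R eval2 \<xi>1 \<zeta>1 r x + eval2 \<xi>2 \<zeta>2 r x) has_vector_derivative
      (c *\<^sub>R L.dot (eval2 \<xi>1 \<zeta>1) t x + L.dot (eval2 \<xi>2 \<zeta>2) t x)) (at t)"
    by (intro has_vector_derivative_add bounded_linear.has_vector_derivative[OF bounded_linear_scaleR_right]
        eval2_derivative_1 assms t)
  show "eval2 \<xi> \<zeta> t x = c *\<^sub>R eval2 \<xi>1 \<zeta>1 t x + eval2 \<xi>2 \<zeta>2 t x" by (rule assms(7)[OF t])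
next
  show "((\<lambda>t. L.dot (eval2 \<xi> \<zeta>) t x) has_vector_derivative second_form x [\<xi> x, \<zeta> x]) (at 0)"
    by (rule eval2_derivative_2[OF assms(1,2)])
  show "((\<lambda>t. c *\<^sub>R L.dot (eval2 \<xi>1 \<zeta>1) t x + L.dot (eval2 \<xi>2 \<zeta>2) t x) has_vector_derivative
      (c *\<^sub>R second_form x [\<xi>1 x, \<zeta>1 x] + second_form x [\<xi>2 x, \<zeta>2 x])) (at 0)"
    by (intro has_vector_derivative_add bounded_linear.has_vector_derivative[OF bounded_linear_scaleR_right]
        eval2_derivative_2 assms)
qed

lemma second_form_lincomb:
  assumes "u \<in> A x" "v \<in> A x" "u1 \<in> A x" "v1 \<in> A x" "u2 \<in> A x" "v2 \<in> A x"
    and "\<And>t. t \<in> Ival \<Longrightarrow> \<eta>t t x [u, v] = c *\<^sub>R \<eta>t t x [u1, v1] + \<eta>t t x [u2, v2]"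
  shows "second_form x [u, v] = c *\<^sub>R second_form x [u1, v1] + second_form x [u2, v2]"
  using second_form_linear[of "extend_vec D A x u" "extend_vec D A x v" "extend_vec D A x u1" "extend_vec D A x v1"
      "extend_vec D A x u2" "extend_vec D A x v2" x c] extend_vec assms by simp

lemma second_form_OmL: "second_form \<in> OmL D A 2"
proof -
  have sec: "(\<lambda>y. second_form y [\<xi> y, \<zeta> y]) \<in> GamL D" if "\<xi> \<in> GamSub D A" "\<zeta> \<in> GamSub D A" for \<xi> \<zeta>
    using L.section_family_slice[OF Ival(1) L.dot_family[OF Ival(1) L.dot_family[OF Ival(1) eval2_family[OF that]]] Ival(2)]
    unfolding second_form_eval2[OF that] .
  have "second_form x \<in> alt_forms (A x) (fib (Lbun D) x) 2" for x
  proof (rule alt_forms_2I)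
    show "degree_form (Suc (Suc 0)) (second_form x)" by (auto simp: degree_form_def second_form_def split: if_splits)
    show "second_form x [a, b] = 0" if "a \<notin> A x \<or> b \<notin> A x" for a b using that by (auto simp: second_form_def)
    show "second_form x [a, b] \<in> fib (Lbun D) x" if "a \<in> A x" "b \<in> A x" for a b
      using L.Gam_fib[OF sec[of "extend_vec D A x a" "extend_vec D A x b"], of x] extend_vec that by simp
    show "0 \<in> fib (Lbun D) x" by (rule zero_in_L)
    show "fibre_linear (A x) (\<lambda>a. second_form x [a, b])" if b: "b \<in> A x" for b
      unfolding fibre_linear_def
    proof (intro ballI allI)
      fix u v c assume uv: "u \<in> A x" "v \<in> A x"
      show "second_form x [c *\<^sub>R u + v, b] = c *\<^sub>R second_form x [u, b] + second_form x [v, b]"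
      proof (rule second_form_lincomb)
        show "c *\<^sub>R u + v \<in> A x" using uv by (simp add: subspace_add subspace_scale A_subspace)
        show "\<eta>t t x [c *\<^sub>R u + v, b] = c *\<^sub>R \<eta>t t x [u, b] + \<eta>t t x [v, b]" if "t \<in> Ival" for t
          using alt_form2_linear_left[OF OmL_alt[OF \<eta>t_OmL[OF that]] b] uv unfolding fibre_linear_def by blast
      qed (use uv b in auto)
    qed
    show "fibre_linear (A x) (\<lambda>a. second_form x [b, a])" if b: "b \<in> A x" for b
      unfolding fibre_linear_def
    proof (intro ballI allI)
      fix u v c assume uv: "u \<in> A x" "v \<in> A x"
      show "second_form x [b, c *\<^sub>R u + v] = c *\<^sub>R second_form x [b, u] + second_form x [b, v]"
      proof (rule second_form_lincomb)
        show "c *\<^sub>R u + v \<in> A x" using uv by (simp add: subspace_add subspace_scale A_subspace)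
        show "\<eta>t t x [b, c *\<^sub>R u + v] = c *\<^sub>R \<eta>t t x [b, u] + \<eta>t t x [b, v]" if "t \<in> Ival" for t
          using alt_form2_linear_right[OF OmL_alt[OF \<eta>t_OmL[OF that]] b] uv unfolding fibre_linear_def by blast
      qed (use uv b in auto)
    qed
    show "second_form x [a, a] = 0" if a: "a \<in> A x" for a
    proof -
      have "\<eta>t t x [a, a] = 0" if "t \<in> Ival" for t
        using alt_formsD(4)[OF OmL_alt[OF \<eta>t_OmL[OF that]], of "[a, a]" x 0 1] a by simp
      \<comment> \<open>The values at a repeated vector are 0 for all t and so satisfy 0 = 0 + 0;
        the inherited relation s = s + s forces s = 0.\<close>
      then have "second_form x [a, a] = 1 *\<^sub>R second_form x [a, a] + second_form x [a, a]"
        by (intro second_form_lincomb a) simp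
      then show ?thesis by simp
    qed
  qed
  moreover have "(\<lambda>x. second_form x (map (\<lambda>X. X x) Xs)) \<in> GamL D" if Xs: "set Xs \<subseteq> GamSub D A" for Xs
  proof (cases "length Xs = 2")
    case True
    then obtain \<xi> \<zeta> where "Xs = [\<xi>, \<zeta>]" by (auto simp: length_Suc_conv eval_nat_numeral)
    then show ?thesis using sec Xs by simp
  qed (simp add: second_form_def L.Gam_zero)
  ultimately show ?thesis by (simp add: OmL_def)
qed

lemma eventually_IvalI: "(\<And>t. t \<in> Ival \<Longrightarrow> P t) \<Longrightarrow> eventually P (at 0)"
  using eventually_mono[OF eventually_at_in_open'[OF Ival], of P] by simp

text \<open>The Koszul formula is linear in the form, and d/dt passes through its derivations. The
  first-order coefficient is the formula for \<eta>, which vanishes by closedness, so the expansion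
  starts with t^2.\<close>

lemma koszul_derivative:
  assumes \<xi>: "\<xi>1 \<in> GamSub D A" "\<xi>2 \<in> GamSub D A" "\<xi>3 \<in> GamSub D A" and closed: "koszul D \<eta> [\<xi>1, \<xi>2, \<xi>3] x = 0"
  shows "((\<lambda>t. (1 / t\<^sup>2) *\<^sub>R koszul D (\<eta>t t) [\<xi>1, \<xi>2, \<xi>3] x) \<longlongrightarrow> (1 / 2) *\<^sub>R koszul D second_form [\<xi>1, \<xi>2, \<xi>3] x) (at 0)"
proof -
  have fib: "\<xi>1 x \<in> fib (Ebun D) x" "\<xi>2 x \<in> fib (Ebun D) x" "\<xi>3 x \<in> fib (Ebun D) x"
    using \<xi> by (auto simp: GamSub_iff E.Gam_fib)
  note br = brk_A[OF \<xi>(1,2)] brk_A[OF \<xi>(1,3)] brk_A[OF \<xi>(2,3)]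
  define f1 where "f1 t = nab D x (\<xi>1 x) (L.dot (eval2 \<xi>2 \<xi>3) t) - nab D x (\<xi>2 x) (L.dot (eval2 \<xi>1 \<xi>3) t)
      + nab D x (\<xi>3 x) (L.dot (eval2 \<xi>1 \<xi>2) t) - L.dot (eval2 (brk D \<xi>1 \<xi>2) \<xi>3) t x
      + L.dot (eval2 (brk D \<xi>1 \<xi>3) \<xi>2) t x - L.dot (eval2 (brk D \<xi>2 \<xi>3) \<xi>1) t x" for t
  show ?thesis
  proof (rule tendsto_second_difference_quotient[OF Ival])
    show "((\<lambda>t. koszul D (\<eta>t t) [\<xi>1, \<xi>2, \<xi>3] x) has_vector_derivative f1 t) (at t)" if "t \<in> Ival" for t
      unfolding koszul3 f1_def
      by (intro has_vector_derivative_add has_vector_derivative_diff nab_derivative_1 eval2_derivative_1 \<xi> br fib that)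
    show "(f1 has_vector_derivative koszul D second_form [\<xi>1, \<xi>2, \<xi>3] x) (at 0)"
      unfolding koszul3 f1_def[abs_def]
      by (intro has_vector_derivative_add has_vector_derivative_diff nab_derivative_2 eval2_derivative_2 \<xi> br fib)
    show "koszul D (\<eta>t 0) [\<xi>1, \<xi>2, \<xi>3] x = 0"
      using nab_section_zero fib by (simp add: koszul3 \<eta>0)
    \<comment> \<open>At t = 0 the first derivative of the family is \<eta>, so this expression is
      the Koszul formula assumed to vanish.\<close>
    show "f1 0 = 0"
      using closed \<xi> br by (simp add: f1_def eval2_dot_0 koszul3)
  qed
qed

lemma nab_quotient:
  assumes "\<xi> \<in> GamSub D A" "\<zeta> \<in> GamSub D A" "u \<in> fib (Ebun D) x"
  shows "((\<lambda>t. (1 / t) *\<^sub>R nab D x u (eval2 \<xi> \<zeta> t)) \<longlongrightarrow> nab D x u (\<lambda>y. \<eta> y [\<xi> y, \<zeta> y])) (at 0)"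
  using nab_derivative_1[OF assms Ival(2)] nab_section_zero[OF assms(3)]
  by (intro tendsto_difference_quotient) (simp_all add: \<eta>0 eval2_dot_0[OF assms(1,2)])

text \<open>The limit exists in the line of L and is transferred to the real coefficients by
  cancelling the generator.\<close>

lemma lc_quotient:
  assumes l: "basis_list (fib (Lbun D) x) [l]" and uv: "u \<in> A x" "v \<in> A x"
  shows "((\<lambda>t. lc l (\<eta>t t x [u, v]) / t) \<longlongrightarrow> lc l (\<eta> x [u, v])) (at 0)"
proof (rule tendsto_scaleR_cancel)
  show "l \<noteq> 0"
    using l by (auto simp: basis_list_def dependent_zero)
  have L: "\<alpha> x [u, v] \<in> fib (Lbun D) x" if "\<alpha> \<in> OmL D A 2" for \<alpha>
    using alt_formsD(2)[OF OmL_alt[OF that], of "[u, v]" x] uv by simp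
  have "((\<lambda>t. (1 / t) *\<^sub>R \<eta>t t x [u, v]) \<longlongrightarrow> lc l (\<eta> x [u, v]) *\<^sub>R l) (at 0)"
    unfolding lc_scale[OF l L[OF \<eta>]] by (rule tendsto_difference_quotient[OF der]) (simp add: \<eta>0)
  then show "((\<lambda>t. (lc l (\<eta>t t x [u, v]) / t) *\<^sub>R l) \<longlongrightarrow> lc l (\<eta> x [u, v]) *\<^sub>R l) (at 0)"
  proof (rule Lim_transform_eventually)
    have ev: "(1 / t) *\<^sub>R \<eta>t t x [u, v] = (lc l (\<eta>t t x [u, v]) / t) *\<^sub>R l" if "t \<in> Ival" for t
      using arg_cong[OF lc_scale[OF l L[OF \<eta>t_OmL[OF that]]], of "scaleR (1 / t)"] by simp
    show "\<forall>\<^sub>F t in at 0. (1 / t) *\<^sub>R \<eta>t t x [u, v] = (lc l (\<eta>t t x [u, v]) / t) *\<^sub>R l"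
      by (rule eventually_IvalI) (rule ev)
  qed
qed

context
  fixes \<xi>1 \<xi>2 \<xi>3 :: "'m \<Rightarrow> 'v" and x :: 'm
  assumes \<xi>: "\<xi>1 \<in> GamSub D A" "\<xi>2 \<in> GamSub D A" "\<xi>3 \<in> GamSub D A"
begin

text \<open>The quadratic term has two factors depending on the family, and each absorbs one factor
  1/t. The cubic term has a third such factor, which tends to 0.\<close>

lemma quad_quotient:
  "((\<lambda>t. (1 / t\<^sup>2) *\<^sub>R quad (\<eta>t t) \<xi>1 \<xi>2 \<xi>3 x) \<longlongrightarrow> quad \<eta> \<xi>1 \<xi>2 \<xi>3 x) (at 0)" (is ?quad)
  and tri_quotient:
  "((\<lambda>t. (1 / t\<^sup>2) *\<^sub>R tri (bsec (\<eta>t t) \<xi>1) (bsec (\<eta>t t) \<xi>2) (bsec (\<eta>t t) \<xi>3) x) \<longlongrightarrow> 0) (at 0)" (is ?tri)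
proof -
  obtain n :: nat and p a l where p: "\<And>k. k < n \<Longrightarrow> p k \<in> GamSub D B" and a: "\<And>k. k < n \<Longrightarrow> a k \<in> A x"
    and l: "basis_list (fib (Lbun D) x) [l]"
    and exp: "\<forall>\<alpha>\<in>OmL D A 2. \<forall>\<xi>\<in>GamSub D A. bsec \<alpha> \<xi> x = (\<Sum>k<n. lc l (\<alpha> x [\<xi> x, a k]) *\<^sub>R p k x)"
    by (rule bsec_expansion[of x]) (rule that; assumption)
  note b = bsec_Gam
  have pf: "p k x \<in> fib (Ebun D) x" if "k < n" for k using p[OF that] by (simp add: GamSub_iff E.Gam_fib)
  have G: "\<xi>1 \<in> GamE D" "\<xi>2 \<in> GamE D" "\<xi>3 \<in> GamE D" using \<xi> by (simp_all add: GamSub_iff)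
  have pE: "p k \<in> GamE D" if "k < n" for k using p[OF that] by (simp add: GamSub_iff)
  have bE: "bsec \<alpha> \<xi> \<in> GamE D" if "\<alpha> \<in> OmL D A 2" "\<xi> \<in> GamSub D A" for \<alpha> \<xi> using bsec_Gam[OF that] by (simp add: GamSub_iff)
  let ?c = "\<lambda>\<alpha> \<xi> k. lc l (\<alpha> x [\<xi> x, a k])"
  have c: "((\<lambda>t. ?c (\<eta>t t) \<xi> k / t) \<longlongrightarrow> ?c \<eta> \<xi> k) (at 0)" if "\<xi> \<in> GamSub D A" "k < n" for \<xi> k
    using lc_quotient[OF l, of "\<xi> x" "a k"] a[OF that(2)] that(1) by (simp add: GamSub_iff)
  have nab: "nab D x (bsec \<alpha> \<xi> x) s = (\<Sum>k<n. ?c \<alpha> \<xi> k *\<^sub>R nab D x (p k x) s)"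
    if "\<alpha> \<in> OmL D A 2" "\<xi> \<in> GamSub D A" "s \<in> GamL D" for \<alpha> \<xi> s
    unfolding exp[rule_format, OF that(1,2)] using pf by (intro nab_sum[OF _ that(3)]) simp
  \<comment> \<open>One factor 1/t goes to the coefficient of the B-component, the other to the
    section that is differentiated.\<close>
  have N: "((\<lambda>t. (1 / t\<^sup>2) *\<^sub>R nab D x (bsec (\<eta>t t) \<xi> x) (eval2 \<zeta> \<kappa> t)) \<longlongrightarrow> nab D x (bsec \<eta> \<xi> x) (\<lambda>y. \<eta> y [\<zeta> y, \<kappa> y])) (at 0)"
    if \<xi>: "\<xi> \<in> GamSub D A" "\<zeta> \<in> GamSub D A" "\<kappa> \<in> GamSub D A" for \<xi> \<zeta> \<kappa>
    unfolding nab[OF \<eta> \<xi>(1) OmL2_section[OF \<eta> \<xi>(2,3)]]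
  proof (rule Lim_transform_eventually)
    show "((\<lambda>t. \<Sum>k<n. (?c (\<eta>t t) \<xi> k / t) *\<^sub>R ((1 / t) *\<^sub>R nab D x (p k x) (eval2 \<zeta> \<kappa> t))) \<longlongrightarrow>
        (\<Sum>k<n. ?c \<eta> \<xi> k *\<^sub>R nab D x (p k x) (\<lambda>y. \<eta> y [\<zeta> y, \<kappa> y]))) (at 0)"
      using c[OF \<xi>(1)] nab_quotient[OF \<xi>(2,3) pf] by (intro tendsto_sum tendsto_scaleR) auto
    have ev: "(\<Sum>k<n. (?c (\<eta>t t) \<xi> k / t) *\<^sub>R ((1 / t) *\<^sub>R nab D x (p k x) (eval2 \<zeta> \<kappa> t))) =
        (1 / t\<^sup>2) *\<^sub>R nab D x (bsec (\<eta>t t) \<xi> x) (eval2 \<zeta> \<kappa> t)" if "t \<in> Ival" for t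
      unfolding nab[OF \<eta>t_OmL[OF that] \<xi>(1) OmL2_section[OF \<eta>t_OmL[OF that] \<xi>(2,3)]] scaleR_sum_right
      by (rule sum.cong[OF refl]) (simp add: power2_eq_square)
    show "\<forall>\<^sub>F t in at 0. (\<Sum>k<n. (?c (\<eta>t t) \<xi> k / t) *\<^sub>R ((1 / t) *\<^sub>R nab D x (p k x) (eval2 \<zeta> \<kappa> t))) =
        (1 / t\<^sup>2) *\<^sub>R nab D x (bsec (\<eta>t t) \<xi> x) (eval2 \<zeta> \<kappa> t)"
      by (rule eventually_IvalI) (rule ev)
  qed
  have tri2: "tri e (bsec \<alpha> \<zeta>) (bsec \<alpha> \<kappa>) x = (\<Sum>j<n. \<Sum>k<n. (?c \<alpha> \<zeta> j * ?c \<alpha> \<kappa> k) *\<^sub>R tri e (p j) (p k) x)"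
    if \<alpha>: "\<alpha> \<in> OmL D A 2" and \<xi>: "e \<in> GamE D" "\<zeta> \<in> GamSub D A" "\<kappa> \<in> GamSub D A" for \<alpha> e \<zeta> \<kappa>
  proof -
    note bb = bsec_Gam[OF \<alpha> \<xi>(2)] bsec_Gam[OF \<alpha> \<xi>(3)]
    have "tri e (bsec \<alpha> \<zeta>) (bsec \<alpha> \<kappa>) x = (\<Sum>j<n. ?c \<alpha> \<zeta> j *\<^sub>R tri e (p j) (bsec \<alpha> \<kappa>) x)"
      by (rule tri_B_sum(2)[OF \<xi>(1) bb p exp[rule_format, OF \<alpha> \<xi>(2)]])
    also have "\<dots> = (\<Sum>j<n. ?c \<alpha> \<zeta> j *\<^sub>R (\<Sum>k<n. ?c \<alpha> \<kappa> k *\<^sub>R tri e (p j) (p k) x))"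
      using tri_B_sum(1)[OF \<xi>(1) bb(2) _ p exp[rule_format, OF \<alpha> \<xi>(3)]] p by (intro sum.cong) auto
    finally show ?thesis by (simp add: scaleR_sum_right)
  qed
  \<comment> \<open>The first entry of \<open>tri\<close> is not pointwise in general. For sections
    of B it can be exchanged with the second, where the expansion applies.\<close>
  have tri3: "tri (bsec \<alpha> \<xi>) b' b'' x = (\<Sum>i<n. ?c \<alpha> \<xi> i *\<^sub>R tri (p i) b' b'' x)"
    if \<alpha>: "\<alpha> \<in> OmL D A 2" and \<xi>: "\<xi> \<in> GamSub D A" "b' \<in> GamSub D B" "b'' \<in> GamSub D B" for \<alpha> \<xi> b' b''
  proof -
    have b'E: "b' \<in> GamE D" using \<xi>(2) by (simp add: GamSub_iff)
    have "tri (bsec \<alpha> \<xi>) b' b'' x = - tri b' (bsec \<alpha> \<xi>) b'' x"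
      by (rule tri_swap_B[OF bsec_Gam[OF \<alpha> \<xi>(1)] \<xi>(2,3)])
    also have "tri b' (bsec \<alpha> \<xi>) b'' x = (\<Sum>i<n. ?c \<alpha> \<xi> i *\<^sub>R tri b' (p i) b'' x)"
      by (rule tri_B_sum(2)[OF b'E bsec_Gam[OF \<alpha> \<xi>(1)] \<xi>(3) p exp[rule_format, OF \<alpha> \<xi>(1)]])
    also have "\<dots> = (\<Sum>i<n. - (?c \<alpha> \<xi> i *\<^sub>R tri (p i) b' b'' x))"
      using tri_swap_B[OF \<xi>(2) p \<xi>(3)] by (intro sum.cong) auto
    finally show ?thesis by (simp add: sum_negf)
  qed
  have T: "((\<lambda>t. (1 / t\<^sup>2) *\<^sub>R tri e (bsec (\<eta>t t) \<zeta>) (bsec (\<eta>t t) \<kappa>) x) \<longlongrightarrow> tri e (bsec \<eta> \<zeta>) (bsec \<eta> \<kappa>) x) (at 0)"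
    if \<xi>: "e \<in> GamE D" "\<zeta> \<in> GamSub D A" "\<kappa> \<in> GamSub D A" for e \<zeta> \<kappa>
    unfolding tri2[OF \<eta> \<xi>]
  proof (rule Lim_transform_eventually)
    show "((\<lambda>t. \<Sum>j<n. \<Sum>k<n. ((?c (\<eta>t t) \<zeta> j / t) * (?c (\<eta>t t) \<kappa> k / t)) *\<^sub>R tri e (p j) (p k) x) \<longlongrightarrow>
        (\<Sum>j<n. \<Sum>k<n. (?c \<eta> \<zeta> j * ?c \<eta> \<kappa> k) *\<^sub>R tri e (p j) (p k) x)) (at 0)"
      using c[OF \<xi>(2)] c[OF \<xi>(3)] by (intro tendsto_sum tendsto_scaleR tendsto_mult tendsto_const) auto
    have ev: "(\<Sum>j<n. \<Sum>k<n. ((?c (\<eta>t t) \<zeta> j / t) * (?c (\<eta>t t) \<kappa> k / t)) *\<^sub>R tri e (p j) (p k) x) =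
        (1 / t\<^sup>2) *\<^sub>R tri e (bsec (\<eta>t t) \<zeta>) (bsec (\<eta>t t) \<kappa>) x" if "t \<in> Ival" for t
      unfolding tri2[OF \<eta>t_OmL[OF that] \<xi>] scaleR_sum_right
      by (intro sum.cong[OF refl]) (simp add: power2_eq_square)
    show "\<forall>\<^sub>F t in at 0. (\<Sum>j<n. \<Sum>k<n. ((?c (\<eta>t t) \<zeta> j / t) * (?c (\<eta>t t) \<kappa> k / t)) *\<^sub>R tri e (p j) (p k) x) =
        (1 / t\<^sup>2) *\<^sub>R tri e (bsec (\<eta>t t) \<zeta>) (bsec (\<eta>t t) \<kappa>) x"
      by (rule eventually_IvalI) (rule ev)
  qed
  have "((\<lambda>t. (1 / t\<^sup>2) *\<^sub>R quad (\<eta>t t) \<xi>1 \<xi>2 \<xi>3 x) \<longlongrightarrow> quad \<eta> \<xi>1 \<xi>2 \<xi>3 x) (at 0)"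
    unfolding quad_def scaleR_add_right scaleR_diff_right by (intro tendsto_add tendsto_diff N T \<xi> G)
  then show ?quad .
  \<comment> \<open>The coefficient is its difference quotient times t; at t = 0 it vanishes because
    the family starts at 0.\<close>
  have c0: "((\<lambda>t. ?c (\<eta>t t) \<xi>1 i) \<longlongrightarrow> 0) (at 0)" if "i < n" for i
  proof (rule Lim_transform_eventually)
    show "((\<lambda>t. ?c (\<eta>t t) \<xi>1 i / t * t) \<longlongrightarrow> 0) (at 0)"
      using tendsto_mult[OF c[OF \<xi>(1) that] tendsto_ident_at[of 0 UNIV]] by simp
    have "\<eta>t 0 = (\<lambda>x vs. 0)" by (rule \<eta>0)
    then have "?c (\<eta>t 0) \<xi>1 i = 0" using lc_scale[OF l zero_in_L] l by (auto simp: basis_list_def dependent_zero)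
    then have ev: "?c (\<eta>t t) \<xi>1 i / t * t = ?c (\<eta>t t) \<xi>1 i" for t
      by (cases "t = 0") auto
    show "\<forall>\<^sub>F t in at 0. ?c (\<eta>t t) \<xi>1 i / t * t = ?c (\<eta>t t) \<xi>1 i"
      by (rule eventually_IvalI) (rule ev)
  qed
  show ?tri
  proof (rule Lim_transform_eventually)
    have "((\<lambda>t. \<Sum>i<n. ?c (\<eta>t t) \<xi>1 i *\<^sub>R ((1 / t\<^sup>2) *\<^sub>R tri (p i) (bsec (\<eta>t t) \<xi>2) (bsec (\<eta>t t) \<xi>3) x)) \<longlongrightarrow>
        (\<Sum>i<n. 0 *\<^sub>R tri (p i) (bsec \<eta> \<xi>2) (bsec \<eta> \<xi>3) x)) (at 0)"
      using c0 T[OF pE \<xi>(2,3)] by (intro tendsto_sum tendsto_scaleR) auto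
    then show "((\<lambda>t. \<Sum>i<n. ?c (\<eta>t t) \<xi>1 i *\<^sub>R ((1 / t\<^sup>2) *\<^sub>R tri (p i) (bsec (\<eta>t t) \<xi>2) (bsec (\<eta>t t) \<xi>3) x)) \<longlongrightarrow> 0) (at 0)"
      by simp
    have ev: "(\<Sum>i<n. ?c (\<eta>t t) \<xi>1 i *\<^sub>R ((1 / t\<^sup>2) *\<^sub>R tri (p i) (bsec (\<eta>t t) \<xi>2) (bsec (\<eta>t t) \<xi>3) x)) =
        (1 / t\<^sup>2) *\<^sub>R tri (bsec (\<eta>t t) \<xi>1) (bsec (\<eta>t t) \<xi>2) (bsec (\<eta>t t) \<xi>3) x" if "t \<in> Ival" for t
      unfolding tri3[OF \<eta>t_OmL[OF that] \<xi>(1) bsec_Gam[OF \<eta>t_OmL[OF that] \<xi>(2)] bsec_Gam[OF \<eta>t_OmL[OF that] \<xi>(3)]] scaleR_sum_right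
      by (intro sum.cong[OF refl] scaleR_left_commute)
    show "\<forall>\<^sub>F t in at 0. (\<Sum>i<n. ?c (\<eta>t t) \<xi>1 i *\<^sub>R ((1 / t\<^sup>2) *\<^sub>R tri (p i) (bsec (\<eta>t t) \<xi>2) (bsec (\<eta>t t) \<xi>3) x)) =
        (1 / t\<^sup>2) *\<^sub>R tri (bsec (\<eta>t t) \<xi>1) (bsec (\<eta>t t) \<xi>2) (bsec (\<eta>t t) \<xi>3) x"
      by (rule eventually_IvalI) (rule ev)
  qed
qed

text \<open>The Maurer--Cartan equation divided by t^2, in the limit t \<rightarrow> 0. The factor 2
  clears the 1/2 that comes from the second-order expansion of the Koszul formula.\<close>

lemma second_order_Maurer_Cartan:
  assumes gr: "\<And>t. t \<in> Ival \<Longrightarrow> dirac_jacobi D (Gr D A B (\<eta>t t))" and closed: "koszul D \<eta> [\<xi>1, \<xi>2, \<xi>3] x = 0"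
  shows "koszul D second_form [\<xi>1, \<xi>2, \<xi>3] x = - (2 *\<^sub>R quad \<eta> \<xi>1 \<xi>2 \<xi>3 x)"
proof -
  let ?s = "\<lambda>t. (1 / t\<^sup>2) *\<^sub>R koszul D (\<eta>t t) [\<xi>1, \<xi>2, \<xi>3] x + (1 / t\<^sup>2) *\<^sub>R quad (\<eta>t t) \<xi>1 \<xi>2 \<xi>3 x
    + (1 / t\<^sup>2) *\<^sub>R tri (bsec (\<eta>t t) \<xi>1) (bsec (\<eta>t t) \<xi>2) (bsec (\<eta>t t) \<xi>3) x"
  have "(?s \<longlongrightarrow> (1 / 2) *\<^sub>R koszul D second_form [\<xi>1, \<xi>2, \<xi>3] x + quad \<eta> \<xi>1 \<xi>2 \<xi>3 x + 0) (at 0)"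
    by (intro tendsto_add koszul_derivative quad_quotient tri_quotient \<xi> closed)
  moreover have "(?s \<longlongrightarrow> 0) (at 0)"
  proof (rule Lim_transform_eventually[OF tendsto_const])
    have ev: "0 = ?s t" if "t \<in> Ival" for t
      using arg_cong[OF Maurer_Cartan[OF \<eta>t_OmL[OF that] gr[OF that] \<xi>, of x], of "scaleR (1 / t\<^sup>2)"]
      by (simp only: scaleR_add_right scaleR_zero_right)
    show "\<forall>\<^sub>F t in at 0. 0 = ?s t"
      by (rule eventually_IvalI) (rule ev)
  qed
  ultimately have "(1 / 2) *\<^sub>R koszul D second_form [\<xi>1, \<xi>2, \<xi>3] x + quad \<eta> \<xi>1 \<xi>2 \<xi>3 x + 0 = 0"
    by (rule tendsto_unique[OF trivial_limit_at])
  then have "2 *\<^sub>R ((1 / 2) *\<^sub>R koszul D second_form [\<xi>1, \<xi>2, \<xi>3] x) = 2 *\<^sub>R (- quad \<eta> \<xi>1 \<xi>2 \<xi>3 x)"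
    by (simp add: add_eq_0_iff)
  then show ?thesis by simp
qed

end

end

end

section \<open>The differential and cohomology classes\<close>

context dj_pair
begin

text \<open>Counting entries: a list of n vectors leads the form to be evaluated on n - 1 entries in
  both sums of the formula, as the second removes two and inserts a bracket.\<close>

lemma dAL_outside:
  assumes \<alpha>: "\<alpha> \<in> OmL D A k" and "int (length vs) \<noteq> k + 1"
  shows "dAL D A \<alpha> x vs = 0"
proof (cases "set vs \<subseteq> A x")
  case True
  let ?Xs = "map (extend_vec D A x) vs"
  have z: "\<alpha> y ws = 0" if "length ws + 1 = length vs" for y ws
    using alt_formsD(1)[OF OmL_alt[OF \<alpha>], of y ws] that assms(2) by fastforce
  have 1: "length (nths ?Xs (- {i})) + 1 = length vs" if "i < length vs" for i
  proof -
    have "{j. j < length vs \<and> j \<noteq> i} = {..<length vs} - {i}" by auto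
    then show ?thesis using that by (simp add: length_nths)
  qed
  have 2: "length (nths ?Xs (- {i, j})) + 2 = length vs" if "i < j" "j < length vs" for i j
  proof -
    have "{m. m < length vs \<and> m \<noteq> i \<and> m \<noteq> j} = {..<length vs} - {i, j}" by auto
    moreover have "card ({..<length vs} - {i, j}) = length vs - 2"
      using that by (subst card_Diff_subset) auto
    ultimately show ?thesis using that by (simp add: length_nths)
  qed
  have "extend_vec D A x (vs ! i) x \<in> fib (Ebun D) x" if "i < length vs" for i
    using extend_vec[of "vs ! i" x] A_fib True that nth_mem by (metis subsetD)
  then have "nabS D (?Xs ! i) (\<lambda>y. \<alpha> y (map (\<lambda>X. X y) (nths ?Xs (- {i})))) x = 0" if "i < length vs" for i
    using z 1[OF that] nab_section_zero that by (simp add: nabS_def)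
  moreover have "\<alpha> x (map (\<lambda>X. X x) (brk D (?Xs ! i) (?Xs ! j) # nths ?Xs (- {i, j}))) = 0"
    if "i < j" "j < length vs" for i j
    using 2[OF that] by (intro z) simp
  ultimately show ?thesis by (simp add: dAL_def koszul_def)
qed (simp add: dAL_def)

text \<open>The extensions used by \<open>dAL\<close> depend on the vectors but not on the form, so
  the same sections occur on both sides.\<close>

lemma dAL_lincomb:
  assumes "\<alpha> \<in> OmL D A 2" "\<beta> \<in> OmL D A 2"
  shows "dAL D A (\<lambda>x vs. c *\<^sub>R \<alpha> x vs + \<beta> x vs) x vs = c *\<^sub>R dAL D A \<alpha> x vs + dAL D A \<beta> x vs"
proof (cases "length vs = 3 \<and> set vs \<subseteq> A x")
  case True
  then obtain u v w where vs: "vs = [u, v, w]" by (auto simp: length_Suc_conv eval_nat_numeral)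
  have e: "extend_vec D A x a \<in> GamSub D A" "extend_vec D A x a x \<in> fib (Ebun D) x" if "a \<in> set vs" for a
    using True that extend_vec A_fib by (auto simp: subset_iff)
  show ?thesis
    using True vs e by (simp add: dAL_def koszul3 nab_section_linear OmL2_section assms) (simp add: algebra_simps)
next
  case False
  then show ?thesis
    using dAL_outside[OF OmL_lincomb[OF assms, of c], of vs x] dAL_outside[OF assms(1), of vs x] dAL_outside[OF assms(2), of vs x]
    by (auto simp: dAL_def)
qed

lemma dAL_zero: "dAL D A (\<lambda>x vs. 0) = (\<lambda>x vs. 0)"
  using dAL_lincomb[OF OmL_zero OmL_zero, of "- 1"] by (auto simp: fun_eq_iff)

text \<open>Adding or subtracting the primitive \<gamma> matches the witnesses for the two classes,
  so they contain the same forms.\<close>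

lemma coh_class_exact:
  assumes "\<beta> \<in> cocycles D A 3" and \<gamma>: "\<gamma> \<in> OmL D A 2" "\<beta> = dAL D A \<gamma>"
  shows "coh_class D A 3 \<beta> = coh_class D A 3 (\<lambda>x vs. 0)"
proof -
  have z: "(\<lambda>x vs. 0) \<in> cocycles D A 3" using OmL_zero dAL_zero by (simp add: cocycles_def)
  have "(\<exists>\<gamma>'\<in>OmL D A 2. (\<lambda>x vs. \<beta> x vs - \<sigma> x vs) = dAL D A \<gamma>') \<longleftrightarrow> (\<exists>\<gamma>'\<in>OmL D A 2. (\<lambda>x vs. 0 - \<sigma> x vs) = dAL D A \<gamma>')" for \<sigma>
  proof
    assume "\<exists>\<gamma>'\<in>OmL D A 2. (\<lambda>x vs. \<beta> x vs - \<sigma> x vs) = dAL D A \<gamma>'"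
    then obtain \<gamma>' where g: "\<gamma>' \<in> OmL D A 2" "(\<lambda>x vs. \<beta> x vs - \<sigma> x vs) = dAL D A \<gamma>'" by blast
    have "(\<lambda>x vs. 0 - \<sigma> x vs) = dAL D A (\<lambda>x vs. (- 1) *\<^sub>R \<gamma> x vs + \<gamma>' x vs)"
      unfolding dAL_lincomb[OF \<gamma>(1) g(1), abs_def] g(2)[symmetric] \<gamma>(2)[symmetric] by simp
    then show "\<exists>\<gamma>'\<in>OmL D A 2. (\<lambda>x vs. 0 - \<sigma> x vs) = dAL D A \<gamma>'"
      using OmL_lincomb[OF \<gamma>(1) g(1)] by blast
  next
    assume "\<exists>\<gamma>'\<in>OmL D A 2. (\<lambda>x vs. 0 - \<sigma> x vs) = dAL D A \<gamma>'"
    then obtain \<gamma>' where g: "\<gamma>' \<in> OmL D A 2" "(\<lambda>x vs. 0 - \<sigma> x vs) = dAL D A \<gamma>'" by blast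
    have "(\<lambda>x vs. \<beta> x vs - \<sigma> x vs) = dAL D A (\<lambda>x vs. 1 *\<^sub>R \<gamma> x vs + \<gamma>' x vs)"
      unfolding dAL_lincomb[OF \<gamma>(1) g(1), abs_def] g(2)[symmetric] \<gamma>(2)[symmetric] by simp
    then show "\<exists>\<gamma>'\<in>OmL D A 2. (\<lambda>x vs. \<beta> x vs - \<sigma> x vs) = dAL D A \<gamma>'"
      using OmL_lincomb[OF \<gamma>(1) g(1)] by blast
  qed
  then show ?thesis
    using assms(1) z by (auto simp: coh_class_def cohomologous_def)
qed

end

section \<open>Exactness of the bracket and the conclusion\<close>

context dj_bracket
begin

text \<open>The primitive is minus the second derivative of the family at t = 0; the second-order
  equation and \<open>br_quad\<close> identify its differential with the bracket.\<close>

lemma bracket_exact: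
  assumes \<eta>: "\<eta> \<in> cocycles D A 2" and def: "smooth_deformation D A B \<epsilon> At" "arises_from D A B \<eta> \<epsilon> At"
  obtains \<gamma> where "\<gamma> \<in> OmL D A 2" "br \<eta> \<eta> = dAL D A \<gamma>"
proof -
  obtain \<eta>t where \<eta>t: "smooth_form_family D A 2 {-\<epsilon><..<\<epsilon>} \<eta>t" "\<eta>t 0 = (\<lambda>x vs. 0)"
    "\<forall>t\<in>{-\<epsilon><..<\<epsilon>}. At t = Gr D A B (\<eta>t t)" "\<forall>x vs. ((\<lambda>t. \<eta>t t x vs) has_vector_derivative \<eta> x vs) (at 0)"
    using def(2) unfolding arises_from_def by blast
  have \<eta>2: "\<eta> \<in> OmL D A 2" and closed: "dAL D A \<eta> = (\<lambda>x vs. 0)"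
    using \<eta> by (simp_all add: cocycles_def)
  have \<epsilon>: "\<epsilon> > 0" using def(1) by (simp add: smooth_deformation_def)
  have dj: "dirac_jacobi D (Gr D A B (\<eta>t t))" if "t \<in> {-\<epsilon><..<\<epsilon>}" for t
    using def(1) \<eta>t(3) that by (simp add: smooth_deformation_def)
  note data = \<epsilon> \<eta>t(1,2) \<eta>2 \<eta>t(4)[rule_format]
  \<comment> \<open>The zero summand brings the form into the shape of \<open>OmL_lincomb\<close>
    and \<open>dAL_lincomb\<close>.\<close>
  define \<gamma> where "\<gamma> = (\<lambda>x vs. (- 1) *\<^sub>R second_form \<eta>t x vs + (0::'l))"
  note S = second_form_OmL[OF data]
  have \<gamma>: "\<gamma> \<in> OmL D A 2" unfolding \<gamma>_def by (rule OmL_lincomb[OF S OmL_zero])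
  have br: "br \<eta> \<eta> \<in> OmL D A 3" using br_OmL[OF \<eta>2 \<eta>2] by simp
  have "br \<eta> \<eta> x vs = dAL D A \<gamma> x vs" for x vs
  proof (cases "length vs = 3 \<and> set vs \<subseteq> A x")
    case True
    then obtain u v w where vs: "vs = [u, v, w]" by (auto simp: length_Suc_conv eval_nat_numeral)
    \<comment> \<open>These extensions occur in the definition of \<open>dAL\<close>, so testing the
      second-order equation on them gives the values of the differential directly.\<close>
    let ?e = "extend_vec D A x"
    have e: "?e u \<in> GamSub D A" "?e v \<in> GamSub D A" "?e w \<in> GamSub D A" "?e u x = u" "?e v x = v" "?e w x = w"
      using True vs extend_vec by auto
    have "koszul D \<eta> [?e u, ?e v, ?e w] x = dAL D A \<eta> x vs" using True by (simp add: dAL_def vs)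
    then have 0: "koszul D \<eta> [?e u, ?e v, ?e w] x = 0" using closed by simp
    have "dAL D A (second_form \<eta>t) x vs = koszul D (second_form \<eta>t) [?e u, ?e v, ?e w] x"
      using True by (simp add: dAL_def vs)
    also have "\<dots> = - (2 *\<^sub>R quad \<eta> (?e u) (?e v) (?e w) x)"
      by (rule second_order_Maurer_Cartan[OF data e(1-3) dj 0])
    also have "\<dots> = - br \<eta> \<eta> x vs"
      using br_quad[OF \<eta>2 e(1-3), of x] by (simp add: e vs)
    finally show ?thesis
      unfolding \<gamma>_def dAL_lincomb[OF S OmL_zero] by (simp add: dAL_zero)
  next
    case False
    have "br \<eta> \<eta> x vs = 0"
      using False alt_formsD(1)[OF OmL_alt[OF br], of x vs] by fastforce
    moreover have "dAL D A \<gamma> x vs = 0"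
      using False dAL_outside[OF \<gamma>, of vs x] by (auto simp: dAL_def)
    ultimately show ?thesis by simp
  qed
  then show ?thesis using \<gamma> by (intro that[of \<gamma>]) auto
qed

text \<open>The bracket of \<eta> with itself has a primitive; to place it in the class of 0 it must
  also be a cocycle, and this is obtained from the Kuranishi map taking values in the
  cohomology.\<close>

lemma Kuranishi_trivial:
  assumes Kur: "is_kuranishi_map D A B br Kur" and \<eta>: "\<eta> \<in> cocycles D A 2"
    and def: "smooth_deformation D A B \<epsilon> At" "arises_from D A B \<eta> \<epsilon> At"
  shows "Kur (coh_class D A 2 \<eta>) = coh_class D A 3 (\<lambda>x vs. 0)"
proof -
  obtain \<gamma> where \<gamma>: "\<gamma> \<in> OmL D A 2" "br \<eta> \<eta> = dAL D A \<gamma>"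
    by (rule bracket_exact[OF \<eta> def]) (rule that; assumption)
  have "linf D A B br [(2, \<eta>), (2, \<eta>)] = br \<eta> \<eta>" by simp
  then have K: "Kur (coh_class D A 2 \<eta>) = coh_class D A 3 (br \<eta> \<eta>)"
    using Kur \<eta> unfolding is_kuranishi_map_def by metis
  have "coh_class D A 2 \<eta> \<in> cohomology D A 2"
    using \<eta> unfolding coh_class_def cohomology_def by (rule quotientI)
  \<comment> \<open>An element of the quotient contains its representative \<tau>, so the class of
    the bracket is nonempty. As \<open>cohomologous\<close> relates cocycles only, the bracket is
    one.\<close>
  then have "coh_class D A 3 (br \<eta> \<eta>) \<in> cohomology D A 3"
    using Kur unfolding is_kuranishi_map_def K[symmetric] by blast
  then obtain \<tau> where \<tau>: "\<tau> \<in> cocycles D A 3" "coh_class D A 3 (br \<eta> \<eta>) = cohomologous D A 3 `` {\<tau>}"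
    unfolding cohomology_def by (rule quotientE)
  have "(\<lambda>x vs. \<tau> x vs - \<tau> x vs) = dAL D A (\<lambda>x vs. 0)" by (simp add: dAL_zero)
  then have "(\<tau>, \<tau>) \<in> cohomologous D A 3"
    using \<tau>(1) OmL_zero unfolding cohomologous_def by blast
  then have "\<tau> \<in> coh_class D A 3 (br \<eta> \<eta>)" using \<tau>(2) by blast
  then have "br \<eta> \<eta> \<in> cocycles D A 3" by (simp add: coh_class_def cohomologous_def)
  then show ?thesis unfolding K by (rule coh_class_exact[OF _ \<gamma>])
qed

end

theorem proposition5p12:
  fixes D :: "('m::{t2_space, second_countable_topology}, 'e::real_normed_vector,
      'v::real_vector, 'l::real_normed_vector) cj_data"
    and A B :: "'m \<Rightarrow> 'v set"
    and br :: "('m, 'v, 'l) form \<Rightarrow> ('m, 'v, 'l) form \<Rightarrow> ('m, 'v, 'l) form"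
    and Kur :: "('m, 'v, 'l) form set \<Rightarrow> ('m, 'v, 'l) form set"
    and \<eta> :: "('m, 'v, 'l) form"
  assumes "courant_jacobi D"
    and "dirac_jacobi D A"
    and "almost_dirac_jacobi D B"
    and "complementary D A B"
    and "is_dagger_bracket D A B br"
    and "is_kuranishi_map D A B br Kur"
    and "infinitesimal_deformation D A \<eta>"
    and "Kur (coh_class D A 2 \<eta>) \<noteq> coh_class D A 3 (\<lambda>x vs. 0)"
  shows "obstructed D A B \<eta>"
proof -
  interpret dj_bracket D A B br
    by unfold_locales (fact assms)+
  have "\<eta> \<in> cocycles D A 2"
    using assms(7) by (simp add: infinitesimal_deformation_def)
  then show ?thesis
    using Kuranishi_trivial[OF assms(6)] assms(8) unfolding obstructed_def by blast
qed

end
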